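(* There exists an absolute constant $C>0$ such that the following holds. Let $q \leq N$ be positive integers, let $\delta>0$, and let $f:\mathbb{Z}\to\mathbb{C}$ be a $1$-bounded function with support in $[N]$. Suppose that $$\|f\|^\flat_{q,N}\geq\delta .$$ Then either $N \leq C (q/\delta)^{C}$, or there exist a positive integer $q'\leq C\delta^{-C}$, a real number $R \geq C^{-1}(\delta/q)^{C}N^{1/2}$, and a $1$-bounded local function $\phi:\mathbb{Z}\to\mathbb{C}$ of resolution $R$ and modulus $qq'$ such that $$\sum_{x\in[N]} f(x)\phi(x) \geq C^{-1} \delta^{2^{66}} N$$ (in particular the left-hand side is real).
   Context: For real $X\ge 1$, $[X]=\{1,2,\dots,\lfloor X\rfloor\}$. A complex-valued function is $1$-bounded if its modulus never exceeds $1$. For a finite set $S$, $\mathbb{E}_{s\in S}f(s)=\frac{1}{|S|}\sum_{s\in S}f(s)$. Counting operator: for positive integers $q\le N$ put $M:=\lfloor\sqrt{N/q}\rfloor$ and, for $f_0,f_1,f_2:\mathbb{Z}\to\mathbb{C}$, $$\Lambda_{q,N}(f_0,f_1,f_2):=\mathbb{E}_{x\in[N]}\mathbb{E}_{y\in[M]}f_0(x)f_1(x+y)f_2(x+qy^2).$$ Partial cut norm: $$\|f\|^\flat_{q,N}:=\sup\{|\Lambda_{q,N}(f,g_1,g_2)|,\ |\Lambda_{q,N}(g_1,f,g_2)|\ :\ |g_i|\le 1,\ \mathrm{supp}(g_i)\subset[N]\},$$ the supremum being over all functions $g_1,g_2:\mathbb{Z}\to\mathbb{C}$ that are $1$-bounded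 and supported in $[N]$. Local function: $\phi:\mathbb{Z}\to\mathbb{C}$ is a local function of resolution $R$ and modulus $m$ if there exists a partition of $\mathbb{R}$ into intervals of length $R$ such that $\phi$ is constant on the intersection of every such interval with every congruence class mod $m$. *)

theory Defs
  imports "HOL-Analysis.Analysis" "HOL-Number_Theory.Cong"
begin

definition bracket :: "real \<Rightarrow> int set" where
  "bracket X = {1..\<lfloor>X\<rfloor>}"

definition one_bounded :: "(int \<Rightarrow> complex) \<Rightarrow> bool" where
  "one_bounded f \<longleftrightarrow> (\<forall>x. norm (f x) \<le> 1)"

definition supp :: "(int \<Rightarrow> complex) \<Rightarrow> int set" where
  "supp f = {x. f x \<noteq> 0}"

definition average :: "int set \<Rightarrow> (int \<Rightarrow> complex) \<Rightarrow> complex" where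
  "average S f = (1 / of_nat (card S)) * (\<Sum>s\<in>S. f s)"

definition counting_op ::
  "nat \<Rightarrow> nat \<Rightarrow> (int \<Rightarrow> complex) \<Rightarrow> (int \<Rightarrow> complex) \<Rightarrow> (int \<Rightarrow> complex) \<Rightarrow> complex" where
  "counting_op q N f0 f1 f2 =
    (let M = \<lfloor>sqrt (real N / real q)\<rfloor> in
      average (bracket (real N)) (\<lambda>x.
        average (bracket (real_of_int M)) (\<lambda>y.
          f0 x * f1 (x + y) * f2 (x + int q * y\<^sup>2))))"

text \<open>The set below is nonempty (take both \<open>g\<close>s to be zero) and bounded above (only finitely
  many values of \<open>f\<close> occur), so the real supremum is the true one.\<close>

definition partial_cut_norm :: "nat \<Rightarrow> nat \<Rightarrow> (int \<Rightarrow> complex) \<Rightarrow> real" where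
  "partial_cut_norm q N f =
    Sup (\<Union>(g1, g2) \<in> {(g1, g2). one_bounded g1 \<and> one_bounded g2 \<and>
                supp g1 \<subseteq> bracket (real N) \<and> supp g2 \<subseteq> bracket (real N)}.
          {norm (counting_op q N f g1 g2), norm (counting_op q N g1 f g2)})"

text \<open>Endpoints may or may not belong to the interval. The conditions \<open>I \<noteq> {}\<close> and
  \<open>bounded I\<close> ensure that \<open>Inf I\<close> and \<open>Sup I\<close> are the actual endpoints.\<close>

definition interval_of_length :: "real \<Rightarrow> real set \<Rightarrow> bool" where
  "interval_of_length R I \<longleftrightarrow>
    is_interval I \<and> I \<noteq> {} \<and> bounded I \<and> Sup I - Inf I = R"

definition local_function :: "real \<Rightarrow> nat \<Rightarrow> (int \<Rightarrow> complex) \<Rightarrow> bool" where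
  "local_function R m \<phi> \<longleftrightarrow>
    (\<exists>P. partition_on (UNIV :: real set) P \<and> (\<forall>I\<in>P. interval_of_length R I) \<and>
         (\<forall>I\<in>P. \<forall>a::int. \<phi> constant_on {x. real_of_int x \<in> I \<and> [x = a] (mod int m)}))"

end

theory Submission
  imports Defs "HOL-Number_Theory.Number_Theory"
begin

text \<open>Everything is carried out for functions on the integers that are periodic modulo
  \<open>n = q a L\<close>, where \<open>n\<close> is comparable to \<open>N\<close> and \<open>a\<close> is a prime slightly smaller than
  \<open>M\<close>. Replacing the third function by the (normalised) dual function and applying van der
  Corput differencing repeatedly removes the other two functions and leaves an average over a
  parallelogram of linear shifts. Fourier analysis on each residue class modulo \<open>q a\<close> turns this
  into a large Fourier coefficient of many multiplicative derivatives of the dual function. A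
  Cauchy--Schwarz argument, which exchanges the dual function for its definition, shows that these
  frequencies agree up to few values, so that the third function may be replaced by a character
  whose frequency depends only on the residue class. A count of additive quadruples shows that only
  few frequencies matter in each class modulo \<open>q\<close>, and a second round of the same argument, now
  modulo \<open>q\<close>, yields frequencies depending on the class modulo \<open>q\<close> alone. By Weyl's
  inequality these lie on major arcs. The third function is then nearly invariant under short shifts
  by multiples of \<open>q q'\<close>, hence the other two functions have large averages along progressions
  of this step, and a random choice of cells produces the local function. Since \<open>f\<close> stands in
  position 0 or 1 of the counting operator, this covers both cases.\<close>

subsection \<open>Averages over residue systems\<close>

text \<open>Polynomial losses rest on matching scales. As \<open>n = q a L\<close> is comparable to
  q M^2 and \<open>a\<close> is smaller than \<open>M\<close> by a power of \<delta>,
  \<open>L\<close> too is \<open>M\<close> up to powers of \<delta>. Differencing in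
  \<open>y\<close> by multiples of \<open>a\<close> gives shifts by multiples of \<open>q a\<close>,
  so inside a class modulo \<open>q a\<close> the variable \<open>y\<close> sweeps a cyclic group of
  order \<open>L\<close>; in the second round, differencing by multiples of \<open>q\<close> uses
  cyclic groups of order \<open>a\<close> in the classes modulo \<open>q\<close>. \<open>a\<close>
  is prime so that nonzero integers below \<open>a\<close> are invertible and linear and quadratic
  congruences have few roots. The obstacle: the first round must exclude minor arcs before its
  frequencies are known to depend only on the class modulo \<open>q\<close>. The second round is
  therefore a statement of its own, \<open>frequency_mod_q\<close>, which remembers the residues its
  frequencies come from. It is used twice: inside the first round, to verify the hypothesis on minor
  arcs, and again on the output. Constants are absorbed into powers of \<rho> = \<delta>/2048: as
  \<rho> <= 1/1024, each factor 1024 costs one power.\<close>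

definition ee :: "real \<Rightarrow> complex" where
  "ee t = cis (2 * pi * t)"

definition per :: "nat \<Rightarrow> (int \<Rightarrow> 'a) \<Rightarrow> bool" where
  "per n f \<longleftrightarrow> (\<forall>x. f (x + int n) = f x)"

text \<open>Serves two purposes: for a function of period \<open>n\<close> it is the mean over the
  cyclic group, and for the variable \<open>y\<close> it is the mean over the interval
  {0,...,M-1}.\<close>

definition av :: "nat \<Rightarrow> (int \<Rightarrow> 'a::real_normed_field) \<Rightarrow> 'a" where
  "av n f = (\<Sum>i<n. f (int i)) / of_nat n"

lemma ee_add: "ee (s + t) = ee s * ee t"
  by (simp add: ee_def cis_mult ring_distribs)

lemma cnj_ee: "cnj (ee t) = ee (- t)"
  by (simp add: ee_def cis_cnj)

lemma norm_ee [simp]: "norm (ee t) = 1"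
  by (simp add: ee_def)

lemma ee_0 [simp]: "ee 0 = 1"
  by (simp add: ee_def)

lemma ee_of_int [simp]: "ee (of_int k) = 1"
  using cis_multiple_2pi[of "of_int k"] by (simp add: ee_def)

lemma ee_add_int [simp]: "ee (t + of_int k) = ee t"
  by (simp add: ee_add)

lemma ee_power: "ee t ^ m = ee (of_nat m * t)"
proof -
  have "ee t ^ m = cis (real m * (2 * pi * t))"
    unfolding ee_def by (rule Complex.DeMoivre)
  also have "real m * (2 * pi * t) = 2 * pi * (of_nat m * t)" by simp
  finally show ?thesis by (simp add: ee_def)
qed

lemma norm_ee_minus_1: "norm (ee t - 1) \<le> 2 * pi * \<bar>t\<bar>"
proof -
  have "norm (ee t - 1) = 2 * \<bar>sin (2 * pi * t / 2)\<bar>"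
    using dist_exp_i_1[of "2 * pi * t"] by (simp add: ee_def cis_conv_exp)
  then show ?thesis
    using abs_sin_x_le_abs_x[of "pi * t"] by (simp add: abs_mult)
qed

lemma ee_eq_1_iff: "ee t = 1 \<longleftrightarrow> t \<in> \<int>"
proof
  assume "ee t = 1"
  then have "cos (2 * pi * t) = 1"
    by (metis Re_complex_of_real cis.sel(1) ee_def of_real_1)
  then obtain k where "2 * pi * t = real_of_int k * 2 * pi"
    by (auto simp: cos_one_2pi_int)
  then have "t = of_int k"
    by (simp add: mult_ac)
  then show "t \<in> \<int>" by simp
qed (auto elim!: Ints_cases)

section \<open>Linearity, interchange and size of averages\<close>

lemma av_add: "av n (\<lambda>x. f x + g x) = av n f + av n g"
  by (simp add: av_def sum.distrib add_divide_distrib)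

lemma av_diff: "av n (\<lambda>x. f x - g x) = av n f - av n g"
  by (simp add: av_def sum_subtractf diff_divide_distrib)

lemma av_cmult: "av n (\<lambda>x. c * f x) = c * av n f"
  by (simp add: av_def sum_distrib_left)

lemma av_cmult_right: "av n (\<lambda>x. f x * c) = av n f * c"
  by (simp add: av_def sum_distrib_right)

lemma av_const: "n > 0 \<Longrightarrow> av n (\<lambda>x. c) = c"
  by (simp add: av_def)

lemma av_sum: "av n (\<lambda>x. \<Sum>i\<in>I. f i x) = (\<Sum>i\<in>I. av n (f i))"
  unfolding av_def by (subst sum.swap) (simp add: sum_divide_distrib)

lemma av_swap: "av n (\<lambda>x. av m (\<lambda>y. f x y)) = av m (\<lambda>y. av n (\<lambda>x. f x y))"
  unfolding av_def
  by (simp add: sum_divide_distrib divide_divide_eq_left mult.commute) (rule sum.swap)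

lemma av_cong: "(\<And>x. 0 \<le> x \<Longrightarrow> x < int n \<Longrightarrow> f x = g x) \<Longrightarrow> av n f = av n g"
  by (simp add: av_def)

lemma cnj_av: "cnj (av n f) = av n (\<lambda>x. cnj (f x))"
  by (simp add: av_def)

lemma of_real_av: "of_real (av n f) = av n (\<lambda>x. of_real (f x))"
  by (simp add: av_def)

lemma av_mono:
  fixes f :: "int \<Rightarrow> real"
  assumes "\<And>x. 0 \<le> x \<Longrightarrow> x < int n \<Longrightarrow> f x \<le> g x"
  shows "av n f \<le> av n g"
  unfolding av_def using assms by (intro divide_right_mono sum_mono) auto

lemma av_nonneg:
  fixes f :: "int \<Rightarrow> real"
  assumes "\<And>x. f x \<ge> 0"
  shows "av n f \<ge> 0"
  unfolding av_def using assms by (intro divide_nonneg_nonneg sum_nonneg) auto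

lemma norm_av_le: "norm (av n f) \<le> av n (\<lambda>x. norm (f x))"
  by (simp add: av_def norm_divide divide_right_mono norm_sum)

lemma norm_av_le_const:
  assumes "\<And>x. 0 \<le> x \<Longrightarrow> x < int n \<Longrightarrow> norm (f x) \<le> c" "c \<ge> 0"
  shows "norm (av n f) \<le> c"
proof (cases "n = 0")
  case False
  have "av n (\<lambda>x. norm (f x)) \<le> av n (\<lambda>x. c)"
    using assms by (intro av_mono)
  then show ?thesis
    using norm_av_le[of n f] False by (simp add: av_const)
qed (simp add: av_def assms)

lemma av_ex_ge:
  fixes f :: "int \<Rightarrow> real"
  assumes "n > 0"
  shows "\<exists>x. 0 \<le> x \<and> x < int n \<and> av n f \<le> f x"
proof (rule ccontr)
  assume *: "\<not> ?thesis"
  have **: "f (int i) < av n f" if "i < n" for i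
    using * that by (meson linorder_not_le of_nat_0_le_iff of_nat_less_iff)
  have "(\<Sum>i<n. f (int i)) < (\<Sum>i<n. av n f)"
    using assms ** by (intro sum_strict_mono) (simp_all add: lessThan_empty_iff)
  then show False using assms by (simp add: av_def)
qed

lemma av_norm_diff_le:
  assumes "\<And>x. 0 \<le> x \<Longrightarrow> x < int n \<Longrightarrow> norm (f x - g x) \<le> c" "c \<ge> 0"
  shows "norm (av n f - av n g) \<le> c"
  using norm_av_le_const[of n "\<lambda>x. f x - g x" c] assms by (simp add: av_diff)

lemma av_square_le: "(norm (av n f))\<^sup>2 \<le> av n (\<lambda>x. (norm (f x))\<^sup>2)"
proof (cases "n = 0")
  case False
  have "(\<Sum>i<n. norm (f (int i)))\<^sup>2 \<le> (\<Sum>i<n. 1\<^sup>2) * (\<Sum>i<n. (norm (f (int i)))\<^sup>2)"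
    using Cauchy_Schwarz_ineq_sum[of "\<lambda>_. 1" "\<lambda>i. norm (f (int i))" "{..<n}"] by simp
  moreover have "(norm (\<Sum>i<n. f (int i)))\<^sup>2 \<le> (\<Sum>i<n. norm (f (int i)))\<^sup>2"
    by (intro power_mono norm_sum) auto
  ultimately have "(norm (\<Sum>i<n. f (int i)))\<^sup>2 \<le> real n * (\<Sum>i<n. (norm (f (int i)))\<^sup>2)"
    by simp
  then show ?thesis
    using False by (simp add: av_def norm_divide power_divide divide_simps power2_eq_square mult_ac)
qed (simp add: av_def)

lemma av_norm_square: "of_real ((norm (av n f))\<^sup>2) = av n (\<lambda>i. av n (\<lambda>j. f i * cnj (f j)))"
  by (simp only: complex_norm_square cnj_av av_cmult av_cmult_right[symmetric])

section \<open>Translation, reflection and cosets for periodic functions\<close>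

lemma sum_int_lessThan: "(\<Sum>i<n. f (int i)) = (\<Sum>x\<in>{0..<int n}. f x)"
  by (rule sum.reindex_bij_witness[where i = nat and j = int]) auto

lemma per_mult: "per n f \<Longrightarrow> f (x + int n * k) = f x"
proof (induction k rule: int_induct[where k = 0])
  case (step1 i)
  then show ?case by (metis (no_types, opaque_lifting) add.assoc distrib_left mult.right_neutral per_def)
next
  case (step2 i)
  have "f (x + int n * (i - 1) + int n) = f (x + int n * (i - 1))"
    using step2.prems by (simp add: per_def)
  then show ?case using step2 by (simp add: algebra_simps)
qed simp

lemma per_mod: "per n f \<Longrightarrow> f (x mod int n) = f x"
  using per_mult[of n f "x mod int n" "x div int n"] by (metis add.commute mult_div_mod_eq)

lemma per_dvd: "per n f \<Longrightarrow> n dvd m \<Longrightarrow> per m f"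
  unfolding per_def[of m] by (metis dvd_def of_nat_mult per_mult)

lemma av_shift:
  assumes "per n f"
  shows "av n (\<lambda>x. f (x + c)) = av n f"
proof (cases "n = 0")
  case False
  have "(\<Sum>x\<in>{0..<int n}. f (x + c)) = (\<Sum>x\<in>{0..<int n}. f x)"
  proof (rule sum.reindex_bij_witness[where j = "\<lambda>x. (x + c) mod int n" and i = "\<lambda>x. (x - c) mod int n"])
    fix x assume "x \<in> {0..<int n}"
    then show "((x + c) mod int n - c) mod int n = x" by (simp add: mod_diff_left_eq)
    show "(x + c) mod int n \<in> {0..<int n}" using False by simp
    show "f ((x + c) mod int n) = f (x + c)" using per_mod[OF assms] by simp
  next
    fix x assume "x \<in> {0..<int n}"
    then show "((x - c) mod int n + c) mod int n = x" by (simp add: mod_add_left_eq)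
    show "(x - c) mod int n \<in> {0..<int n}" using False by simp
  qed
  then show ?thesis
    using sum_int_lessThan[of "\<lambda>x. f (x + c)" n] by (simp add: av_def sum_int_lessThan)
qed (simp add: av_def)

lemma av_minus:
  assumes "per n f"
  shows "av n (\<lambda>x. f (- x)) = av n f"
proof (cases "n = 0")
  case False
  have "(\<Sum>x\<in>{0..<int n}. f (- x)) = (\<Sum>x\<in>{0..<int n}. f x)"
  proof (rule sum.reindex_bij_witness[where j = "\<lambda>x. (- x) mod int n" and i = "\<lambda>x. (- x) mod int n"])
    fix x assume "x \<in> {0..<int n}"
    then show *: "(- ((- x) mod int n)) mod int n = x" by (simp add: mod_minus_eq)
    show "(- x) mod int n \<in> {0..<int n}" using False by simp
    show "f ((- x) mod int n) = f (- x)" using per_mod[OF assms] by simp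
  next
    fix x assume "x \<in> {0..<int n}"
    then show "(- ((- x) mod int n)) mod int n = x" by (simp add: mod_minus_eq)
    show "(- x) mod int n \<in> {0..<int n}" using False by simp
  qed
  then show ?thesis
    using sum_int_lessThan[of "\<lambda>x. f (- x)" n] by (simp add: av_def sum_int_lessThan)
qed (simp add: av_def)

text \<open>Division with remainder: each index is \<open>r + d * m\<close> in exactly one way. This
  splits a mean over a cyclic group into means over the residue classes modulo \<open>d\<close>,
  where the Fourier analysis takes place.\<close>

lemma av_coset: "av (d * L) f = av d (\<lambda>r. av L (\<lambda>m. f (r + int d * m)))"
proof -
  have "(\<Sum>i<d * L. f (int i)) = (\<Sum>m<L. \<Sum>r<d. f (int r + int d * int m))"
  proof (induction L)
    case (Suc L)
    have "(\<Sum>i<d * Suc L. f (int i)) = (\<Sum>i<d * L. f (int i)) + (\<Sum>i\<in>{d * L..<d * Suc L}. f (int i))"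
      by (metis (no_types, lifting) atLeast0LessThan le_add2 mult_Suc_right sum.atLeastLessThan_concat zero_le)
    also have "(\<Sum>i\<in>{d * L..<d * Suc L}. f (int i)) = (\<Sum>r<d. f (int r + int d * int L))"
      by (rule sum.reindex_bij_witness[where i = "\<lambda>r. r + d * L" and j = "\<lambda>i. i - d * L"]) auto
    finally show ?case using Suc by simp
  qed simp
  also have "\<dots> = (\<Sum>r<d. \<Sum>m<L. f (int r + int d * int m))"
    by (rule sum.swap)
  finally show ?thesis
    by (simp add: av_def sum_divide_distrib mult.commute)
qed

lemma av_per_dvd:
  assumes "per m f" "m dvd n" "n > 0"
  shows "av n f = av m f"
proof -
  obtain L where L: "n = m * L" using assms by (auto elim: dvdE)
  then have "L > 0" using assms by auto
  then have "av L (\<lambda>k. f (r + int m * k)) = f r" for r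
    using assms(1) by (simp add: per_mult av_const)
  then show ?thesis unfolding L av_coset by simp
qed

subsection \<open>Van der Corput differencing\<close>

text \<open>The windows {0,...,M-1} and {s,...,M+s-1} differ in at most \<open>s\<close> points on
  either side.\<close>

lemma av_shift_close:
  fixes g :: "int \<Rightarrow> complex"
  assumes "M > 0" "\<And>y. norm (g y) \<le> 1" "0 \<le> s"
  shows "norm (av M g - av M (\<lambda>y. g (y + s))) \<le> 2 * of_int s / of_nat M"
proof -
  define A where "A = {0..<int M}"
  define B where "B = {s..<int M + s}"
  have 1: "(\<Sum>i<M. g (int i)) = sum g A"
    unfolding A_def by (rule sum_int_lessThan)
  have 2: "(\<Sum>i<M. g (int i + s)) = sum g B"
    unfolding B_def by (rule sum.reindex_bij_witness[where i = "\<lambda>x. nat (x - s)" and j = "\<lambda>i. int i + s"]) auto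
  have "sum g A - sum g B = sum g (A - B) - sum g (B - A)"
    using sum.Int_Diff[of A g B] sum.Int_Diff[of B g A] by (simp add: A_def B_def Int_commute)
  also have "norm \<dots> \<le> of_nat (card (A - B)) + of_nat (card (B - A))"
    using norm_triangle_ineq4[of "sum g (A - B)" "sum g (B - A)"]
      sum_norm_bound[of "A - B" g 1] sum_norm_bound[of "B - A" g 1] assms(2) by (simp add: )
  also have "card (A - B) \<le> nat s"
  proof -
    have "A - B \<subseteq> {0..<s}" using assms(3) by (auto simp: A_def B_def)
    from card_mono[OF _ this] show ?thesis by simp
  qed
  also have "card (B - A) \<le> nat s"
  proof -
    have "B - A \<subseteq> {int M..<int M + s}" using assms(3) by (auto simp: A_def B_def)
    from card_mono[OF _ this] show ?thesis by simp
  qed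
  finally have "norm (sum g A - sum g B) \<le> 2 * of_int s"
    using assms by simp
  then show ?thesis
    using assms(1) by (simp add: av_def 1 2 divide_right_mono norm_divide flip: diff_divide_distrib)
qed

lemma av_average_shifts_close:
  fixes g :: "int \<Rightarrow> complex"
  assumes "M > 0" "J > 0" "\<And>y. norm (g y) \<le> 1"
    and "\<And>j. 0 \<le> j \<Longrightarrow> j < int J \<Longrightarrow> 0 \<le> s j \<and> s j \<le> S"
  shows "norm (av M g - av J (\<lambda>j. av M (\<lambda>y. g (y + s j)))) \<le> 2 * of_int S / of_nat M"
proof -
  have S: "S \<ge> 0" using assms(4)[of 0] assms(2) by simp
  have "norm (av J (\<lambda>j. av M g) - av J (\<lambda>j. av M (\<lambda>y. g (y + s j)))) \<le> 2 * of_int S / of_nat M"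
  proof (rule av_norm_diff_le)
    fix j assume j: "0 \<le> j" "j < int J"
    have "2 * real_of_int (s j) / of_nat M \<le> 2 * of_int S / of_nat M"
      using assms(4)[OF j] by (intro divide_right_mono) auto
    then show "norm (av M g - av M (\<lambda>y. g (y + s j))) \<le> 2 * of_int S / of_nat M"
      using av_shift_close[where g = g and M = M and s = "s j"] assms(1,3) assms(4)[OF j] by simp
  qed (use S in simp)
  then show ?thesis using assms(2) by (simp add: av_const)
qed

text \<open>The mean over the shifts \<open>s j\<close> is inserted in \<open>y\<close> at a cost of
  at most half of \<eta>; Cauchy-Schwarz in both \<open>x\<close> and \<open>y\<close> then removes
  \<open>b\<close>, and the square is opened. The double mean over shifts is kept instead of being
  regrouped by differences, which avoids weights and lets \<open>s\<close> run through multiples of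
  any fixed integer.\<close>

lemma van_der_corput:
  fixes b :: "int \<Rightarrow> complex" and G :: "int \<Rightarrow> int \<Rightarrow> complex"
  assumes "n > 0" "M > 0" "J > 0"
    and b: "\<And>x. norm (b x) \<le> 1" and G: "\<And>x y. norm (G x y) \<le> 1"
    and s: "\<And>j. 0 \<le> j \<Longrightarrow> j < int J \<Longrightarrow> 0 \<le> s j \<and> s j \<le> S"
    and ge: "\<eta> \<le> norm (av n (\<lambda>x. b x * av M (G x)))" and "2 * of_int S / of_nat M \<le> \<eta> / 2" "\<eta> > 0"
  shows "\<eta>\<^sup>2 / 4 \<le> norm (av J (\<lambda>i. av J (\<lambda>j. av n (\<lambda>x. av M (\<lambda>y. G x (y + s i) * cnj (G x (y + s j)))))))"
proof -
  define A where "A = av n (\<lambda>x. b x * av M (G x))"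
  define A' where "A' = av n (\<lambda>x. b x * av J (\<lambda>j. av M (\<lambda>y. G x (y + s j))))"
  define X where "X = av n (\<lambda>x. av M (\<lambda>y. (norm (av J (\<lambda>j. G x (y + s j))))\<^sup>2))"
  have S: "S \<ge> 0" using s[of 0] assms(3) by simp
  have "norm (A - A') \<le> 2 * of_int S / of_nat M"
    unfolding A_def A'_def
  proof (rule av_norm_diff_le)
    fix x
    have "norm (av M (G x) - av J (\<lambda>j. av M (\<lambda>y. G x (y + s j)))) \<le> 2 * of_int S / of_nat M"
      by (rule av_average_shifts_close) (use assms in auto)
    then have "norm (b x) * norm (av M (G x) - av J (\<lambda>j. av M (\<lambda>y. G x (y + s j)))) \<le> 1 * (2 * of_int S / of_nat M)"
      using b[of x] by (intro mult_mono) auto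
    then show "norm (b x * av M (G x) - b x * av J (\<lambda>j. av M (\<lambda>y. G x (y + s j)))) \<le> 2 * of_int S / of_nat M"
      by (simp add: norm_mult flip: right_diff_distrib)
  qed (use S in simp)
  then have "\<eta> / 2 \<le> norm A'"
    using assms(8) ge norm_triangle_ineq2[of A A'] unfolding A_def by linarith
  then have "(\<eta> / 2)\<^sup>2 \<le> (norm A')\<^sup>2"
    using assms(9) by (intro power_mono) auto
  also have "A' = av n (\<lambda>x. av M (\<lambda>y. b x * av J (\<lambda>j. G x (y + s j))))"
    unfolding A'_def by (subst av_swap) (simp add: av_cmult)
  also have "(norm \<dots>)\<^sup>2 \<le> av n (\<lambda>x. (norm (av M (\<lambda>y. b x * av J (\<lambda>j. G x (y + s j)))))\<^sup>2)"
    by (rule av_square_le)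
  also have "\<dots> \<le> X"
    unfolding X_def
  proof (rule av_mono)
    fix x
    have "(norm (av M (\<lambda>y. b x * av J (\<lambda>j. G x (y + s j)))))\<^sup>2 \<le> av M (\<lambda>y. (norm (b x * av J (\<lambda>j. G x (y + s j))))\<^sup>2)"
      by (rule av_square_le)
    also have "\<dots> \<le> av M (\<lambda>y. (norm (av J (\<lambda>j. G x (y + s j))))\<^sup>2)"
      using b[of x] by (intro av_mono power_mono) (auto simp: norm_mult mult_left_le_one_le)
    finally show "(norm (av M (\<lambda>y. b x * av J (\<lambda>j. G x (y + s j)))))\<^sup>2 \<le> \<dots>" .
  qed
  also have "X = norm (complex_of_real X)"
    by (simp add: X_def av_nonneg)
  also have "complex_of_real X = av n (\<lambda>x. av M (\<lambda>y. av J (\<lambda>i. av J (\<lambda>j. G x (y + s i) * cnj (G x (y + s j))))))"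
    unfolding X_def of_real_av av_norm_square ..
  also have "\<dots> = av n (\<lambda>x. av J (\<lambda>i. av M (\<lambda>y. av J (\<lambda>j. G x (y + s i) * cnj (G x (y + s j))))))"
    by (subst av_swap) (rule refl)
  also have "\<dots> = av J (\<lambda>i. av n (\<lambda>x. av J (\<lambda>j. av M (\<lambda>y. G x (y + s i) * cnj (G x (y + s j))))))"
    by (subst av_swap, subst (2) av_swap) (rule refl)
  also have "\<dots> = av J (\<lambda>i. av J (\<lambda>j. av n (\<lambda>x. av M (\<lambda>y. G x (y + s i) * cnj (G x (y + s j))))))"
    by (subst (2) av_swap) (rule refl)
  finally show ?thesis by (simp add: power_divide)
qed

text \<open>The best \<open>i\<close> is fixed first. Its diagonal term contributes at most 1/J,
  that is at most half of \<eta>, so some other \<open>j\<close> must carry the remaining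
  half.\<close>

lemma off_diagonal_large:
  fixes a :: "int \<Rightarrow> int \<Rightarrow> complex"
  assumes ge: "\<eta> \<le> norm (av J (\<lambda>i. av J (a i)))" and a: "\<And>i j. norm (a i j) \<le> 1"
    and J: "1 / of_nat J \<le> \<eta> / 2" "J > 0" and "\<eta> > 0"
  obtains i j where "0 \<le> i" "i < int J" "0 \<le> j" "j < int J" "i \<noteq> j" "\<eta> / 2 \<le> norm (a i j)"
proof -
  have "\<eta> \<le> av J (\<lambda>i. norm (av J (a i)))"
    using ge norm_av_le[of J "\<lambda>i. av J (a i)"] by simp
  then obtain i where i: "0 \<le> i" "i < int J" "\<eta> \<le> norm (av J (a i))"
    using av_ex_ge[OF J(2), of "\<lambda>i. norm (av J (a i))"] by auto
  have "\<eta> \<le> av J (\<lambda>j. norm (a i j))"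
    using i(3) norm_av_le[of J "a i"] by linarith
  then have 1: "\<eta> * J \<le> (\<Sum>j\<in>{0..<int J}. norm (a i j))"
    using J(2) sum_int_lessThan[of "\<lambda>j. norm (a i j)" J] by (simp add: av_def field_simps)
  have "(\<Sum>j\<in>{0..<int J}. norm (a i j)) = norm (a i i) + (\<Sum>j\<in>{0..<int J} - {i}. norm (a i j))"
    using i by (simp add: sum.remove)
  then have 2: "\<eta> * J - 1 \<le> (\<Sum>j\<in>{0..<int J} - {i}. norm (a i j))"
    using 1 a[of i i] by linarith
  have "\<exists>j\<in>{0..<int J} - {i}. \<eta> / 2 \<le> norm (a i j)"
  proof (rule ccontr)
    assume "\<not> ?thesis"
    then have "(\<Sum>j\<in>{0..<int J} - {i}. norm (a i j)) \<le> (\<Sum>j\<in>{0..<int J} - {i}. \<eta> / 2)"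
      by (intro sum_mono) (meson less_imp_le not_le)
    also have "\<dots> = (real J - 1) * (\<eta> / 2)"
      using i J(2) by (simp add: card_Diff_singleton of_nat_diff)
    finally have "\<eta> * J - 1 \<le> (real J - 1) * (\<eta> / 2)" using 2 by simp
    moreover have "1 \<le> \<eta> / 2 * J" using J by (simp add: field_simps)
    ultimately show False using assms(5) by (simp add: field_simps)
  qed
  then obtain j where "j \<in> {0..<int J} - {i}" "\<eta> / 2 \<le> norm (a i j)" by blast
  then show ?thesis using that[of i j] i by auto
qed

text \<open>The counting operator on the cyclic group of order \<open>n\<close>. The variable
  \<open>y\<close> starts at 0; the passage from the range 1,...,M is made in
  \<open>counting_op_le\<close>.\<close>

definition Lam :: "nat \<Rightarrow> nat \<Rightarrow> nat \<Rightarrow> (int \<Rightarrow> complex) \<Rightarrow> (int \<Rightarrow> complex) \<Rightarrow> (int \<Rightarrow> complex) \<Rightarrow> complex" where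
  "Lam n q M f0 f1 f2 = av n (\<lambda>x. av M (\<lambda>y. f0 x * f1 (x + y) * f2 (x + int q * y\<^sup>2)))"

lemma norm_mult_le_1:
  fixes a b :: complex
  shows "norm a \<le> 1 \<Longrightarrow> norm b \<le> 1 \<Longrightarrow> norm (a * b) \<le> 1"
  by (simp add: norm_mult mult_le_one)

lemma one_boundedD: "one_bounded f \<Longrightarrow> norm (f x) \<le> 1"
  by (simp add: one_bounded_def)

lemma perD: "per n f \<Longrightarrow> f (x + int n) = f x"
  by (simp add: per_def)

lemma per_eq: "per n f \<Longrightarrow> u = v + int n \<Longrightarrow> f u = f v"
  by (simp add: per_def)

lemma per_shift:
  assumes "per n f"
  shows "per n (\<lambda>x. f (x + c))"
  unfolding per_def using per_eq[OF assms] by (metis add.assoc add.commute)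

text \<open>Differencing in \<open>y\<close> removes \<open>f0\<close>. After \<open>x\<close> is
  replaced by \<open>x - y\<close> the factor coming from \<open>f1\<close> is free of
  \<open>y\<close>, so a second differencing removes it as well. In the four remaining factors the
  term q y^2 is common and disappears under a translation of \<open>x\<close>, which leaves shifts
  linear in \<open>y\<close>. Since all differencing shifts are multiples of \<tau>, so are the
  constants \<open>b1\<close>, ..., \<open>b4\<close>.\<close>

lemma parallelogram_differencing:
  assumes "n > 0" "M > 0" "J > 0" "\<tau> > 0"
    and per: "per n f0" "per n f1" "per n f2"
    and bd: "one_bounded f0" "one_bounded f1" "one_bounded f2"
    and eta: "0 < \<eta>" "\<eta> \<le> 1" "\<eta> \<le> norm (Lam n q M f0 f1 f2)"
    and J: "512 / \<eta> ^ 4 \<le> real J" and tau: "32 * real \<tau> * (real J)\<^sup>2 \<le> \<eta>\<^sup>2 * real M"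
  obtains e1 e2 e3 e4 b1 b2 b3 b4 :: int where
    "0 \<le> e1" "e1 < int J ^ 2" "0 \<le> e2" "e2 < int J ^ 2" "0 \<le> e3" "e3 < int J ^ 2" "0 \<le> e4" "e4 < int J ^ 2"
    "e4 \<noteq> e1" "e4 \<noteq> e2" "e4 \<noteq> e3" "e1 + e4 = e2 + e3"
    "int \<tau> dvd b1" "int \<tau> dvd b2" "int \<tau> dvd b3" "int \<tau> dvd b4"
    "\<eta> ^ 4 / 512 \<le> norm (av n (\<lambda>x. av M (\<lambda>y. f2 (x + b1 + 2 * int q * int \<tau> * e1 * y) *
       cnj (f2 (x + b2 + 2 * int q * int \<tau> * e2 * y)) * cnj (f2 (x + b3 + 2 * int q * int \<tau> * e3 * y)) *
       f2 (x + b4 + 2 * int q * int \<tau> * e4 * y))))"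
proof -
  \<comment> \<open>The first differencing leaves \<eta>^2/4, of which half survives off the
    diagonal; the second one turns this into \<theta>^2/8 = \<eta>^4/512.\<close>
  define \<theta> where "\<theta> = \<eta>\<^sup>2 / 8"
  have th: "0 < \<theta>" "\<theta> \<le> 1" using eta power_le_one[of \<eta> 2] by (auto simp: \<theta>_def)
  have J1: "1 / real J \<le> \<eta> ^ 4 / 512"
    using J eta(1) \<open>J > 0\<close> by (simp add: field_simps)
  have "\<eta> ^ 4 \<le> \<eta>\<^sup>2" using eta by (intro power_decreasing) auto
  then have J2: "1 / real J \<le> (\<eta>\<^sup>2 / 4) / 2" using J1 zero_le_power2[of \<eta>] by linarith
  have J3: "1 / real J \<le> (\<theta>\<^sup>2 / 4) / 2"
    using J1 by (simp add: \<theta>_def power_divide flip: power_mult)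
  have tau2: "2 * real_of_int (int \<tau> * int J * int J) / real M \<le> \<theta> / 2"
    using tau \<open>M > 0\<close> by (simp add: \<theta>_def field_simps power2_eq_square)
  have "real \<tau> * real J \<le> real \<tau> * (real J)\<^sup>2"
    using \<open>J > 0\<close> by (intro mult_left_mono self_le_power) auto
  then have "32 * (real \<tau> * real J) \<le> \<eta>\<^sup>2 * real M" using tau by linarith
  also have "\<dots> \<le> \<eta> * real M"
    using eta by (intro mult_right_mono) (auto simp: power2_eq_square mult_left_le_one_le)
  finally have "32 * (real \<tau> * real J) \<le> \<eta> * real M" .
  have tau1: "2 * real_of_int (int \<tau> * int J) / real M \<le> \<eta> / 2"
  proof -
    have "0 \<le> real \<tau> * real J" by simp
    then have "4 * (real \<tau> * real J) \<le> \<eta> * real M" using \<open>32 * (real \<tau> * real J) \<le> \<eta> * real M\<close> by linarith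
    then show ?thesis using \<open>M > 0\<close> by (simp add: field_simps)
  qed
  note b0 = bd[THEN one_boundedD]
  note nb = norm_mult_le_1 b0
  have L: "Lam n q M f0 f1 f2 = av n (\<lambda>x. f0 x * av M (\<lambda>y. f1 (x + y) * f2 (x + int q * y\<^sup>2)))"
    unfolding Lam_def by (simp add: mult.assoc av_cmult)
  have "\<eta>\<^sup>2 / 4 \<le> norm (av J (\<lambda>i. av J (\<lambda>j. av n (\<lambda>x. av M (\<lambda>y.
      (f1 (x + (y + int \<tau> * i)) * f2 (x + int q * (y + int \<tau> * i)\<^sup>2)) *
      cnj (f1 (x + (y + int \<tau> * j)) * f2 (x + int q * (y + int \<tau> * j)\<^sup>2)))))))"
    by (rule van_der_corput[where b = f0 and S = "int \<tau> * int J", OF assms(1-3)])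
      (use eta tau1 L nb in \<open>auto intro: mult_left_mono\<close>)
  then obtain j j' where j: "0 \<le> j" "j < int J" "0 \<le> j'" "j' < int J" "j \<noteq> j'"
    and ge: "\<theta> \<le> norm (av n (\<lambda>x. av M (\<lambda>y.
      (f1 (x + (y + int \<tau> * j)) * f2 (x + int q * (y + int \<tau> * j)\<^sup>2)) *
      cnj (f1 (x + (y + int \<tau> * j')) * f2 (x + int q * (y + int \<tau> * j')\<^sup>2)))))"
  proof (rule off_diagonal_large)
    show "norm (av n (\<lambda>x. av M (\<lambda>y. (f1 (x + (y + int \<tau> * i)) * f2 (x + int q * (y + int \<tau> * i)\<^sup>2)) *
      cnj (f1 (x + (y + int \<tau> * j)) * f2 (x + int q * (y + int \<tau> * j)\<^sup>2))))) \<le> 1" for i j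
      by (intro norm_av_le_const norm_mult_le_1) (auto simp: norm_mult intro!: mult_le_one b0)
  qed (use J2 \<open>J > 0\<close> eta in \<open>auto simp: \<theta>_def\<close>)
  define B where "B = (\<lambda>x. f1 (x + int \<tau> * j) * cnj (f1 (x + int \<tau> * j')))"
  define H where "H = (\<lambda>x y. f2 (x - y + int q * (y + int \<tau> * j)\<^sup>2) * cnj (f2 (x - y + int q * (y + int \<tau> * j')\<^sup>2)))"
  have pB: "per n B" and pH: "per n (\<lambda>x. H x y)" for y
    unfolding per_def B_def H_def
    by (intro allI arg_cong2[where f = "(*)"] arg_cong[where f = cnj] per_eq[OF per(2)] per_eq[OF per(3)]; simp)+
  have bB: "norm (B x) \<le> 1" and bH: "norm (H x y) \<le> 1" for x y
    unfolding B_def H_def by (auto intro!: norm_mult_le_1 b0)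
  have "av n (\<lambda>x. av M (\<lambda>y.
      (f1 (x + (y + int \<tau> * j)) * f2 (x + int q * (y + int \<tau> * j)\<^sup>2)) *
      cnj (f1 (x + (y + int \<tau> * j')) * f2 (x + int q * (y + int \<tau> * j')\<^sup>2))))
     = av M (\<lambda>y. av n (\<lambda>x. (\<lambda>x. B x * H x y) (x + y)))"
    by (subst av_swap) (simp add: B_def H_def add.assoc mult_ac)
  also have "\<dots> = av M (\<lambda>y. av n (\<lambda>x. B x * H x y))"
    using pB pH by (subst av_shift) (auto simp: per_def)
  also have "\<dots> = av n (\<lambda>x. B x * av M (H x))"
    by (subst av_swap) (simp add: av_cmult)
  finally have ge2: "\<theta> \<le> norm (av n (\<lambda>x. B x * av M (H x)))" using ge by simp
  have "\<theta>\<^sup>2 / 4 \<le> norm (av J (\<lambda>i. av J (\<lambda>i'. av n (\<lambda>x. av M (\<lambda>y.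
      H x (y + int \<tau> * int J * i) * cnj (H x (y + int \<tau> * int J * i')))))))"
    by (rule van_der_corput[where b = B and S = "int \<tau> * int J * int J", OF assms(1-3)])
      (use th tau2 ge2 bB bH in \<open>auto intro: mult_left_mono\<close>)
  then obtain i i' where i: "0 \<le> i" "i < int J" "0 \<le> i'" "i' < int J" "i \<noteq> i'"
    and ge3: "\<theta>\<^sup>2 / 4 / 2 \<le> norm (av n (\<lambda>x. av M (\<lambda>y.
      H x (y + int \<tau> * int J * i) * cnj (H x (y + int \<tau> * int J * i')))))"
  proof (rule off_diagonal_large)
    show "norm (av n (\<lambda>x. av M (\<lambda>y. H x (y + int \<tau> * int J * i) * cnj (H x (y + int \<tau> * int J * i'))))) \<le> 1" for i i'
      by (intro norm_av_le_const norm_mult_le_1) (auto intro: bH)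
  qed (use J3 \<open>J > 0\<close> th in auto)
  \<comment> \<open>The second differencing uses steps of \<open>\<tau> * J\<close>, so that a pair
    (i, j) enters through a number with digits i and j in base \<open>J\<close>. Distinct pairs give
    distinct numbers, and \<open>e4\<close> differs from the other three.\<close>
  define e where "e = (\<lambda>i j. int J * i + j)"
  define \<beta> where "\<beta> = (\<lambda>i j. int q * (int \<tau>)\<^sup>2 * (e i j)\<^sup>2 - int \<tau> * int J * i)"
  define K where "K = (\<lambda>x y. f2 (x + \<beta> i j + 2 * int q * int \<tau> * e i j * y) *
       cnj (f2 (x + \<beta> i j' + 2 * int q * int \<tau> * e i j' * y)) * cnj (f2 (x + \<beta> i' j + 2 * int q * int \<tau> * e i' j * y)) *
       f2 (x + \<beta> i' j' + 2 * int q * int \<tau> * e i' j' * y))"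
  have pK: "per n (\<lambda>x. K x y)" for y
  proof -
    have "f2 (x + int n + u + v) = f2 (x + u + v)" for x u v
      by (rule per_eq[OF per(3)]) simp
    then show ?thesis by (simp add: per_def K_def)
  qed
  have "av n (\<lambda>x. av M (\<lambda>y. H x (y + int \<tau> * int J * i) * cnj (H x (y + int \<tau> * int J * i')))) =
        av M (\<lambda>y. av n (\<lambda>x. K (x + (int q * y\<^sup>2 - y)) y))"
    unfolding K_def H_def \<beta>_def e_def
    by (subst av_swap) (simp add: algebra_simps power2_eq_square)
  also have "\<dots> = av M (\<lambda>y. av n (\<lambda>x. K x y))"
    using pK by (subst av_shift) auto
  also have "\<dots> = av n (\<lambda>x. av M (K x))" by (rule av_swap)
  finally have fin: "\<eta> ^ 4 / 512 \<le> norm (av n (\<lambda>x. av M (K x)))"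
    using ge3 by (simp add: \<theta>_def power_divide flip: power_mult)
  have bound: "0 \<le> e k l \<and> e k l < int J ^ 2" if "0 \<le> k" "k < int J" "0 \<le> l" "l < int J" for k l
  proof -
    have "int J * k \<le> int J * (int J - 1)" using that by (intro mult_left_mono) auto
    then show ?thesis using that by (simp add: e_def power2_eq_square algebra_simps)
  qed
  have ne: "e i' j' \<noteq> e i l" if "0 \<le> l" "l < int J" for l
  proof
    assume "e i' j' = e i l"
    then have "int J * (i' - i) = l - j'" by (simp add: e_def algebra_simps)
    then have "int J dvd l - j'" by (metis dvd_triv_left)
    moreover have "\<bar>l - j'\<bar> < int J" using that j by auto
    ultimately have "l = j'" using zdvd_imp_le[of "int J" "\<bar>l - j'\<bar>"] by (cases "l = j'") auto
    then show False using \<open>e i' j' = e i l\<close> i(5) \<open>J > 0\<close> by (simp add: e_def)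
  qed
  show ?thesis
  proof (rule that[of "e i j" "e i j'" "e i' j" "e i' j'" "\<beta> i j" "\<beta> i j'" "\<beta> i' j" "\<beta> i' j'"])
    show "e i' j' \<noteq> e i' j" using j by (simp add: e_def)
    show "e i j + e i' j' = e i j' + e i' j" by (simp add: e_def)
    show "int \<tau> dvd \<beta> i j" "int \<tau> dvd \<beta> i j'" "int \<tau> dvd \<beta> i' j" "int \<tau> dvd \<beta> i' j'"
      by (auto simp: \<beta>_def power2_eq_square mult_ac)
    show "\<eta> ^ 4 / 512 \<le> norm (av n (\<lambda>x. av M (\<lambda>y. f2 (x + \<beta> i j + 2 * int q * int \<tau> * e i j * y) *
       cnj (f2 (x + \<beta> i j' + 2 * int q * int \<tau> * e i j' * y)) * cnj (f2 (x + \<beta> i' j + 2 * int q * int \<tau> * e i' j * y)) *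
       f2 (x + \<beta> i' j' + 2 * int q * int \<tau> * e i' j' * y))))"
      using fin by (simp add: K_def)
  qed (use bound i j ne in auto)
qed

subsection \<open>Fourier analysis on cyclic groups\<close>

lemma av_divide: "av n (\<lambda>x. f x / c) = av n f / c"
  by (simp add: av_def sum_divide_distrib divide_divide_eq_left mult.commute)

definition chi :: "nat \<Rightarrow> int \<Rightarrow> complex" where
  "chi L j = ee (of_int j / of_nat L)"

text \<open>Normalised as a mean, so that bounded functions have coefficients of modulus at most 1.
  Frequencies are averaged with \<open>av\<close> as well, hence the factor \<open>L\<close> in
  inversion and in Parseval's identity.\<close>

definition ft :: "nat \<Rightarrow> (int \<Rightarrow> complex) \<Rightarrow> int \<Rightarrow> complex" where
  "ft L g k = av L (\<lambda>m. g m * chi L (- (k * m)))"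

lemma norm_chi [simp]: "norm (chi L j) = 1"
  by (simp add: chi_def)

lemma chi_add: "chi L (i + j) = chi L i * chi L j"
  by (simp add: chi_def add_divide_distrib ee_add)

lemma cnj_chi: "cnj (chi L j) = chi L (- j)"
  by (simp add: chi_def cnj_ee)

lemma chi_0 [simp]: "chi L 0 = 1"
  by (simp add: chi_def)

lemma chi_mult: "L > 0 \<Longrightarrow> chi L (int L * k) = 1"
  by (simp add: chi_def)

lemma chi_eq: "L > 0 \<Longrightarrow> i = j + int L * k \<Longrightarrow> chi L i = chi L j"
  by (simp add: chi_add chi_mult)

lemma chi_eq_1_iff:
  assumes "L > 0"
  shows "chi L j = 1 \<longleftrightarrow> int L dvd j"
proof
  assume "chi L j = 1"
  then obtain k where "real_of_int j / real L = real_of_int k"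
    unfolding chi_def ee_eq_1_iff by (auto elim: Ints_cases)
  then have "real_of_int j = real_of_int (int L * k)"
    using assms by (simp add: field_simps)
  then show "int L dvd j" by (metis dvd_triv_left of_int_eq_iff)
qed (use assms in \<open>auto simp: chi_mult elim!: dvdE\<close>)

lemma av_chi:
  assumes "L > 0"
  shows "av L (\<lambda>k. chi L (k * j)) = (if int L dvd j then 1 else 0)"
proof (cases "int L dvd j")
  case True
  then have "chi L (k * j) = 1" for k using assms by (simp add: chi_eq_1_iff)
  then show ?thesis using True assms by (simp add: av_const)
next
  case False
  have pw: "chi L (int k * j) = chi L j ^ k" for k
    by (simp add: chi_def ee_power)
  have "chi L j ^ L = 1"
    using pw[of L] assms by (simp add: chi_mult)
  moreover have "chi L j \<noteq> 1" using False assms by (simp add: chi_eq_1_iff)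
  ultimately have "(\<Sum>k<L. chi L j ^ k) = 0"
    by (simp add: geometric_sum)
  then show ?thesis using False by (simp add: av_def pw)
qed

lemma av_indicator:
  assumes "per L g" "L > 0"
  shows "of_nat L * av L (\<lambda>i. g i * (if int L dvd m - i then 1 else 0)) = (g m :: complex)"
proof -
  have "of_nat L * av L (\<lambda>i. g i * (if int L dvd m - i then 1 else 0))
      = (\<Sum>i\<in>{0..<int L}. g i * (if int L dvd m - i then 1 else 0))"
    using assms(2) sum_int_lessThan[of "\<lambda>i. g i * (if int L dvd m - i then 1 else 0)" L] by (simp add: av_def)
  also have "\<dots> = (\<Sum>i\<in>{0..<int L}. if i = m mod int L then g i else 0)"
  proof (rule sum.cong)
    fix i assume "i \<in> {0..<int L}"
    then have "int L dvd m - i \<longleftrightarrow> i = m mod int L"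
      by (metis atLeastLessThan_iff mod_eq_dvd_iff mod_pos_pos_trivial)
    then show "g i * (if int L dvd m - i then 1 else 0) = (if i = m mod int L then g i else 0)" by simp
  qed simp
  also have "\<dots> = g (m mod int L)" using assms(2) by simp
  finally show ?thesis using per_mod[OF assms(1)] by simp
qed

lemma ft_inversion:
  assumes "per L g" "L > 0"
  shows "g m = of_nat L * av L (\<lambda>k. ft L g k * chi L (k * m))"
proof -
  have "av L (\<lambda>k. ft L g k * chi L (k * m)) = av L (\<lambda>k. av L (\<lambda>i. g i * chi L (k * (m - i))))"
    unfolding ft_def av_cmult_right[symmetric]
    by (simp add: mult.assoc flip: chi_add) (simp add: algebra_simps)
  also have "\<dots> = av L (\<lambda>i. g i * (if int L dvd m - i then 1 else 0))"
    by (subst av_swap) (simp add: av_cmult av_chi[OF assms(2)])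
  finally show ?thesis using av_indicator[OF assms] by simp
qed

lemma parseval:
  assumes "per L g" "L > 0"
  shows "real L * av L (\<lambda>k. (norm (ft L g k))\<^sup>2) = av L (\<lambda>m. (norm (g m))\<^sup>2)"
proof -
  have "complex_of_real (real L * av L (\<lambda>k. (norm (ft L g k))\<^sup>2)) = of_nat L * av L (\<lambda>k. ft L g k * cnj (ft L g k))"
    by (simp only: of_real_mult of_real_of_nat_eq of_real_av complex_norm_square)
  also have "\<dots> = of_nat L * av L (\<lambda>k. av L (\<lambda>m. cnj (g m) * (ft L g k * chi L (k * m))))"
    unfolding ft_def[of L g] cnj_av av_cmult[symmetric] by (simp add: cnj_chi mult_ac)
  also have "\<dots> = av L (\<lambda>m. cnj (g m) * (of_nat L * av L (\<lambda>k. ft L g k * chi L (k * m))))"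
    by (subst av_swap) (simp add: av_cmult[symmetric] mult_ac)
  also have "\<dots> = av L (\<lambda>m. cnj (g m) * g m)"
    using ft_inversion[OF assms] by simp
  also have "\<dots> = complex_of_real (av L (\<lambda>m. (norm (g m))\<^sup>2))"
    by (simp only: of_real_av complex_norm_square) (simp add: mult.commute)
  finally show ?thesis using of_real_eq_iff by blast
qed

lemma parseval_le:
  assumes "per L g" "L > 0" "\<And>m. norm (g m) \<le> 1"
  shows "real L * av L (\<lambda>k. (norm (ft L g k))\<^sup>2) \<le> 1"
proof -
  have "av L (\<lambda>m. (norm (g m))\<^sup>2) \<le> av L (\<lambda>m. 1)"
    using assms(3) by (intro av_mono) (simp add: power_le_one)
  then show ?thesis using assms(2) by (simp add: parseval[OF assms(1,2)] av_const)
qed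

lemma per_ft: "L > 0 \<Longrightarrow> per L (ft L g)"
  unfolding per_def ft_def
proof (intro allI av_cong arg_cong2[where f = "(*)"] refl)
  fix k m assume "L > 0"
  then show "chi L (- ((k + int L) * m)) = chi L (- (k * m))"
    by (intro chi_eq[where k = "- m"]) (auto simp: algebra_simps)
qed

lemma ft_bound:
  assumes "\<And>m. norm (g m) \<le> 1"
  shows "norm (ft L g k) \<le> 1"
  unfolding ft_def using assms by (intro norm_av_le_const) (auto simp: norm_mult)

section \<open>Points of an interval in a residue class, and kernel estimates\<close>

lemma card_cong_le:
  assumes "m > 0"
  shows "card {x \<in> {lo..<lo + int M}. int m dvd x - y} \<le> M div m + 1"
proof -
  define r where "r = (y - lo) mod int m"
  have "{x \<in> {lo..<lo + int M}. int m dvd x - y} \<subseteq> (\<lambda>i. lo + r + int m * int i) ` {0..M div m}"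
  proof
    fix x assume x: "x \<in> {x \<in> {lo..<lo + int M}. int m dvd x - y}"
    then have "(x - lo) mod int m = r"
      unfolding r_def by (simp add: mod_eq_dvd_iff)
    then have "x = lo + r + int m * ((x - lo) div int m)"
      using mult_div_mod_eq[of "int m" "x - lo"] by linarith
    moreover have "0 \<le> (x - lo) div int m" using x assms by (simp add: pos_imp_zdiv_nonneg_iff)
    moreover have "(x - lo) div int m \<le> int M div int m"
      using x assms by (intro zdiv_mono1) auto
    ultimately show "x \<in> (\<lambda>i. lo + r + int m * int i) ` {0..M div m}"
      by (intro image_eqI[of _ _ "nat ((x - lo) div int m)"]) (auto simp: nat_le_iff zdiv_int)
  qed
  then have "card {x \<in> {lo..<lo + int M}. int m dvd x - y} \<le> card ((\<lambda>i. lo + r + int m * int i) ` {0..M div m})"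
    by (intro card_mono) auto
  also have "\<dots> \<le> card {0..M div m}" by (rule card_image_le) simp
  finally show ?thesis by simp
qed

text \<open>Opening the square and summing over \<open>l\<close> leaves the pairs with
  \<open>y\<close> and \<open>y'\<close> congruent modulo \<open>L / gcd v L\<close>, at most M
  gcd/L + 1 of them for each \<open>y\<close>. So the squared kernel has small total mass along a
  progression of frequencies whose step is nearly coprime to \<open>L\<close>.\<close>

lemma weight_sum:
  assumes "L > 0" "M > 0"
  shows "real L * av L (\<lambda>l. (norm (av M (\<lambda>y. chi L ((c + l * v) * y))))\<^sup>2) \<le> real_of_int (gcd v (int L)) + real L / real M"
proof -
  define g where "g = gcd v (int L)"
  have g: "g > 0" "g dvd int L" "g dvd v" using assms by (auto simp: g_def)
  define m where "m = nat (int L div g)"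
  have m: "int L = g * int m" and "m > 0"
    using g assms by (auto simp: m_def pos_imp_zdiv_pos_iff zdvd_imp_le pos_imp_zdiv_nonneg_iff)
  define W where "W = (\<lambda>y y'. if int L dvd v * (y - y') then 1 else 0 :: real)"
  have "complex_of_real (av L (\<lambda>l. (norm (av M (\<lambda>y. chi L ((c + l * v) * y))))\<^sup>2))
      = av L (\<lambda>l. av M (\<lambda>y. av M (\<lambda>y'. chi L ((c + l * v) * y) * cnj (chi L ((c + l * v) * y')))))"
    by (simp only: of_real_av av_norm_square)
  also have "\<dots> = av M (\<lambda>y. av M (\<lambda>y'. av L (\<lambda>l. chi L ((c + l * v) * y) * cnj (chi L ((c + l * v) * y')))))"
    by (subst av_swap, subst (2) av_swap) (rule refl)
  also have "\<dots> = av M (\<lambda>y. av M (\<lambda>y'. chi L (c * (y - y')) * complex_of_real (W y y')))"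
  proof (intro av_cong)
    fix y y'
    have "av L (\<lambda>l. chi L ((c + l * v) * y) * cnj (chi L ((c + l * v) * y')))
        = av L (\<lambda>l. chi L (c * (y - y')) * chi L (l * (v * (y - y'))))"
      by (simp add: cnj_chi flip: chi_add) (simp add: algebra_simps)
    then show "av L (\<lambda>l. chi L ((c + l * v) * y) * cnj (chi L ((c + l * v) * y'))) = chi L (c * (y - y')) * complex_of_real (W y y')"
      using assms(1) by (simp add: av_cmult av_chi W_def)
  qed
  finally have eq: "complex_of_real (av L (\<lambda>l. (norm (av M (\<lambda>y. chi L ((c + l * v) * y))))\<^sup>2)) = \<dots>" .
  have "av L (\<lambda>l. (norm (av M (\<lambda>y. chi L ((c + l * v) * y))))\<^sup>2)
      = norm (complex_of_real (av L (\<lambda>l. (norm (av M (\<lambda>y. chi L ((c + l * v) * y))))\<^sup>2)))"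
    by (simp add: av_nonneg)
  also have "\<dots> \<le> real_of_int g / real L + 1 / real M"
    unfolding eq
  proof (rule norm_av_le_const)
    fix y
    have sub: "{y' \<in> {0..<int M}. int L dvd v * (y - y')} \<subseteq> {y' \<in> {0..<0 + int M}. int m dvd y' - y}"
    proof safe
      fix y' assume "int L dvd v * (y - y')" 
      then have "g * int m dvd g * ((v div g) * (y - y'))"
        using g(3) m by (metis dvd_mult_div_cancel mult.assoc)
      then have "int m dvd (v div g) * (y - y')" using g by simp
      moreover have "coprime (int m) (v div g)"
        using g m div_gcd_coprime[of v "int L"] assms(1) unfolding g_def[symmetric]
        by (metis coprime_commute nonzero_mult_div_cancel_left of_nat_0_less_iff less_irrefl)
      ultimately have "int m dvd y - y'" by (simp add: coprime_dvd_mult_right_iff)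
      then show "int m dvd y' - y" by (simp add: dvd_diff_commute)
    qed auto
    have cd: "card {y' \<in> {0..<int M}. int L dvd v * (y - y')} \<le> M div m + 1"
    proof (rule order_trans[OF card_mono[OF _ sub] card_cong_le[OF \<open>m > 0\<close>]])
      show "finite {y' \<in> {0..<0 + int M}. int m dvd y' - y}"
        by (rule finite_subset[of _ "{0..<int M}"]) auto
    qed
    have "norm (av M (\<lambda>y'. chi L (c * (y - y')) * complex_of_real (W y y'))) \<le> av M (\<lambda>y'. W y y')"
      by (rule order_trans[OF norm_av_le]) (auto simp: norm_mult W_def intro!: av_mono)
    also have "\<dots> = (\<Sum>y'\<in>{0..<int M}. if int L dvd v * (y - y') then 1 else 0) / real M"
      using sum_int_lessThan[of "W y" M] by (simp add: av_def W_def)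
    also have "(\<Sum>y'\<in>{0..<int M}. if int L dvd v * (y - y') then 1 else 0 :: real) = card {y' \<in> {0..<int M}. int L dvd v * (y - y')}"
      by (simp add: sum.If_cases Int_def)
    also have "real (card {y' \<in> {0..<int M}. int L dvd v * (y - y')}) / real M \<le> (real M / real m + 1) / real M"
      using of_nat_div_le_of_nat[of M m, where ?'a = real] cd by (intro divide_right_mono) linarith+
    also have "\<dots> = 1 / real m + 1 / real M" using assms by (simp add: field_simps)
    also have "1 / real m = real_of_int g / real L"
    proof -
      have "real L = real_of_int (int L)" by simp
      also have "\<dots> = real_of_int g * real m" unfolding m by simp
      finally show ?thesis using g \<open>m > 0\<close> by simp
    qed
    finally show "norm (av M (\<lambda>y'. chi L (c * (y - y')) * complex_of_real (W y y'))) \<le> real_of_int g / real L + 1 / real M" .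
  qed (use g in auto)
  finally show ?thesis
    using assms unfolding g_def[symmetric] by (simp add: field_simps)
qed

text \<open>In Fourier space the form is a sum over two frequencies of coefficients of
  \<open>a\<close>, \<open>b\<close>, \<open>c\<close> times two Dirichlet kernels, one from
  \<open>y\<close> and one from the auxiliary \<open>z\<close>. The variable \<open>z\<close> is
  there to produce the second kernel: a product of two is bounded by squares, which are summable.
  The coefficient of \<open>c\<close> is estimated by its maximum \<open>S\<close>, the other two by
  Parseval.\<close>

lemma three_term_bound:
  assumes "L > 0" "M > 0" "T > 0" "T \<le> M"
    and per: "per L a" "per L b" "per L c"
    and bd: "\<And>m. norm (a m) \<le> 1" "\<And>m. norm (b m) \<le> 1" "\<And>k. norm (ft L c k) \<le> S"
    and g: "real_of_int (gcd v4 (int L)) \<le> \<gamma>" "real_of_int (gcd (v4 - v3) (int L)) \<le> \<gamma>"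
  shows "norm (av L (\<lambda>m. av M (\<lambda>y. av T (\<lambda>z. a m * b (m + v3 * (y + z)) * c (m + v4 * (y + z)))))) \<le> S * (\<gamma> + real L / real T)"
proof -
  define DM where "DM = (\<lambda>j. av M (\<lambda>y. chi L (j * y)))"
  define DT where "DT = (\<lambda>j. av T (\<lambda>y. chi L (j * y)))"
  define X where "X = (\<lambda>j. ((norm (DM j))\<^sup>2 + (norm (DT j))\<^sup>2) / 2)"
  define K where "K = \<gamma> + real L / real T"
  define B where "B = (\<lambda>k. norm (ft L b k))"
  define A where "A = (\<lambda>k. norm (ft L a k))"
  have S: "S \<ge> 0" using bd(3)[of 0] norm_ge_zero order_trans by blast
  have pD: "per L DM" "per L DT"
    unfolding per_def DM_def DT_def
  proof (safe intro!: av_cong)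
    show "chi L ((x + int L) * y) = chi L (x * y)" for x y
      by (rule chi_eq[OF assms(1), where k = y]) (simp add: algebra_simps)
    then show "chi L ((x + int L) * y) = chi L (x * y)" for x y .
  qed
  have pX: "per L X" using pD by (simp add: per_def X_def)
  have pA: "per L A" unfolding A_def using per_ft[OF assms(1), of a] by (simp add: per_def)
  have K0: "real L / real M \<le> real L / real T"
    using assms by (intro divide_left_mono) auto
  have XS: "real L * av L (\<lambda>l. X (c' + l * v)) \<le> K" if "real_of_int (gcd v (int L)) \<le> \<gamma>" for c' v
  proof -
    have "real L * av L (\<lambda>l. X (c' + l * v)) = (real L * av L (\<lambda>l. (norm (DM (c' + l * v)))\<^sup>2) + real L * av L (\<lambda>l. (norm (DT (c' + l * v)))\<^sup>2)) / 2"
      by (simp add: X_def av_add av_divide add_divide_distrib ring_distribs)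
    also have "\<dots> \<le> K"
    proof -
      have aux: "(x + y) / 2 \<le> \<gamma>' + t" if "x \<le> g + m" "y \<le> g + t" "g \<le> \<gamma>'" "m \<le> t" for x y g m t \<gamma>' :: real
        using that by argo
      show ?thesis
        unfolding DM_def DT_def K_def
        by (rule aux[OF weight_sum[OF assms(1,2)] weight_sum[OF assms(1,3)] that K0])
    qed
    finally show ?thesis .
  qed
  have B1: "real L * av L (\<lambda>k. (B k)\<^sup>2) \<le> 1" and A1: "real L * av L (\<lambda>k. (A k)\<^sup>2) \<le> 1"
    unfolding B_def A_def using parseval_le assms(1) per bd by blast+
  have A1': "real L * av L (\<lambda>k. (A (- k))\<^sup>2) \<le> 1"
    using A1 av_minus[of L "\<lambda>k. (A k)\<^sup>2"] pA by (simp add: per_def)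
  have "av L (\<lambda>m. av M (\<lambda>y. av T (\<lambda>z. a m * b (m + v3 * (y + z)) * c (m + v4 * (y + z)))))
     = av L (\<lambda>m. av M (\<lambda>y. av T (\<lambda>z. of_nat L * of_nat L * av L (\<lambda>k. av L (\<lambda>l. ft L b k * ft L c l *
         ((a m * chi L (- (- (k + l) * m))) * (chi L ((k * v3 + l * v4) * y) * chi L ((k * v3 + l * v4) * z))))))))"
  proof (intro av_cong)
    fix m y z
    have "b (m + v3 * (y + z)) * c (m + v4 * (y + z)) = of_nat L * of_nat L *
      (av L (\<lambda>k. ft L b k * chi L (k * (m + v3 * (y + z)))) * av L (\<lambda>l. ft L c l * chi L (l * (m + v4 * (y + z)))))"
      by (subst ft_inversion[OF per(2) assms(1), of "m + v3 * (y + z)"],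
          subst ft_inversion[OF per(3) assms(1), of "m + v4 * (y + z)"]) (simp only: mult_ac)
    also have "av L (\<lambda>k. ft L b k * chi L (k * (m + v3 * (y + z)))) * av L (\<lambda>l. ft L c l * chi L (l * (m + v4 * (y + z))))
      = av L (\<lambda>k. av L (\<lambda>l. (ft L b k * chi L (k * (m + v3 * (y + z)))) * (ft L c l * chi L (l * (m + v4 * (y + z))))))"
      by (simp only: av_cmult av_cmult_right)
    also have "\<dots> = av L (\<lambda>k. av L (\<lambda>l. ft L b k * ft L c l *
         (chi L (- (- (k + l) * m)) * (chi L ((k * v3 + l * v4) * y) * chi L ((k * v3 + l * v4) * z)))))"
    proof (intro av_cong)
      fix k l
      have eq: "chi L (k * (m + v3 * (y + z))) * chi L (l * (m + v4 * (y + z)))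
         = chi L (- (- (k + l) * m)) * (chi L ((k * v3 + l * v4) * y) * chi L ((k * v3 + l * v4) * z))"
        unfolding chi_add[symmetric] by (rule arg_cong[where f = "chi L"]) (simp add: algebra_simps)
      have "(ft L b k * chi L (k * (m + v3 * (y + z)))) * (ft L c l * chi L (l * (m + v4 * (y + z))))
        = ft L b k * ft L c l * (chi L (k * (m + v3 * (y + z))) * chi L (l * (m + v4 * (y + z))))"
        by (simp only: mult_ac)
      then show "(ft L b k * chi L (k * (m + v3 * (y + z)))) * (ft L c l * chi L (l * (m + v4 * (y + z))))
        = ft L b k * ft L c l * (chi L (- (- (k + l) * m)) * (chi L ((k * v3 + l * v4) * y) * chi L ((k * v3 + l * v4) * z)))"
        unfolding eq .
    qed
    finally have "a m * (b (m + v3 * (y + z)) * c (m + v4 * (y + z))) = of_nat L * of_nat L * (a m * \<dots>)"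
      by (simp only: mult_ac)
    then show "a m * b (m + v3 * (y + z)) * c (m + v4 * (y + z)) = of_nat L * of_nat L * av L (\<lambda>k. av L (\<lambda>l. ft L b k * ft L c l *
         ((a m * chi L (- (- (k + l) * m))) * (chi L ((k * v3 + l * v4) * y) * chi L ((k * v3 + l * v4) * z)))))"
      by (simp only: av_cmult[symmetric] mult_ac)
  qed
  also have "\<dots> = of_nat L * of_nat L * av L (\<lambda>k. av L (\<lambda>l. ft L b k * ft L c l *
         (ft L a (- (k + l)) * (DM (k * v3 + l * v4) * DT (k * v3 + l * v4)))))"
  proof -
    have sw: "av L (\<lambda>m. av M (\<lambda>y. av T (\<lambda>z. of_nat L * of_nat L * av L (\<lambda>k. av L (F m y z k)))))
       = of_nat L * of_nat L * av L (\<lambda>k. av L (\<lambda>l. av L (\<lambda>m. av M (\<lambda>y. av T (\<lambda>z. F m y z k l)))))" for F :: "int \<Rightarrow> int \<Rightarrow> int \<Rightarrow> int \<Rightarrow> int \<Rightarrow> complex"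
    proof -
      have "av L (\<lambda>m. av M (\<lambda>y. av T (\<lambda>z. av L (\<lambda>k. av L (F m y z k)))))
        = av L (\<lambda>m. av M (\<lambda>y. av L (\<lambda>k. av L (\<lambda>l. av T (\<lambda>z. F m y z k l)))))"
        by (subst av_swap[of T], subst av_swap[of T]) (rule refl)
      also have "\<dots> = av L (\<lambda>m. av L (\<lambda>k. av L (\<lambda>l. av M (\<lambda>y. av T (\<lambda>z. F m y z k l)))))"
        by (subst av_swap[of M], subst av_swap[of M]) (rule refl)
      also have "\<dots> = av L (\<lambda>k. av L (\<lambda>m. av L (\<lambda>l. av M (\<lambda>y. av T (\<lambda>z. F m y z k l)))))"
        by (rule av_swap)
      also have "\<dots> = av L (\<lambda>k. av L (\<lambda>l. av L (\<lambda>m. av M (\<lambda>y. av T (\<lambda>z. F m y z k l)))))"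
        by (rule arg_cong[where f = "av L"], rule ext, rule av_swap)
      finally show ?thesis by (simp only: av_cmult)
    qed
    show ?thesis
      unfolding sw by (simp only: av_cmult av_cmult_right ft_def[of L a] DM_def DT_def)
  qed
  finally have E: "av L (\<lambda>m. av M (\<lambda>y. av T (\<lambda>z. a m * b (m + v3 * (y + z)) * c (m + v4 * (y + z))))) = of_nat L * of_nat L * av L (\<lambda>k. av L (\<lambda>l. ft L b k * ft L c l *
         (ft L a (- (k + l)) * (DM (k * v3 + l * v4) * DT (k * v3 + l * v4)))))" .
  have N: "norm (of_nat L * of_nat L * av L (\<lambda>k. av L (\<lambda>l. ft L b k * ft L c l *
         (ft L a (- (k + l)) * (DM (k * v3 + l * v4) * DT (k * v3 + l * v4)))))) \<le> real L * real L * av L (\<lambda>k. av L (\<lambda>l. S * (((B k)\<^sup>2 + (A (- (k + l)))\<^sup>2) / 2 * X (k * v3 + l * v4))))"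
  proof -
    have "norm (av L (\<lambda>k. av L (\<lambda>l. ft L b k * ft L c l * (ft L a (- (k + l)) * (DM (k * v3 + l * v4) * DT (k * v3 + l * v4))))))
       \<le> av L (\<lambda>k. av L (\<lambda>l. norm (ft L b k * ft L c l * (ft L a (- (k + l)) * (DM (k * v3 + l * v4) * DT (k * v3 + l * v4))))))"
      by (rule order_trans[OF norm_av_le]) (intro av_mono norm_av_le)
    also have "\<dots> \<le> av L (\<lambda>k. av L (\<lambda>l. S * (((B k)\<^sup>2 + (A (- (k + l)))\<^sup>2) / 2 * X (k * v3 + l * v4))))"
    proof (intro av_mono)
      fix k l
      \<comment> \<open>Used twice: for the coefficients of \<open>a\<close> and \<open>b\<close>,
        and for the two kernels, whose squares are averaged in \<open>X\<close>.\<close>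
      have am: "x * y \<le> (x\<^sup>2 + y\<^sup>2) / 2" for x y :: real
        using sum_squares_bound[of x y] by simp
      have "norm (ft L b k * ft L c l * (ft L a (- (k + l)) * (DM (k * v3 + l * v4) * DT (k * v3 + l * v4))))
         = norm (ft L c l) * ((B k * A (- (k + l))) * (norm (DM (k * v3 + l * v4)) * norm (DT (k * v3 + l * v4))))"
        by (simp add: norm_mult A_def B_def)
      also have "\<dots> \<le> S * (((B k)\<^sup>2 + (A (- (k + l)))\<^sup>2) / 2 * X (k * v3 + l * v4))"
        unfolding X_def
        by (intro mult_mono bd(3) am) (auto simp: A_def B_def S)
      finally show "norm (ft L b k * ft L c l * (ft L a (- (k + l)) * (DM (k * v3 + l * v4) * DT (k * v3 + l * v4)))) \<le> \<dots>" .
    qed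
    finally show ?thesis
      by (simp add: norm_mult mult.assoc mult_left_mono)
  qed
  have eq: "real L * real L * av L (\<lambda>k. av L (\<lambda>l. S * (((B k)\<^sup>2 + (A (- (k + l)))\<^sup>2) / 2 * X (k * v3 + l * v4)))) = S * ((real L * av L (\<lambda>k. (B k)\<^sup>2 * (real L * av L (\<lambda>l. X (k * v3 + l * v4)))) +
      real L * av L (\<lambda>k. real L * av L (\<lambda>l. (A (- (k + l)))\<^sup>2 * X (k * v3 + l * v4)))) / 2)"
    unfolding av_cmult[symmetric]
    by (simp add: av_add[symmetric] av_divide[symmetric] av_cmult[symmetric]) (simp add: field_simps)
  have F: "S * ((real L * av L (\<lambda>k. (B k)\<^sup>2 * (real L * av L (\<lambda>l. X (k * v3 + l * v4)))) +
      real L * av L (\<lambda>k. real L * av L (\<lambda>l. (A (- (k + l)))\<^sup>2 * X (k * v3 + l * v4)))) / 2) \<le> S * ((K + K) / 2)"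
  proof (intro mult_left_mono divide_right_mono add_mono S)
    have "real L * av L (\<lambda>k. (B k)\<^sup>2 * (real L * av L (\<lambda>l. X (k * v3 + l * v4)))) \<le> real L * av L (\<lambda>k. (B k)\<^sup>2 * K)"
      using XS[OF g(1)] by (intro mult_left_mono av_mono) auto
    also have "\<dots> = (real L * av L (\<lambda>k. (B k)\<^sup>2)) * K" by (simp add: av_cmult_right)
    also have "\<dots> \<le> 1 * K"
    proof (rule mult_right_mono[OF B1])
      have "gcd v4 (int L) > 0" using assms by simp
      then have "\<gamma> \<ge> 0" using g(1) by linarith
      then show "K \<ge> 0" by (simp add: K_def)
    qed
    finally show "real L * av L (\<lambda>k. (B k)\<^sup>2 * (real L * av L (\<lambda>l. X (k * v3 + l * v4)))) \<le> K" by simp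
  next
    \<comment> \<open>With k - l in place of k the coefficient of \<open>a\<close> no longer depends
      on \<open>l\<close>, and the kernel is taken at \<open>k * v3 + l * (v4 - v3)\<close>. This is
      why the gcd of \<open>v4 - v3\<close> with \<open>L\<close> has to be small too.\<close>
    have "av L (\<lambda>k. av L (\<lambda>l. (A (- (k + l)))\<^sup>2 * X (k * v3 + l * v4)))
        = av L (\<lambda>l. av L (\<lambda>k. (\<lambda>k. (A (- k))\<^sup>2 * X ((k - l) * v3 + l * v4)) (k + l)))"
      by (subst av_swap) simp
    also have "\<dots> = av L (\<lambda>l. av L (\<lambda>k. (A (- k))\<^sup>2 * X ((k - l) * v3 + l * v4)))"
    proof (rule arg_cong[where f = "av L"], rule ext)
      fix l
      have "A (- (x + int L)) = A (- x)" for x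
        using perD[OF pA, of "- x - int L"] by simp
      moreover have "X ((x + int L - l) * v3 + l * v4) = X ((x - l) * v3 + l * v4)" for x
        using per_mult[OF pX, of "(x - l) * v3 + l * v4" v3] by (simp add: algebra_simps)
      ultimately have "per L (\<lambda>k. (A (- k))\<^sup>2 * X ((k - l) * v3 + l * v4))"
        by (simp add: per_def)
      from av_shift[OF this, of l]
      show "av L (\<lambda>k. (\<lambda>k. (A (- k))\<^sup>2 * X ((k - l) * v3 + l * v4)) (k + l)) = av L (\<lambda>k. (A (- k))\<^sup>2 * X ((k - l) * v3 + l * v4))" .
    qed
    also have "\<dots> = av L (\<lambda>k. (A (- k))\<^sup>2 * av L (\<lambda>l. X (k * v3 + l * (v4 - v3))))"
      by (subst av_swap) (simp add: av_cmult algebra_simps)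
    finally have "real L * av L (\<lambda>k. real L * av L (\<lambda>l. (A (- (k + l)))\<^sup>2 * X (k * v3 + l * v4)))
       = real L * av L (\<lambda>k. (A (- k))\<^sup>2 * (real L * av L (\<lambda>l. X (k * v3 + l * (v4 - v3)))))"
      by (simp add: av_cmult mult.left_commute)
    also have "\<dots> \<le> real L * av L (\<lambda>k. (A (- k))\<^sup>2 * K)"
      using XS[OF g(2)] by (intro mult_left_mono av_mono) auto
    also have "\<dots> = (real L * av L (\<lambda>k. (A (- k))\<^sup>2)) * K" by (simp add: av_cmult_right)
    also have "\<dots> \<le> 1 * K"
    proof (rule mult_right_mono[OF A1'])
      have "gcd v4 (int L) > 0" using assms by simp
      then have "\<gamma> \<ge> 0" using g(1) by linarith
      then show "K \<ge> 0" by (simp add: K_def)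
    qed
    finally show "real L * av L (\<lambda>k. real L * av L (\<lambda>l. (A (- (k + l)))\<^sup>2 * X (k * v3 + l * v4))) \<le> K" by simp
  qed auto
  have "norm (av L (\<lambda>m. av M (\<lambda>y. av T (\<lambda>z. a m * b (m + v3 * (y + z)) * c (m + v4 * (y + z)))))) \<le> S * ((K + K) / 2)"
    unfolding E by (rule order_trans[OF N order_trans[OF eq_refl[OF eq] F]])
  moreover have "(K + K) / 2 = \<gamma> + real L / real T" by (simp add: K_def)
  ultimately show ?thesis by simp
qed

subsection \<open>Quadratic exponential sums and major arcs\<close>

text \<open>Collects the pairs in {0,...,M-1} with a given difference \<open>t\<close>, as needed
  for regrouping double sums in Weyl differencing.\<close>

definition Yt :: "nat \<Rightarrow> int \<Rightarrow> int set" where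
  "Yt M t = {y \<in> {0..<int M}. y + t \<in> {0..<int M}}"

lemma Yt_interval: "Yt M t = {max 0 (- t)..<min (int M) (int M - t)}"
  by (auto simp: Yt_def)

lemma finite_Yt [simp]: "finite (Yt M t)"
  by (simp add: Yt_interval)

lemma card_Yt_le: "card (Yt M t) \<le> M"
proof -
  have "Yt M t \<subseteq> {0..<int M}" by (auto simp: Yt_def)
  from card_mono[OF _ this] show ?thesis by simp
qed

lemma double_sum_shift:
  fixes \<Phi> :: "int \<Rightarrow> int \<Rightarrow> 'a::comm_monoid_add"
  shows "(\<Sum>y\<in>{0..<int M}. \<Sum>y'\<in>{0..<int M}. \<Phi> y y') = (\<Sum>t\<in>{- int M..int M}. \<Sum>y\<in>Yt M t. \<Phi> y (y + t))"
proof -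
  have "(\<Sum>y\<in>{0..<int M}. \<Sum>y'\<in>{0..<int M}. \<Phi> y y') = (\<Sum>(y, y')\<in>{0..<int M} \<times> {0..<int M}. \<Phi> y y')"
    by (simp add: sum.cartesian_product)
  also have "\<dots> = (\<Sum>(t, y)\<in>(SIGMA t:{- int M..int M}. Yt M t). \<Phi> y (y + t))"
    by (rule sum.reindex_bij_witness[where i = "\<lambda>(t, y). (y, y + t)" and j = "\<lambda>(y, y'). (y' - y, y)"])
      (auto simp: Yt_def)
  also have "\<dots> = (\<Sum>t\<in>{- int M..int M}. \<Sum>y\<in>Yt M t. \<Phi> y (y + t))"
    by (simp add: sum.Sigma)
  finally show ?thesis .
qed

lemma av_av_sum: "av M (\<lambda>y. av M (F y)) = (\<Sum>y\<in>{0..<int M}. \<Sum>y'\<in>{0..<int M}. F y y') / (of_nat M)\<^sup>2"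
proof -
  have "av M (\<lambda>y. av M (F y)) = (\<Sum>y\<in>{0..<int M}. av M (F y)) / of_nat M"
    using sum_int_lessThan[of "\<lambda>y. av M (F y)" M] by (simp add: av_def[of M "\<lambda>y. av M (F y)"])
  also have "(\<Sum>y\<in>{0..<int M}. av M (F y)) = (\<Sum>y\<in>{0..<int M}. \<Sum>y'\<in>{0..<int M}. F y y') / of_nat M"
    by (simp add: av_def sum_int_lessThan sum_divide_distrib)
  finally show ?thesis by (simp add: power2_eq_square)
qed

text \<open>After a translation that makes \<open>f1\<close> depend on one variable alone,
  Cauchy-Schwarz removes it. The two copies of \<open>f0\<close> then depend only on
  \<open>x\<close> and on the difference \<open>t\<close> of the two values of \<open>y\<close>, so
  absolute values around the sum for fixed \<open>t\<close> remove them too.\<close>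

lemma norm_Lam_square_le:
  assumes "n > 0" "M > 0"
    and per: "per n f0" "per n f1" "per n f2"
    and bd: "one_bounded f0" "one_bounded f1"
  shows "(norm (Lam n q M f0 f1 f2))\<^sup>2 \<le> av n (\<lambda>x. (\<Sum>t\<in>{- int M..int M}.
     norm (\<Sum>y\<in>Yt M t. f2 (x + int q * y\<^sup>2) * cnj (f2 (x - t + int q * (y + t)\<^sup>2)))) / (real M)\<^sup>2)"
proof -
  note b0 = bd[THEN one_boundedD]
  define G where "G = (\<lambda>u y. f0 (u - y) * f2 (u - y + int q * y\<^sup>2))"
  define \<Phi> where "\<Phi> = (\<lambda>x y y'. f0 x * cnj (f0 (x + y - y')) * (f2 (x + int q * y\<^sup>2) * cnj (f2 (x + y - y' + int q * y'\<^sup>2))))"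
  have pG: "per n (\<lambda>u. G u y)" for y
    unfolding per_def G_def
    by (intro allI arg_cong2[where f = "(*)"] per_eq[OF per(1)] per_eq[OF per(3)]; simp)
  have pP: "per n (\<lambda>x. \<Phi> x y y')" for y y'
    unfolding per_def \<Phi>_def
    by (intro allI arg_cong2[where f = "(*)"] arg_cong[where f = cnj] per_eq[OF per(1)] per_eq[OF per(3)]; simp)
  have "Lam n q M f0 f1 f2 = av M (\<lambda>y. av n (\<lambda>x. (\<lambda>u. f1 u * G u y) (x + y)))"
    unfolding Lam_def G_def by (subst av_swap) (simp add: mult_ac)
  also have "\<dots> = av M (\<lambda>y. av n (\<lambda>u. f1 u * G u y))"
    using per(2) pG by (subst av_shift) (auto simp: per_def)
  also have "\<dots> = av n (\<lambda>u. f1 u * av M (G u))"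
    by (subst av_swap) (simp add: av_cmult)
  finally have "(norm (Lam n q M f0 f1 f2))\<^sup>2 \<le> av n (\<lambda>u. (norm (f1 u * av M (G u)))\<^sup>2)"
    using av_square_le by metis
  also have "\<dots> \<le> av n (\<lambda>u. (norm (av M (G u)))\<^sup>2)"
    using b0(2) by (intro av_mono power_mono) (auto simp: norm_mult mult_left_le_one_le)
  also have "\<dots> = norm (complex_of_real (av n (\<lambda>u. (norm (av M (G u)))\<^sup>2)))"
    by (simp add: av_nonneg)
  finally have 1: "(norm (Lam n q M f0 f1 f2))\<^sup>2 \<le> norm (complex_of_real (av n (\<lambda>u. (norm (av M (G u)))\<^sup>2)))" .
  have "complex_of_real (av n (\<lambda>u. (norm (av M (G u)))\<^sup>2)) = av n (\<lambda>u. av M (\<lambda>y. av M (\<lambda>y'. G u y * cnj (G u y'))))"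
    unfolding of_real_av av_norm_square ..
  also have "\<dots> = av M (\<lambda>y. av M (\<lambda>y'. av n (\<lambda>u. (\<lambda>x. \<Phi> x y y') (u - y))))"
    by (subst av_swap, subst (2) av_swap) (simp add: G_def \<Phi>_def mult_ac)
  also have "\<dots> = av M (\<lambda>y. av M (\<lambda>y'. av n (\<lambda>x. \<Phi> x y y')))"
    using av_shift[OF pP] by (simp only: diff_conv_add_uminus)
  also have "\<dots> = av n (\<lambda>x. av M (\<lambda>y. av M (\<lambda>y'. \<Phi> x y y')))"
    by (subst av_swap, subst av_swap) (rule refl)
  finally have 2: "complex_of_real (av n (\<lambda>u. (norm (av M (G u)))\<^sup>2)) = av n (\<lambda>x. av M (\<lambda>y. av M (\<lambda>y'. \<Phi> x y y')))" .
  have "(norm (Lam n q M f0 f1 f2))\<^sup>2 \<le> norm (av n (\<lambda>x. av M (\<lambda>y. av M (\<lambda>y'. \<Phi> x y y'))))"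
    using 1 unfolding 2 .
  also have "\<dots> \<le> av n (\<lambda>x. norm (av M (\<lambda>y. av M (\<Phi> x y))))"
    by (rule norm_av_le)
  also have "\<dots> \<le> av n (\<lambda>x. (\<Sum>t\<in>{- int M..int M}.
     norm (\<Sum>y\<in>Yt M t. f2 (x + int q * y\<^sup>2) * cnj (f2 (x - t + int q * (y + t)\<^sup>2)))) / (real M)\<^sup>2)"
  proof (intro av_mono)
    fix x
    have "norm (av M (\<lambda>y. av M (\<Phi> x y))) = norm (\<Sum>t\<in>{- int M..int M}. \<Sum>y\<in>Yt M t. \<Phi> x y (y + t)) / (real M)\<^sup>2"
      unfolding av_av_sum double_sum_shift by (simp add: norm_divide norm_power)
    also have "\<dots> \<le> (\<Sum>t\<in>{- int M..int M}. norm (\<Sum>y\<in>Yt M t. f2 (x + int q * y\<^sup>2) * cnj (f2 (x - t + int q * (y + t)\<^sup>2)))) / (real M)\<^sup>2"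
    proof (rule divide_right_mono[OF order_trans[OF norm_sum sum_mono]])
      fix t
      have e: "(\<Sum>y\<in>Yt M t. \<Phi> x y (y + t)) = f0 x * cnj (f0 (x - t)) * (\<Sum>y\<in>Yt M t. f2 (x + int q * y\<^sup>2) * cnj (f2 (x - t + int q * (y + t)\<^sup>2)))"
        by (simp add: \<Phi>_def sum_distrib_left)
      have "norm (f0 x * cnj (f0 (x - t))) \<le> 1"
        by (intro norm_mult_le_1) (auto intro: b0)
      then show "norm (\<Sum>y\<in>Yt M t. \<Phi> x y (y + t)) \<le> norm (\<Sum>y\<in>Yt M t. f2 (x + int q * y\<^sup>2) * cnj (f2 (x - t + int q * (y + t)\<^sup>2)))"
        unfolding e norm_mult[of "f0 x * cnj (f0 (x - t))"] by (simp add: mult_left_le_one_le)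
    qed simp
    finally show "norm (av M (\<lambda>y. av M (\<Phi> x y))) \<le> \<dots>" .
  qed
  finally show ?thesis .
qed

section \<open>Geometric sums, Vinogradov's lemma and Weyl's inequality for quadratic phases\<close>

lemma sin_ge_half:
  assumes "0 \<le> x" "x \<le> pi / 2"
  shows "x / 2 \<le> sin (x::real)"
proof -
  have "\<bar>sin x - (\<Sum>m<3. sin_coeff m * x ^ m)\<bar> \<le> inverse (fact 3) * \<bar>x\<bar> ^ 3"
    by (rule Maclaurin_sin_bound)
  then have "\<bar>sin x - x\<bar> \<le> x ^ 3 / 6"
    using assms by (simp add: sin_coeff_def numeral_eq_Suc)
  then have "x - x ^ 3 / 6 \<le> sin x" by linarith
  moreover have "x ^ 3 \<le> 3 * x"
  proof -
    have "pi \<le> 16 / 5" using pi_approx by simp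
    then have "x \<le> 8 / 5" using assms by argo
    then have "x * x \<le> 8 / 5 * (8 / 5)" using assms by (intro mult_mono) auto
    then have "x * (x * x) \<le> x * 3" using assms by (intro mult_left_mono) auto
    then show ?thesis by (simp add: power3_eq_cube)
  qed
  ultimately show ?thesis by linarith
qed

text \<open>The sum is at most 2/|e(t) - 1| <= 1/|t|, where t is the signed distance of \<theta>
  from the nearest integer.\<close>

lemma geo_sum_int:
  assumes "X > 0" "X \<le> norm (\<Sum>i<K. ee (\<theta> * real i))"
  shows "\<exists>m::int. \<bar>\<theta> - of_int m\<bar> \<le> 1 / X"
proof -
  define t where "t = \<theta> - of_int (round \<theta>)"
  have t: "\<bar>t\<bar> \<le> 1 / 2" using of_int_round_abs_le[of \<theta>] by (simp add: t_def abs_minus_commute)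
  have "\<bar>t\<bar> \<le> 1 / X"
  proof (cases "t = 0")
    case False
    have e: "ee (\<theta> * real i) = ee t ^ i" for i
    proof -
      have "\<theta> * real i = real i * t + of_int (round \<theta> * int i)" by (simp add: t_def algebra_simps)
      then show ?thesis by (simp only: ee_add_int ee_power)
    qed
    have "t \<notin> \<int>"
    proof
      assume "t \<in> \<int>"
      then obtain k where "t = of_int k" by (auto elim: Ints_cases)
      moreover then have "k \<noteq> 0" using False by simp
      then have "1 \<le> \<bar>real_of_int k\<bar>" by linarith
      ultimately show False using t by simp
    qed
    then have ne: "ee t \<noteq> 1" by (simp add: ee_eq_1_iff)
    have lower: "2 * \<bar>t\<bar> \<le> norm (ee t - 1)"
    proof -
      have "norm (ee t - 1) = 2 * \<bar>sin (2 * pi * t / 2)\<bar>"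
        using dist_exp_i_1[of "2 * pi * t"] by (simp add: ee_def cis_conv_exp)
      also have "\<bar>sin (2 * pi * t / 2)\<bar> = \<bar>sin (pi * \<bar>t\<bar>)\<bar>"
        by (cases "t \<ge> 0") auto
      also have "pi * \<bar>t\<bar> / 2 \<le> sin (pi * \<bar>t\<bar>)"
        using t by (intro sin_ge_half) (auto simp: field_simps)
      then have "pi * \<bar>t\<bar> / 2 \<le> \<bar>sin (pi * \<bar>t\<bar>)\<bar>" by linarith
      moreover have "\<bar>t\<bar> \<le> pi * \<bar>t\<bar> / 2" using mult_right_mono[OF pi_ge_two, of "\<bar>t\<bar>"] by simp
      ultimately show ?thesis by linarith
    qed
    have "norm (\<Sum>i<K. ee (\<theta> * real i)) = norm ((ee t ^ K - 1) / (ee t - 1))"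
      using ne by (simp add: e geometric_sum)
    also have "\<dots> = norm (ee t ^ K - 1) / norm (ee t - 1)" by (rule norm_divide)
    also have "\<dots> \<le> 2 / norm (ee t - 1)"
      using norm_triangle_ineq4[of "ee t ^ K" 1] by (intro divide_right_mono) (auto simp: norm_power)
    also have "\<dots> \<le> 2 / (2 * \<bar>t\<bar>)"
      using lower False ne by (intro divide_left_mono) auto
    finally have "X \<le> 1 / \<bar>t\<bar>" using assms(2) by simp
    then show ?thesis using assms(1) False by (simp add: field_simps)
  qed (use assms in simp)
  then show ?thesis unfolding t_def by blast
qed

lemma interval_sum_nat: "(\<Sum>y\<in>{a..<b}. f y) = (\<Sum>i<nat (b - a). f (a + int i))"
  by (rule sum.reindex_bij_witness[where i = "\<lambda>i. a + int i" and j = "\<lambda>y. nat (y - a)"]) auto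

lemma geo_sum_interval:
  assumes "X > 0" "X \<le> norm (\<Sum>y\<in>{a..<b}. ee (\<theta> * of_int y))"
  shows "\<exists>m::int. \<bar>\<theta> - of_int m\<bar> \<le> 1 / X"
proof -
  have "(\<Sum>y\<in>{a..<b}. ee (\<theta> * of_int y)) = ee (\<theta> * of_int a) * (\<Sum>i<nat (b - a). ee (\<theta> * real i))"
    unfolding interval_sum_nat by (simp add: ring_distribs ee_add sum_distrib_left)
  then show ?thesis using assms by (intro geo_sum_int) (auto simp: norm_mult)
qed

text \<open>Let b/k be a Dirichlet approximation of \<theta>. For h in \<open>S\<close> the number b
  h is within k \<epsilon> + 1/4 of a multiple of k. If this bound is below 1, all of
  \<open>S\<close> is divisible by k, and the density of \<open>S\<close> bounds k; otherwise
  \<open>S\<close> meets too few residue classes modulo k to be that large.\<close>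

lemma vinogradov:
  fixes S :: "int set"
  assumes S: "S \<subseteq> {- int M..int M}" and xi: "0 < \<xi>" "\<xi> \<le> 1" "4 \<le> \<xi> * real M"
    and card: "\<xi> * real M \<le> real (card S)"
    and eps: "0 \<le> \<epsilon>" "56 * \<epsilon> < \<xi>"
    and near: "\<And>h. h \<in> S \<Longrightarrow> \<exists>m::int. \<bar>\<theta> * of_int h - of_int m\<bar> \<le> \<epsilon>"
  shows "\<exists>k m::int. 1 \<le> k \<and> real_of_int k \<le> 4 / \<xi> \<and> \<bar>of_int k * \<theta> - of_int m\<bar> \<le> 16 * \<epsilon> / (\<xi>\<^sup>2 * real M)"
proof -
  have M: "M > 0" using xi by (cases M) auto
  \<comment> \<open>Denominators up to \<open>4 * M\<close> are allowed so that the error of k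
    \<theta> is still at most 1/4 after multiplication by any h in \<open>S\<close>.\<close>
  obtain b k where bk: "coprime b k" "0 < k" "k \<le> int (4 * M)" "\<bar>of_int k * \<theta> - of_int b\<bar> < 1 / real (4 * M)"
    using Dirichlet_approx_coprime[of "4 * M" \<theta>] M by auto
  have finS: "finite S" using S finite_subset by blast
  define \<rho> where "\<rho> = of_int k * \<theta> - of_int b"
  have rho: "\<bar>\<rho>\<bar> < 1 / (4 * real M)" using bk by (simp add: \<rho>_def)
  have rh: "\<bar>\<rho> * of_int h\<bar> \<le> 1 / 4" if "h \<in> S" for h
  proof -
    have "- int M \<le> h" "h \<le> int M" using that S by auto
    then have "\<bar>real_of_int h\<bar> \<le> real M" by linarith
    then have "\<bar>\<rho>\<bar> * \<bar>real_of_int h\<bar> \<le> 1 / (4 * real M) * real M"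
      using rho by (intro mult_mono) auto
    then show ?thesis using M by (simp add: abs_mult)
  qed
  have kh: "\<exists>m::int. \<bar>real_of_int (b * h - m * k)\<bar> \<le> of_int k * \<epsilon> + 1 / 4 \<and> \<bar>\<theta> * of_int h - of_int m\<bar> \<le> \<epsilon>" if h: "h \<in> S" for h
  proof -
    obtain m :: int where m: "\<bar>\<theta> * of_int h - of_int m\<bar> \<le> \<epsilon>" using near[OF h] by blast
    have "real_of_int (b * h - m * k) = of_int k * (\<theta> * of_int h - of_int m) - \<rho> * of_int h"
      by (simp add: \<rho>_def algebra_simps)
    also have "\<bar>\<dots>\<bar> \<le> \<bar>of_int k * (\<theta> * of_int h - of_int m)\<bar> + \<bar>\<rho> * of_int h\<bar>"
      by (rule abs_triangle_ineq4)
    also have "\<bar>of_int k * (\<theta> * of_int h - of_int m)\<bar> \<le> of_int k * \<epsilon>"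
      using m bk(2) by (simp add: abs_mult)
    finally show ?thesis using rh[OF h] m by (intro exI[of _ m]) linarith
  qed
  show ?thesis
  proof (cases "4 * of_int k * \<epsilon> \<le> 1")
    case True
    have bh: "b * h = m * k" if "\<bar>real_of_int (b * h - m * k)\<bar> \<le> of_int k * \<epsilon> + 1 / 4" for h m
      using that True by linarith
    have dvd: "k dvd h" if "h \<in> S" for h
    proof -
      obtain m where "b * h = m * k" using kh[OF \<open>h \<in> S\<close>] bh by blast
      then have "k dvd b * h" by simp
      then show ?thesis using bk(1) by (simp add: coprime_dvd_mult_right_iff coprime_commute)
    qed
    have sub: "S \<subseteq> {x \<in> {- int M..<- int M + int (2 * M + 1)}. int (nat k) dvd x - 0}"
      using S dvd bk(2) by auto
    have "card S \<le> (2 * M + 1) div nat k + 1"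
    proof (rule order_trans[OF card_mono[OF _ sub] card_cong_le])
      show "finite {x \<in> {- int M..<- int M + int (2 * M + 1)}. int (nat k) dvd x - 0}"
        by (rule finite_subset[of _ "{- int M..<- int M + int (2 * M + 1)}"]) auto
    qed (use bk(2) in simp)
    then have "real (card S) \<le> (2 * real M + 1) / real (nat k) + 1"
      using of_nat_div_le_of_nat[of "2 * M + 1" "nat k", where ?'a = real] by (simp add: add.commute)
    then have c1: "\<xi> * real M \<le> (2 * real M + 1) / of_int k + 1"
      using card bk(2) by simp
    have kl: "real_of_int k \<le> 4 / \<xi>"
    proof -
      have "3 / 4 * (\<xi> * real M) \<le> (2 * real M + 1) / of_int k" using c1 xi(3) by linarith
      also have "\<dots> \<le> 3 * real M / of_int k" using M bk(2) by (intro divide_right_mono) auto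
      finally have "of_int k * (\<xi> * real M) \<le> 4 * real M" using bk(2) by (simp add: field_simps)
      then show ?thesis using M xi by (simp add: field_simps)
    qed
    \<comment> \<open>A dense set contains an element of size comparable to
      \<open>\<xi> * M\<close>; dividing by it gains the factor \<open>M\<close> in the final
      bound.\<close>
    have "\<exists>h\<in>S. \<xi> * real M / 4 \<le> \<bar>real_of_int h\<bar>"
    proof (rule ccontr)
      assume "\<not> ?thesis"
      then have *: "\<bar>real_of_int h\<bar> < \<xi> * real M / 4" if "h \<in> S" for h
        using that by (meson not_le)
      have "S \<subseteq> {- \<lfloor>\<xi> * real M / 4\<rfloor>..\<lfloor>\<xi> * real M / 4\<rfloor>}"
      proof
        fix h assume "h \<in> S"
        then have "\<bar>h\<bar> \<le> \<lfloor>\<xi> * real M / 4\<rfloor>" using *[of h] by (simp add: le_floor_iff)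
        then show "h \<in> {- \<lfloor>\<xi> * real M / 4\<rfloor>..\<lfloor>\<xi> * real M / 4\<rfloor>}" by auto
      qed
      then have "card S \<le> nat (2 * \<lfloor>\<xi> * real M / 4\<rfloor> + 1)"
        using card_mono[of "{- \<lfloor>\<xi> * real M / 4\<rfloor>..\<lfloor>\<xi> * real M / 4\<rfloor>}" S] by (simp add: algebra_simps)
      then have "real (card S) \<le> real (nat (2 * \<lfloor>\<xi> * real M / 4\<rfloor> + 1))" by linarith
      also have "\<dots> \<le> 2 * (\<xi> * real M / 4) + 1"
        using xi by (simp add: of_nat_nat) linarith
      finally show False using card xi(3) by linarith
    qed
    then obtain h where h: "h \<in> S" "\<xi> * real M / 4 \<le> \<bar>real_of_int h\<bar>" by blast
    obtain m where m: "\<bar>real_of_int (b * h - m * k)\<bar> \<le> of_int k * \<epsilon> + 1 / 4" "\<bar>\<theta> * of_int h - of_int m\<bar> \<le> \<epsilon>"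
      using kh[OF h(1)] by blast
    have "\<rho> * of_int h = of_int k * (\<theta> * of_int h - of_int m) - real_of_int (b * h - m * k)"
      by (simp add: \<rho>_def algebra_simps)
    also have "\<dots> = of_int k * (\<theta> * of_int h - of_int m)" using bh[OF m(1)] by simp
    finally have "\<bar>\<rho>\<bar> * \<bar>real_of_int h\<bar> \<le> of_int k * \<epsilon>"
      using m(2) bk(2) by (metis abs_mult abs_of_pos mult_left_mono less_imp_le of_int_0_less_iff)
    moreover have "\<bar>\<rho>\<bar> * (\<xi> * real M / 4) \<le> \<bar>\<rho>\<bar> * \<bar>real_of_int h\<bar>"
      using h(2) by (intro mult_left_mono) auto
    moreover have "of_int k * \<epsilon> \<le> 4 / \<xi> * \<epsilon>" using kl eps by (intro mult_right_mono)
    ultimately have "\<bar>\<rho>\<bar> * (\<xi> * real M / 4) \<le> 4 / \<xi> * \<epsilon>" by linarith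
    then have "\<bar>\<rho>\<bar> \<le> 16 * \<epsilon> / (\<xi>\<^sup>2 * real M)"
      using xi M by (simp add: field_simps power2_eq_square)
    then show ?thesis using kl bk(2) unfolding \<rho>_def by (intro exI[of _ k] exI[of _ b]) auto
  next
    case False
    \<comment> \<open>Here k \<epsilon> > 1/4, and \<open>S\<close> falls into at most 2J + 1 <= 8 k
      \<epsilon> classes modulo \<open>k\<close> with at most 7 M/k members each. The total 56
      \<epsilon> M contradicts the density.\<close>
    define J where "J = \<lfloor>of_int k * \<epsilon> + 1 / 4\<rfloor>"
    have J0: "0 \<le> J" using bk(2) eps by (simp add: J_def)
    have "S \<subseteq> (\<Union>j\<in>{- J..J}. {h \<in> {- int M..int M}. k dvd b * h - j})"
    proof
      fix h assume h: "h \<in> S"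
      obtain m where m: "\<bar>real_of_int (b * h - m * k)\<bar> \<le> of_int k * \<epsilon> + 1 / 4" using kh[OF h] by blast
      then have "\<bar>b * h - m * k\<bar> \<le> J" unfolding J_def by (simp add: le_floor_iff)
      moreover have "k dvd b * h - (b * h - m * k)" by simp
      ultimately show "h \<in> (\<Union>j\<in>{- J..J}. {h \<in> {- int M..int M}. k dvd b * h - j})"
        using S h by (intro UN_I[of "b * h - m * k"]) auto
    qed
    moreover have "finite (\<Union>j\<in>{- J..J}. {h \<in> {- int M..int M}. k dvd b * h - j})"
      by (rule finite_subset[of _ "{- int M..int M}"]) auto
    ultimately have "card S \<le> card (\<Union>j\<in>{- J..J}. {h \<in> {- int M..int M}. k dvd b * h - j})"
      by (intro card_mono)
    also have "\<dots> \<le> (\<Sum>j\<in>{- J..J}. card {h \<in> {- int M..int M}. k dvd b * h - j})"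
      by (rule card_UN_le) simp
    also have "\<dots> \<le> (\<Sum>j\<in>{- J..J}. (2 * M + 1) div nat k + 1)"
    proof (rule sum_mono)
      fix j
      show "card {h \<in> {- int M..int M}. k dvd b * h - j} \<le> (2 * M + 1) div nat k + 1"
      proof (cases "{h \<in> {- int M..int M}. k dvd b * h - j} = {}")
        case nonempty: False
        then obtain h0 where h0: "k dvd b * h0 - j" by auto
        have sub: "{h \<in> {- int M..int M}. k dvd b * h - j} \<subseteq> {x \<in> {- int M..<- int M + int (2 * M + 1)}. int (nat k) dvd x - h0}"
        proof safe
          fix h assume "k dvd b * h - j"
          then have "k dvd b * (h - h0)" using dvd_diff[OF _ h0, of "b * h - j"] by (simp add: algebra_simps)
          then have "k dvd h - h0" using bk(1) by (simp add: coprime_dvd_mult_right_iff coprime_commute)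
          then show "int (nat k) dvd h - h0" using bk(2) by simp
        qed auto
        show ?thesis
        proof (rule order_trans[OF card_mono[OF _ sub] card_cong_le])
          show "finite {x \<in> {- int M..<- int M + int (2 * M + 1)}. int (nat k) dvd x - h0}"
            by (rule finite_subset[of _ "{- int M..<- int M + int (2 * M + 1)}"]) auto
        qed (use bk(2) in simp)
      qed (metis card.empty zero_le)
    qed
    also have "\<dots> = nat (2 * J + 1) * ((2 * M + 1) div nat k + 1)"
      by (simp add: algebra_simps)
    finally have "real (card S) \<le> real (nat (2 * J + 1)) * real ((2 * M + 1) div nat k + 1)"
      by (metis of_nat_le_iff of_nat_mult)
    also have "\<dots> \<le> (8 * (of_int k * \<epsilon>)) * (7 * real M / of_int k)"
    proof (intro mult_mono)
      have "real (nat (2 * J + 1)) = 2 * real_of_int J + 1" using J0 by simp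
      also have "real_of_int J \<le> of_int k * \<epsilon> + 1 / 4" by (simp add: J_def)
      finally have "real (nat (2 * J + 1)) \<le> 2 * (of_int k * \<epsilon> + 1 / 4) + 1" by simp
      moreover have "1 < 4 * (of_int k * \<epsilon>)" using False by (simp add: mult.assoc)
      ultimately show "real (nat (2 * J + 1)) \<le> 8 * (of_int k * \<epsilon>)" by argo
      have "real ((2 * M + 1) div nat k + 1) \<le> (2 * real M + 1) / of_int k + 1"
        using of_nat_div_le_of_nat[of "2 * M + 1" "nat k", where ?'a = real] bk(2) by (simp add: add.commute)
      also have "\<dots> \<le> 7 * real M / of_int k"
      proof -
        have "real_of_int k \<le> 4 * real M" "1 \<le> real M" using bk(3) M by linarith+
        then have "2 * real M + 1 + of_int k \<le> 7 * real M" by linarith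
        then have "(2 * real M + 1 + of_int k) / of_int k \<le> 7 * real M / of_int k"
          using bk(2) by (intro divide_right_mono) auto
        then show ?thesis using bk(2) by (simp add: add_divide_distrib)
      qed
      finally show "real ((2 * M + 1) div nat k + 1) \<le> 7 * real M / of_int k" .
    qed (use bk eps in auto)
    also have "\<dots> = 56 * \<epsilon> * real M" using bk(2) by simp
    also have "\<dots> < \<xi> * real M" using eps M by simp
    finally show ?thesis using card by linarith
  qed
qed

lemma sum_large_le:
  fixes E :: "'b \<Rightarrow> real"
  assumes "finite A" "\<And>t. t \<in> A \<Longrightarrow> E t \<le> B" "0 \<le> \<kappa>" "0 \<le> B"
  shows "sum E A \<le> real (card A) * \<kappa> + B * real (card {t \<in> A. \<kappa> \<le> E t})"
proof -
  have "sum E A \<le> (\<Sum>t\<in>A. \<kappa> + (if t \<in> {t \<in> A. \<kappa> \<le> E t} then B else 0))"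
  proof (rule sum_mono)
    fix t assume "t \<in> A"
    then show "E t \<le> \<kappa> + (if t \<in> {t \<in> A. \<kappa> \<le> E t} then B else 0)"
      using assms(2)[of t] assms(3,4) by (cases "\<kappa> \<le> E t") auto
  qed
  also have "\<dots> = real (card A) * \<kappa> + (\<Sum>t\<in>{t \<in> A. \<kappa> \<le> E t}. B)"
    unfolding sum.distrib using assms(1)
    by (simp add: sum.inter_filter[symmetric] sum.If_cases Int_def conj_commute)
  finally show ?thesis by (simp add: mult.commute)
qed

text \<open>The conclusion concerns the linear coefficient \<gamma>, because in the application
  \<gamma> involves a single frequency while \<beta> is a difference of two. Weyl differencing and
  \<open>vinogradov\<close> place 2 \<beta> near a rational with small denominator k. On
  progressions of step 2k the quadratic phase is then almost constant modulo 1, so a short geometric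
  sum with frequency 2 k \<gamma> is large.\<close>

lemma weyl_quadratic:
  fixes \<beta> \<gamma> \<xi> :: real
  assumes xi: "0 < \<xi>" "\<xi> \<le> 1" and M: "60000 \<le> \<xi> ^ 7 * real M"
    and lohi: "0 \<le> lo" "hi \<le> int M"
    and ge: "\<xi> * real M \<le> norm (\<Sum>y\<in>{lo..<hi}. ee (\<beta> * (of_int y)\<^sup>2 + \<gamma> * of_int y))"
  shows "\<exists>k m::int. 1 \<le> k \<and> real_of_int k \<le> 16 / \<xi>\<^sup>2 \<and> \<bar>of_int k * \<gamma> - of_int m\<bar> \<le> 240000 / (\<xi> ^ 8 * real M)"
proof -
  define f where "f = (\<lambda>y::int. ee (\<beta> * (of_int y)\<^sup>2 + \<gamma> * of_int y))"
  define f' where "f' = (\<lambda>y. if y \<in> {lo..<hi} then f y else 0)"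
  define S where "S = (\<Sum>y\<in>{lo..<hi}. f y)"
  have M0: "M > 0" using M by (cases M) auto
  have pw: "\<xi> ^ i \<le> \<xi> ^ j" if "j \<le> i" for i j
    using xi that by (intro power_decreasing) auto
  have M4: "60000 \<le> \<xi> ^ 4 * real M" and M2: "60000 \<le> \<xi>\<^sup>2 * real M"
    using M mult_right_mono[OF pw[of 4 7], of "real M"] mult_right_mono[OF pw[of 2 7], of "real M"] by simp_all
  have nf: "norm (f y) = 1" for y by (simp add: f_def)
  have Sf': "S = (\<Sum>y\<in>{0..<int M}. f' y)"
    unfolding S_def f'_def using lohi by (intro sum.mono_neutral_cong_left) auto
  define J where "J = (\<lambda>t. {max lo (lo - t)..<min hi (hi - t)})"
  define E where "E = (\<lambda>t. norm (\<Sum>y\<in>J t. ee (- 2 * \<beta> * of_int t * of_int y)))"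
  have inner: "norm (\<Sum>y\<in>Yt M t. f' y * cnj (f' (y + t))) = E t" for t
  proof -
    have "(\<Sum>y\<in>Yt M t. f' y * cnj (f' (y + t))) = (\<Sum>y\<in>J t. f y * cnj (f (y + t)))"
      unfolding f'_def J_def
    proof (intro sum.mono_neutral_cong_right)
      show "finite (Yt M t)" by simp
    qed (use lohi in \<open>auto simp: Yt_def\<close>)
    also have "\<dots> = (\<Sum>y\<in>J t. ee (- \<beta> * (of_int t)\<^sup>2 - \<gamma> * of_int t) * ee (- 2 * \<beta> * of_int t * of_int y))"
    proof (rule sum.cong[OF refl])
      fix y
      show "f y * cnj (f (y + t)) = ee (- \<beta> * (of_int t)\<^sup>2 - \<gamma> * of_int t) * ee (- 2 * \<beta> * of_int t * of_int y)"
        unfolding f_def cnj_ee ee_add[symmetric]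
        by (rule arg_cong[where f = ee]) (simp add: algebra_simps power2_eq_square)
    qed
    finally show ?thesis by (simp add: E_def norm_mult flip: sum_distrib_left)
  qed
  have "complex_of_real ((norm S)\<^sup>2) = (\<Sum>y\<in>{0..<int M}. \<Sum>y'\<in>{0..<int M}. f' y * cnj (f' y'))"
    unfolding complex_norm_square Sf' by (simp add: sum_product cnj_sum)
  also have "\<dots> = (\<Sum>t\<in>{- int M..int M}. \<Sum>y\<in>Yt M t. f' y * cnj (f' (y + t)))"
    by (rule double_sum_shift)
  finally have "(norm S)\<^sup>2 = norm (\<Sum>t\<in>{- int M..int M}. \<Sum>y\<in>Yt M t. f' y * cnj (f' (y + t)))"
    by (metis abs_of_nonneg norm_of_real zero_le_power2)
  then have "(norm S)\<^sup>2 \<le> (\<Sum>t\<in>{- int M..int M}. E t)"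
    unfolding inner[symmetric] by (simp only: norm_sum)
  moreover have "(\<xi> * real M)\<^sup>2 \<le> (norm S)\<^sup>2"
    using ge xi by (intro power_mono) (auto simp: S_def f_def)
  ultimately have sumE: "\<xi>\<^sup>2 * (real M)\<^sup>2 \<le> (\<Sum>t\<in>{- int M..int M}. E t)" by (simp add: power_mult_distrib)
  define H where "H = {t \<in> {- int M..int M}. \<xi>\<^sup>2 * real M / 6 \<le> E t}"
  have EM: "E t \<le> real M" for t
  proof -
    have "E t \<le> real (card (J t))"
      unfolding E_def using sum_norm_bound[of "J t" "\<lambda>y. ee (- 2 * \<beta> * of_int t * of_int y)" 1] by simp
    also have "card (J t) \<le> M" unfolding J_def using lohi by simp
    finally show ?thesis by simp
  qed
  have "(\<Sum>t\<in>{- int M..int M}. E t) \<le> real (card {- int M..int M}) * (\<xi>\<^sup>2 * real M / 6) + real M * real (card H)"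
    unfolding H_def using EM xi by (intro sum_large_le) auto
  also have "real (card {- int M..int M}) = 2 * real M + 1" by simp
  also have "(2 * real M + 1) * (\<xi>\<^sup>2 * real M / 6) \<le> 3 * real M * (\<xi>\<^sup>2 * real M / 6)"
    using M0 by (intro mult_right_mono) auto
  finally have "\<xi>\<^sup>2 * (real M)\<^sup>2 \<le> 3 * real M * (\<xi>\<^sup>2 * real M / 6) + real M * card H" using sumE by linarith
  then have "real M * (\<xi>\<^sup>2 / 2 * real M) \<le> real M * card H" by (simp add: power2_eq_square field_simps)
  then have cardH: "\<xi>\<^sup>2 / 2 * real M \<le> card H" using M0 by simp
  have "\<exists>k m::int. 1 \<le> k \<and> real_of_int k \<le> 4 / (\<xi>\<^sup>2 / 2) \<and>
    \<bar>of_int k * (- 2 * \<beta>) - of_int m\<bar> \<le> 16 * (6 / (\<xi>\<^sup>2 * real M)) / ((\<xi>\<^sup>2 / 2)\<^sup>2 * real M)"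
  proof (rule vinogradov)
    show "H \<subseteq> {- int M..int M}" by (auto simp: H_def)
    show "\<xi>\<^sup>2 / 2 \<le> 1" using pw[of 0 2] by simp
    show "56 * (6 / (\<xi>\<^sup>2 * real M)) < \<xi>\<^sup>2 / 2"
    proof -
      have "672 < \<xi>\<^sup>2 * (\<xi>\<^sup>2 * real M)" using M4 by (simp flip: mult.assoc power_add)
      then show ?thesis using xi M0 by (simp add: field_simps)
    qed
    fix t assume t: "t \<in> H"
    have "\<exists>m::int. \<bar>- 2 * \<beta> * of_int t - of_int m\<bar> \<le> 1 / (\<xi>\<^sup>2 * real M / 6)"
      using t xi M0 unfolding H_def E_def J_def by (intro geo_sum_interval) auto
    then show "\<exists>m::int. \<bar>- 2 * \<beta> * of_int t - of_int m\<bar> \<le> 6 / (\<xi>\<^sup>2 * real M)" by simp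
  qed (use xi M2 cardH in auto)
  then obtain k b :: int where k: "1 \<le> k" "real_of_int k \<le> 8 / \<xi>\<^sup>2"
    and kb: "\<bar>of_int k * (- 2 * \<beta>) - of_int b\<bar> \<le> 16 * (6 / (\<xi>\<^sup>2 * real M)) / ((\<xi>\<^sup>2 / 2)\<^sup>2 * real M)" by auto
  \<comment> \<open>With this step \<beta> (Y + q0 v)^2 - \<beta> Y^2 is an integer (called
    \<open>w v\<close> below) times \<open>q0 * \<beta>\<close>, which is within
    \<open>\<tau>\<close> of an integer.\<close>
  define q0 where "q0 = 2 * k"
  define \<tau> where "\<tau> = of_int q0 * \<beta> + of_int b"
  have "16 * (6 / (\<xi>\<^sup>2 * real M)) / ((\<xi>\<^sup>2 / 2)\<^sup>2 * real M) = 384 / (\<xi> ^ 6 * (real M)\<^sup>2)"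
    using xi M0 by (simp add: field_simps power2_eq_square numeral_eq_Suc)
  moreover have "\<bar>\<tau>\<bar> = \<bar>of_int k * (- 2 * \<beta>) - of_int b\<bar>"
    by (simp add: \<tau>_def q0_def abs_if algebra_simps)
  ultimately have tau: "\<bar>\<tau>\<bar> \<le> 384 / (\<xi> ^ 6 * (real M)\<^sup>2)" using kb by simp
  have q0: "1 \<le> q0" "real_of_int q0 \<le> 16 / \<xi>\<^sup>2" using k by (auto simp: q0_def)
  define K where "K = nat (hi - lo)"
  \<comment> \<open>Length of the short progressions: long enough to determine
    \<open>q0 * \<gamma>\<close> with an error of order 1/M, short enough that \<open>\<tau>\<close>
    times the integers \<open>w v\<close>, of size at most 3 M V, stays below a small multiple of
    \<xi>.\<close>
  define V where "V = nat \<lfloor>\<xi> ^ 7 * real M / 30000\<rfloor>"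
  have V: "real V \<le> \<xi> ^ 7 * real M / 30000" "\<xi> ^ 7 * real M / 60000 \<le> real V" "V > 0"
    using M xi unfolding V_def by linarith+
  have SK: "norm S \<le> real K"
    unfolding S_def K_def using sum_norm_bound[of "{lo..<hi}" f 1] nf by simp
  then have K: "\<xi> * real M \<le> real K" using ge by (simp add: S_def f_def)
  have K0: "K > 0" using K xi M0 by (cases K) (auto simp: mult_le_0_iff)
  have KM: "real K \<le> real M" using lohi by (simp add: K_def)
  define g where "g = (\<lambda>y. f (lo + y))"
  have "S = (\<Sum>i<K. g (int i))" by (simp add: S_def interval_sum_nat K_def g_def)
  then have "norm (av K g) = norm S / real K" by (simp add: av_def norm_divide)
  also have "\<dots> \<ge> \<xi> * real M / real M"
    using ge K0 KM xi by (intro frac_le) (auto simp: S_def f_def)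
  finally have avg: "\<xi> \<le> norm (av K g)" using M0 by simp
  have q0V: "real_of_int q0 * real V \<le> \<xi> ^ 5 * real M / 1800"
  proof -
    have "real_of_int q0 * real V \<le> 16 / \<xi>\<^sup>2 * (\<xi> ^ 7 * real M / 30000)"
      using q0 V xi by (intro mult_mono) auto
    also have "\<dots> = 16 / 30000 * (\<xi> ^ 5 * real M)"
      using xi by (simp add: field_simps power2_eq_square numeral_eq_Suc)
    also have "\<dots> \<le> \<xi> ^ 5 * real M / 1800" using xi by simp
    finally show ?thesis .
  qed
  have q0VM: "real_of_int q0 * real V \<le> real M"
  proof -
    have "\<xi> ^ 5 * real M \<le> 1 * real M" using pw[of 0 5] by (intro mult_right_mono) auto
    then show ?thesis using q0V M0 by linarith
  qed
  have "norm (av K g - av V (\<lambda>v. av K (\<lambda>y. g (y + q0 * v)))) \<le> 2 * of_int (q0 * int V) / of_nat K"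
    by (rule av_average_shifts_close[OF K0 V(3)]) (use q0 nf in \<open>auto simp: g_def intro: mult_left_mono\<close>)
  also have "\<dots> \<le> 2 * (\<xi> ^ 5 * real M / 1800) / (\<xi> * real M)"
    using q0V K xi M0 by (intro frac_le mult_left_mono) auto
  also have "\<dots> = \<xi> ^ 4 / 900" using xi M0 by (simp add: field_simps numeral_eq_Suc)
  also have "\<dots> \<le> \<xi> / 4" using pw[of 1 4] xi by simp
  finally have "\<xi> - \<xi> / 4 \<le> norm (av V (\<lambda>v. av K (\<lambda>y. g (y + q0 * v))))"
    using avg norm_triangle_ineq2[of "av K g" "av V (\<lambda>v. av K (\<lambda>y. g (y + q0 * v)))"] by linarith
  also have "av V (\<lambda>v. av K (\<lambda>y. g (y + q0 * v))) = av K (\<lambda>y. av V (\<lambda>v. g (y + q0 * v)))" by (rule av_swap)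
  finally have "\<xi> - \<xi> / 4 \<le> av K (\<lambda>y. norm (av V (\<lambda>v. g (y + q0 * v))))"
    using norm_av_le[of K "\<lambda>y. av V (\<lambda>v. g (y + q0 * v))"] by linarith
  then obtain y where y: "0 \<le> y" "y < int K" "\<xi> - \<xi> / 4 \<le> norm (av V (\<lambda>v. g (y + q0 * v)))"
    using av_ex_ge[OF K0, of "\<lambda>y. norm (av V (\<lambda>v. g (y + q0 * v)))"] by auto
  define Y where "Y = lo + y"
  have Y: "0 \<le> Y" "Y \<le> int M" using y lohi by (auto simp: Y_def K_def split: if_splits)
  define w where "w = (\<lambda>v. 2 * Y * v + q0 * v\<^sup>2)"
  define c where "c = ee (\<beta> * (of_int Y)\<^sup>2 + \<gamma> * of_int Y)"
  have gw: "g (y + q0 * v) = c * (ee (\<tau> * of_int (w v)) * ee (of_int q0 * \<gamma> * of_int v))" for v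
  proof -
    have "\<beta> * (of_int (Y + q0 * v))\<^sup>2 + \<gamma> * of_int (Y + q0 * v) =
      (\<beta> * (of_int Y)\<^sup>2 + \<gamma> * of_int Y) + (\<tau> * of_int (w v) + of_int q0 * \<gamma> * of_int v) + of_int (- b * w v)"
      by (simp add: \<tau>_def w_def algebra_simps power2_eq_square)
    then have "f (Y + q0 * v) = c * (ee (\<tau> * of_int (w v)) * ee (of_int q0 * \<gamma> * of_int v))"
      unfolding f_def c_def ee_add[symmetric] by (metis ee_add_int)
    then show ?thesis by (simp add: g_def Y_def add.assoc)
  qed
  have "norm (av V (\<lambda>v. g (y + q0 * v)) - av V (\<lambda>v. c * ee (of_int q0 * \<gamma> * of_int v))) \<le> \<xi> / 4"
  proof (rule av_norm_diff_le)
    fix v assume v: "0 \<le> v" "v < int V"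
    have "g (y + q0 * v) - c * ee (of_int q0 * \<gamma> * of_int v) = c * ee (of_int q0 * \<gamma> * of_int v) * (ee (\<tau> * of_int (w v)) - 1)"
      unfolding gw by (simp add: algebra_simps)
    then have "norm (g (y + q0 * v) - c * ee (of_int q0 * \<gamma> * of_int v)) = norm (ee (\<tau> * of_int (w v)) - 1)"
      by (simp add: norm_mult c_def)
    also have "\<dots> \<le> 2 * pi * (\<bar>\<tau>\<bar> * \<bar>of_int (w v)\<bar>)"
      using norm_ee_minus_1[of "\<tau> * of_int (w v)"] by (simp add: abs_mult)
    also have "\<dots> \<le> 2 * pi * (384 / (\<xi> ^ 6 * (real M)\<^sup>2) * (3 * real M * real V))"
    proof (intro mult_left_mono mult_mono tau)
      have "w v \<ge> 0" using Y v q0 by (simp add: w_def)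
      moreover have "real_of_int (w v) \<le> 2 * real M * real V + real M * real V"
      proof -
        have "real_of_int Y * real_of_int v \<le> real M * real V" using Y v by (intro mult_mono) auto
        moreover have "real_of_int q0 * (real_of_int v)\<^sup>2 \<le> real M * real V"
        proof -
          have "real_of_int q0 * real_of_int v * real_of_int v \<le> real_of_int q0 * real V * real V"
            using q0 v by (intro mult_mono) auto
          also have "\<dots> \<le> real M * real V" using q0VM by (intro mult_right_mono) auto
          finally show ?thesis by (simp add: power2_eq_square mult.assoc)
        qed
        ultimately show ?thesis by (simp add: w_def)
      qed
      ultimately show "\<bar>real_of_int (w v)\<bar> \<le> 3 * real M * real V" by simp
    qed (use xi in auto)
    also have "\<dots> \<le> 2 * pi * (384 / (\<xi> ^ 6 * (real M)\<^sup>2) * (3 * real M * (\<xi> ^ 7 * real M / 30000)))"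
      using V xi by (intro mult_left_mono) auto
    also have "\<dots> = pi * (2304 / 30000) * \<xi>"
      using xi M0 by (simp add: field_simps power2_eq_square numeral_eq_Suc)
    also have "\<dots> \<le> 1 / 4 * \<xi>"
    proof (rule mult_right_mono)
      have "pi \<le> 16 / 5" using pi_approx by simp
      then show "pi * (2304 / 30000) \<le> 1 / 4" by simp
    qed (use xi in auto)
    finally show "norm (g (y + q0 * v) - c * ee (of_int q0 * \<gamma> * of_int v)) \<le> \<xi> / 4" by simp
  qed (use xi in auto)
  then have "\<xi> / 2 \<le> norm (av V (\<lambda>v. c * ee (of_int q0 * \<gamma> * of_int v)))"
    using y(3) norm_triangle_ineq2[of "av V (\<lambda>v. g (y + q0 * v))" "av V (\<lambda>v. c * ee (of_int q0 * \<gamma> * of_int v))"] by linarith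
  also have "\<dots> = norm (\<Sum>i<V. ee (of_int q0 * \<gamma> * real i)) / real V"
    by (simp add: av_cmult norm_mult c_def) (simp add: av_def norm_divide)
  finally have "\<xi> / 2 * real V \<le> norm (\<Sum>i<V. ee (of_int q0 * \<gamma> * real i))"
    using V by (simp add: field_simps)
  then obtain m :: int where m: "\<bar>of_int q0 * \<gamma> - of_int m\<bar> \<le> 1 / (\<xi> / 2 * real V)"
    using geo_sum_int[of "\<xi> / 2 * real V"] xi V by auto
  also have "\<dots> \<le> 1 / (\<xi> / 2 * (\<xi> ^ 7 * real M / 60000))"
    using xi V M0 by (intro divide_left_mono mult_left_mono) auto
  also have "\<dots> = 120000 / (\<xi> ^ 8 * real M)"
    using xi M0 by (simp add: field_simps numeral_eq_Suc)
  also have "\<dots> \<le> 240000 / (\<xi> ^ 8 * real M)"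
    using xi M0 by (intro divide_right_mono) auto
  finally show ?thesis using q0 by blast
qed

text \<open>\<open>norm_Lam_square_le\<close> leaves quadratic sums over \<open>y\<close> for each
  difference \<open>t\<close>, and their linear coefficient involves the frequency of one class c
  only. Weyl's inequality makes it nearly rational for many \<open>t\<close>; a pigeonhole gives a
  common denominator, and as the coefficient is a multiple of \<open>t\<close>,
  \<open>vinogradov\<close> applies once more, now to the set of these \<open>t\<close>. The class
  found has nonzero weight because the factor |W c| is kept in \<open>Z\<close>.\<close>

lemma major_arc:
  fixes W :: "int \<Rightarrow> complex" and \<alpha> :: "int \<Rightarrow> int"
  assumes "n > 0" "q > 0" "q dvd n"
    and per: "per n g0" "per n g1" and bd: "one_bounded g0" "one_bounded g1" "one_bounded W"
    and eta: "0 < \<eta>" "\<eta> \<le> 1" and M: "10 ^ 18 \<le> \<eta> ^ 22 * real M"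
    and ge: "\<eta> \<le> norm (Lam n q M g0 g1 (\<lambda>x. W (x mod int q) * chi n (\<alpha> (x mod int q) * x)))"
  shows "\<exists>c k m::int. 0 \<le> c \<and> c < int q \<and> W c \<noteq> 0 \<and> 1 \<le> k \<and> real_of_int k \<le> 10 ^ 7 / \<eta> ^ 10 \<and>
    \<bar>of_int (k * int q * \<alpha> c) / real n - of_int m\<bar> \<le> 10 ^ 19 / (\<eta> ^ 28 * (real M)\<^sup>2)"
proof -
  have M0: "M > 0" using M by (cases M) auto
  have pw: "\<eta> ^ i \<le> \<eta> ^ j" if "j \<le> i" for i j
    using eta that by (intro power_decreasing) auto
  define f2 where "f2 = (\<lambda>x. W (x mod int q) * chi n (\<alpha> (x mod int q) * x))"
  define \<beta> where "\<beta> = (\<lambda>c t. real_of_int (int q * (\<alpha> ((c + t) mod int q) - \<alpha> (c mod int q))) / real n)"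
  define \<gamma> where "\<gamma> = (\<lambda>c t. - (2 * real_of_int (int q * \<alpha> (c mod int q) * t) / real n))"
  define E where "E = (\<lambda>c t. norm (\<Sum>y\<in>Yt M t. ee (\<beta> c t * (of_int y)\<^sup>2 + \<gamma> c t * of_int y)))"
  define Z where "Z = (\<lambda>c t. norm (W (c mod int q)) * E c t)"
  have pf2: "per n f2"
  proof -
    have "(x + int n) mod int q = x mod int q" for x
      using assms(3) by (metis dvd_def mod_mult_self2 of_nat_mult)
    moreover have "chi n (\<alpha> u * (x + int n)) = chi n (\<alpha> u * x)" for u x
      using assms(1) by (intro chi_eq[where k = "\<alpha> u"]) (auto simp: algebra_simps)
    ultimately show ?thesis by (simp add: per_def f2_def)
  qed
  have mq: "(x + int q * u) mod int q = x mod int q" for x u by simp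
  have tb: "norm (\<Sum>y\<in>Yt M t. f2 (x + int q * y\<^sup>2) * cnj (f2 (x - t + int q * (y + t)\<^sup>2))) \<le> Z (x - t) t" for x t
  proof -
    define a where "a = \<alpha> (x mod int q)"
    define a' where "a' = \<alpha> ((x - t) mod int q)"
    define C where "C = W (x mod int q) * cnj (W ((x - t) mod int q)) * chi n (a * x - a' * (x - t) - int q * a' * t\<^sup>2)"
    have "(\<Sum>y\<in>Yt M t. f2 (x + int q * y\<^sup>2) * cnj (f2 (x - t + int q * (y + t)\<^sup>2)))
      = (\<Sum>y\<in>Yt M t. C * ee (\<beta> (x - t) t * (of_int y)\<^sup>2 + \<gamma> (x - t) t * of_int y))"
    proof (rule sum.cong[OF refl])
      fix y
      have "chi n (a * (x + int q * y\<^sup>2)) * cnj (chi n (a' * (x - t + int q * (y + t)\<^sup>2)))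
         = chi n (a * (x + int q * y\<^sup>2) - a' * (x - t + int q * (y + t)\<^sup>2))"
        by (simp add: cnj_chi flip: chi_add)
      also have "a * (x + int q * y\<^sup>2) - a' * (x - t + int q * (y + t)\<^sup>2)
         = (a * x - a' * (x - t) - int q * a' * t\<^sup>2) + (int q * (a - a') * y\<^sup>2 - 2 * int q * a' * t * y)"
        by (simp add: algebra_simps power2_eq_square)
      also have "chi n \<dots> = chi n (a * x - a' * (x - t) - int q * a' * t\<^sup>2) * chi n (int q * (a - a') * y\<^sup>2 - 2 * int q * a' * t * y)"
        by (rule chi_add)
      also have "chi n (int q * (a - a') * y\<^sup>2 - 2 * int q * a' * t * y) = ee (\<beta> (x - t) t * (of_int y)\<^sup>2 + \<gamma> (x - t) t * of_int y)"
        unfolding chi_def \<beta>_def \<gamma>_def a_def a'_def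
        by (rule arg_cong[where f = ee]) (use assms(1) in \<open>simp add: field_simps\<close>)
      finally show "f2 (x + int q * y\<^sup>2) * cnj (f2 (x - t + int q * (y + t)\<^sup>2)) = C * ee (\<beta> (x - t) t * (of_int y)\<^sup>2 + \<gamma> (x - t) t * of_int y)"
        unfolding f2_def mq a_def[symmetric] a'_def[symmetric] C_def by (simp add: mult_ac)
    qed
    then have "norm (\<Sum>y\<in>Yt M t. f2 (x + int q * y\<^sup>2) * cnj (f2 (x - t + int q * (y + t)\<^sup>2))) = norm C * E (x - t) t"
      by (simp add: E_def norm_mult flip: sum_distrib_left)
    also have "norm C \<le> norm (W ((x - t) mod int q))"
      using one_boundedD[OF bd(3)] by (simp add: C_def norm_mult mult_left_le_one_le)
    finally show ?thesis by (simp add: Z_def E_def mult_right_mono)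
  qed
  have pZ: "per n (\<lambda>c. Z c t)" for t
  proof -
    have "(x + int n + t) mod int q = (x + t) mod int q" "(x + int n) mod int q = x mod int q" for x t
      using assms(3) by (metis add.assoc add.commute dvd_def mod_mult_self2 of_nat_mult)+
    then show ?thesis by (simp add: per_def Z_def E_def \<beta>_def \<gamma>_def)
  qed
  have "\<eta>\<^sup>2 \<le> (norm (Lam n q M g0 g1 f2))\<^sup>2"
    using ge eta by (intro power_mono) (auto simp: f2_def)
  also have "\<dots> \<le> av n (\<lambda>x. (\<Sum>t\<in>{- int M..int M}.
     norm (\<Sum>y\<in>Yt M t. f2 (x + int q * y\<^sup>2) * cnj (f2 (x - t + int q * (y + t)\<^sup>2)))) / (real M)\<^sup>2)"
    by (rule norm_Lam_square_le[OF assms(1) M0 per pf2 bd(1,2)])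
  also have "\<dots> \<le> av n (\<lambda>x. (\<Sum>t\<in>{- int M..int M}. Z (x - t) t) / (real M)\<^sup>2)"
    by (intro av_mono divide_right_mono sum_mono tb) auto
  also have "\<dots> = (\<Sum>t\<in>{- int M..int M}. av n (\<lambda>x. Z (x - t) t)) / (real M)\<^sup>2"
    by (simp add: av_divide av_sum)
  \<comment> \<open>Translation by \<open>t\<close> makes the class whose frequency enters the
    linear term the same for all differences \<open>t\<close>.\<close>
  also have "\<dots> = (\<Sum>t\<in>{- int M..int M}. av n (\<lambda>x. Z x t)) / (real M)\<^sup>2"
  proof -
    have "av n (\<lambda>x. Z (x - t) t) = av n (\<lambda>x. Z x t)" for t
      using av_shift[OF pZ[of t], of "- t"] by simp
    then show ?thesis by simp
  qed
  also have "\<dots> = av n (\<lambda>x. (\<Sum>t\<in>{- int M..int M}. Z x t) / (real M)\<^sup>2)"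
    by (simp add: av_divide av_sum)
  finally obtain x where x: "\<eta>\<^sup>2 \<le> (\<Sum>t\<in>{- int M..int M}. Z x t) / (real M)\<^sup>2"
    using av_ex_ge[OF assms(1), of "\<lambda>x. (\<Sum>t\<in>{- int M..int M}. Z x t) / (real M)\<^sup>2"] by (meson order.trans)
  define c where "c = x mod int q"
  have c: "0 \<le> c" "c < int q" using assms(2) by (auto simp: c_def)
  have x2: "\<eta>\<^sup>2 * (real M)\<^sup>2 \<le> (\<Sum>t\<in>{- int M..int M}. Z x t)"
    using x M0 by (simp add: field_simps)
  have Wc: "W c \<noteq> 0"
  proof
    assume "W c = 0"
    then have "\<eta>\<^sup>2 * (real M)\<^sup>2 \<le> 0" using x2 by (simp add: Z_def c_def)
    moreover have "0 < \<eta>\<^sup>2 * (real M)\<^sup>2" using eta M0 by simp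
    ultimately show False by linarith
  qed
  define \<xi> where "\<xi> = \<eta>\<^sup>2 / 6"
  have xi: "0 < \<xi>" "\<xi> \<le> 1" using eta pw[of 0 2] by (auto simp: \<xi>_def)
  define H where "H = {t \<in> {- int M..int M}. \<xi> * real M \<le> E x t}"
  have EM: "E x t \<le> real M" for t
  proof -
    have "E x t \<le> real (card (Yt M t))"
      unfolding E_def using sum_norm_bound[of "Yt M t" "\<lambda>y. ee (\<beta> x t * (of_int y)\<^sup>2 + \<gamma> x t * of_int y)" 1] by simp
    then show ?thesis using card_Yt_le[of M t] by linarith
  qed
  have "(\<Sum>t\<in>{- int M..int M}. Z x t) \<le> (\<Sum>t\<in>{- int M..int M}. E x t)"
    unfolding Z_def using one_boundedD[OF bd(3)]
    by (intro sum_mono) (auto simp: E_def intro!: mult_left_le_one_le)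
  also have "\<dots> \<le> real (card {- int M..int M}) * (\<xi> * real M) + real M * real (card H)"
    unfolding H_def using EM xi by (intro sum_large_le) auto
  also have "real (card {- int M..int M}) = 2 * real M + 1" by simp
  also have "(2 * real M + 1) * (\<xi> * real M) \<le> 3 * real M * (\<xi> * real M)"
    using M0 xi by (intro mult_right_mono) auto
  finally have "\<eta>\<^sup>2 * (real M)\<^sup>2 \<le> 3 * real M * (\<xi> * real M) + real M * card H" using x2 by linarith
  then have "real M * (\<eta>\<^sup>2 / 2 * real M) \<le> real M * card H" by (simp add: \<xi>_def power2_eq_square field_simps)
  then have cardH: "\<eta>\<^sup>2 / 2 * real M \<le> card H" using M0 by simp
  have xi7: "60000 \<le> \<xi> ^ 7 * real M"
  proof -
    have "10 ^ 18 \<le> \<eta> ^ 14 * real M"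
      using M mult_right_mono[OF pw[of 14 22], of "real M"] by simp
    then show ?thesis by (simp add: \<xi>_def power_divide flip: power_mult)
  qed
  have "\<exists>k m::int. 1 \<le> k \<and> real_of_int k \<le> 16 / \<xi>\<^sup>2 \<and> \<bar>of_int k * \<gamma> x t - of_int m\<bar> \<le> 240000 / (\<xi> ^ 8 * real M)" if "t \<in> H" for t
    using that unfolding H_def E_def Yt_interval
    by (intro weyl_quadratic[OF xi xi7, of "max 0 (- t)" "min (int M) (int M - t)" "\<beta> x t"]) auto
  then obtain kk mm where km: "\<And>t. t \<in> H \<Longrightarrow> 1 \<le> kk t \<and> real_of_int (kk t) \<le> 16 / \<xi>\<^sup>2 \<and> \<bar>of_int (kk t) * \<gamma> x t - of_int (mm t)\<bar> \<le> 240000 / (\<xi> ^ 8 * real M)"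
    by metis
  define Q where "Q = \<lfloor>16 / \<xi>\<^sup>2\<rfloor>"
  have Q: "real_of_int Q \<le> 16 / \<xi>\<^sup>2" by (simp add: Q_def)
  have kkQ: "kk t \<in> {1..Q}" if "t \<in> H" for t using km[OF that] by (simp add: Q_def le_floor_iff)
  have "H \<noteq> {}"
  proof
    assume "H = {}"
    then have "\<eta>\<^sup>2 / 2 * real M \<le> 0" using cardH by simp
    moreover have "0 < \<eta>\<^sup>2 / 2 * real M" using eta M0 by simp
    ultimately show False by linarith
  qed
  then have Q1: "1 \<le> Q" using kkQ by fastforce
  have "\<exists>p\<in>{1..Q}. real (card H) / real_of_int Q \<le> card {t \<in> H. kk t = p}"
  proof (rule ccontr)
    assume no: "\<not> ?thesis"
    have "finite H" unfolding H_def by (rule finite_subset[of _ "{- int M..int M}"]) auto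
    have "real (card H) = (\<Sum>p\<in>{1..Q}. real (card {t \<in> H. kk t = p}))"
    proof -
      have "(\<Sum>p\<in>{1..Q}. \<Sum>t\<in>{t \<in> H. kk t = p}. 1) = (\<Sum>t\<in>H. 1::nat)"
        by (rule sum.group) (use kkQ \<open>finite H\<close> in auto)
      then have "card H = (\<Sum>p\<in>{1..Q}. card {t \<in> H. kk t = p})" by simp
      then show ?thesis by simp
    qed
    also have "\<dots> < (\<Sum>p\<in>{1..Q}. real (card H) / real_of_int Q)"
      using no Q1 by (intro sum_strict_mono) (auto simp: not_le)
    also have "\<dots> = real (card H)" using Q1 by simp
    finally show False by simp
  qed
  then obtain p where p: "1 \<le> p" "p \<le> Q" "real (card H) / real_of_int Q \<le> card {t \<in> H. kk t = p}" by auto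
  define H' where "H' = {t \<in> H. kk t = p}"
  define \<theta> where "\<theta> = - 2 * real_of_int (p * int q * \<alpha> c) / real n"
  define \<xi>' where "\<xi>' = \<eta> ^ 6 / 1152"
  define \<epsilon> where "\<epsilon> = 240000 / (\<xi> ^ 8 * real M)"
  have xi': "0 < \<xi>'" "\<xi>' \<le> 1" using eta pw[of 0 6] by (auto simp: \<xi>'_def)
  have cardH': "\<xi>' * real M \<le> card H'"
  proof -
    have "\<xi>' * real M * real_of_int Q \<le> \<xi>' * real M * (16 / \<xi>\<^sup>2)"
      using Q xi' by (intro mult_left_mono) auto
    also have "\<dots> = \<eta>\<^sup>2 / 2 * real M"
      using eta by (simp add: \<xi>'_def \<xi>_def field_simps power2_eq_square numeral_eq_Suc)
    also have "\<dots> \<le> card H" by (rule cardH)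
    finally have "\<xi>' * real M \<le> real (card H) / real_of_int Q"
      using Q1 by (simp add: pos_le_divide_eq)
    then show ?thesis using p(3) unfolding H'_def by linarith
  qed
  have eps: "\<epsilon> = 240000 * 6 ^ 8 / (\<eta> ^ 16 * real M)"
    by (simp add: \<epsilon>_def \<xi>_def power_divide flip: power_mult)
  have "\<exists>k m::int. 1 \<le> k \<and> real_of_int k \<le> 4 / \<xi>' \<and> \<bar>of_int k * \<theta> - of_int m\<bar> \<le> 16 * \<epsilon> / (\<xi>'\<^sup>2 * real M)"
  proof (rule vinogradov[where S = H'])
    show "H' \<subseteq> {- int M..int M}" by (auto simp: H'_def H_def)
    have "10 ^ 18 \<le> \<eta> ^ 6 * real M"
      using M mult_right_mono[OF pw[of 6 22], of "real M"] by simp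
    then show "4 \<le> \<xi>' * real M" by (simp add: \<xi>'_def)
    show "0 \<le> \<epsilon>" using xi by (simp add: \<epsilon>_def)
    show "56 * \<epsilon> < \<xi>'"
    proof -
      have "56 * 240000 * 6 ^ 8 * 1152 < \<eta> ^ 6 * (\<eta> ^ 16 * real M)"
        using M by (simp flip: mult.assoc power_add)
      then show ?thesis unfolding eps \<xi>'_def using eta M0 by (simp add: field_simps)
    qed
    fix t assume t: "t \<in> H'"
    then have "\<theta> * of_int t = of_int (kk t) * \<gamma> x t"
      by (simp add: \<theta>_def H'_def \<gamma>_def c_def)
    then show "\<exists>m::int. \<bar>\<theta> * of_int t - of_int m\<bar> \<le> \<epsilon>"
      using km[of t] t by (auto simp: H'_def \<epsilon>_def)
  qed (use xi' cardH' in auto)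
  then obtain k m :: int where k: "1 \<le> k" "real_of_int k \<le> 4 / \<xi>'" "\<bar>of_int k * \<theta> - of_int m\<bar> \<le> 16 * \<epsilon> / (\<xi>'\<^sup>2 * real M)" by blast
  show ?thesis
  proof (intro exI conjI)
    have "0 < k * p" using k p by simp
    then show "1 \<le> 2 * k * p" by linarith
    show "real_of_int (2 * k * p) \<le> 10 ^ 7 / \<eta> ^ 10"
    proof -
      have "real_of_int k * real_of_int p \<le> 4 / \<xi>' * (16 / \<xi>\<^sup>2)"
        using k p Q xi' by (intro mult_mono) auto
      also have "\<dots> = 4 * 1152 * 16 * 36 / \<eta> ^ 10"
        using eta by (simp add: \<xi>'_def \<xi>_def field_simps power2_eq_square numeral_eq_Suc)
      finally have "real_of_int (2 * k * p) \<le> 2 * (4 * 1152 * 16 * 36 / \<eta> ^ 10)" by simp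
      also have "\<dots> = 2 * (4 * 1152 * 16 * 36) / \<eta> ^ 10" by simp
      also have "\<dots> \<le> 10 ^ 7 / \<eta> ^ 10" using eta by (intro divide_right_mono) auto
      finally show ?thesis .
    qed
    have "\<bar>of_int (2 * k * p * int q * \<alpha> c) / real n - of_int (- m)\<bar> = \<bar>of_int k * \<theta> - of_int m\<bar>"
      proof -
      have "of_int (2 * k * p * int q * \<alpha> c) / real n - of_int (- m) = - (of_int k * \<theta> - of_int m)"
        unfolding \<theta>_def by simp
      then show ?thesis by (simp only: abs_minus_cancel)
    qed
    also have "\<dots> \<le> 16 * \<epsilon> / (\<xi>'\<^sup>2 * real M)" by (rule k(3))
    also have "\<dots> = 16 * 240000 * 6 ^ 8 * 1152\<^sup>2 / (\<eta> ^ 28 * (real M)\<^sup>2)"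
      unfolding eps \<xi>'_def using eta M0 by (simp add: field_simps power2_eq_square numeral_eq_Suc)
    also have "\<dots> \<le> 10 ^ 19 / (\<eta> ^ 28 * (real M)\<^sup>2)"
      using eta M0 by (intro divide_right_mono) auto
    finally show "\<bar>of_int (2 * k * p * int q * \<alpha> c) / real n - of_int (- m)\<bar> \<le> 10 ^ 19 / (\<eta> ^ 28 * (real M)\<^sup>2)" .
  qed (use c Wc in auto)
qed

subsection \<open>Counting coincidences of popular frequencies\<close>

lemma card_Sigma_le:
  assumes "finite A" "\<And>x. x \<in> A \<Longrightarrow> finite (B x) \<and> card (B x) \<le> K" "card A \<le> N"
  shows "finite (Sigma A B) \<and> card (Sigma A B) \<le> N * K"
proof -
  have "card (Sigma A B) = (\<Sum>x\<in>A. card (B x))"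
    using assms by (intro card_SigmaI) auto
  also have "\<dots> \<le> (\<Sum>x\<in>A. K)" using assms by (intro sum_mono) auto
  also have "\<dots> \<le> N * K" using assms(3) by simp
  finally show ?thesis using assms by auto
qed

text \<open>Cauchy-Schwarz over the sizes of the fibres of \<open>f\<close>.\<close>

lemma card_fibres_le:
  assumes "finite T" "finite Z" "f ` T \<subseteq> Z"
  shows "(card T)\<^sup>2 \<le> card Z * card {(s, s'). s \<in> T \<and> s' \<in> T \<and> f s = f s'}"
proof -
  define F where "F = (\<lambda>z. {s \<in> T. f s = z})"
  have 1: "card T = (\<Sum>z\<in>Z. card (F z))"
    using sum.group[OF assms(1,2,3), of "\<lambda>_. 1::nat"] by (simp add: F_def)
  have "{(s, s'). s \<in> T \<and> s' \<in> T \<and> f s = f s'} = (\<Union>z\<in>Z. F z \<times> F z)"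
    using assms(3) by (auto simp: F_def)
  also have "card \<dots> = (\<Sum>z\<in>Z. card (F z \<times> F z))"
    using assms by (intro card_UN_disjoint) (auto simp: F_def)
  also have "\<dots> = (\<Sum>z\<in>Z. (card (F z))\<^sup>2)" by (simp add: card_cartesian_product power2_eq_square)
  finally have 2: "card {(s, s'). s \<in> T \<and> s' \<in> T \<and> f s = f s'} = (\<Sum>z\<in>Z. (card (F z))\<^sup>2)" .
  have "(\<Sum>z\<in>Z. 1 * real (card (F z)))\<^sup>2 \<le> (\<Sum>z\<in>Z. 1\<^sup>2) * (\<Sum>z\<in>Z. (real (card (F z)))\<^sup>2)"
    by (rule Cauchy_Schwarz_ineq_sum)
  then have "real ((card T)\<^sup>2) \<le> real (card Z * card {(s, s'). s \<in> T \<and> s' \<in> T \<and> f s = f s'})"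
    unfolding 1 2 by simp
  then show ?thesis by linarith
qed

lemma finite_filter_int: "finite {x \<in> {a..<b::int}. P x}"
  by (rule finite_subset[of _ "{a..<b}"]) auto

lemma card_lin_roots:
  fixes p :: nat and A :: int
  assumes "prime p" "\<not> int p dvd A"
  shows "card {y \<in> {lo..<lo + int M}. int p dvd A * y - X} \<le> M div p + 1"
proof (cases "{y \<in> {lo..<lo + int M}. int p dvd A * y - X} = {}")
  case False
  then obtain y0 where y0: "int p dvd A * y0 - X" by auto
  have pos: "p > 0" using assms(1) prime_gt_0_nat by blast
  have sub: "{y \<in> {lo..<lo + int M}. int p dvd A * y - X} \<subseteq> {y \<in> {lo..<lo + int M}. int p dvd y - y0}"
  proof safe
    fix y assume "int p dvd A * y - X"
    then have "int p dvd A * (y - y0)" using dvd_diff[OF _ y0, of "A * y - X"] by (simp add: algebra_simps)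
    then show "int p dvd y - y0" using assms prime_dvd_mult_iff[of "int p"] by simp
  qed
  show ?thesis
    using order_trans[OF card_mono[OF finite_filter_int sub] card_cong_le[OF pos]] .
next
  case True
  show ?thesis unfolding True by simp
qed

text \<open>Two roots that are incongruent modulo \<open>p\<close> have a sum fixed modulo
  \<open>p\<close>, so every further root is congruent to one of them.\<close>

lemma card_quad_roots:
  fixes p :: nat and A :: int
  assumes "prime p" "\<not> int p dvd A"
  shows "card {y \<in> {0..<int M}. int p dvd A * y\<^sup>2 + B * y + C} \<le> 2 * (M div p + 1)"
proof (cases "\<exists>y1 y2. int p dvd A * y1\<^sup>2 + B * y1 + C \<and> int p dvd A * y2\<^sup>2 + B * y2 + C \<and> \<not> int p dvd y2 - y1")
  case True
  then obtain y1 y2 where y: "int p dvd A * y1\<^sup>2 + B * y1 + C" "int p dvd A * y2\<^sup>2 + B * y2 + C" "\<not> int p dvd y2 - y1" by blast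
  have pos: "p > 0" using assms(1) prime_gt_0_nat by blast
  have fac: "int p dvd y - z \<or> int p dvd A * (y + z) + B" if "int p dvd A * y\<^sup>2 + B * y + C" "int p dvd A * z\<^sup>2 + B * z + C" for y z
  proof -
    have "(A * y\<^sup>2 + B * y + C) - (A * z\<^sup>2 + B * z + C) = (y - z) * (A * (y + z) + B)"
      by (simp add: algebra_simps power2_eq_square)
    then have "int p dvd (y - z) * (A * (y + z) + B)" using dvd_diff[OF that] by simp
    then show ?thesis using assms(1) prime_dvd_mult_iff[of "int p"] by simp
  qed
  have k: "int p dvd A * (y2 + y1) + B" using fac[OF y(2,1)] y(3) by simp
  have sub: "{y \<in> {0..<int M}. int p dvd A * y\<^sup>2 + B * y + C} \<subseteq> {y \<in> {0..<0 + int M}. int p dvd y - y1} \<union> {y \<in> {0..<0 + int M}. int p dvd y - y2}"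
  proof safe
    fix z assume z: "z \<in> {0..<int M}" "int p dvd A * z\<^sup>2 + B * z + C" and nz: "\<not> int p dvd z - y2"
    show "int p dvd z - y1"
    proof (rule ccontr)
      assume "\<not> int p dvd z - y1"
      then have "int p dvd A * (z + y1) + B" using fac[OF z(2) y(1)] by simp
      then have "int p dvd A * (z - y2)" using dvd_diff[OF _ k, of "A * (z + y1) + B"] by (simp add: algebra_simps)
      then show False using assms prime_dvd_mult_iff[of "int p"] nz by simp
    qed
  qed auto
  have "card {y \<in> {0..<int M}. int p dvd A * y\<^sup>2 + B * y + C} \<le> card ({y \<in> {0..<0 + int M}. int p dvd y - y1} \<union> {y \<in> {0..<0 + int M}. int p dvd y - y2})"
    by (rule card_mono[OF _ sub]) (use finite_filter_int in auto)
  also have "\<dots> \<le> card {y \<in> {0..<0 + int M}. int p dvd y - y1} + card {y \<in> {0..<0 + int M}. int p dvd y - y2}"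
    by (rule card_Un_le)
  also have "\<dots> \<le> 2 * (M div p + 1)"
    using add_mono[OF card_cong_le[OF pos, of 0 M y1] card_cong_le[OF pos, of 0 M y2]] by simp
  finally show ?thesis .
next
  case no: False
  have pos: "p > 0" using assms(1) prime_gt_0_nat by blast
  show ?thesis
  proof (cases "{y \<in> {0..<int M}. int p dvd A * y\<^sup>2 + B * y + C} = {}")
    case False
    then obtain y1 where y1: "int p dvd A * y1\<^sup>2 + B * y1 + C" by auto
    have sub: "{y \<in> {0..<int M}. int p dvd A * y\<^sup>2 + B * y + C} \<subseteq> {y \<in> {0..<0 + int M}. int p dvd y - y1}"
      using no y1 by auto
    show ?thesis
      by (rule order_trans[OF order_trans[OF card_mono[OF finite_filter_int sub] card_cong_le[OF pos]]]) simp
  next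
    case True
    show ?thesis unfolding True by simp
  qed
qed

lemma dvd_mod_diff: "(d::int) dvd m \<Longrightarrow> x mod m = y mod m \<Longrightarrow> d dvd x - y"
  by (metis dvd_trans mod_eq_dvd_iff)

text \<open>An additive energy argument: \<open>T\<close> consists of quadruples for which four
  frequencies satisfy k1 - k2 - k3 + k4 = 0 modulo \<open>L\<close>. By Cauchy-Schwarz its size is
  controlled by the pairs of quadruples with the same first three residues. In such a pair the
  fourth residues share their frequency and their class modulo \<open>q\<close>, so unpopularity
  leaves at most \<open>s\<close> choices for the second once the first is known. The other
  parameters are tied together by congruences modulo \<open>a\<close> and \<open>q\<close>.\<close>

lemma popular_count:
  fixes W :: "int \<Rightarrow> complex" and k :: "int \<Rightarrow> int"
  assumes "q > 0" "L > 0" "prime a" "\<not> a dvd 2 * q" "a \<le> M" "q \<le> M"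
    and krange: "\<And>r. 0 \<le> k r \<and> k r < int L"
    and unpop: "\<And>r. 0 \<le> r \<Longrightarrow> r < int (q * a) \<Longrightarrow>
       card {r' \<in> {0..<int (q * a)}. r' mod int q = r mod int q \<and> W r' \<noteq> 0 \<and> k r' = k r} \<le> s"
    and T: "T \<subseteq> {(\<rho>, t, y, y'). 0 \<le> \<rho> \<and> \<rho> < int (q * a) \<and> t \<in> {- int M..int M} \<and> \<not> int a dvd t \<and> y \<in> {0..<int M} \<and> y' \<in> {0..<int M} \<and>
       W ((\<rho> - t + int q * (y' + t)\<^sup>2) mod int (q * a)) \<noteq> 0 \<and>
       int L dvd k ((\<rho> + int q * y\<^sup>2) mod int (q * a)) - k ((\<rho> - t + int q * (y + t)\<^sup>2) mod int (q * a))
         - k ((\<rho> + int q * y'\<^sup>2) mod int (q * a)) + k ((\<rho> - t + int q * (y' + t)\<^sup>2) mod int (q * a))}"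
  shows "(card T)\<^sup>2 \<le> (q * a * (q * a) * (a + 1)) *
    ((q * a * s) * ((2 * M + 1) * (((2 * M + 1) div q + 1) * (M * ((2 * (M div a + 1)) * ((M div a + 1) * (M div a + 1)))))) +
     (q * a) * ((2 * M + 1) * ((2 * ((2 * M + 1) div (q * a) + 1)) * (M * (M * ((M div a + 1) * (2 * (M div a + 1))))))))"
proof -
  define Q where "Q = int (q * a)"
  define r1 where "r1 = (\<lambda>(\<rho>::int, t::int, y::int, y'::int). (\<rho> + int q * y\<^sup>2) mod Q)"
  define r2 where "r2 = (\<lambda>(\<rho>::int, t::int, y::int, y'::int). (\<rho> - t + int q * (y + t)\<^sup>2) mod Q)"
  define r3 where "r3 = (\<lambda>(\<rho>::int, t::int, y::int, y'::int). (\<rho> + int q * y'\<^sup>2) mod Q)"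
  define r4 where "r4 = (\<lambda>(\<rho>::int, t::int, y::int, y'::int). (\<rho> - t + int q * (y' + t)\<^sup>2) mod Q)"
  define f where "f = (\<lambda>s. (r1 s, (r2 s, r3 s)))"
  define P where "P = {(s::int \<times> int \<times> int \<times> int, s'). s \<in> T \<and> s' \<in> T \<and> f s = f s'}"
  define w where "w = M div a + 1"
  have a0: "a > 0" using assms(3) prime_gt_0_nat by blast
  have Q0: "Q > 0" using assms a0 by (simp add: Q_def)
  have qQ: "int q dvd Q" and aQ: "int a dvd Q" by (auto simp: Q_def)
  have na2q: "\<not> int a dvd 2 * int q" using assms(4) by (metis int_dvd_int_iff of_nat_mult of_nat_numeral)
  have naq: "\<not> int a dvd int q" using na2q by auto
  have pa: "prime (int a)" using assms(3) by simp
  have cop: "coprime (int q) (int a)"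
    using pa naq by (metis coprime_commute prime_imp_coprime)
  have TT: "0 \<le> \<rho> \<and> \<rho> < Q \<and> t \<in> {- int M..int M} \<and> \<not> int a dvd t \<and> y \<in> {0..<int M} \<and> y' \<in> {0..<int M} \<and>
     W (r4 (\<rho>, t, y, y')) \<noteq> 0 \<and> int L dvd k (r1 (\<rho>, t, y, y')) - k (r2 (\<rho>, t, y, y')) - k (r3 (\<rho>, t, y, y')) + k (r4 (\<rho>, t, y, y'))"
    if "(\<rho>, t, y, y') \<in> T" for \<rho> t y y'
    using subsetD[OF T that] by (simp add: Q_def r1_def r2_def r3_def r4_def)
  have "T \<subseteq> {0..<Q} \<times> {- int M..int M} \<times> {0..<int M} \<times> {0..<int M}"
    using TT by force
  then have finT: "finite T" by (rule finite_subset) auto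
  \<comment> \<open>The third residue contributes only a + 1 values, since it agrees with the first
    one modulo \<open>q\<close>.\<close>
  define Z where "Z = (SIGMA x:{0..<Q}. SIGMA y:{0..<Q}. {z \<in> {0..<0 + int (q * a)}. int q dvd z - x})"
  have cz: "card {z \<in> {0..<0 + int (q * a)}. int q dvd z - x} \<le> a + 1" for x
    using card_cong_le[of q 0 "q * a" x] assms(1) by simp
  have Z: "finite Z \<and> card Z \<le> (q * a) * ((q * a) * (a + 1))"
    unfolding Z_def
  proof (intro card_Sigma_le)
    show "finite {z \<in> {0..<0 + int (q * a)}. int q dvd z - x} \<and> card {z \<in> {0..<0 + int (q * a)}. int q dvd z - x} \<le> a + 1" for x
      using cz finite_filter_int by (intro conjI)
  qed (auto simp: Q_def nat_mult_distrib)
  have rr: "int q dvd r3 s - r1 s" for s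
  proof -
    obtain \<rho> t y y' where s: "s = (\<rho>, t, y, y')" by (cases s)
    have d: "int q dvd (\<rho> + int q * y'\<^sup>2) mod Q - (\<rho> + int q * y'\<^sup>2)" "int q dvd (\<rho> + int q * y\<^sup>2) mod Q - (\<rho> + int q * y\<^sup>2)"
      by (rule dvd_mod_diff[OF qQ]; simp)+
    have "int q dvd ((\<rho> + int q * y'\<^sup>2) mod Q - (\<rho> + int q * y'\<^sup>2)) - ((\<rho> + int q * y\<^sup>2) mod Q - (\<rho> + int q * y\<^sup>2)) + int q * (y'\<^sup>2 - y\<^sup>2)"
      by (rule dvd_add[OF dvd_diff[OF d] dvd_triv_left])
    then show ?thesis unfolding s r1_def r3_def by (simp add: algebra_simps)
  qed
  have "f ` T \<subseteq> Z"
  proof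
    fix z assume "z \<in> f ` T"
    then obtain \<rho> t y y' where z: "z = f (\<rho>, t, y, y')" by force
    show "z \<in> Z" unfolding z f_def Z_def using rr[of "(\<rho>, t, y, y')"] Q0
      by (simp add: r1_def r2_def r3_def Q_def)
  qed
  then have main: "(card T)\<^sup>2 \<le> card Z * card P"
    unfolding P_def using finT Z by (intro card_fibres_le) auto
  \<comment> \<open>Subtracting the equalities of the first and of the second residues cancels the
    base points and leaves a congruence modulo \<open>a\<close> that is linear in z.\<close>
  define E where "E = (\<lambda>t t' y. {z \<in> {0..<0 + int M}. int a dvd 2 * int q * t' * z - (- t + 2 * int q * t * y + int q * t\<^sup>2 + t' - int q * t'\<^sup>2)})"
  have E: "finite (E t t' y) \<and> card (E t t' y) \<le> w" if "\<not> int a dvd t'" for t t' y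
  proof -
    have "\<not> int a dvd 2 * int q * t'" using that na2q pa prime_dvd_mult_iff by blast
    then show ?thesis unfolding E_def w_def by (intro conjI finite_filter_int card_lin_roots[OF assms(3)])
  qed
  have facts: "int q dvd t' - t \<and> int a dvd (\<rho> + int q * y\<^sup>2) - (\<rho>' + int q * z\<^sup>2) \<and>
      z \<in> E t t' y \<and> int a dvd (\<rho> + int q * y'\<^sup>2) - (\<rho>' + int q * z'\<^sup>2)"
    if st: "((\<rho>, t, y, y'), (\<rho>', t', z, z')) \<in> P" for \<rho> t y y' \<rho>' t' z z'
  proof -
    have eq: "(\<rho> + int q * y\<^sup>2) mod Q = (\<rho>' + int q * z\<^sup>2) mod Q"
      "(\<rho> - t + int q * (y + t)\<^sup>2) mod Q = (\<rho>' - t' + int q * (z + t')\<^sup>2) mod Q"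
      "(\<rho> + int q * y'\<^sup>2) mod Q = (\<rho>' + int q * z'\<^sup>2) mod Q"
      using st by (simp_all add: P_def f_def r1_def r2_def r3_def)
    have inT: "(\<rho>', t', z, z') \<in> T" using st by (simp add: P_def)
    have d1: "d dvd (\<rho> + int q * y\<^sup>2) - (\<rho>' + int q * z\<^sup>2)" if "d dvd Q" for d by (rule dvd_mod_diff[OF that eq(1)])
    have d2: "d dvd (\<rho> - t + int q * (y + t)\<^sup>2) - (\<rho>' - t' + int q * (z + t')\<^sup>2)" if "d dvd Q" for d by (rule dvd_mod_diff[OF that eq(2)])
    have e: "((\<rho> - t + int q * (y + t)\<^sup>2) - (\<rho>' - t' + int q * (z + t')\<^sup>2)) - ((\<rho> + int q * y\<^sup>2) - (\<rho>' + int q * z\<^sup>2))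
      = (t' - t) + int q * (2 * y * t + t\<^sup>2 - 2 * z * t' - t'\<^sup>2)"
      by (simp add: algebra_simps power2_eq_square)
    have "int q dvd (t' - t) + int q * (2 * y * t + t\<^sup>2 - 2 * z * t' - t'\<^sup>2)"
      using dvd_diff[OF d2[OF qQ] d1[OF qQ]] unfolding e .
    then have "int q dvd t' - t" by (simp add: dvd_add_left_iff)
    moreover have "int a dvd (t' - t) + int q * (2 * y * t + t\<^sup>2 - 2 * z * t' - t'\<^sup>2)"
      using dvd_diff[OF d2[OF aQ] d1[OF aQ]] unfolding e .
    then have "int a dvd - ((t' - t) + int q * (2 * y * t + t\<^sup>2 - 2 * z * t' - t'\<^sup>2))" by (simp only: dvd_minus_iff)
    then have "z \<in> E t t' y" using TT[OF inT] by (simp add: E_def algebra_simps)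
    ultimately show ?thesis using d1[OF aQ] dvd_mod_diff[OF aQ eq(3)] by blast
  qed
  \<comment> \<open>The quadratic congruence used below has leading coefficient 4 q^2 (t^2 - t'^2),
    so the pairs for which \<open>a\<close> divides t^2 - t'^2 are counted separately.\<close>
  define Pd where "Pd = {((\<rho>, t, y, y'), (\<rho>', t', z, z')). ((\<rho>, t, y, y'), (\<rho>', t', z, z')) \<in> P \<and> int a dvd t\<^sup>2 - t'\<^sup>2}"
  define Pn where "Pn = {((\<rho>, t, y, y'), (\<rho>', t', z, z')). ((\<rho>, t, y, y'), (\<rho>', t', z, z')) \<in> P \<and> \<not> int a dvd t\<^sup>2 - t'\<^sup>2}"
  have "P = Pn \<union> Pd" by (auto simp: Pd_def Pn_def)
  then have cP: "card P \<le> card Pn + card Pd" using card_Un_le by metis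
  have tcard: "card {- int M..int M} \<le> 2 * M + 1" by simp
  have ycard: "card {0..<int M} \<le> M" by simp
  define Prs where "Prs = (SIGMA r:{0..<Q}. {r' \<in> {0..<Q}. r' mod int q = r mod int q \<and> W r' \<noteq> 0 \<and> k r' = k r})"
  have Prs: "finite Prs \<and> card Prs \<le> (q * a) * s"
    unfolding Prs_def
  proof (intro card_Sigma_le)
    fix x assume "x \<in> {0..<Q}"
    then show "finite {r' \<in> {0..<Q}. r' mod int q = x mod int q \<and> W r' \<noteq> 0 \<and> k r' = k x} \<and>
        card {r' \<in> {0..<Q}. r' mod int q = x mod int q \<and> W r' \<noteq> 0 \<and> k r' = k x} \<le> s"
      using unpop[of x] finite_filter_int[of 0 Q] unfolding Q_def by auto
  qed (auto simp: Q_def nat_mult_distrib)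
  define B where "B = (\<lambda>t. {t' \<in> {- int M..<- int M + int (2 * M + 1)}. int q dvd t' - t})"
  have B: "finite (B t) \<and> card (B t) \<le> (2 * M + 1) div q + 1" for t
    unfolding B_def by (intro conjI finite_filter_int card_cong_le[OF assms(1)])
  define g2 where "g2 = (\<lambda>t t'. - t + int q * t\<^sup>2 + t' - int q * t'\<^sup>2)"
  \<comment> \<open>Obtained by eliminating z and z', which are linear in y and in y' modulo
    \<open>a\<close>, from q (y^2 - z^2) = q (y'^2 - z'^2) modulo \<open>a\<close>; the latter
    compares the equalities of the first and third residues.\<close>
  define D where "D = (\<lambda>p t t' y'. {y \<in> {0..<int M}. int a dvd (4 * (int q)\<^sup>2 * (t\<^sup>2 - t'\<^sup>2)) * y\<^sup>2 + (4 * int q * t * g2 t t') * y +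
      ((2 * int q * t')\<^sup>2 * y'\<^sup>2 - (2 * int q * t * y' + (snd p - fst p + g2 t t'))\<^sup>2 + (g2 t t')\<^sup>2)})"
  define F where "F = (\<lambda>p t t' y'. {z \<in> {0..<0 + int M}. int a dvd 2 * int q * t' * z - (2 * int q * t * y' + (snd p - fst p + g2 t t'))})"
  \<comment> \<open>Order of the choices: the fourth residues, then t, t' and y', then y, z, z' as
    roots of congruences modulo \<open>a\<close>. The base points are recovered from the fourth
    residues.\<close>
  define Sn where "Sn = (SIGMA p:Prs. SIGMA t:{- int M..int M}. SIGMA t':{t'\<in>B t. \<not> int a dvd t\<^sup>2 - t'\<^sup>2 \<and> \<not> int a dvd t'}. SIGMA y':{0..<int M}. SIGMA y:D p t t' y'. SIGMA z:E t t' y. F p t t' y')"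
  have D: "finite (D p t t' y') \<and> card (D p t t' y') \<le> 2 * w" if "\<not> int a dvd t\<^sup>2 - t'\<^sup>2" for p t t' y'
  proof -
    have "4 * (int q)\<^sup>2 * (t\<^sup>2 - t'\<^sup>2) = (2 * int q) * (2 * int q) * (t\<^sup>2 - t'\<^sup>2)" by (simp add: power2_eq_square)
    then have "\<not> int a dvd 4 * (int q)\<^sup>2 * (t\<^sup>2 - t'\<^sup>2)" using that na2q pa by (metis prime_dvd_mult_iff)
    then show ?thesis unfolding D_def w_def by (intro conjI finite_filter_int card_quad_roots[OF assms(3)])
  qed
  have F: "finite (F p t t' y') \<and> card (F p t t' y') \<le> w" if "\<not> int a dvd t'" for p t t' y'
  proof -
    have "\<not> int a dvd 2 * int q * t'" using that na2q pa prime_dvd_mult_iff by blast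
    then show ?thesis unfolding F_def w_def by (intro conjI finite_filter_int card_lin_roots[OF assms(3)])
  qed
  have Sn: "finite Sn \<and> card Sn \<le> (q * a * s) * ((2 * M + 1) * (((2 * M + 1) div q + 1) * (M * ((2 * w) * (w * w)))))"
    unfolding Sn_def
  proof (intro card_Sigma_le)
    fix t
    have "card {t' \<in> B t. \<not> int a dvd t\<^sup>2 - t'\<^sup>2 \<and> \<not> int a dvd t'} \<le> card (B t)"
      using B[of t] by (intro card_mono) auto
    then show "card {t' \<in> B t. \<not> int a dvd t\<^sup>2 - t'\<^sup>2 \<and> \<not> int a dvd t'} \<le> (2 * M + 1) div q + 1" using B[of t] by linarith
    show "finite {t' \<in> B t. \<not> int a dvd t\<^sup>2 - t'\<^sup>2 \<and> \<not> int a dvd t'}" using B[of t] by auto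
  qed (use Prs D E F ycard tcard in \<open>auto\<close>)
  define gn where "gn = (\<lambda>(s, s'). case s of (\<rho>::int, t::int, y::int, y'::int) \<Rightarrow> case s' of (\<rho>'::int, t'::int, z::int, z'::int) \<Rightarrow>
     ((r4 s, r4 s'), (t, (t', (y', (y, (z, z')))))))"
  have modinj: "\<rho> = \<rho>'" if "(\<rho> + u) mod Q = (\<rho>' + u) mod Q" "0 \<le> \<rho>" "\<rho> < Q" "0 \<le> \<rho>'" "\<rho>' < Q" for \<rho> \<rho>' u
  proof -
    have "Q dvd (\<rho> + u) - (\<rho>' + u)" using that(1) by (simp add: mod_eq_dvd_iff)
    then have "Q dvd \<rho> - \<rho>'" by simp
    then show ?thesis using that by (metis mod_eq_dvd_iff mod_pos_pos_trivial)
  qed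
  have "inj_on gn Pn"
  proof (rule inj_onI)
    fix p p' assume pp: "p \<in> Pn" "p' \<in> Pn" "gn p = gn p'"
    obtain \<rho> t y y' \<rho>' t' z z' where p: "p = ((\<rho>, t, y, y'), (\<rho>', t', z, z'))" by (metis prod.exhaust)
    obtain \<rho>1 t1 y1 y1' \<rho>1' t1' z1 z1' where p': "p' = ((\<rho>1, t1, y1, y1'), (\<rho>1', t1', z1, z1'))" by (metis prod.exhaust)
    have mem: "(\<rho>, t, y, y') \<in> T" "(\<rho>', t', z, z') \<in> T" "(\<rho>1, t1, y1, y1') \<in> T" "(\<rho>1', t1', z1, z1') \<in> T"
      using pp(1,2) by (auto simp: p p' Pn_def P_def)
    have eqs: "t1 = t" "t1' = t'" "y1' = y'" "y1 = y" "z1 = z" "z1' = z'"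
      "(\<rho> + (- t + int q * (y' + t)\<^sup>2)) mod Q = (\<rho>1 + (- t + int q * (y' + t)\<^sup>2)) mod Q"
      "(\<rho>' + (- t' + int q * (z' + t')\<^sup>2)) mod Q = (\<rho>1' + (- t' + int q * (z' + t')\<^sup>2)) mod Q"
      using pp(3) by (auto simp: p p' gn_def r4_def algebra_simps)
    have "\<rho> = \<rho>1" "\<rho>' = \<rho>1'"
      using modinj[OF eqs(7)] modinj[OF eqs(8)] TT[OF mem(1)] TT[OF mem(2)] TT[OF mem(3)] TT[OF mem(4)] by blast+
    then show "p = p'" by (simp add: p p' eqs)
  qed
  moreover have "gn ` Pn \<subseteq> Sn"
  proof
    fix v assume "v \<in> gn ` Pn"
    then obtain \<rho> t y y' \<rho>' t' z z' where p: "((\<rho>, t, y, y'), (\<rho>', t', z, z')) \<in> Pn"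
      and v: "v = gn ((\<rho>, t, y, y'), (\<rho>', t', z, z'))" by force
    have pP: "((\<rho>, t, y, y'), (\<rho>', t', z, z')) \<in> P" and nd: "\<not> int a dvd t\<^sup>2 - t'\<^sup>2" using p by (auto simp: Pn_def)
    have mem: "(\<rho>, t, y, y') \<in> T" "(\<rho>', t', z, z') \<in> T" and ff: "f (\<rho>, t, y, y') = f (\<rho>', t', z, z')"
      using pP by (auto simp: P_def)
    note T1 = TT[OF mem(1)] and T2 = TT[OF mem(2)] and fc = facts[OF pP]
    define R where "R = r4 (\<rho>, t, y, y')"
    define R' where "R' = r4 (\<rho>', t', z, z')"
    have Rr: "0 \<le> R" "R < Q" "0 \<le> R'" "R' < Q" using Q0 by (auto simp: R_def R'_def r4_def)
    have dR: "d dvd R - (\<rho> - t + int q * (y' + t)\<^sup>2)" "d dvd R' - (\<rho>' - t' + int q * (z' + t')\<^sup>2)" if "d dvd Q" for d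
      unfolding R_def R'_def r4_def by (auto intro: dvd_mod_diff[OF that])
    have "int L dvd (k (r1 (\<rho>, t, y, y')) - k (r2 (\<rho>, t, y, y')) - k (r3 (\<rho>, t, y, y')) + k R) -
       (k (r1 (\<rho>', t', z, z')) - k (r2 (\<rho>', t', z, z')) - k (r3 (\<rho>', t', z, z')) + k R')"
      using T1 T2 unfolding R_def R'_def by (intro dvd_diff) auto
    then have "int L dvd k R - k R'" using ff by (simp add: f_def)
    then have kR: "k R' = k R" using krange by (metis mod_eq_dvd_iff mod_pos_pos_trivial)
    have cl: "R' mod int q = R mod int q"
    proof -
      have h1: "int q dvd \<rho>' - \<rho>"
      proof -
        have "(\<rho> + int q * y\<^sup>2) mod Q = (\<rho>' + int q * z\<^sup>2) mod Q" using ff by (simp add: f_def r1_def)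
        from dvd_mod_diff[OF qQ this] have "int q dvd (\<rho> - \<rho>') + int q * (y\<^sup>2 - z\<^sup>2)" by (simp add: algebra_simps)
        then have "int q dvd \<rho> - \<rho>'" by (simp add: dvd_add_left_iff)
        then show ?thesis by (simp add: dvd_diff_commute)
      qed
      have "R' - R = (R' - (\<rho>' - t' + int q * (z' + t')\<^sup>2)) - (R - (\<rho> - t + int q * (y' + t)\<^sup>2)) + (\<rho>' - \<rho>) - (t' - t)
         + int q * ((z' + t')\<^sup>2 - (y' + t)\<^sup>2)" by (simp add: algebra_simps)
      then have "int q dvd R' - R"
        using dvd_add[OF dvd_diff[OF dvd_add[OF dvd_diff[OF dR(2)[OF qQ] dR(1)[OF qQ]] h1] conjunct1[OF fc]] dvd_triv_left] by (simp only:)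
      then show ?thesis by (simp add: mod_eq_dvd_iff)
    qed
    have inPrs: "(R, R') \<in> Prs" using Rr T2 kR cl by (simp add: Prs_def R'_def)
    have inB: "t' \<in> B t" using T2 fc by (auto simp: B_def)
    have d3: "int a dvd (\<rho> + int q * y'\<^sup>2) - (\<rho>' + int q * z'\<^sup>2)" using fc by blast
    have eF: "2 * int q * t' * z' - (2 * int q * t * y' + (R' - R + g2 t t')) =
       - (R' - (\<rho>' - t' + int q * (z' + t')\<^sup>2)) + (R - (\<rho> - t + int q * (y' + t)\<^sup>2)) + ((\<rho> + int q * y'\<^sup>2) - (\<rho>' + int q * z'\<^sup>2))"
      by (simp add: g2_def algebra_simps power2_eq_square)
    have dF: "int a dvd 2 * int q * t' * z' - (2 * int q * t * y' + (R' - R + g2 t t'))"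
      unfolding eF by (rule dvd_add[OF dvd_add[OF iffD2[OF dvd_minus_iff dR(2)[OF aQ]] dR(1)[OF aQ]] d3])
    then have inF: "z' \<in> F (R, R') t t' y'" using T2 by (simp add: F_def)
    have inE: "z \<in> E t t' y" using fc by blast
    have dE: "int a dvd 2 * int q * t' * z - (2 * int q * t * y + g2 t t')"
      using inE by (simp add: E_def g2_def algebra_simps)
    have d1: "int a dvd (\<rho> + int q * y\<^sup>2) - (\<rho>' + int q * z\<^sup>2)" using fc by blast
    define U where "U = 2 * int q * t * y' + (R' - R + g2 t t')"
    define V where "V = 2 * int q * t * y + g2 t t'"
    define zz where "zz = 2 * int q * t' * z"
    define zz' where "zz' = 2 * int q * t' * z'"
    \<comment> \<open>The identity behind the elimination: every summand on the right is a multiple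
      of a quantity already known to vanish modulo \<open>a\<close>.\<close>
    have eD: "(4 * (int q)\<^sup>2 * (t\<^sup>2 - t'\<^sup>2)) * y\<^sup>2 + (4 * int q * t * g2 t t') * y +
      ((2 * int q * t')\<^sup>2 * y'\<^sup>2 - (2 * int q * t * y' + (R' - R + g2 t t'))\<^sup>2 + (g2 t t')\<^sup>2)
      = (4 * int q * t'\<^sup>2) * (((\<rho> + int q * y'\<^sup>2) - (\<rho>' + int q * z'\<^sup>2)) - ((\<rho> + int q * y\<^sup>2) - (\<rho>' + int q * z\<^sup>2)))
        + (zz' - U) * (zz' + U) - (zz - V) * (zz + V)"
      unfolding U_def[symmetric] by (simp add: V_def zz_def zz'_def algebra_simps power2_eq_square)
    have "int a dvd (4 * (int q)\<^sup>2 * (t\<^sup>2 - t'\<^sup>2)) * y\<^sup>2 + (4 * int q * t * g2 t t') * y +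
      ((2 * int q * t')\<^sup>2 * y'\<^sup>2 - (2 * int q * t * y' + (R' - R + g2 t t'))\<^sup>2 + (g2 t t')\<^sup>2)"
      unfolding eD
    proof (intro dvd_add dvd_diff)
      show "int a dvd (4 * int q * t'\<^sup>2) * (((\<rho> + int q * y'\<^sup>2) - (\<rho>' + int q * z'\<^sup>2)) - ((\<rho> + int q * y\<^sup>2) - (\<rho>' + int q * z\<^sup>2)))"
        using dvd_diff[OF d3 d1] by (rule dvd_mult)
      show "int a dvd (zz' - U) * (zz' + U)" using dF unfolding zz'_def[symmetric] U_def[symmetric] by (rule dvd_mult2)
      show "int a dvd (zz - V) * (zz + V)" using dE unfolding zz_def[symmetric] V_def[symmetric] by (rule dvd_mult2)
    qed
    then have inD: "y \<in> D (R, R') t t' y'" using T1 by (simp add: D_def)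
    show "v \<in> Sn"
      unfolding v gn_def Sn_def using inPrs inB inF inE inD T1 T2 nd by (simp add: R_def R'_def)
  qed
  ultimately have cPn: "card Pn \<le> card Sn" using Sn card_inj_on_le by blast
  \<comment> \<open>For degenerate pairs t' equals t modulo \<open>q\<close> and plus or minus t
    modulo \<open>a\<close>, which leaves two classes modulo \<open>q a\<close>. Then \<rho>, y, y'
    run freely, z and z' are roots of congruences, and the second base point is recovered from the
    first residue.\<close>
  define B' where "B' = (\<lambda>t. {t' \<in> {- int M..int M}. \<not> int a dvd t' \<and> int q dvd t' - t \<and> int a dvd t\<^sup>2 - t'\<^sup>2})"
  have B': "finite (B' t) \<and> card (B' t) \<le> 2 * ((2 * M + 1) div (q * a) + 1)" for t
  proof -
    define C1 where "C1 = {t' \<in> {- int M..<- int M + int (2 * M + 1)}. int (q * a) dvd t' - t}"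
    define C2 where "C2 = {t' \<in> {- int M..<- int M + int (2 * M + 1)}. int q dvd t' - t \<and> int a dvd t' + t}"
    have qa: "int (q * a) dvd x" if "int q dvd x" "int a dvd x" for x
      using divides_mult[OF that cop] by simp
    have pos: "q * a > 0" using assms(1) a0 by simp
    have "B' t \<subseteq> C1 \<union> C2"
    proof
      fix t' assume t': "t' \<in> B' t"
      then have "int a dvd (t' - t) * (t' + t)"
        by (simp add: B'_def algebra_simps power2_eq_square dvd_diff_commute)
      then have "int a dvd t' - t \<or> int a dvd t' + t" using pa prime_dvd_mult_iff by blast
      then show "t' \<in> C1 \<union> C2" using t' qa by (auto simp: B'_def C1_def C2_def)
    qed
    moreover have "finite C1" "finite C2" unfolding C1_def C2_def by (rule finite_filter_int)+
    ultimately have "finite (B' t)" "card (B' t) \<le> card C1 + card C2"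
      using finite_subset card_mono[of "C1 \<union> C2" "B' t"] card_Un_le[of C1 C2] by fastforce+
    moreover have "card C1 \<le> (2 * M + 1) div (q * a) + 1"
      unfolding C1_def by (rule card_cong_le[OF pos])
    moreover have "card C2 \<le> (2 * M + 1) div (q * a) + 1"
    proof (cases "C2 = {}")
      case False
      then obtain t0 where t0: "int q dvd t0 - t" "int a dvd t0 + t" by (auto simp: C2_def)
      have sub: "C2 \<subseteq> {t' \<in> {- int M..<- int M + int (2 * M + 1)}. int (q * a) dvd t' - t0}"
      proof
        fix t' assume "t' \<in> C2"
        then have t': "t' \<in> {- int M..<- int M + int (2 * M + 1)}" "int q dvd t' - t" "int a dvd t' + t" by (auto simp: C2_def)
        have "int q dvd t' - t0" "int a dvd t' - t0"
          using dvd_diff[OF t'(2) t0(1)] dvd_diff[OF t'(3) t0(2)] by simp_all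
        then show "t' \<in> {t' \<in> {- int M..<- int M + int (2 * M + 1)}. int (q * a) dvd t' - t0}" using t'(1) qa by blast
      qed
      show ?thesis using order_trans[OF card_mono[OF finite_filter_int sub] card_cong_le[OF pos]] .
    qed simp
    ultimately show ?thesis by simp
  qed
  define F' where "F' = (\<lambda>y y' z. {z' \<in> {0..<int M}. int a dvd int q * z'\<^sup>2 + 0 * z' + (int q * y\<^sup>2 - int q * z\<^sup>2 - int q * y'\<^sup>2)})"
  have F': "finite (F' y y' z) \<and> card (F' y y' z) \<le> 2 * w" for y y' z
    unfolding F'_def w_def by (intro conjI finite_filter_int card_quad_roots[OF assms(3) naq])
  define Sd where "Sd = (SIGMA \<rho>:{0..<Q}. SIGMA t:{- int M..int M}. SIGMA t':B' t. SIGMA y:{0..<int M}. SIGMA y':{0..<int M}. SIGMA z:E t t' y. F' y y' z)"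
  have Sd: "finite Sd \<and> card Sd \<le> (q * a) * ((2 * M + 1) * ((2 * ((2 * M + 1) div (q * a) + 1)) * (M * (M * (w * (2 * w))))))"
    unfolding Sd_def
  proof (intro card_Sigma_le)
    show "finite (E t t' y)" "card (E t t' y) \<le> w" if "t' \<in> B' t" for t t' y
      using E that by (auto simp: B'_def)
  qed (use B' F' in \<open>auto simp: Q_def nat_mult_distrib\<close>)
  define gd where "gd = (\<lambda>(s, s'). case s of (\<rho>::int, t::int, y::int, y'::int) \<Rightarrow> case s' of (\<rho>'::int, t'::int, z::int, z'::int) \<Rightarrow>
     (\<rho>, (t, (t', (y, (y', (z, z')))))))"
  have "inj_on gd Pd"
  proof (rule inj_onI)
    fix p p' assume pp: "p \<in> Pd" "p' \<in> Pd" "gd p = gd p'"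
    obtain \<rho> t y y' \<rho>' t' z z' where p: "p = ((\<rho>, t, y, y'), (\<rho>', t', z, z'))" by (metis prod.exhaust)
    obtain \<rho>1 t1 y1 y1' \<rho>1' t1' z1 z1' where p': "p' = ((\<rho>1, t1, y1, y1'), (\<rho>1', t1', z1, z1'))" by (metis prod.exhaust)
    have mem: "(\<rho>', t', z, z') \<in> T" "(\<rho>1', t1', z1, z1') \<in> T"
      and ff: "f (\<rho>, t, y, y') = f (\<rho>', t', z, z')" "f (\<rho>1, t1, y1, y1') = f (\<rho>1', t1', z1, z1')"
      using pp(1,2) by (auto simp: p p' Pd_def P_def)
    have eqs: "\<rho>1 = \<rho>" "t1 = t" "t1' = t'" "y1' = y'" "y1 = y" "z1 = z" "z1' = z'"
      using pp(3) by (auto simp: p p' gd_def)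
    have "(\<rho>' + int q * z\<^sup>2) mod Q = (\<rho>1' + int q * z\<^sup>2) mod Q"
      using ff by (simp add: f_def r1_def eqs)
    then have "\<rho>' = \<rho>1'" using modinj TT[OF mem(1)] TT[OF mem(2)] by blast
    then show "p = p'" by (simp add: p p' eqs)
  qed
  moreover have "gd ` Pd \<subseteq> Sd"
  proof
    fix v assume "v \<in> gd ` Pd"
    then obtain \<rho> t y y' \<rho>' t' z z' where p: "((\<rho>, t, y, y'), (\<rho>', t', z, z')) \<in> Pd"
      and v: "v = gd ((\<rho>, t, y, y'), (\<rho>', t', z, z'))" by force
    have pP: "((\<rho>, t, y, y'), (\<rho>', t', z, z')) \<in> P" and dg: "int a dvd t\<^sup>2 - t'\<^sup>2" using p by (auto simp: Pd_def)
    have mem: "(\<rho>, t, y, y') \<in> T" "(\<rho>', t', z, z') \<in> T" using pP by (auto simp: P_def)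
    note T1 = TT[OF mem(1)] and T2 = TT[OF mem(2)] and fc = facts[OF pP]
    have "int q * z'\<^sup>2 + 0 * z' + (int q * y\<^sup>2 - int q * z\<^sup>2 - int q * y'\<^sup>2) =
      ((\<rho> + int q * y\<^sup>2) - (\<rho>' + int q * z\<^sup>2)) - ((\<rho> + int q * y'\<^sup>2) - (\<rho>' + int q * z'\<^sup>2))" by (simp add: algebra_simps)
    also have "int a dvd \<dots>" by (rule dvd_diff) (use fc in blast)+
    finally have "z' \<in> F' y y' z" using T2 by (simp add: F'_def)
    then show "v \<in> Sd" unfolding v gd_def Sd_def using T1 T2 fc dg by (simp add: B'_def)
  qed
  ultimately have cPd: "card Pd \<le> card Sd" using Sd card_inj_on_le by blast
  have "card Z * card P \<le> (q * a * (q * a) * (a + 1)) *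
    ((q * a * s) * ((2 * M + 1) * (((2 * M + 1) div q + 1) * (M * ((2 * w) * (w * w))))) +
     (q * a) * ((2 * M + 1) * ((2 * ((2 * M + 1) div (q * a) + 1)) * (M * (M * (w * (2 * w)))))))"
  proof (rule mult_mono)
    show "card Z \<le> q * a * (q * a) * (a + 1)" using conjunct2[OF Z] by (simp only: mult.assoc)
    show "card P \<le> (q * a * s) * ((2 * M + 1) * (((2 * M + 1) div q + 1) * (M * ((2 * w) * (w * w))))) +
     (q * a) * ((2 * M + 1) * ((2 * ((2 * M + 1) div (q * a) + 1)) * (M * (M * (w * (2 * w))))))"
      using cP cPn cPd Sn Sd by linarith
  qed auto
  then show ?thesis using main unfolding w_def by linarith
qed

subsection \<open>Dual functions and the inverse step\<close>

definition max_coeff :: "nat \<Rightarrow> nat \<Rightarrow> (int \<Rightarrow> complex) \<Rightarrow> int \<Rightarrow> real" where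
  "max_coeff d L h r = Max ((\<lambda>k. norm (ft L (\<lambda>m. h (r + int d * m)) k)) ` {0..<int L})"

lemma max_coeff_ge:
  assumes "L > 0"
  shows "norm (ft L (\<lambda>m. h (r + int d * m)) k) \<le> max_coeff d L h r"
proof -
  have "ft L (\<lambda>m. h (r + int d * m)) k = ft L (\<lambda>m. h (r + int d * m)) (k mod int L)"
    using per_mod[OF per_ft[OF assms]] by metis
  then show ?thesis unfolding max_coeff_def using assms by (intro Max_ge) auto
qed

lemma max_coeff_attained:
  assumes "L > 0"
  shows "\<exists>k. 0 \<le> k \<and> k < int L \<and> norm (ft L (\<lambda>m. h (r + int d * m)) k) = max_coeff d L h r"
proof -
  have "max_coeff d L h r \<in> (\<lambda>k. norm (ft L (\<lambda>m. h (r + int d * m)) k)) ` {0..<int L}"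
    unfolding max_coeff_def using assms by (intro Max_in) auto
  then show ?thesis by auto
qed

lemma max_coeff_shift: "max_coeff d L (\<lambda>x. h (x + c)) r = max_coeff d L h (r + c)"
  by (simp add: max_coeff_def algebra_simps)

lemma max_coeff_nonneg: "L > 0 \<Longrightarrow> 0 \<le> max_coeff d L h r"
  using max_coeff_ge[of L h r d 0] norm_ge_zero order_trans by blast

lemma max_coeff_le_1:
  assumes "L > 0" "\<And>x. norm (h x) \<le> 1"
  shows "max_coeff d L h r \<le> 1"
  using max_coeff_attained[OF assms(1), of h r d] ft_bound[of "\<lambda>m. h (r + int d * m)" L] assms(2) by metis

lemma ft_shift:
  assumes "per L g" "L > 0"
  shows "ft L (\<lambda>m. g (m + c)) k = chi L (k * c) * ft L g k"
proof -
  have "per L (\<lambda>m. g m * chi L (- (k * m)))"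
    unfolding per_def
  proof
    fix x
    have "chi L (- (k * (x + int L))) = chi L (- (k * x))"
      by (rule chi_eq[OF assms(2), of _ _ "- k"]) (simp add: algebra_simps)
    then show "g (x + int L) * chi L (- (k * (x + int L))) = g x * chi L (- (k * x))"
      using perD[OF assms(1)] by simp
  qed
  from av_shift[OF this, of c] have "ft L g k = av L (\<lambda>m. g (m + c) * chi L (- (k * (m + c))))"
    by (simp add: ft_def)
  then have "chi L (k * c) * ft L g k = av L (\<lambda>m. g (m + c) * (chi L (k * c) * chi L (- (k * (m + c)))))"
    by (simp add: av_cmult[symmetric] mult_ac)
  then show ?thesis by (simp add: ft_def chi_add[symmetric] algebra_simps)
qed

lemma per_class: "per (d * L) h \<Longrightarrow> per L (\<lambda>m. h (r + int d * m))"
  unfolding per_def by (simp add: distrib_left flip: add.assoc)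

text \<open>Passing to the next representative of a class translates the sequence by one, which
  changes each coefficient by a phase only.\<close>

lemma per_max_coeff:
  assumes "per (d * L) h" "L > 0"
  shows "per d (max_coeff d L h)"
  unfolding per_def
proof
  fix r
  have "norm (ft L (\<lambda>m. h (r + int d + int d * m)) k) = norm (ft L (\<lambda>m. h (r + int d * m)) k)" for k
    using arg_cong[where f=norm, OF ft_shift[OF per_class[OF assms(1), of r] assms(2), of 1 k]]
    by (simp add: norm_mult algebra_simps)
  then show "max_coeff d L h (r + int d) = max_coeff d L h r" by (simp add: max_coeff_def)
qed

lemma per_cmp: "per n F \<Longrightarrow> per n (\<lambda>x. f (F x))"
  by (simp add: per_def)

lemma per_times: "per n F \<Longrightarrow> per n G \<Longrightarrow> per n (\<lambda>x. F x * G x)"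
  by (simp add: per_def)

text \<open>Supplies the auxiliary mean over \<open>z\<close> for \<open>three_term_bound\<close>,
  at the cost 2 T/M, and applies that bound in each class modulo \<open>d\<close>, where shifts by
  multiples of \<open>d\<close> become shifts by \<open>v3 * y\<close> and
  \<open>v4 * y\<close>.\<close>

lemma three_term_class:
  assumes dL: "d > 0" "L > 0" "M > 0" "T > 0" "T \<le> M"
    and per: "per (d * L) \<Delta>2" "per (d * L) \<Delta>3" "per (d * L) \<Delta>4"
    and bd: "\<And>x. norm (\<Delta>2 x) \<le> 1" "\<And>x. norm (\<Delta>3 x) \<le> 1" "\<And>x. norm (\<Delta>4 x) \<le> 1"
    and g: "real_of_int (gcd v4 (int L)) \<le> \<gamma>" "real_of_int (gcd (v4 - v3) (int L)) \<le> \<gamma>"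
  shows "norm (av (d * L) (\<lambda>x. av M (\<lambda>y. \<Delta>2 x * \<Delta>3 (x + int d * v3 * y) * \<Delta>4 (x + int d * v4 * y))))
    \<le> (\<gamma> + real L / real T) * av d (max_coeff d L \<Delta>4) + 2 * real T / real M"
proof -
  define P where "P = (\<lambda>r m y. \<Delta>2 (r + int d * m) * \<Delta>3 (r + int d * (m + v3 * y)) * \<Delta>4 (r + int d * (m + v4 * y)))"
  have Pb: "norm (P r m y) \<le> 1" for r m y
    unfolding P_def by (intro norm_mult_le_1 bd)
  have 1: "norm (av L (\<lambda>m. av M (P r m))) \<le> max_coeff d L \<Delta>4 r * (\<gamma> + real L / real T) + 2 * real T / real M" for r
  proof -
    have a: "norm (av L (\<lambda>m. av M (P r m)) - av L (\<lambda>m. av T (\<lambda>z. av M (\<lambda>y. P r m (y + z))))) \<le> 2 * real T / real M"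
    proof (rule av_norm_diff_le)
      fix m
      show "norm (av M (P r m) - av T (\<lambda>z. av M (\<lambda>y. P r m (y + z)))) \<le> 2 * real T / real M"
        using av_average_shifts_close[of M T "P r m" "\<lambda>j. j" "int T"] dL Pb by simp
    qed simp
    have "av L (\<lambda>m. av T (\<lambda>z. av M (\<lambda>y. P r m (y + z)))) = av L (\<lambda>m. av M (\<lambda>y. av T (\<lambda>z. P r m (y + z))))"
      by (subst av_swap[of T]) simp
    moreover have "norm (av L (\<lambda>m. av M (\<lambda>y. av T (\<lambda>z. P r m (y + z))))) \<le> max_coeff d L \<Delta>4 r * (\<gamma> + real L / real T)"
      unfolding P_def
      by (rule three_term_bound[OF dL(2-5) per_class[OF per(1)] per_class[OF per(2)] per_class[OF per(3)] bd(1,2) max_coeff_ge[OF dL(2)] g])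
    ultimately have b: "norm (av L (\<lambda>m. av T (\<lambda>z. av M (\<lambda>y. P r m (y + z))))) \<le> max_coeff d L \<Delta>4 r * (\<gamma> + real L / real T)"
      by simp
    show ?thesis
      using order_trans[OF norm_triangle_sub add_mono[OF b a]] .
  qed
  have eq: "av (d * L) (\<lambda>x. av M (\<lambda>y. \<Delta>2 x * \<Delta>3 (x + int d * v3 * y) * \<Delta>4 (x + int d * v4 * y)))
    = av d (\<lambda>r. av L (\<lambda>m. av M (P r m)))"
    unfolding av_coset P_def by (simp add: algebra_simps)
  have "norm (av d (\<lambda>r. av L (\<lambda>m. av M (P r m)))) \<le> av d (\<lambda>r. norm (av L (\<lambda>m. av M (P r m))))"
    by (rule norm_av_le)
  moreover have "av d (\<lambda>r. norm (av L (\<lambda>m. av M (P r m)))) \<le> av d (\<lambda>r. max_coeff d L \<Delta>4 r * (\<gamma> + real L / real T) + 2 * real T / real M)"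
    using 1 by (intro av_mono)
  moreover have "av d (\<lambda>r. max_coeff d L \<Delta>4 r * (\<gamma> + real L / real T) + 2 * real T / real M)
    = (\<gamma> + real L / real T) * av d (max_coeff d L \<Delta>4) + 2 * real T / real M"
    using dL by (simp only: av_add av_cmult_right av_const mult.commute)
  ultimately show ?thesis unfolding eq by linarith
qed

text \<open>Once \<open>x\<close> is translated so that \<open>F1\<close> does not depend on
  \<open>y\<close>, differencing in \<open>y\<close> removes it. The other three factors become
  derivatives whose shifts, after another translation, are 0, e3 - e2 and e4 - e2 times
  \<open>D * y\<close>, which is the situation of \<open>three_term_class\<close>. One of the two
  differencing parameters is then frozen.\<close>

lemma large_derivative_coefficients:
  assumes dL: "d > 0" "L > 0" "M > 0" "T > 0" and D: "D = int d * v"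
    and per: "per (d * L) F1" "per (d * L) F2" "per (d * L) F3" "per (d * L) F4"
    and bd: "\<And>x. norm (F1 x) \<le> 1" "\<And>x. norm (F2 x) \<le> 1" "\<And>x. norm (F3 x) \<le> 1" "\<And>x. norm (F4 x) \<le> 1"
    and g: "real_of_int (gcd (v * (e4 - e2)) (int L)) \<le> \<gamma>" "real_of_int (gcd (v * (e4 - e3)) (int L)) \<le> \<gamma>"
    and eta: "0 < \<eta>" "\<eta> \<le> 1" "16 * real T \<le> \<eta>\<^sup>2 * real M"
    and ge: "\<eta> \<le> norm (av (d * L) (\<lambda>x. av M (\<lambda>y. F1 (x + D * e1 * y) * F2 (x + D * e2 * y) * F3 (x + D * e3 * y) * F4 (x + D * e4 * y))))"
  shows "\<exists>j. 0 \<le> j \<and> j < int T \<and> \<eta>\<^sup>2 / 8 \<le> (\<gamma> + real L / real T) *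
     av T (\<lambda>i. av d (max_coeff d L (\<lambda>x. F4 (x + D * (e4 - e1) * i) * cnj (F4 (x + D * (e4 - e1) * j)))))"
proof -
  define n where "n = d * L"
  have n0: "n > 0" using dL by (simp add: n_def)
  note pern = per[folded n_def]
  have e2: "\<eta>\<^sup>2 \<le> \<eta>" using eta by (simp add: power2_eq_square mult_left_le_one_le)
  have TM: "2 * real T / real M \<le> \<eta>\<^sup>2 / 8" using eta(3) dL by (simp add: field_simps)
  have "\<eta>\<^sup>2 * real M \<le> real M" using eta e2 by (simp add: mult_left_le_one_le)
  then have "T \<le> M" using eta(3) by linarith
  define K where "K = \<gamma> + real L / real T"
  define G where "G = (\<lambda>x y. F2 (x + D * (e2 - e1) * y) * F3 (x + D * (e3 - e1) * y) * F4 (x + D * (e4 - e1) * y))"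
  have shp: "per n (\<lambda>x. F2 (x + c) * F3 (x + c') * F4 (x + c''))" for c c' c''
    by (intro per_times per_shift pern)
  have A: "av n (\<lambda>x. av M (\<lambda>y. F1 (x + D * e1 * y) * F2 (x + D * e2 * y) * F3 (x + D * e3 * y) * F4 (x + D * e4 * y)))
    = av n (\<lambda>x. F1 x * av M (G x))"
  proof -
    have "av n (\<lambda>x. F1 (x + D * e1 * y) * F2 (x + D * e2 * y) * F3 (x + D * e3 * y) * F4 (x + D * e4 * y))
       = av n (\<lambda>x. F1 x * G x y)" for y
    proof -
      have "per n (\<lambda>x. F1 x * G x y)" unfolding G_def by (intro per_times per_shift pern)
      from av_shift[OF this, of "D * e1 * y"] show ?thesis
        by (simp add: G_def algebra_simps)
    qed
    then have "av M (\<lambda>y. av n (\<lambda>x. F1 (x + D * e1 * y) * F2 (x + D * e2 * y) * F3 (x + D * e3 * y) * F4 (x + D * e4 * y)))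
       = av M (\<lambda>y. av n (\<lambda>x. F1 x * G x y))" by simp
    then show ?thesis by (simp only: av_swap[of n] av_cmult[symmetric])
  qed
  define H where "H = (\<lambda>i j. av n (\<lambda>x. av M (\<lambda>y. G x (y + i) * cnj (G x (y + j)))))"
  have "\<eta>\<^sup>2 / 4 \<le> norm (av T (\<lambda>i. av T (\<lambda>j. H i j)))"
    unfolding H_def
  proof (rule van_der_corput[OF n0 dL(3,4) bd(1)])
    show "norm (G x y) \<le> 1" for x y unfolding G_def by (intro norm_mult_le_1 bd)
    show "\<eta> \<le> norm (av n (\<lambda>x. F1 x * av M (G x)))" using ge A by (simp add: n_def)
    show "2 * real_of_int (int T) / real M \<le> \<eta> / 2" using TM e2 eta by simp
  qed (use eta in auto)
  define A' where "A' = (\<lambda>i j. av d (max_coeff d L (\<lambda>x. F4 (x + D * (e4 - e1) * i) * cnj (F4 (x + D * (e4 - e1) * j)))))"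
  have Hb: "norm (H i j) \<le> K * A' i j + \<eta>\<^sup>2 / 8" for i j
  proof -
    define \<Delta> where "\<Delta> = (\<lambda>F e x. F (x + D * (e - e1) * i) * cnj (F (x + D * (e - e1) * j)))"
    have p\<Delta>: "per n (\<Delta> F e)" if "per n F" for F e
      unfolding \<Delta>_def by (intro per_times per_cmp[of n _ cnj] per_shift that)
    have b\<Delta>: "norm (\<Delta> F e x) \<le> 1" if "\<And>x. norm (F x) \<le> 1" for F e x
      unfolding \<Delta>_def using that by (intro norm_mult_le_1) auto
    have "H i j = av M (\<lambda>y. av n (\<lambda>x. G x (y + i) * cnj (G x (y + j))))"
      unfolding H_def by (rule av_swap)
    also have "\<dots> = av M (\<lambda>y. av n (\<lambda>x. \<Delta> F2 e2 x * \<Delta> F3 e3 (x + int d * (v * (e3 - e2)) * y) * \<Delta> F4 e4 (x + int d * (v * (e4 - e2)) * y)))"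
    proof (rule arg_cong[where f="av M"], rule ext)
      fix y
      have "per n (\<lambda>x. \<Delta> F2 e2 x * \<Delta> F3 e3 (x + int d * (v * (e3 - e2)) * y) * \<Delta> F4 e4 (x + int d * (v * (e4 - e2)) * y))"
        by (intro per_times per_shift p\<Delta> pern)
      from av_shift[OF this, of "D * (e2 - e1) * y", symmetric]
      show "av n (\<lambda>x. G x (y + i) * cnj (G x (y + j))) = av n (\<lambda>x. \<Delta> F2 e2 x * \<Delta> F3 e3 (x + int d * (v * (e3 - e2)) * y) * \<Delta> F4 e4 (x + int d * (v * (e4 - e2)) * y))"
        by (simp add: G_def \<Delta>_def D algebra_simps)
    qed
    also have "\<dots> = av n (\<lambda>x. av M (\<lambda>y. \<Delta> F2 e2 x * \<Delta> F3 e3 (x + int d * (v * (e3 - e2)) * y) * \<Delta> F4 e4 (x + int d * (v * (e4 - e2)) * y)))"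
      by (rule av_swap)
    finally have eq: "H i j = \<dots>" .
    have vv: "v * (e4 - e2) - v * (e3 - e2) = v * (e4 - e3)" by (simp add: algebra_simps)
    have "norm (H i j) \<le> (\<gamma> + real L / real T) * av d (max_coeff d L (\<Delta> F4 e4)) + 2 * real T / real M"
      unfolding eq n_def
      by (rule three_term_class[OF dL \<open>T \<le> M\<close>])
        (use p\<Delta> pern b\<Delta> bd g vv in \<open>simp_all add: n_def\<close>)
    also have "\<dots> \<le> K * A' i j + \<eta>\<^sup>2 / 8" using TM by (simp add: K_def A'_def \<Delta>_def)
    finally show ?thesis .
  qed
  have "norm (av T (\<lambda>i. av T (\<lambda>j. H i j))) \<le> av T (\<lambda>i. norm (av T (\<lambda>j. H i j)))" by (rule norm_av_le)
  also have "\<dots> \<le> av T (\<lambda>i. av T (\<lambda>j. norm (H i j)))" by (intro av_mono norm_av_le)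
  also have "\<dots> \<le> av T (\<lambda>i. av T (\<lambda>j. K * A' i j + \<eta>\<^sup>2 / 8))" by (intro av_mono Hb)
  also have "\<dots> = av T (\<lambda>j. av T (\<lambda>i. K * A' i j + \<eta>\<^sup>2 / 8))" by (rule av_swap)
  finally have "norm (av T (\<lambda>i. av T (\<lambda>j. H i j))) \<le> av T (\<lambda>j. av T (\<lambda>i. K * A' i j + \<eta>\<^sup>2 / 8))" .
  moreover obtain j where j: "0 \<le> j" "j < int T" "av T (\<lambda>j. av T (\<lambda>i. K * A' i j + \<eta>\<^sup>2 / 8)) \<le> av T (\<lambda>i. K * A' i j + \<eta>\<^sup>2 / 8)"
    using av_ex_ge[OF dL(4), of "\<lambda>j. av T (\<lambda>i. K * A' i j + \<eta>\<^sup>2 / 8)"] by blast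
  moreover have "av T (\<lambda>i. K * A' i j + \<eta>\<^sup>2 / 8) = K * av T (\<lambda>i. A' i j) + \<eta>\<^sup>2 / 8"
    using dL by (simp only: av_add av_cmult av_const)
  ultimately have "\<eta>\<^sup>2 / 8 \<le> K * av T (\<lambda>i. A' i j)"
    using \<open>\<eta>\<^sup>2 / 4 \<le> norm (av T (\<lambda>i. av T (\<lambda>j. H i j)))\<close> by linarith
  then show ?thesis using j unfolding K_def A'_def by blast
qed

section \<open>Extremal frequencies in residue classes\<close>

lemma chi_scale: "d > 0 \<Longrightarrow> L > 0 \<Longrightarrow> chi (d * L) (int d * j) = chi L j"
  by (simp add: chi_def)

definition max_freq :: "nat \<Rightarrow> nat \<Rightarrow> (int \<Rightarrow> complex) \<Rightarrow> int \<Rightarrow> int" where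
  "max_freq d L h r = (SOME k. norm (ft L (\<lambda>m. h (r + int d * m)) k) = max_coeff d L h r)"

text \<open>The phase that turns the extremal coefficient into its modulus (and 0 if that
  coefficient vanishes). It refers to the character modulo \<open>d * L\<close> at the point
  \<open>r + d * m\<close> itself, so that one formula describes the extremal characters of all
  classes.\<close>

definition max_phase :: "nat \<Rightarrow> nat \<Rightarrow> (int \<Rightarrow> complex) \<Rightarrow> int \<Rightarrow> complex" where
  "max_phase d L h r = cnj (sgn (av L (\<lambda>m. h (r + int d * m) * chi (d * L) (- (max_freq d L h r * (r + int d * m))))))"

lemma max_freq: "L > 0 \<Longrightarrow> norm (ft L (\<lambda>m. h (r + int d * m)) (max_freq d L h r)) = max_coeff d L h r"
  unfolding max_freq_def by (rule someI_ex) (use max_coeff_attained in blast)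

lemma norm_max_phase: "norm (max_phase d L h r) \<le> 1"
  by (simp add: max_phase_def norm_sgn)

lemma cnj_sgn_mult: "cnj (sgn z) * z = of_real (norm z)"
proof (cases "z = 0")
  case False
  have "cnj z * z = of_real ((norm z)\<^sup>2)" by (simp only: complex_norm_square mult.commute)
  moreover have "cnj (sgn z) * z = (cnj z * z) / of_real (norm z)" by (simp add: sgn_eq)
  ultimately show ?thesis using False by (simp add: power2_eq_square)
qed simp

lemma max_phase_mult:
  assumes "d > 0" "L > 0"
  shows "max_phase d L h r * av L (\<lambda>m. h (r + int d * m) * chi (d * L) (- (max_freq d L h r * (r + int d * m)))) = of_real (max_coeff d L h r)"
proof -
  define k where "k = max_freq d L h r"
  have "chi (d * L) (- (k * (r + int d * m))) = chi (d * L) (- (k * r)) * chi L (- (k * m))" for m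
  proof -
    have "- (k * (r + int d * m)) = - (k * r) + int d * (- (k * m))" by (simp add: algebra_simps)
    then show ?thesis using chi_scale[OF assms, of "- (k * m)"] by (simp only: chi_add)
  qed
  then have "av L (\<lambda>m. h (r + int d * m) * chi (d * L) (- (k * (r + int d * m)))) =
     chi (d * L) (- (k * r)) * ft L (\<lambda>m. h (r + int d * m)) k"
    by (simp add: ft_def av_cmult[symmetric] mult_ac)
  then have "norm (av L (\<lambda>m. h (r + int d * m) * chi (d * L) (- (k * (r + int d * m))))) = max_coeff d L h r"
    using max_freq[OF assms(2)] by (simp add: norm_mult k_def)
  then show ?thesis unfolding max_phase_def cnj_sgn_mult by (simp add: k_def)
qed

lemma av_class:
  assumes "d > 0"
  shows "av (d * L) (\<lambda>x. F (x mod int d) x) = av d (\<lambda>r. av L (\<lambda>m. F r (r + int d * m)))"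
  unfolding av_coset by (rule av_cong) (simp add: assms)

lemma per_classfun:
  assumes "d dvd n"
  shows "per n (\<lambda>x. W (x mod int d))"
proof -
  have "(x + int n) mod int d = x mod int d" for x
    using assms by (auto simp: dvd_def mod_add_right_eq)
  then show ?thesis by (simp add: per_def)
qed

lemma per_chi_class:
  assumes "d dvd n" "n > 0" "n dvd N"
  shows "per N (\<lambda>x. chi n (k (x mod int d) * x))"
proof (rule per_dvd[OF _ assms(3)])
  show "per n (\<lambda>x. chi n (k (x mod int d) * x))"
    unfolding per_def
  proof
    fix x
    have "(x + int n) mod int d = x mod int d" using assms by (auto simp: dvd_def)
    then show "chi n (k ((x + int n) mod int d) * (x + int n)) = chi n (k (x mod int d) * x)"
      using chi_eq[OF assms(2), of "k (x mod int d) * (x + int n)" _ "k (x mod int d)"] by (simp add: algebra_simps)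
  qed
qed

text \<open>As a function of the shift, the k-th coefficient of the derivative of \<open>g\<close>
  has Fourier transform \<open>ft L g l * cnj (ft L g (l - k))\<close>, and Parseval bounds its mean
  square by S^2. The shifts \<open>w * i + c\<close> meet each residue modulo \<open>L\<close> at
  most \<gamma> (T/L + 1) times. Hence derivatives that correlate with one common frequency force a
  large coefficient of \<open>g\<close> itself.\<close>

lemma autocorr:
  assumes L: "L > 0" "T > 0" and per: "per L g" and bd: "\<And>m. norm (g m) \<le> 1" "\<And>k. norm (ft L g k) \<le> S"
    and \<gamma>: "real_of_int (gcd w (int L)) \<le> \<gamma>"
  shows "av T (\<lambda>i. (norm (av L (\<lambda>m. g (m + (w * i + c)) * cnj (g m) * chi L (- (k * m)))))\<^sup>2) \<le> \<gamma> * (1 + real L / real T) * S\<^sup>2"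
proof -
  define co where "co = (\<lambda>s. av L (\<lambda>m. g (m + s) * cnj (g m) * chi L (- (k * m))))"
  have perco: "per L co"
    unfolding per_def co_def using perD[OF per] by (simp flip: add.assoc)
  have ftco: "ft L co l = ft L g l * cnj (ft L g (l - k))" for l
  proof -
    have "ft L co l = av L (\<lambda>s. av L (\<lambda>m. g (m + s) * cnj (g m) * chi L (- (k * m)) * chi L (- (l * s))))"
      by (simp add: ft_def co_def av_cmult_right)
    also have "\<dots> = av L (\<lambda>m. av L (\<lambda>s. g (m + s) * cnj (g m) * chi L (- (k * m)) * chi L (- (l * s))))"
      by (rule av_swap)
    also have "\<dots> = av L (\<lambda>m. ft L g l * cnj (g m * chi L (- ((l - k) * m))))"
    proof (rule arg_cong[where f="av L"], rule ext)
      fix m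
      have "av L (\<lambda>s. g (m + s) * cnj (g m) * chi L (- (k * m)) * chi L (- (l * s))) =
        cnj (g m) * chi L (- (k * m)) * av L (\<lambda>s. g (s + m) * chi L (- (l * s)))"
        by (simp add: av_cmult[symmetric] mult_ac add.commute)
      also have "av L (\<lambda>s. g (s + m) * chi L (- (l * s))) = chi L (l * m) * ft L g l"
        using ft_shift[OF per L(1), of m l] by (simp add: ft_def)
      finally show "av L (\<lambda>s. g (m + s) * cnj (g m) * chi L (- (k * m)) * chi L (- (l * s))) = ft L g l * cnj (g m * chi L (- ((l - k) * m)))"
        using chi_add[of L "- (k * m)" "l * m"] by (simp add: cnj_chi algebra_simps)
    qed
    also have "\<dots> = ft L g l * cnj (ft L g (l - k))"
      by (simp only: av_cmult ft_def cnj_av)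
    finally show ?thesis .
  qed
  have e1: "av L (\<lambda>s. (norm (co s))\<^sup>2) \<le> S\<^sup>2"
  proof -
    have "av L (\<lambda>s. (norm (co s))\<^sup>2) = real L * av L (\<lambda>l. (norm (ft L co l))\<^sup>2)"
      by (rule parseval[OF perco L(1), symmetric])
    also have "\<dots> \<le> real L * av L (\<lambda>l. S\<^sup>2 * (norm (ft L g l))\<^sup>2)"
    proof (intro mult_left_mono av_mono)
      fix l
      have "(norm (ft L g (l - k)))\<^sup>2 \<le> S\<^sup>2" using bd(2) by (intro power_mono) auto
      then show "(norm (ft L co l))\<^sup>2 \<le> S\<^sup>2 * (norm (ft L g l))\<^sup>2"
        using mult_left_mono[of _ _ "(norm (ft L g l))\<^sup>2"]
        by (simp add: ftco norm_mult power_mult_distrib mult.commute[of "S\<^sup>2"])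
    qed auto
    also have "\<dots> = S\<^sup>2 * (real L * av L (\<lambda>l. (norm (ft L g l))\<^sup>2))" by (simp add: av_cmult)
    also have "\<dots> \<le> S\<^sup>2 * 1" using parseval_le[OF per L(1) bd(1)] by (intro mult_left_mono) auto
    finally show ?thesis by simp
  qed
  define g0 where "g0 = gcd w (int L)"
  have g0: "g0 > 0" using L by (simp add: g0_def)
  have \<gamma>1: "1 \<le> \<gamma>"
  proof -
    have "1 \<le> real_of_int g0" using g0 by simp
    then show ?thesis using \<gamma> by (simp add: g0_def)
  qed
  define L' where "L' = nat (int L div g0)"
  have L'g: "int L = g0 * int L'" and L'0: "L' > 0"
  proof -
    have "g0 dvd int L" by (simp add: g0_def)
    then obtain u where u: "int L = g0 * u" by (auto simp: dvd_def)
    then have "u > 0" using L g0 by (metis of_nat_0_less_iff zero_less_mult_pos)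
    then show "int L = g0 * int L'" "L' > 0" using g0 u by (auto simp: L'_def)
  qed
  have cnt: "real (card {i \<in> {0..<int T}. (w * i + c) mod int L = s}) \<le> \<gamma> * (real T / real L + 1)" for s
  proof (cases "{i \<in> {0..<int T}. (w * i + c) mod int L = s} = {}")
    case False
    then obtain i0 where i0: "(w * i0 + c) mod int L = s" by auto
    have "{i \<in> {0..<int T}. (w * i + c) mod int L = s} \<subseteq> {i \<in> {0..<0 + int T}. int L' dvd i - i0}"
    proof
      fix i assume i: "i \<in> {i \<in> {0..<int T}. (w * i + c) mod int L = s}"
      then have "(w * i + c) mod int L = (w * i0 + c) mod int L" using i0 by simp
      from dvd_mod_diff[OF dvd_refl this] have "int L dvd (w * i + c) - (w * i0 + c)" .
      then have "int L dvd w * (i - i0)" by (simp add: algebra_simps)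
      moreover obtain w' where w': "w = g0 * w'" using g0_def by (metis dvd_def gcd_dvd1)
      ultimately have "int L' dvd w' * (i - i0)" using g0 L'g by (simp add: mult.assoc)
      moreover have "coprime (int L') w'"
      proof -
        have "g0 * gcd w' (int L') = g0" using g0_def w' L'g g0
          by (metis abs_of_pos gcd_mult_distrib_int)
        then have "gcd w' (int L') = 1" using g0 by simp
        then show ?thesis by (simp add: coprime_iff_gcd_eq_1 gcd.commute)
      qed
      ultimately have "int L' dvd i - i0" by (simp add: coprime_dvd_mult_right_iff)
      then show "i \<in> {i \<in> {0..<0 + int T}. int L' dvd i - i0}" using i by simp
    qed
    then have "card {i \<in> {0..<int T}. (w * i + c) mod int L = s} \<le> T div L' + 1"
      using order_trans[OF card_mono[OF finite_filter_int] card_cong_le[OF L'0]] by blast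
    then have "real (card {i \<in> {0..<int T}. (w * i + c) mod int L = s}) \<le> real (T div L') + 1" by linarith
    moreover have "real (T div L') \<le> real T / real L'" using of_nat_div_le_of_nat[of T L', where ?'a = real] by simp
    moreover have "real T / real L' = real_of_int g0 * (real T / real L)"
    proof -
      have "real L = real_of_int g0 * real L'" using arg_cong[OF L'g, of real_of_int] by simp
      then show ?thesis using g0 L'0 by simp
    qed
    moreover have "real_of_int g0 * (real T / real L) \<le> \<gamma> * (real T / real L)"
      using \<gamma> by (intro mult_right_mono) (auto simp: g0_def)
    moreover note \<gamma>1
    ultimately show ?thesis by (simp only: distrib_left)
  next
    case True
    have "0 \<le> \<gamma>" using \<gamma>1 by simp
    then show ?thesis unfolding True by simp
  qed
  define h where "h = (\<lambda>s. (norm (co s))\<^sup>2)"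
  have hmod: "h (x mod int L) = h x" for x using per_mod[OF perco] by (simp add: h_def)
  have "(\<Sum>i\<in>{0..<int T}. h (w * i + c)) = (\<Sum>i\<in>{0..<int T}. \<Sum>s\<in>{0..<int L}. if (w * i + c) mod int L = s then h s else 0)"
    using L by (intro sum.cong refl) (simp add: hmod)
  also have "\<dots> = (\<Sum>s\<in>{0..<int L}. \<Sum>i\<in>{0..<int T}. if (w * i + c) mod int L = s then h s else 0)"
    by (rule sum.swap)
  also have "\<dots> = (\<Sum>s\<in>{0..<int L}. h s * real (card {i \<in> {0..<int T}. (w * i + c) mod int L = s}))"
  proof (rule sum.cong[OF refl])
    fix s
    have "(\<Sum>i\<in>{0..<int T}. if (w * i + c) mod int L = s then h s else 0) = (\<Sum>i\<in>{i \<in> {0..<int T}. (w * i + c) mod int L = s}. h s)"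
      by (rule sum.inter_filter[symmetric]) simp
    then show "(\<Sum>i\<in>{0..<int T}. if (w * i + c) mod int L = s then h s else 0) = h s * real (card {i \<in> {0..<int T}. (w * i + c) mod int L = s})"
      by simp
  qed
  also have "\<dots> \<le> (\<Sum>s\<in>{0..<int L}. h s * (\<gamma> * (real T / real L + 1)))"
    using cnt by (intro sum_mono mult_left_mono) (auto simp: h_def)
  also have "\<dots> = (\<Sum>s\<in>{0..<int L}. h s) * (\<gamma> * (real T / real L + 1))" by (simp only: sum_distrib_right)
  finally have "av T (\<lambda>i. h (w * i + c)) \<le> av L h * (\<gamma> * (1 + real L / real T))"
    using L unfolding av_def sum_int_lessThan[of "\<lambda>i. h (w * i + c)"] sum_int_lessThan[of h] by (simp add: field_simps)
  also have "\<dots> \<le> S\<^sup>2 * (\<gamma> * (1 + real L / real T))"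
  proof (rule mult_right_mono)
    have "0 \<le> \<gamma>" using \<gamma>1 by simp
    then show "0 \<le> \<gamma> * (1 + real L / real T)" by simp
  qed (use e1 in \<open>simp add: h_def\<close>)
  finally show ?thesis by (simp add: h_def co_def mult_ac)
qed

text \<open>Chosen so that \<open>Lam n q M u0 u1 G\<close> becomes the mean of \<open>G\<close>
  times this function; see \<open>Lam_dual\<close>.\<close>

definition dualB :: "nat \<Rightarrow> nat \<Rightarrow> (int \<Rightarrow> complex) \<Rightarrow> (int \<Rightarrow> complex) \<Rightarrow> int \<Rightarrow> complex" where
  "dualB q M u0 u1 x = av M (\<lambda>y. u0 (x - int q * y\<^sup>2) * u1 (x + y - int q * y\<^sup>2))"

lemma per_dualB:
  assumes "per n u0" "per n u1"
  shows "per n (dualB q M u0 u1)"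
  unfolding per_def
proof
  fix x
  have "u0 (x + int n - int q * y\<^sup>2) = u0 (x - int q * y\<^sup>2)" for y by (rule per_eq[OF assms(1)]) simp
  moreover have "u1 (x + int n + y - int q * y\<^sup>2) = u1 (x + y - int q * y\<^sup>2)" for y by (rule per_eq[OF assms(2)]) simp
  ultimately show "dualB q M u0 u1 (x + int n) = dualB q M u0 u1 x" by (simp add: dualB_def)
qed

lemma norm_dualB: "one_bounded u0 \<Longrightarrow> one_bounded u1 \<Longrightarrow> norm (dualB q M u0 u1 x) \<le> 1"
  unfolding dualB_def by (intro norm_av_le_const norm_mult_le_1 one_boundedD) auto

lemma Lam_dual:
  assumes "per n u0" "per n u1" "per n G"
  shows "Lam n q M u0 u1 G = av n (\<lambda>x. G x * dualB q M u0 u1 x)"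
proof -
  have "av n (\<lambda>x. u0 x * u1 (x + y) * G (x + int q * y\<^sup>2)) =
     av n (\<lambda>x. G x * (u0 (x - int q * y\<^sup>2) * u1 (x + y - int q * y\<^sup>2)))" for y
  proof -
    have "per n (\<lambda>x. u0 x * u1 (x + y) * G (x + int q * y\<^sup>2))"
      by (intro per_times per_shift assms)
    from av_shift[OF this, of "- (int q * y\<^sup>2)", symmetric] show ?thesis
      by (simp add: algebra_simps)
  qed
  then show ?thesis unfolding Lam_def dualB_def
    by (simp only: av_swap[of n] av_cmult[symmetric])
qed

lemma Lam_le:
  assumes "per n u0" "per n u1" "per n G" "one_bounded u0" "one_bounded u1"
  shows "norm (Lam n q M u0 u1 G) \<le> av n (\<lambda>x. norm (G x))"
proof -
  have "norm (av n (\<lambda>x. G x * dualB q M u0 u1 x)) \<le> av n (\<lambda>x. norm (G x * dualB q M u0 u1 x))"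
    by (rule norm_av_le)
  also have "\<dots> \<le> av n (\<lambda>x. norm (G x))"
    using norm_dualB[OF assms(4,5)] by (intro av_mono) (simp add: norm_mult mult_left_le)
  finally show ?thesis unfolding Lam_dual[OF assms(1-3)] .
qed

lemma Lam_add: "Lam n q M u0 u1 (\<lambda>x. G x + H x) = Lam n q M u0 u1 G + Lam n q M u0 u1 H"
  unfolding Lam_def by (simp add: distrib_left av_add)

lemma Lam_sum: "Lam n q M u0 u1 (\<lambda>x. \<Sum>i\<in>I. G i x) = (\<Sum>i\<in>I. Lam n q M u0 u1 (G i))"
  unfolding Lam_def by (simp add: sum_distrib_left av_sum)

text \<open>Writing out the dual function allows the mean over \<open>i\<close> to become the
  innermost one. Cauchy-Schwarz in \<open>x\<close> and \<open>y\<close> removes \<open>b\<close>,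
  and opening the square restores the counting operator, with derivatives of \<open>u0\<close> and
  \<open>u1\<close> in the first two places and a product of two weights in the third.\<close>

lemma interchange:
  assumes "n > 0" "M > 0" "T > 0" and per: "per n u0" "per n u1" "per n b" "\<And>i. per n (w i)"
    and bd: "one_bounded u0" "one_bounded u1" "\<And>x. norm (b x) \<le> 1" "\<And>i x. norm (w i x) \<le> 1"
    and ge: "\<zeta> \<le> norm (av T (\<lambda>i. av n (\<lambda>x. cnj (dualB q M u0 u1 (x + l i)) * b x * w i x)))" "0 \<le> \<zeta>"
  shows "\<zeta>\<^sup>2 \<le> av T (\<lambda>j. av T (\<lambda>i. norm (Lam n q M (\<lambda>x. cnj (u0 (x + l i)) * u0 (x + l j)) (\<lambda>x. cnj (u1 (x + l i)) * u1 (x + l j)) (\<lambda>x. w i x * cnj (w j x)))))"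
proof -
  define X where "X = (\<lambda>x y i. cnj (u0 (x + l i - int q * y\<^sup>2)) * cnj (u1 (x + l i + y - int q * y\<^sup>2)) * w i x)"
  have "av T (\<lambda>i. av n (\<lambda>x. cnj (dualB q M u0 u1 (x + l i)) * b x * w i x)) = av T (\<lambda>i. av n (\<lambda>x. av M (\<lambda>y. b x * X x y i)))"
    unfolding dualB_def X_def cnj_av by (simp add: av_cmult[symmetric] mult_ac)
  also have "\<dots> = av n (\<lambda>x. av T (\<lambda>i. av M (\<lambda>y. b x * X x y i)))" by (rule av_swap)
  also have "\<dots> = av n (\<lambda>x. av M (\<lambda>y. av T (\<lambda>i. b x * X x y i)))" by (subst av_swap[of T]) (rule refl)
  also have "\<dots> = av n (\<lambda>x. av M (\<lambda>y. b x * av T (X x y)))" by (simp only: av_cmult)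
  finally have 1: "\<zeta> \<le> norm (av n (\<lambda>x. av M (\<lambda>y. b x * av T (X x y))))" using ge by simp
  have "\<zeta>\<^sup>2 \<le> (norm (av n (\<lambda>x. av M (\<lambda>y. b x * av T (X x y)))))\<^sup>2"
    using 1 ge(2) by (rule power_mono)
  also have "\<dots> \<le> av n (\<lambda>x. (norm (av M (\<lambda>y. b x * av T (X x y))))\<^sup>2)" by (rule av_square_le)
  also have "\<dots> \<le> av n (\<lambda>x. av M (\<lambda>y. (norm (b x * av T (X x y)))\<^sup>2))" by (intro av_mono av_square_le)
  also have "\<dots> \<le> av n (\<lambda>x. av M (\<lambda>y. (norm (av T (X x y)))\<^sup>2))"
    using bd(3) by (intro av_mono power_mono) (auto simp: norm_mult mult_left_le_one_le)
  finally have 2: "\<zeta>\<^sup>2 \<le> av n (\<lambda>x. av M (\<lambda>y. (norm (av T (X x y)))\<^sup>2))" .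
  define \<Lambda> where "\<Lambda> = (\<lambda>i j. Lam n q M (\<lambda>x. cnj (u0 (x + l i)) * u0 (x + l j)) (\<lambda>x. cnj (u1 (x + l i)) * u1 (x + l j)) (\<lambda>x. w i x * cnj (w j x)))"
  have "complex_of_real (av n (\<lambda>x. av M (\<lambda>y. (norm (av T (X x y)))\<^sup>2))) =
     av n (\<lambda>x. av M (\<lambda>y. av T (\<lambda>i. av T (\<lambda>j. X x y i * cnj (X x y j)))))"
    by (simp only: of_real_av av_norm_square)
  also have "\<dots> = av n (\<lambda>x. av T (\<lambda>i. av M (\<lambda>y. av T (\<lambda>j. X x y i * cnj (X x y j)))))"
    by (subst av_swap[of M]) (rule refl)
  also have "\<dots> = av n (\<lambda>x. av T (\<lambda>i. av T (\<lambda>j. av M (\<lambda>y. X x y i * cnj (X x y j)))))"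
    by (subst av_swap[of M]) (rule refl)
  also have "\<dots> = av T (\<lambda>i. av n (\<lambda>x. av T (\<lambda>j. av M (\<lambda>y. X x y i * cnj (X x y j)))))"
    by (rule av_swap)
  also have "\<dots> = av T (\<lambda>i. av T (\<lambda>j. av n (\<lambda>x. av M (\<lambda>y. X x y i * cnj (X x y j)))))"
    by (subst av_swap[of n]) (rule refl)
  also have "\<dots> = av T (\<lambda>i. av T (\<lambda>j. \<Lambda> i j))"
  proof -
    have "av n (\<lambda>x. av M (\<lambda>y. X x y i * cnj (X x y j))) = \<Lambda> i j" for i j
    proof -
      have p: "per n (\<lambda>x. cnj (u0 (x + l i)) * u0 (x + l j))" "per n (\<lambda>x. cnj (u1 (x + l i)) * u1 (x + l j))" "per n (\<lambda>x. w i x * cnj (w j x))"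
        by (intro per_times per_cmp[of n _ cnj] per_shift per)+
      show ?thesis unfolding \<Lambda>_def Lam_dual[OF p] dualB_def X_def
        by (simp add: av_cmult[symmetric] algebra_simps)
    qed
    then show ?thesis by simp
  qed
  also have "\<dots> = av T (\<lambda>j. av T (\<lambda>i. \<Lambda> i j))" by (rule av_swap)
  finally have 3: "complex_of_real (av n (\<lambda>x. av M (\<lambda>y. (norm (av T (X x y)))\<^sup>2))) = av T (\<lambda>j. av T (\<lambda>i. \<Lambda> i j))" .
  have "av n (\<lambda>x. av M (\<lambda>y. (norm (av T (X x y)))\<^sup>2)) \<le> norm (complex_of_real (av n (\<lambda>x. av M (\<lambda>y. (norm (av T (X x y)))\<^sup>2))))"
    by simp
  also have "\<dots> \<le> av T (\<lambda>j. norm (av T (\<lambda>i. \<Lambda> i j)))" unfolding 3 by (rule norm_av_le)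
  also have "\<dots> \<le> av T (\<lambda>j. av T (\<lambda>i. norm (\<Lambda> i j)))" by (intro av_mono norm_av_le)
  finally show ?thesis using 2 unfolding \<Lambda>_def by linarith
qed

lemma per_av:
  assumes "\<And>y. per n (\<lambda>x. F x y)"
  shows "per n (\<lambda>x. av M (F x))"
proof -
  have "F (x + int n) = F x" for x
    by (rule ext) (rule perD[OF assms])
  then show ?thesis by (simp add: per_def)
qed

lemma class_shift: "(x + int d * s) mod int d = x mod int d"
  by simp

text \<open>The assumption \<open>minor\<close> says that frequencies outside the few classes in \<open>Rs\<close> do not correlate.
  It is applied to the differences of the frequencies of two multiplicative derivatives, and is what
  forces these frequencies to be nearly independent of the derivative. The phases \<open>\<alpha>\<close> survive
  differencing because the shifts form a parallelogram and preserve the classes modulo \<open>d\<close>.\<close>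

lemma class_frequency_step:
  assumes pos: "d > 0" "L > 0" "h > 0" "M > 0" "J > 0" "T > 0" "\<tau> > 0"
    and n: "n = d * L * h" and D: "2 * int q * int \<tau> = int d * v"
    and \<alpha>: "(\<forall>c. \<alpha> c = 0) \<or> d dvd \<tau>"
    and per: "per n u0" "per n u1" "per (d * L) g" and bd: "one_bounded u0" "one_bounded u1" "one_bounded g"
    and eta: "0 < \<eta>" "\<eta> \<le> 1" "\<eta> \<le> norm (Lam n q M u0 u1 (\<lambda>x. g x * chi n (\<alpha> (x mod int d) * x)))"
    and J: "512 / \<eta> ^ 8 \<le> real J" and tau: "32 * real \<tau> * (real J)\<^sup>2 \<le> \<eta> ^ 4 * real M"
    and T: "16 * real T \<le> (\<eta> ^ 8 / 512)\<^sup>2 * real M"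
    and gam: "\<And>e. e \<noteq> 0 \<Longrightarrow> \<bar>e\<bar> < int J ^ 2 \<Longrightarrow> real_of_int (gcd (v * e) (int L)) \<le> \<gamma>"
    and K: "\<gamma> * (1 + real L / real T) \<le> K" "1 \<le> \<gamma>"
    and zeta: "\<zeta> = \<eta> ^ 16 / (2 ^ 22 * K)"
    and Rs: "finite Rs" "card Rs \<le> m0" "0 < m0"
    and minor: "\<And>g0 g1 W j. per n g0 \<Longrightarrow> per n g1 \<Longrightarrow> one_bounded g0 \<Longrightarrow> one_bounded g1 \<Longrightarrow> one_bounded W \<Longrightarrow>
       (\<And>r. 0 \<le> r \<Longrightarrow> r < int d \<Longrightarrow> W r \<noteq> 0 \<Longrightarrow> j r mod int L \<notin> Rs) \<Longrightarrow>
       norm (Lam n q M g0 g1 (\<lambda>x. W (x mod int d) * chi (d * L) (j (x mod int d) * x))) \<le> \<zeta>\<^sup>2 / 2"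
  shows "\<exists>W k. one_bounded W \<and> \<zeta> ^ 4 / (2 * real m0 * K) \<le>
     norm (Lam n q M u0 u1 (\<lambda>x. W (x mod int d) * chi (d * L) (k (x mod int d) * x) * chi n (\<alpha> (x mod int d) * x)))"
proof -
  define N' where "N' = d * L"
  have N'0: "N' > 0" and n0: "n > 0" and nN: "n = N' * h" using pos n by (auto simp: N'_def)
  have dN: "d dvd N'" and dn: "d dvd n" and Nn: "N' dvd n" by (auto simp: N'_def n)
  have K0: "K > 0" and gK: "\<gamma> + real L / real T \<le> K"
  proof -
    have "real L / real T \<le> \<gamma> * (real L / real T)" using K(2) by (simp add: mult_right_le_one_le le_divide_eq_1 divide_right_mono mult_le_cancel_right1)
    then show "\<gamma> + real L / real T \<le> K" using K(1) by (simp add: distrib_left)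
    moreover have "0 \<le> real L / real T" by simp
    ultimately show "K > 0" using K(2) by linarith
  qed
  have z0: "\<zeta> > 0" using eta K0 by (simp add: zeta)
  define E where "E = (\<lambda>x. chi n (\<alpha> (x mod int d) * x))"
  have perE: "per n E" unfolding E_def by (rule per_chi_class[OF dn n0 dvd_refl])
  have Eshift: "E (x + int d * s) = chi n (\<alpha> (x mod int d) * (x + int d * s))" for x s
    by (simp add: E_def)
  have Eshift': "E (x + int d * s) = E x * chi n (\<alpha> (x mod int d) * (int d * s))" for x s
    unfolding Eshift by (simp add: E_def distrib_left chi_add)
  define B where "B = dualB q M u0 u1"
  have perB: "per n B" unfolding B_def by (rule per_dualB[OF per(1,2)])
  have nB: "norm (B x) \<le> 1" for x unfolding B_def by (rule norm_dualB[OF bd(1,2)])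
  \<comment> \<open>The mean of the twisted dual function over cosets of the multiples of
    \<open>N'\<close>: a factor of period \<open>N'\<close> correlates with nothing else. By
    Cauchy-Schwarz its conjugate \<open>f\<close> may replace the bounded function \<open>g\<close>,
    with \<eta>^2 in place of \<eta>.\<close>
  define ftl where "ftl = (\<lambda>x. av h (\<lambda>m. E (x + int N' * m) * B (x + int N' * m)))"
  define f where "f = (\<lambda>x. cnj (ftl x))"
  have pf: "per N' f"
    unfolding per_def
  proof
    fix x
    have "per h (\<lambda>m. E (x + int N' * m) * B (x + int N' * m))"
      by (intro per_times; unfold per_def; intro allI)
        (rule per_eq[OF perE] per_eq[OF perB], simp add: nN distrib_left)+
    from av_shift[OF this, of 1] have "ftl (x + int N') = ftl x"
      unfolding ftl_def by (simp add: distrib_left add_ac)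
    then show "f (x + int N') = f x" by (simp add: f_def)
  qed
  have bf: "norm (f x) \<le> 1" for x
  proof -
    have "norm (ftl x) \<le> 1"
      unfolding ftl_def by (intro norm_av_le_const norm_mult_le_1 nB) (simp_all add: E_def)
    then show ?thesis by (simp add: f_def)
  qed
  have G1: "av N' (\<lambda>x. ftl x * V x) = Lam n q M u0 u1 (\<lambda>x. V x * E x)" if V: "per N' V" for V
  proof -
    have "per n (\<lambda>x. V x * E x)" by (rule per_times[OF per_dvd[OF V Nn] perE])
    from Lam_dual[OF per(1,2) this] have "Lam n q M u0 u1 (\<lambda>x. V x * E x) = av (N' * h) (\<lambda>x. V x * E x * B x)"
      by (simp add: B_def nN)
    also have "\<dots> = av N' (\<lambda>x. V x * ftl x)"
      unfolding av_coset ftl_def by (simp add: per_mult[OF V] av_cmult[symmetric] mult.assoc)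
    finally show ?thesis by (simp add: mult.commute)
  qed
  have G2: "\<eta>\<^sup>2 \<le> norm (Lam n q M u0 u1 (\<lambda>x. f x * E x))"
  proof -
    have "\<eta> \<le> norm (av N' (\<lambda>x. ftl x * g x))"
      using eta(3) G1[of g] per(3) by (simp add: N'_def E_def)
    then have "\<eta>\<^sup>2 \<le> (norm (av N' (\<lambda>x. ftl x * g x)))\<^sup>2" using eta by (intro power_mono) auto
    also have "\<dots> \<le> av N' (\<lambda>x. (norm (ftl x * g x))\<^sup>2)" by (rule av_square_le)
    also have "\<dots> \<le> av N' (\<lambda>x. (norm (ftl x))\<^sup>2)"
      using one_boundedD[OF bd(3)] by (intro av_mono power_mono) (auto simp: norm_mult mult_left_le)
    finally have 1: "\<eta>\<^sup>2 \<le> av N' (\<lambda>x. (norm (ftl x))\<^sup>2)" .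
    have "Lam n q M u0 u1 (\<lambda>x. f x * E x) = av N' (\<lambda>x. ftl x * f x)" by (rule G1[OF pf, symmetric])
    also have "\<dots> = of_real (av N' (\<lambda>x. (norm (ftl x))\<^sup>2))"
      unfolding of_real_av f_def complex_norm_square ..
    finally have "norm (Lam n q M u0 u1 (\<lambda>x. f x * E x)) = \<bar>av N' (\<lambda>x. (norm (ftl x))\<^sup>2)\<bar>" by simp
    then show ?thesis using 1 by linarith
  qed
  define D' where "D' = 2 * int q * int \<tau>"
  have D'v: "D' = int d * v" using D by (simp add: D'_def)
  have pfE: "per n (\<lambda>x. f x * E x)" by (rule per_times[OF per_dvd[OF pf Nn] perE])
  have bfE: "one_bounded (\<lambda>x. f x * E x)"
    unfolding one_bounded_def by (intro allI norm_mult_le_1 bf) (simp add: E_def)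
  have eta2: "0 < \<eta>\<^sup>2" "\<eta>\<^sup>2 \<le> 1" using eta by (auto simp: power_le_one)
  have J': "512 / (\<eta>\<^sup>2) ^ 4 \<le> real J" using J by (simp flip: power_mult)
  have tau': "32 * real \<tau> * (real J)\<^sup>2 \<le> (\<eta>\<^sup>2)\<^sup>2 * real M" using tau by (simp flip: power_mult)
  obtain e1 e2 e3 e4 b1 b2 b3 b4 :: int where
    er: "0 \<le> e1" "e1 < int J ^ 2" "0 \<le> e2" "e2 < int J ^ 2" "0 \<le> e3" "e3 < int J ^ 2" "0 \<le> e4" "e4 < int J ^ 2"
    and en: "e4 \<noteq> e1" "e4 \<noteq> e2" "e4 \<noteq> e3" and es: "e1 + e4 = e2 + e3"
    and bdv: "int \<tau> dvd b1" "int \<tau> dvd b2" "int \<tau> dvd b3" "int \<tau> dvd b4"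
    and pt: "(\<eta>\<^sup>2) ^ 4 / 512 \<le> norm (av n (\<lambda>x. av M (\<lambda>y. f (x + b1 + 2 * int q * int \<tau> * e1 * y) * E (x + b1 + 2 * int q * int \<tau> * e1 * y) *
       cnj (f (x + b2 + 2 * int q * int \<tau> * e2 * y) * E (x + b2 + 2 * int q * int \<tau> * e2 * y)) *
       cnj (f (x + b3 + 2 * int q * int \<tau> * e3 * y) * E (x + b3 + 2 * int q * int \<tau> * e3 * y)) *
       (f (x + b4 + 2 * int q * int \<tau> * e4 * y) * E (x + b4 + 2 * int q * int \<tau> * e4 * y)))))"
    by (rule parallelogram_differencing[OF n0 pos(4,5,7) per(1,2) pfE bd(1,2) bfE eta2 G2 J' tau'])
  \<comment> \<open>The four twists combine. All shifts are multiples of \<open>d\<close>, the terms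
    in \<open>x\<close> cancel by the signs, and the terms in \<open>y\<close> cancel because e1 +
    e4 = e2 + e3. What remains depends on the class modulo \<open>d\<close> only and is absorbed
    into \<open>F1\<close>.\<close>
  define \<beta> where "\<beta> = (\<lambda>x. chi n (\<alpha> (x mod int d) * (b1 - b2 - b3 + b4)))"
  have phase: "E (x + b1 + D' * e1 * y) * cnj (E (x + b2 + D' * e2 * y)) * cnj (E (x + b3 + D' * e3 * y)) * E (x + b4 + D' * e4 * y)
     = \<beta> (x + D' * e1 * y)" for x y
  proof (cases "\<forall>c. \<alpha> c = 0")
    case True
    then show ?thesis by (simp add: E_def \<beta>_def)
  next
    case False
    then have "d dvd \<tau>" using \<alpha> by blast
    then have "int d dvd int \<tau>" by simp
    then have "int d dvd b1" "int d dvd b2" "int d dvd b3" "int d dvd b4" using bdv by (meson dvd_trans)+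
    then obtain c1 c2 c3 c4 where c: "b1 = int d * c1" "b2 = int d * c2" "b3 = int d * c3" "b4 = int d * c4"
      by (auto simp: dvd_def)
    have ex: "E (x + int d * c + D' * e * y) = chi n (\<alpha> (x mod int d) * (x + int d * c + D' * e * y))" for c e
      using Eshift[of x "c + v * e * y"] by (simp add: D'v algebra_simps)
    have bx: "\<beta> (x + D' * e1 * y) = chi n (\<alpha> (x mod int d) * (b1 - b2 - b3 + b4))"
      using class_shift[of x d "v * e1 * y"] by (simp add: \<beta>_def D'v algebra_simps)
    have e4: "e4 = e2 + e3 - e1" using es by simp
    have "\<alpha> (x mod int d) * (x + int d * c1 + D' * e1 * y) + - (\<alpha> (x mod int d) * (x + int d * c2 + D' * e2 * y))
      + - (\<alpha> (x mod int d) * (x + int d * c3 + D' * e3 * y)) + \<alpha> (x mod int d) * (x + int d * c4 + D' * e4 * y)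
      = \<alpha> (x mod int d) * (b1 - b2 - b3 + b4)"
      unfolding c e4 by (simp add: algebra_simps)
    then show ?thesis unfolding bx unfolding c ex cnj_chi chi_add[symmetric] by simp
  qed
  define F1 where "F1 = (\<lambda>x. \<beta> x * f (x + b1))"
  define F2 where "F2 = (\<lambda>x. cnj (f (x + b2)))"
  define F3 where "F3 = (\<lambda>x. cnj (f (x + b3)))"
  define F4 where "F4 = (\<lambda>x. f (x + b4))"
  have pF: "per N' F1" "per N' F2" "per N' F3" "per N' F4"
    unfolding F1_def F2_def F3_def F4_def \<beta>_def
    by (intro per_times per_cmp[of N' _ cnj] per_shift pf per_classfun[OF dN])+
  have bF: "norm (F1 x) \<le> 1" "norm (F2 x) \<le> 1" "norm (F3 x) \<le> 1" "norm (F4 x) \<le> 1" for x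
    unfolding F1_def F2_def F3_def F4_def \<beta>_def using bf by (simp_all add: norm_mult)
  define Q where "Q = (\<lambda>x. av M (\<lambda>y. F1 (x + D' * e1 * y) * F2 (x + D' * e2 * y) * F3 (x + D' * e3 * y) * F4 (x + D' * e4 * y)))"
  have perQ: "per N' Q"
    unfolding Q_def by (intro per_av per_times per_shift pF)
  have "f (x + b1 + D' * e1 * y) * E (x + b1 + D' * e1 * y) * cnj (f (x + b2 + D' * e2 * y) * E (x + b2 + D' * e2 * y)) *
       cnj (f (x + b3 + D' * e3 * y) * E (x + b3 + D' * e3 * y)) * (f (x + b4 + D' * e4 * y) * E (x + b4 + D' * e4 * y))
     = F1 (x + D' * e1 * y) * F2 (x + D' * e2 * y) * F3 (x + D' * e3 * y) * F4 (x + D' * e4 * y)" for x y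
  proof -
    have sw: "x + D' * e * y + b = x + b + D' * e * y" for e b by simp
    have *: "a1 * E1 * cnj (a2 * E2) * cnj (a3 * E3) * (a4 * E4) = ((E1 * cnj E2 * cnj E3 * E4) * a1) * cnj a2 * cnj a3 * a4"
      for a1 a2 a3 a4 E1 E2 E3 E4 :: complex by (simp add: mult_ac)
    show ?thesis unfolding * phase F1_def F2_def F3_def F4_def sw ..
  qed
  then have "\<eta> ^ 8 / 512 \<le> norm (av n Q)"
    using pt unfolding D'_def[symmetric] Q_def by (simp flip: power_mult)
  then have ge1: "\<eta> ^ 8 / 512 \<le> norm (av (d * L) (\<lambda>x. av M (\<lambda>y. F1 (x + D' * e1 * y) * F2 (x + D' * e2 * y) * F3 (x + D' * e3 * y) * F4 (x + D' * e4 * y))))"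
    unfolding av_per_dvd[OF perQ Nn n0] by (simp add: Q_def N'_def)
  have e8: "0 < \<eta> ^ 8 / 512" "\<eta> ^ 8 / 512 \<le> 1" using eta power_le_one[of \<eta> 8] by auto
  have gg: "real_of_int (gcd (v * (e4 - e2)) (int L)) \<le> \<gamma>" "real_of_int (gcd (v * (e4 - e3)) (int L)) \<le> \<gamma>"
    using er en by (auto intro!: gam)
  obtain j where j: "0 \<le> j" "j < int T" and kj: "(\<eta> ^ 8 / 512)\<^sup>2 / 8 \<le> (\<gamma> + real L / real T) *
     av T (\<lambda>i. av d (max_coeff d L (\<lambda>x. F4 (x + D' * (e4 - e1) * i) * cnj (F4 (x + D' * (e4 - e1) * j)))))"
    using large_derivative_coefficients[OF pos(1,2,4,6) D'v pF[unfolded N'_def] bF gg e8 T ge1] by blast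
  define e where "e = e4 - e1"
  \<comment> \<open>Only the difference of the two shifts matters: a translation of \<open>x\<close>
    permutes the classes modulo \<open>d\<close>, over which the extremal coefficients are
    averaged.\<close>
  define l where "l = (\<lambda>i. int d * (v * e * (i - j)))"
  define H where "H = (\<lambda>i x. f (x + l i) * cnj (f x))"
  have pH: "per N' (H i)" for i unfolding H_def by (intro per_times per_cmp[of N' _ cnj] per_shift pf)
  have bH: "norm (H i x) \<le> 1" for i x unfolding H_def using bf by (intro norm_mult_le_1) auto
  have "av d (max_coeff d L (\<lambda>x. F4 (x + D' * (e4 - e1) * i) * cnj (F4 (x + D' * (e4 - e1) * j)))) = av d (max_coeff d L (H i))" for i
  proof -
    have "(\<lambda>x. F4 (x + D' * (e4 - e1) * i) * cnj (F4 (x + D' * (e4 - e1) * j))) = (\<lambda>x. H i (x + (b4 + D' * e * j)))"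
      by (rule ext) (simp add: F4_def H_def e_def l_def D'v algebra_simps)
    then have "av d (max_coeff d L (\<lambda>x. F4 (x + D' * (e4 - e1) * i) * cnj (F4 (x + D' * (e4 - e1) * j)))) = av d (\<lambda>r. max_coeff d L (H i) (r + (b4 + D' * e * j)))"
      by (simp only: max_coeff_shift[abs_def])
    then show ?thesis using av_shift[OF per_max_coeff[OF pH[unfolded N'_def] pos(2)]] by simp
  qed
  then have kj: "(\<eta> ^ 8 / 512)\<^sup>2 / 8 \<le> (\<gamma> + real L / real T) * av T (\<lambda>i. av d (max_coeff d L (H i)))"
    using kj by simp
  have mxn: "0 \<le> max_coeff d L u r" for u r by (rule max_coeff_nonneg[OF pos(2)])
  \<comment> \<open>\<open>\<zeta>\<close> is defined to make this work: (\<eta>^8/512)^2/8 =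
    \<eta>^16/2^21 = 2 \<zeta> K.\<close>
  have G4: "2 * \<zeta> \<le> av T (\<lambda>i. av d (max_coeff d L (H i)))"
  proof -
    have "(\<gamma> + real L / real T) * av T (\<lambda>i. av d (max_coeff d L (H i))) \<le> K * av T (\<lambda>i. av d (max_coeff d L (H i)))"
      using gK mxn by (intro mult_right_mono av_nonneg) auto
    then have "(\<eta> ^ 8 / 512)\<^sup>2 / 8 \<le> K * av T (\<lambda>i. av d (max_coeff d L (H i)))" using kj by linarith
    moreover have "(\<eta> ^ 8 / 512)\<^sup>2 / 8 = 2 * \<zeta> * K" using K0 by (simp add: zeta power_divide flip: power_mult)
    ultimately show ?thesis using K0 by (simp add: mult.commute)
  qed
  define \<kappa> where "\<kappa> = (\<lambda>i. max_freq d L (H i))"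
  \<comment> \<open>Classes whose extremal coefficient is below \<open>\<zeta>\<close> get weight 0.
    This costs at most \<open>\<zeta>\<close> in the mean and ensures that every class counted later
    has a coefficient of at least \<open>\<zeta>\<close>.\<close>
  define \<theta> where "\<theta> = (\<lambda>i r. if \<zeta> \<le> max_coeff d L (H i) r then max_phase d L (H i) r else 0)"
  define w where "w = (\<lambda>i x. \<theta> i (x mod int d) * chi N' (- (\<kappa> i (x mod int d) * x)))"
  have b\<theta>: "norm (\<theta> i r) \<le> 1" for i r by (simp add: \<theta>_def norm_max_phase)
  have bw: "norm (w i x) \<le> 1" for i x by (simp add: w_def norm_mult b\<theta>)
  have pw: "per N' (w i)" for i
    using per_times[OF per_classfun[OF dN, of "\<theta> i"] per_chi_class[OF dN N'0 dvd_refl, of "\<lambda>r. - \<kappa> i r"]]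
    by (simp add: w_def)
  have G5: "av N' (\<lambda>x. H i x * w i x) = of_real (av d (\<lambda>r. if \<zeta> \<le> max_coeff d L (H i) r then max_coeff d L (H i) r else 0))" for i
  proof -
    have "av N' (\<lambda>x. H i x * w i x) = av d (\<lambda>r. av L (\<lambda>m. H i (r + int d * m) * (\<theta> i r * chi N' (- (\<kappa> i r * (r + int d * m))))))"
      unfolding w_def N'_def by (rule av_class[OF pos(1), where F = "\<lambda>r x. H i x * (\<theta> i r * chi (d * L) (- (\<kappa> i r * x)))"])
    also have "\<dots> = av d (\<lambda>r. \<theta> i r * av L (\<lambda>m. H i (r + int d * m) * chi N' (- (\<kappa> i r * (r + int d * m)))))"
      by (simp add: av_cmult[symmetric] mult_ac)
    also have "\<dots> = av d (\<lambda>r. of_real (if \<zeta> \<le> max_coeff d L (H i) r then max_coeff d L (H i) r else 0))"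
      using max_phase_mult[OF pos(1,2)] by (intro av_cong) (simp add: \<theta>_def \<kappa>_def N'_def)
    finally show ?thesis by (simp add: of_real_av)
  qed
  have ge2: "\<zeta> \<le> norm (av T (\<lambda>i. av N' (\<lambda>x. H i x * w i x)))"
  proof -
    have "2 * \<zeta> - \<zeta> \<le> av T (\<lambda>i. av d (max_coeff d L (H i))) - \<zeta>" using G4 by simp
    also have "\<dots> = av T (\<lambda>i. av d (\<lambda>r. max_coeff d L (H i) r - \<zeta>))"
      using pos by (simp add: av_diff av_const)
    also have "\<dots> \<le> av T (\<lambda>i. av d (\<lambda>r. if \<zeta> \<le> max_coeff d L (H i) r then max_coeff d L (H i) r else 0))"
      using z0 by (intro av_mono) auto
    also have "\<dots> \<le> norm (complex_of_real (av T (\<lambda>i. av d (\<lambda>r. if \<zeta> \<le> max_coeff d L (H i) r then max_coeff d L (H i) r else 0))))"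
      by simp
    finally show ?thesis by (simp add: G5 of_real_av)
  qed
  define b where "b = (\<lambda>x. cnj (f x) * cnj (E x))"
  define w' where "w' = (\<lambda>i x. w i x * chi n (- (\<alpha> (x mod int d) * l i)))"
  \<comment> \<open>As \<open>l i\<close> is a multiple of \<open>d\<close>, unfolding
    \<open>f (x + l i)\<close> leaves the dual function at \<open>x + l i\<close> together with a
    phase that depends on the class modulo \<open>d\<close>; that phase moves into
    \<open>w'\<close>.\<close>
  have G6: "av N' (\<lambda>x. H i x * w i x) = av n (\<lambda>x. cnj (B (x + l i)) * b x * w' i x)" for i
  proof -
    have "av n (\<lambda>x. cnj (B (x + l i)) * b x * w' i x) =
      av N' (\<lambda>x. av h (\<lambda>m. cnj (B (x + int N' * m + l i)) * b (x + int N' * m) * w' i (x + int N' * m)))"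
      unfolding nN by (rule av_coset)
    also have "\<dots> = av N' (\<lambda>x. H i x * w i x)"
    proof (rule arg_cong[where f="av N'"], rule ext)
      fix x
      have mm: "(x + int N' * m) mod int d = x mod int d" for m
        using class_shift[of x d "int L * m"] by (simp add: N'_def mult.assoc)
      have Es: "E (x + l i + int N' * m) = E (x + int N' * m) * chi n (\<alpha> (x mod int d) * l i)" for m
        using Eshift'[of "x + int N' * m" "v * e * (i - j)"] by (simp add: mm l_def add_ac)
      have bm: "b (x + int N' * m) = cnj (f x) * cnj (E (x + int N' * m))" for m
        by (simp add: b_def per_mult[OF pf])
      have w'm: "w' i (x + int N' * m) = w i x * chi n (- (\<alpha> (x mod int d) * l i))" for m
        unfolding w'_def by (simp only: per_mult[OF pw] mm)
      have "H i x * w i x = av h (\<lambda>m. cnj (E (x + l i + int N' * m) * B (x + l i + int N' * m))) * cnj (f x) * w i x"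
        by (simp add: H_def f_def ftl_def cnj_av)
      also have "\<dots> = av h (\<lambda>m. cnj (B (x + int N' * m + l i)) * b (x + int N' * m) * w' i (x + int N' * m))"
        unfolding Es bm w'm by (simp add: cnj_chi av_cmult[symmetric] mult_ac add_ac)
      finally show "av h (\<lambda>m. cnj (B (x + int N' * m + l i)) * b (x + int N' * m) * w' i (x + int N' * m)) = H i x * w i x" ..
    qed
    finally show ?thesis ..
  qed
  have pb: "per n b" unfolding b_def by (intro per_times per_cmp[of n _ cnj] per_dvd[OF pf Nn] perE)
  have bb: "norm (b x) \<le> 1" for x unfolding b_def using bf by (simp add: norm_mult E_def)
  have pw': "per n (w' i)" for i
    unfolding w'_def using per_times[OF per_dvd[OF pw Nn] per_classfun[OF dn, of "\<lambda>c. chi n (- (\<alpha> c * l i))"]] .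
  have bw': "norm (w' i x) \<le> 1" for i x unfolding w'_def using bw by (simp add: norm_mult)
  define U0 where "U0 = (\<lambda>i j x. cnj (u0 (x + l i)) * u0 (x + l j))"
  define U1 where "U1 = (\<lambda>i j x. cnj (u1 (x + l i)) * u1 (x + l j))"
  have pU: "per n (U0 i j)" "per n (U1 i j)" for i j
    unfolding U0_def U1_def by (intro per_times per_cmp[of n _ cnj] per_shift per)+
  have bU: "one_bounded (U0 i j)" "one_bounded (U1 i j)" for i j
    unfolding U0_def U1_def one_bounded_def
    using one_boundedD[OF bd(1)] one_boundedD[OF bd(2)] by (intro allI norm_mult_le_1; simp)+
  have "\<zeta>\<^sup>2 \<le> av T (\<lambda>j. av T (\<lambda>i. norm (Lam n q M (U0 i j) (U1 i j) (\<lambda>x. w' i x * cnj (w' j x)))))"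
    unfolding U0_def U1_def
    by (rule interchange[OF n0 pos(4,6) per(1,2) pb pw' bd(1,2) bb bw'])
      (use ge2 z0 in \<open>simp_all add: G6 B_def\<close>)
  \<comment> \<open>One derivative is frozen, and the frequencies of all others are compared with
    its frequencies.\<close>
  then obtain j0 where j0: "\<zeta>\<^sup>2 \<le> av T (\<lambda>i. norm (Lam n q M (U0 i j0) (U1 i j0) (\<lambda>x. w' i x * cnj (w' j0 x))))"
    using av_ex_ge[OF pos(6), of "\<lambda>j. av T (\<lambda>i. norm (Lam n q M (U0 i j) (U1 i j) (\<lambda>x. w' i x * cnj (w' j x))))"]
    by (meson order_trans)
  define \<iota> where "\<iota> = (\<lambda>i r. \<kappa> j0 r - \<kappa> i r)"
  define \<Omega> where "\<Omega> = (\<lambda>i r. \<theta> i r * cnj (\<theta> j0 r) * (chi n (- (\<alpha> r * l i)) * cnj (chi n (- (\<alpha> r * l j0)))))"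
  have b\<Omega>: "norm (\<Omega> i r) \<le> 1" for i r unfolding \<Omega>_def using b\<theta> by (simp add: norm_mult mult_le_one)
  \<comment> \<open>Frequency differences lying in \<open>Rs\<close> modulo \<open>L\<close> are
    kept and counted by \<open>\<mu>\<close>; for the others the hypothesis \<open>minor\<close>
    bounds the form.\<close>
  define \<Omega>1 where "\<Omega>1 = (\<lambda>i r. if \<iota> i r mod int L \<in> Rs then \<Omega> i r else 0)"
  define \<Omega>2 where "\<Omega>2 = (\<lambda>i r. if \<iota> i r mod int L \<in> Rs then 0 else \<Omega> i r)"
  define \<mu> where "\<mu> = (\<lambda>i r. if \<theta> i r \<noteq> 0 \<and> \<iota> i r mod int L \<in> Rs then 1 else 0 :: real)"
  have G8: "norm (Lam n q M (U0 i j0) (U1 i j0) (\<lambda>x. w' i x * cnj (w' j0 x))) \<le> av d (\<mu> i) + \<zeta>\<^sup>2 / 2" for i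
  proof -
    have "w' i x * cnj (w' j0 x) = \<Omega>1 i (x mod int d) * chi N' (\<iota> i (x mod int d) * x) + \<Omega>2 i (x mod int d) * chi N' (\<iota> i (x mod int d) * x)" for x
    proof -
      have "chi N' (- (\<kappa> i (x mod int d) * x)) * cnj (chi N' (- (\<kappa> j0 (x mod int d) * x))) = chi N' (\<iota> i (x mod int d) * x)"
        unfolding cnj_chi chi_add[symmetric] \<iota>_def by (simp add: algebra_simps)
      then have "w' i x * cnj (w' j0 x) = \<Omega> i (x mod int d) * chi N' (\<iota> i (x mod int d) * x)"
        by (simp add: w'_def w_def \<Omega>_def mult_ac)
      then show ?thesis by (simp add: \<Omega>1_def \<Omega>2_def)
    qed
    then have eq: "Lam n q M (U0 i j0) (U1 i j0) (\<lambda>x. w' i x * cnj (w' j0 x)) =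
      Lam n q M (U0 i j0) (U1 i j0) (\<lambda>x. \<Omega>1 i (x mod int d) * chi N' (\<iota> i (x mod int d) * x)) +
      Lam n q M (U0 i j0) (U1 i j0) (\<lambda>x. \<Omega>2 i (x mod int d) * chi N' (\<iota> i (x mod int d) * x))"
      by (simp only: Lam_add)
    have o2: "norm (Lam n q M (U0 i j0) (U1 i j0) (\<lambda>x. \<Omega>2 i (x mod int d) * chi N' (\<iota> i (x mod int d) * x))) \<le> \<zeta>\<^sup>2 / 2"
      unfolding N'_def
    proof (rule minor[OF pU bU])
      show "one_bounded (\<Omega>2 i)" using b\<Omega> by (simp add: one_bounded_def \<Omega>2_def)
      show "\<iota> i r mod int L \<notin> Rs" if "\<Omega>2 i r \<noteq> 0" for r using that by (auto simp: \<Omega>2_def split: if_splits)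
    qed
    have o1: "norm (Lam n q M (U0 i j0) (U1 i j0) (\<lambda>x. \<Omega>1 i (x mod int d) * chi N' (\<iota> i (x mod int d) * x))) \<le> av d (\<mu> i)"
    proof -
      have "norm (Lam n q M (U0 i j0) (U1 i j0) (\<lambda>x. \<Omega>1 i (x mod int d) * chi N' (\<iota> i (x mod int d) * x)))
         \<le> av n (\<lambda>x. norm (\<Omega>1 i (x mod int d) * chi N' (\<iota> i (x mod int d) * x)))"
        by (rule Lam_le[OF pU per_times[OF per_classfun[OF dn] per_chi_class[OF dN N'0 Nn]] bU])
      also have "\<dots> \<le> av n (\<lambda>x. \<mu> i (x mod int d))"
      proof (rule av_mono)
        fix x
        show "norm (\<Omega>1 i (x mod int d) * chi N' (\<iota> i (x mod int d) * x)) \<le> \<mu> i (x mod int d)"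
          using b\<Omega>[of i "x mod int d"] by (auto simp: norm_mult \<Omega>1_def \<mu>_def \<Omega>_def)
      qed
      also have "\<dots> = av d (\<lambda>x. \<mu> i (x mod int d))" by (rule av_per_dvd[OF per_classfun dn n0]) simp
      also have "\<dots> = av d (\<mu> i)" by (rule av_cong) simp
      finally show ?thesis .
    qed
    show ?thesis unfolding eq by (rule order_trans[OF norm_triangle_ineq add_mono[OF o1 o2]])
  qed
  have G8': "\<zeta>\<^sup>2 / 2 \<le> av T (\<lambda>i. av d (\<mu> i))"
  proof -
    have "\<zeta>\<^sup>2 \<le> av T (\<lambda>i. av d (\<mu> i) + \<zeta>\<^sup>2 / 2)" by (rule order_trans[OF j0 av_mono[OF G8]])
    then show ?thesis using pos by (simp add: av_add av_const)
  qed
  define \<nu> where "\<nu> = (\<lambda>m i r. if \<theta> i r \<noteq> 0 \<and> \<iota> i r mod int L = m then 1 else 0 :: real)"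
  have "\<mu> i r \<le> (\<Sum>m\<in>Rs. \<nu> m i r)" for i r
  proof (cases "\<theta> i r \<noteq> 0 \<and> \<iota> i r mod int L \<in> Rs")
    case True
    then have "\<mu> i r = \<nu> (\<iota> i r mod int L) i r" by (simp add: \<mu>_def \<nu>_def)
    also have "\<dots> \<le> (\<Sum>m\<in>Rs. \<nu> m i r)" using True Rs(1) by (intro member_le_sum) (auto simp: \<nu>_def)
    finally show ?thesis .
  next
    case False
    then have "\<mu> i r = 0" by (auto simp: \<mu>_def)
    then show ?thesis by (simp add: \<nu>_def sum_nonneg)
  qed
  then have "\<zeta>\<^sup>2 / 2 \<le> av T (\<lambda>i. av d (\<lambda>r. \<Sum>m\<in>Rs. \<nu> m i r))"
    by (intro order_trans[OF G8'] av_mono)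
  then have S: "\<zeta>\<^sup>2 / 2 \<le> (\<Sum>m\<in>Rs. av T (\<lambda>i. av d (\<nu> m i)))" by (simp only: av_sum)
  have "\<exists>m\<in>Rs. \<zeta>\<^sup>2 / (2 * real m0) \<le> av T (\<lambda>i. av d (\<nu> m i))"
  proof (rule ccontr)
    assume nex: "\<not> (\<exists>m\<in>Rs. \<zeta>\<^sup>2 / (2 * real m0) \<le> av T (\<lambda>i. av d (\<nu> m i)))"
    have "Rs \<noteq> {}" using S z0 by auto
    then have "(\<Sum>m\<in>Rs. av T (\<lambda>i. av d (\<nu> m i))) < (\<Sum>m\<in>Rs. \<zeta>\<^sup>2 / (2 * real m0))"
      using nex Rs(1) by (intro sum_strict_mono) (auto simp: not_le)
    also have "\<dots> = real (card Rs) * (\<zeta>\<^sup>2 / (2 * real m0))" by simp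
    also have "\<dots> \<le> real m0 * (\<zeta>\<^sup>2 / (2 * real m0))"
      using Rs z0 by (intro mult_right_mono) auto
    also have "\<dots> = \<zeta>\<^sup>2 / 2" using Rs(3) by simp
    finally show False using S by simp
  qed
  then obtain m where m: "\<zeta>\<^sup>2 / (2 * real m0) \<le> av T (\<lambda>i. av d (\<nu> m i))" by blast
  \<comment> \<open>After a pigeonhole over \<open>Rs\<close>, the extremal frequency of the
    derivative in class \<open>r\<close> is \<open>kk r\<close> modulo \<open>L\<close> for many
    pairs (i, r). It is independent of \<open>i\<close>, as \<open>autocorr\<close>
    requires.\<close>
  define kk where "kk = (\<lambda>r. \<kappa> j0 r - m)"
  define co where "co = (\<lambda>i r. (norm (ft L (\<lambda>m. H i (r + int d * m)) (kk r)))\<^sup>2)"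
  have "\<zeta>\<^sup>2 * \<nu> m i r \<le> co i r" for i r
  proof (cases "\<theta> i r \<noteq> 0 \<and> \<iota> i r mod int L = m")
    case True
    have "\<zeta> \<le> max_coeff d L (H i) r" using True by (auto simp: \<theta>_def split: if_splits)
    have "kk r mod int L = \<kappa> i r mod int L"
    proof -
      have "kk r = \<kappa> i r + int L * (\<iota> i r div int L)"
        using True mult_div_mod_eq[of "int L" "\<iota> i r"] unfolding kk_def \<iota>_def by linarith
      then show ?thesis by simp
    qed
    then have "ft L (\<lambda>m. H i (r + int d * m)) (kk r) = ft L (\<lambda>m. H i (r + int d * m)) (\<kappa> i r)"
      using per_mod[OF per_ft[OF pos(2)]] by metis
    then have "norm (ft L (\<lambda>m. H i (r + int d * m)) (kk r)) = max_coeff d L (H i) r"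
      using max_freq[OF pos(2), of "H i" r d] by (simp add: \<kappa>_def)
    then show ?thesis using True \<open>\<zeta> \<le> max_coeff d L (H i) r\<close> z0 by (simp add: \<nu>_def co_def power_mono)
  qed (auto simp: \<nu>_def co_def)
  then have "av T (\<lambda>i. av d (\<lambda>r. \<zeta>\<^sup>2 * \<nu> m i r)) \<le> av T (\<lambda>i. av d (co i))" by (intro av_mono)
  moreover have "av T (\<lambda>i. av d (\<lambda>r. \<zeta>\<^sup>2 * \<nu> m i r)) = \<zeta>\<^sup>2 * av T (\<lambda>i. av d (\<nu> m i))" by (simp only: av_cmult)
  moreover have "\<zeta>\<^sup>2 * (\<zeta>\<^sup>2 / (2 * real m0)) \<le> \<zeta>\<^sup>2 * av T (\<lambda>i. av d (\<nu> m i))" using m by (intro mult_left_mono) auto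
  moreover have "\<zeta>\<^sup>2 * (\<zeta>\<^sup>2 / (2 * real m0)) = \<zeta> ^ 4 / (2 * real m0)" by (simp add: power4_eq_xxxx power2_eq_square)
  ultimately have "\<zeta> ^ 4 / (2 * real m0) \<le> av T (\<lambda>i. av d (co i))" by linarith
  also have "\<dots> = av d (\<lambda>r. av T (\<lambda>i. co i r))" by (rule av_swap)
  also have "\<dots> \<le> av d (\<lambda>r. K * max_coeff d L f r)"
  proof (rule av_mono)
    fix r
    have "av T (\<lambda>i. co i r) = av T (\<lambda>i. (norm (av L (\<lambda>m. f (r + int d * (m + ((v * e) * i + - (v * e * j)))) * cnj (f (r + int d * m)) * chi L (- (kk r * m)))))\<^sup>2)"
      unfolding co_def ft_def H_def l_def by (simp add: algebra_simps)
    also have "\<dots> \<le> \<gamma> * (1 + real L / real T) * (max_coeff d L f r)\<^sup>2"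
      by (rule autocorr[where g = "\<lambda>m. f (r + int d * m)", OF pos(2,6) per_class[OF pf[unfolded N'_def]] bf max_coeff_ge[OF pos(2)] gam])
        (use er en in \<open>auto simp: e_def\<close>)
    also have "\<dots> \<le> K * (max_coeff d L f r)\<^sup>2" using K(1) by (intro mult_right_mono) auto
    also have "\<dots> \<le> K * max_coeff d L f r"
      using K0 max_coeff_le_1[where h=f and d=d and r=r, OF pos(2) bf] mxn[of f r] by (intro mult_left_mono) (auto simp: power2_eq_square mult_left_le_one_le)
    finally show "av T (\<lambda>i. co i r) \<le> K * max_coeff d L f r" .
  qed
  also have "\<dots> = K * av d (max_coeff d L f)" by (simp only: av_cmult)
  finally have "\<zeta> ^ 4 / (2 * real m0) \<le> av d (max_coeff d L f) * K" by (simp only: mult.commute)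
  then have "\<zeta> ^ 4 / (2 * real m0) / K \<le> av d (max_coeff d L f)" using K0 by (simp only: pos_divide_le_eq)
  then have G9: "\<zeta> ^ 4 / (2 * real m0 * K) \<le> av d (max_coeff d L f)" by (simp only: divide_divide_eq_left)
  \<comment> \<open>The extremal characters of \<open>f\<close> on the single classes, assembled
    into one function of period \<open>N'\<close> that correlates with \<open>ftl\<close>.\<close>
  define V where "V = (\<lambda>x. cnj (max_phase d L f (x mod int d)) * chi N' (max_freq d L f (x mod int d) * x))"
  have pV: "per N' V" unfolding V_def
    by (rule per_times[OF per_classfun[OF dN, of "\<lambda>r. cnj (max_phase d L f r)"] per_chi_class[OF dN N'0 dvd_refl]])
  have "cnj (av N' (\<lambda>x. ftl x * V x)) = av N' (\<lambda>x. f x * (max_phase d L f (x mod int d) * chi N' (- (max_freq d L f (x mod int d) * x))))"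
    by (simp add: cnj_av V_def f_def cnj_chi)
  also have "\<dots> = av d (\<lambda>r. av L (\<lambda>m. f (r + int d * m) * (max_phase d L f r * chi N' (- (max_freq d L f r * (r + int d * m))))))"
    unfolding N'_def by (rule av_class[OF pos(1), where F = "\<lambda>r x. f x * (max_phase d L f r * chi (d * L) (- (max_freq d L f r * x)))"])
  also have "\<dots> = av d (\<lambda>r. max_phase d L f r * av L (\<lambda>m. f (r + int d * m) * chi N' (- (max_freq d L f r * (r + int d * m)))))"
    by (simp add: av_cmult[symmetric] mult_ac)
  also have "\<dots> = of_real (av d (max_coeff d L f))"
    unfolding of_real_av N'_def max_phase_mult[OF pos(1,2)] ..
  finally have "norm (cnj (av N' (\<lambda>x. ftl x * V x))) = \<bar>av d (max_coeff d L f)\<bar>" by simp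
  then have "\<zeta> ^ 4 / (2 * real m0 * K) \<le> norm (Lam n q M u0 u1 (\<lambda>x. V x * E x))"
    using G9 G1[OF pV] by simp
  then show ?thesis
    using norm_max_phase by (intro exI[of _ "\<lambda>r. cnj (max_phase d L f r)"] exI[of _ "max_freq d L f"]) (simp add: one_bounded_def V_def E_def N'_def)
qed

lemma chi_div: "n > 0 \<Longrightarrow> L > 0 \<Longrightarrow> chi (n * L) (int L * j) = chi n j"
  by (simp add: chi_def)

lemma real_div_le: "real (x div y) \<le> real x / real y"
  using of_nat_div_le_of_nat[of x y, where ?'a = real] by simp

text \<open>Pure arithmetic. \<open>E1\<close> is the lower bound coming from the form, where the
  last term accounts for the quadruples with \<open>a\<close> dividing t, and \<open>E2\<close> is
  the bound of \<open>popular_count\<close>. The condition 24 <= \<eta>^4 a makes that last term at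
  most half of the left side.\<close>

lemma popular_numeric:
  assumes "q > 0" "a > 0" "a \<le> M" "q \<le> M"
    and eta: "0 < \<eta>" "24 \<le> \<eta> ^ 4 * real a"
    and E1: "\<eta> ^ 4 * real M ^ 4 * real (q * a) \<le> real (2 * M + 1) * (real cT + real (q * a * (((2 * M + 1) div a + 1) * (M * M))))"
    and E2: "cT\<^sup>2 \<le> (q * a * (q * a) * (a + 1)) *
    ((q * a * s) * ((2 * M + 1) * (((2 * M + 1) div q + 1) * (M * ((2 * (M div a + 1)) * ((M div a + 1) * (M div a + 1)))))) +
     (q * a) * ((2 * M + 1) * ((2 * ((2 * M + 1) div (q * a) + 1)) * (M * (M * ((M div a + 1) * (2 * (M div a + 1))))))))"
  shows "\<eta> ^ 8 * real a \<le> 13824 * (real s + real q)"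
proof -
  define Mr ar qr c where "Mr = real M" and "ar = real a" and "qr = real q" and "c = real cT"
  have pos: "1 \<le> ar" "1 \<le> qr" "ar \<le> Mr" "qr \<le> Mr" "0 < Mr" "0 \<le> c"
    using assms by (auto simp: Mr_def ar_def qr_def c_def)
  have b1: "real (2 * M + 1) \<le> 3 * Mr" using pos by (simp add: Mr_def)
  have gen: "real ((2 * M + 1) div y + 1) \<le> 4 * Mr / real y" if "0 < y" "y \<le> M" for y
  proof -
    have "real ((2 * M + 1) div y) \<le> real (2 * M + 1) / real y" by (rule real_div_le)
    also have "\<dots> \<le> 3 * Mr / real y" using b1 by (intro divide_right_mono) auto
    finally have "real ((2 * M + 1) div y) \<le> 3 * Mr / real y" .
    moreover have "1 \<le> Mr / real y" using that by (simp add: Mr_def)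
    ultimately show ?thesis by (simp add: add_divide_distrib)
  qed
  have b2: "real ((2 * M + 1) div q + 1) \<le> 4 * Mr / qr" using gen[of q] assms by (simp add: qr_def)
  have b3: "real ((2 * M + 1) div a + 1) \<le> 4 * Mr / ar" using gen[of a] assms by (simp add: ar_def)
  have "(2 * M + 1) div (q * a) \<le> (2 * M + 1) div a" using assms(1,2) by (intro div_le_mono2) auto
  then have b4: "real ((2 * M + 1) div (q * a) + 1) \<le> 4 * Mr / ar" using b3 by linarith
  have b5: "real (M div a + 1) \<le> 2 * Mr / ar"
  proof -
    have "real (M div a) \<le> Mr / ar" using real_div_le[of M a] by (simp add: Mr_def ar_def)
    moreover have "1 \<le> Mr / ar" using pos by simp
    ultimately show ?thesis by simp
  qed
  have "real (cT\<^sup>2) \<le> real ((q * a * (q * a) * (a + 1)) *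
    ((q * a * s) * ((2 * M + 1) * (((2 * M + 1) div q + 1) * (M * ((2 * (M div a + 1)) * ((M div a + 1) * (M div a + 1)))))) +
     (q * a) * ((2 * M + 1) * ((2 * ((2 * M + 1) div (q * a) + 1)) * (M * (M * ((M div a + 1) * (2 * (M div a + 1)))))))))"
    using E2 by (simp only: of_nat_le_iff)
  also have "\<dots> \<le> (qr * ar * (qr * ar) * (2 * ar)) *
    ((qr * ar * real s) * ((3 * Mr) * ((4 * Mr / qr) * (Mr * ((2 * (2 * Mr / ar)) * ((2 * Mr / ar) * (2 * Mr / ar)))))) +
     (qr * ar) * ((3 * Mr) * ((2 * (4 * Mr / ar)) * (Mr * (Mr * ((2 * Mr / ar) * (2 * (2 * Mr / ar))))))))"
    (is "_ \<le> ?R")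
  proof -
    have a1: "real (a + 1) \<le> 2 * ar" using pos by (simp add: ar_def)
    show ?thesis
      unfolding of_nat_mult[where 'a=real] of_nat_add[where 'a=real, of "_ * _" "_ * _ * _"] Mr_def[symmetric] ar_def[symmetric] qr_def[symmetric]
      by (intro mult_mono add_mono a1 b1 b2 b4 b5 order_refl; (use pos in \<open>simp; fail\<close>)?)
  qed
  also have "?R = 384 * qr\<^sup>2 * ar * Mr ^ 6 * (real s + qr)"
    using pos by (simp add: field_simps power2_eq_square numeral_eq_Suc)
  finally have F2: "c\<^sup>2 \<le> 384 * qr\<^sup>2 * ar * Mr ^ 6 * (real s + qr)" by (simp add: c_def)
  have "\<eta> ^ 4 * Mr ^ 4 * (qr * ar) \<le> real (2 * M + 1) * (c + real (q * a * (((2 * M + 1) div a + 1) * (M * M))))"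
    using E1 by (simp add: Mr_def ar_def qr_def c_def)
  also have "\<dots> \<le> (3 * Mr) * (c + qr * ar * (4 * Mr / ar * (Mr * Mr)))"
  proof (intro mult_mono add_mono b1 order_refl)
    show "real (q * a * (((2 * M + 1) div a + 1) * (M * M))) \<le> qr * ar * (4 * Mr / ar * (Mr * Mr))"
      unfolding of_nat_mult Mr_def[symmetric] ar_def[symmetric] qr_def[symmetric]
      using b3 pos by (intro mult_left_mono mult_right_mono) auto
  qed (use pos in auto)
  also have "\<dots> = 3 * Mr * c + 12 * qr * Mr ^ 4" using pos by (simp add: field_simps numeral_eq_Suc)
  finally have 1: "\<eta> ^ 4 * Mr ^ 4 * (qr * ar) \<le> 3 * Mr * c + 12 * qr * Mr ^ 4" .
  have "24 * (qr * Mr ^ 4) \<le> (\<eta> ^ 4 * ar) * (qr * Mr ^ 4)"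
    using eta pos by (intro mult_right_mono) (auto simp: ar_def)
  then have "\<eta> ^ 4 * Mr ^ 4 * (qr * ar) \<le> 6 * Mr * c" using 1 by (simp add: algebra_simps)
  also have "\<dots> = Mr * (6 * c)" by simp
  finally have "Mr * (\<eta> ^ 4 * Mr ^ 3 * qr * ar) \<le> Mr * (6 * c)" by (simp add: field_simps numeral_eq_Suc)
  then have "\<eta> ^ 4 * Mr ^ 3 * qr * ar \<le> 6 * c" using pos by (simp only: mult_le_cancel_left_pos)
  then have "(\<eta> ^ 4 * Mr ^ 3 * qr * ar)\<^sup>2 \<le> (6 * c)\<^sup>2" using pos eta by (intro power_mono) auto
  also have "(6 * c)\<^sup>2 = 36 * c\<^sup>2" by (simp add: power_mult_distrib)
  also have "36 * c\<^sup>2 \<le> 36 * (384 * qr\<^sup>2 * ar * Mr ^ 6 * (real s + qr))" using F2 by (rule mult_left_mono) simp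
  finally have "(qr\<^sup>2 * ar * Mr ^ 6) * (\<eta> ^ 8 * ar) \<le> (qr\<^sup>2 * ar * Mr ^ 6) * (13824 * (real s + qr))"
    by (simp add: power_mult_distrib algebra_simps power2_eq_square flip: power_mult power_add)
  moreover have "0 < qr\<^sup>2 * ar * Mr ^ 6" using pos by simp
  ultimately have "\<eta> ^ 8 * ar \<le> 13824 * (real s + qr)" by (simp only: mult_le_cancel_left_pos)
  then show ?thesis by (simp add: ar_def qr_def)
qed

text \<open>The fourth power of the form is bounded by a count. After
  \<open>norm_Lam_square_le\<close> and another Cauchy-Schwarz, the square of each sum over
  \<open>y\<close> opens into products of four characters, whose mean over a class modulo
  \<open>q a\<close> vanishes unless the four frequencies cancel modulo \<open>L\<close>. Such
  quadruples are few by \<open>popular_count\<close>.\<close>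

lemma unpopular_small:
  fixes W :: "int \<Rightarrow> complex" and k :: "int \<Rightarrow> int"
  assumes "q > 0" "L > 0" "prime a" "\<not> a dvd 2 * q" "a \<le> M" "q \<le> M" and n: "n = q * a * L"
    and per: "per n g0" "per n g1" and bd: "one_bounded g0" "one_bounded g1" "one_bounded W"
    and krange: "\<And>r. 0 \<le> k r \<and> k r < int L"
    and unpop: "\<And>r. 0 \<le> r \<Longrightarrow> r < int (q * a) \<Longrightarrow>
       card {r' \<in> {0..<int (q * a)}. r' mod int q = r mod int q \<and> W r' \<noteq> 0 \<and> k r' = k r} \<le> s"
    and eta: "0 < \<eta>" "24 \<le> \<eta> ^ 4 * real a"
    and ge: "\<eta> \<le> norm (Lam n q M g0 g1 (\<lambda>x. W (x mod int (q * a)) * chi n (k (x mod int (q * a)) * x)))"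
  shows "\<eta> ^ 8 * real a \<le> 13824 * (real s + real q)"
proof -
  define Q where "Q = q * a"
  have a0: "a > 0" using assms(3) prime_gt_0_nat by blast
  have Q0: "Q > 0" and M0: "M > 0" and n0: "n > 0" and nQ: "n = Q * L" using assms a0 by (auto simp: Q_def)
  have Qn: "Q dvd n" by (simp add: nQ)
  define f where "f = (\<lambda>x. W (x mod int Q) * chi n (k (x mod int Q) * x))"
  have pf: "per n f" unfolding f_def
    by (rule per_times[OF per_classfun[OF Qn, of W] per_chi_class[OF Qn n0 dvd_refl]])
  define z where "z = (\<lambda>t x y. f (x + int q * y\<^sup>2) * cnj (f (x - t + int q * (y + t)\<^sup>2)))"
  define X where "X = (\<lambda>x t. norm (\<Sum>y\<in>Yt M t. z t x y))"
  define A where "A = {- int M..int M}"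
  have cA: "real (card A) = real (2 * M + 1)" by (simp add: A_def)
  have "\<eta>\<^sup>2 \<le> (norm (Lam n q M g0 g1 f))\<^sup>2" using ge eta by (intro power_mono) (auto simp: f_def Q_def)
  also have "\<dots> \<le> av n (\<lambda>x. (\<Sum>t\<in>A. X x t) / (real M)\<^sup>2)"
    unfolding X_def z_def A_def by (rule norm_Lam_square_le[OF n0 M0 per pf bd(1,2)])
  finally have "\<eta>\<^sup>2 \<le> av n (\<lambda>x. (\<Sum>t\<in>A. X x t) / (real M)\<^sup>2)" .
  then have "(\<eta>\<^sup>2)\<^sup>2 \<le> (norm (av n (\<lambda>x. (\<Sum>t\<in>A. X x t) / (real M)\<^sup>2)))\<^sup>2"
    by (intro power_mono) auto
  also have "\<dots> \<le> av n (\<lambda>x. (norm ((\<Sum>t\<in>A. X x t) / (real M)\<^sup>2))\<^sup>2)" by (rule av_square_le)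
  also have "\<dots> \<le> av n (\<lambda>x. real (2 * M + 1) * (\<Sum>t\<in>A. (X x t)\<^sup>2) / real M ^ 4)"
  proof (rule av_mono)
    fix x
    have "(\<Sum>t\<in>A. 1 * X x t)\<^sup>2 \<le> (\<Sum>t\<in>A. 1\<^sup>2) * (\<Sum>t\<in>A. (X x t)\<^sup>2)" by (rule Cauchy_Schwarz_ineq_sum)
    then have "(\<Sum>t\<in>A. X x t)\<^sup>2 \<le> real (2 * M + 1) * (\<Sum>t\<in>A. (X x t)\<^sup>2)" using cA by simp
    then have "(\<Sum>t\<in>A. X x t)\<^sup>2 / real M ^ 4 \<le> real (2 * M + 1) * (\<Sum>t\<in>A. (X x t)\<^sup>2) / real M ^ 4"
      by (rule divide_right_mono) simp
    moreover have "(norm ((\<Sum>t\<in>A. X x t) / (real M)\<^sup>2))\<^sup>2 = (\<Sum>t\<in>A. X x t)\<^sup>2 / real M ^ 4"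
      by (simp add: power_divide flip: power_mult)
    ultimately show "(norm ((\<Sum>t\<in>A. X x t) / (real M)\<^sup>2))\<^sup>2 \<le> real (2 * M + 1) * (\<Sum>t\<in>A. (X x t)\<^sup>2) / real M ^ 4" by simp
  qed
  also have "\<dots> = real (2 * M + 1) * (\<Sum>t\<in>A. av n (\<lambda>x. (X x t)\<^sup>2)) / real M ^ 4"
    by (simp only: av_divide av_cmult av_sum)
  finally have 1: "\<eta> ^ 4 * real M ^ 4 \<le> real (2 * M + 1) * (\<Sum>t\<in>A. av n (\<lambda>x. (X x t)\<^sup>2))"
    using M0 by (simp add: pos_le_divide_eq flip: power_mult)
  define ind where "ind = (\<lambda>\<rho> t y y'. if W ((\<rho> - t + int q * (y' + t)\<^sup>2) mod int Q) \<noteq> 0 \<and>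
       int L dvd k ((\<rho> + int q * y\<^sup>2) mod int Q) - k ((\<rho> - t + int q * (y + t)\<^sup>2) mod int Q)
         - k ((\<rho> + int q * y'\<^sup>2) mod int Q) + k ((\<rho> - t + int q * (y' + t)\<^sup>2) mod int Q) then 1 else 0 :: real)"
  have fexp: "f (\<rho> + int Q * m + c) = W ((\<rho> + c) mod int Q) * chi n (k ((\<rho> + c) mod int Q) * (\<rho> + c)) * chi L (k ((\<rho> + c) mod int Q) * m)" for \<rho> m c
  proof -
    have m: "(\<rho> + int Q * m + c) mod int Q = (\<rho> + c) mod int Q"
      using class_shift[of "\<rho> + c" Q m] by (simp add: add_ac)
    have "k ((\<rho> + c) mod int Q) * (\<rho> + int Q * m + c) = k ((\<rho> + c) mod int Q) * (\<rho> + c) + int Q * (k ((\<rho> + c) mod int Q) * m)"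
      by (simp add: algebra_simps)
    then show ?thesis unfolding f_def m by (simp add: chi_add nQ chi_scale[OF Q0 assms(2)] mult.assoc)
  qed
  have zz: "norm (av n (\<lambda>x. z t x y * cnj (z t x y'))) \<le> av Q (\<lambda>\<rho>. ind \<rho> t y y')" for t y y'
  proof -
    have "norm (av L (\<lambda>m. z t (\<rho> + int Q * m) y * cnj (z t (\<rho> + int Q * m) y'))) \<le> ind \<rho> t y y'" for \<rho>
    proof -
      define c1 where "c1 = int q * y\<^sup>2"
      define c2 where "c2 = - t + int q * (y + t)\<^sup>2"
      define c3 where "c3 = int q * y'\<^sup>2"
      define c4 where "c4 = - t + int q * (y' + t)\<^sup>2"
      define w where "w = (\<lambda>c. W ((\<rho> + c) mod int Q) * chi n (k ((\<rho> + c) mod int Q) * (\<rho> + c)))"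
      define \<kappa> where "\<kappa> = (\<lambda>c. k ((\<rho> + c) mod int Q))"
      have nw: "norm (w c) \<le> 1" for c using one_boundedD[OF bd(3)] by (simp add: w_def norm_mult)
      have fe: "f (\<rho> + int Q * m + c) = w c * chi L (m * \<kappa> c)" for m c
        unfolding fexp w_def \<kappa>_def by (simp add: mult.commute)
      have "z t (\<rho> + int Q * m) y * cnj (z t (\<rho> + int Q * m) y') =
        (w c1 * cnj (w c2) * cnj (w c3) * w c4) * chi L (m * (\<kappa> c1 - \<kappa> c2 - \<kappa> c3 + \<kappa> c4))" for m
      proof -
        have "z t (\<rho> + int Q * m) y * cnj (z t (\<rho> + int Q * m) y') =
          f (\<rho> + int Q * m + c1) * cnj (f (\<rho> + int Q * m + c2)) * cnj (f (\<rho> + int Q * m + c3)) * f (\<rho> + int Q * m + c4)"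
        proof -
          have a24: "\<rho> + int Q * m - t + int q * (y + t)\<^sup>2 = \<rho> + int Q * m + c2" "\<rho> + int Q * m - t + int q * (y' + t)\<^sup>2 = \<rho> + int Q * m + c4"
            by (simp_all add: c2_def c4_def)
          show ?thesis unfolding z_def a24 c1_def[symmetric] c3_def[symmetric] by (simp add: mult_ac)
        qed
        also have "\<dots> = (w c1 * cnj (w c2) * cnj (w c3) * w c4) * (chi L (m * \<kappa> c1) * chi L (- (m * \<kappa> c2)) * chi L (- (m * \<kappa> c3)) * chi L (m * \<kappa> c4))"
          unfolding fe by (simp add: cnj_chi mult_ac)
        also have "chi L (m * \<kappa> c1) * chi L (- (m * \<kappa> c2)) * chi L (- (m * \<kappa> c3)) * chi L (m * \<kappa> c4) = chi L (m * (\<kappa> c1 - \<kappa> c2 - \<kappa> c3 + \<kappa> c4))"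
          unfolding chi_add[symmetric] by (simp add: algebra_simps)
        finally show ?thesis .
      qed
      then have eq: "av L (\<lambda>m. z t (\<rho> + int Q * m) y * cnj (z t (\<rho> + int Q * m) y')) =
         (w c1 * cnj (w c2) * cnj (w c3) * w c4) * (if int L dvd \<kappa> c1 - \<kappa> c2 - \<kappa> c3 + \<kappa> c4 then 1 else 0)"
        by (simp only: av_cmult av_chi[OF assms(2)])
      have nn: "norm (w c1 * cnj (w c2) * cnj (w c3) * w c4) \<le> 1" using nw by (intro norm_mult_le_1) auto
      have c24: "\<rho> + c2 = \<rho> - t + int q * (y + t)\<^sup>2" "\<rho> + c4 = \<rho> - t + int q * (y' + t)\<^sup>2" by (auto simp: c2_def c4_def)
      show ?thesis
        unfolding eq ind_def c24[symmetric] c1_def[symmetric] c3_def[symmetric] \<kappa>_def[symmetric]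
        using nn by (auto simp: norm_mult \<kappa>_def w_def)
    qed
    then have 2: "av Q (\<lambda>\<rho>. norm (av L (\<lambda>m. z t (\<rho> + int Q * m) y * cnj (z t (\<rho> + int Q * m) y')))) \<le> av Q (\<lambda>\<rho>. ind \<rho> t y y')"
      by (intro av_mono)
    show ?thesis unfolding nQ av_coset by (rule order_trans[OF norm_av_le 2])
  qed
  have XX: "av n (\<lambda>x. (X x t)\<^sup>2) \<le> (\<Sum>y\<in>{0..<int M}. \<Sum>y'\<in>{0..<int M}. av Q (\<lambda>\<rho>. ind \<rho> t y y'))" for t
  proof -
    have i0: "0 \<le> av Q (\<lambda>\<rho>. ind \<rho> t y y')" for y y' by (rule av_nonneg) (simp add: ind_def)
    have "complex_of_real (av n (\<lambda>x. (X x t)\<^sup>2)) = av n (\<lambda>x. (\<Sum>y\<in>Yt M t. z t x y) * cnj (\<Sum>y\<in>Yt M t. z t x y))"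
      unfolding of_real_av X_def by (simp only: complex_norm_square)
    also have "\<dots> = (\<Sum>y\<in>Yt M t. \<Sum>y'\<in>Yt M t. av n (\<lambda>x. z t x y * cnj (z t x y')))"
      unfolding cnj_sum sum_product av_sum ..
    finally have e: "complex_of_real (av n (\<lambda>x. (X x t)\<^sup>2)) = (\<Sum>y\<in>Yt M t. \<Sum>y'\<in>Yt M t. av n (\<lambda>x. z t x y * cnj (z t x y')))" .
    have "av n (\<lambda>x. (X x t)\<^sup>2) \<le> norm (complex_of_real (av n (\<lambda>x. (X x t)\<^sup>2)))" by simp
    also have "\<dots> \<le> (\<Sum>y\<in>Yt M t. \<Sum>y'\<in>Yt M t. norm (av n (\<lambda>x. z t x y * cnj (z t x y'))))"
      unfolding e by (intro order_trans[OF norm_sum] sum_mono norm_sum)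
    also have "\<dots> \<le> (\<Sum>y\<in>Yt M t. \<Sum>y'\<in>Yt M t. av Q (\<lambda>\<rho>. ind \<rho> t y y'))"
      by (intro sum_mono zz)
    also have "\<dots> \<le> (\<Sum>y\<in>{0..<int M}. \<Sum>y'\<in>Yt M t. av Q (\<lambda>\<rho>. ind \<rho> t y y'))"
      using i0 by (intro sum_mono2 sum_nonneg) (auto simp: Yt_def)
    also have "\<dots> \<le> (\<Sum>y\<in>{0..<int M}. \<Sum>y'\<in>{0..<int M}. av Q (\<lambda>\<rho>. ind \<rho> t y y'))"
      using i0 by (intro sum_mono sum_mono2) (auto simp: Yt_def)
    finally show ?thesis .
  qed
  define full where "full = {0..<int Q} \<times> A \<times> {0..<int M} \<times> {0..<int M}"
  have ff: "finite full" by (simp add: full_def A_def)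
  define S where "S = {p \<in> full. case p of (\<rho>, t, y, y') \<Rightarrow> ind \<rho> t y y' = 1}"
  have "(\<Sum>t\<in>A. av n (\<lambda>x. (X x t)\<^sup>2)) \<le> (\<Sum>t\<in>A. \<Sum>y\<in>{0..<int M}. \<Sum>y'\<in>{0..<int M}. av Q (\<lambda>\<rho>. ind \<rho> t y y'))"
    by (intro sum_mono XX)
  also have "\<dots> = av Q (\<lambda>\<rho>. \<Sum>t\<in>A. \<Sum>y\<in>{0..<int M}. \<Sum>y'\<in>{0..<int M}. ind \<rho> t y y')"
    by (simp only: av_sum)
  also have "\<dots> = (\<Sum>\<rho>\<in>{0..<int Q}. \<Sum>t\<in>A. \<Sum>y\<in>{0..<int M}. \<Sum>y'\<in>{0..<int M}. ind \<rho> t y y') / real Q"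
    unfolding av_def sum_int_lessThan[of "\<lambda>\<rho>. \<Sum>t\<in>A. \<Sum>y\<in>{0..<int M}. \<Sum>y'\<in>{0..<int M}. ind \<rho> t y y'"] by simp
  also have "(\<Sum>\<rho>\<in>{0..<int Q}. \<Sum>t\<in>A. \<Sum>y\<in>{0..<int M}. \<Sum>y'\<in>{0..<int M}. ind \<rho> t y y') = (\<Sum>p\<in>full. case p of (\<rho>, t, y, y') \<Rightarrow> ind \<rho> t y y')"
    unfolding full_def by (simp add: sum.cartesian_product A_def split_def)
  also have "\<dots> = (\<Sum>p\<in>full. if (case p of (\<rho>, t, y, y') \<Rightarrow> ind \<rho> t y y' = 1) then 1 else 0)"
    by (intro sum.cong refl) (auto simp: ind_def split: prod.splits)
  also have "\<dots> = real (card S)"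
    using sum.inter_filter[OF ff, of "\<lambda>_. 1::real", symmetric] by (simp add: S_def)
  finally have 2: "(\<Sum>t\<in>A. av n (\<lambda>x. (X x t)\<^sup>2)) \<le> real (card S) / real Q" .
  \<comment> \<open>\<open>popular_count\<close> solves congruences modulo \<open>a\<close> with
    coefficient proportional to t, so the quadruples with \<open>a\<close> dividing t are set apart
    in \<open>T0\<close> and counted trivially.\<close>
  define T where "T = {(\<rho>, t, y, y'). (\<rho>, t, y, y') \<in> S \<and> \<not> int a dvd t}"
  define T0 where "T0 = (SIGMA \<rho>:{0..<int Q}. SIGMA t:{t \<in> {- int M..<- int M + int (2 * M + 1)}. int a dvd t - 0}. {0..<int M} \<times> {0..<int M})"
  have "S \<subseteq> T \<union> T0" by (auto simp: S_def T_def T0_def full_def A_def)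
  moreover have T0: "finite T0 \<and> card T0 \<le> Q * (((2 * M + 1) div a + 1) * (M * M))"
    unfolding T0_def
    by (intro card_Sigma_le conjI finite_filter_int card_cong_le[OF a0]) (auto simp: card_cartesian_product)
  moreover have fT: "finite T"
    by (rule finite_subset[OF _ ff]) (auto simp: T_def S_def)
  ultimately have "card S \<le> card T + Q * (((2 * M + 1) div a + 1) * (M * M))"
    using card_mono[of "T \<union> T0" S] card_Un_le[of T T0] by fastforce
  then have 3: "real (card S) \<le> real (card T) + real (Q * (((2 * M + 1) div a + 1) * (M * M)))"
    by (metis of_nat_add of_nat_le_iff)
  have "\<eta> ^ 4 * real M ^ 4 \<le> real (2 * M + 1) * (real (card S) / real Q)"
    by (rule order_trans[OF 1 mult_left_mono[OF 2]]) simp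
  then have "\<eta> ^ 4 * real M ^ 4 * real Q \<le> real (2 * M + 1) * real (card S)"
    using Q0 by (simp add: pos_le_divide_eq)
  also have "\<dots> \<le> real (2 * M + 1) * (real (card T) + real (Q * (((2 * M + 1) div a + 1) * (M * M))))"
    using 3 by (rule mult_left_mono) simp
  finally have E1: "\<eta> ^ 4 * real M ^ 4 * real (q * a) \<le> real (2 * M + 1) * (real (card T) + real (q * a * (((2 * M + 1) div a + 1) * (M * M))))"
    unfolding Q_def .
  have "T \<subseteq> {(\<rho>, t, y, y'). 0 \<le> \<rho> \<and> \<rho> < int (q * a) \<and> t \<in> {- int M..int M} \<and> \<not> int a dvd t \<and> y \<in> {0..<int M} \<and> y' \<in> {0..<int M} \<and>
       W ((\<rho> - t + int q * (y' + t)\<^sup>2) mod int (q * a)) \<noteq> 0 \<and>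
       int L dvd k ((\<rho> + int q * y\<^sup>2) mod int (q * a)) - k ((\<rho> - t + int q * (y + t)\<^sup>2) mod int (q * a))
         - k ((\<rho> + int q * y'\<^sup>2) mod int (q * a)) + k ((\<rho> - t + int q * (y' + t)\<^sup>2) mod int (q * a))}"
    unfolding T_def S_def full_def A_def ind_def Q_def by (auto split: if_splits)
  from popular_numeric[OF assms(1) a0 assms(5,6) eta E1 popular_count[OF assms(1-6) krange unpop this]]
  show ?thesis .
qed

subsection \<open>Frequencies depending on the class modulo q\<close>

text \<open>Call a frequency popular in a class modulo \<open>q\<close> if more than
  \<open>s\<close> residues modulo \<open>q a\<close> of that class carry it; there are at most
  \<open>H\<close> of these per class. The unpopular part is below \<eta>/2 by
  \<open>unpopular_small\<close>. The rest splits into \<open>H\<close> pieces, the i-th of which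
  uses the i-th popular frequency of every class.\<close>

lemma popular_frequencies:
  fixes W :: "int \<Rightarrow> complex" and k :: "int \<Rightarrow> int"
  assumes "q > 0" "L > 0" "prime a" "\<not> a dvd 2 * q" "a \<le> M" "q \<le> M" and n: "n = q * a * L"
    and per: "per n g0" "per n g1" and bd: "one_bounded g0" "one_bounded g1" "one_bounded W"
    and krange: "\<And>r. 0 \<le> k r \<and> k r < int L"
    and eta: "0 < \<eta>" "384 \<le> \<eta> ^ 4 * real a" "2 ^ 22 * (real s + real q) < \<eta> ^ 8 * real a" "a + 1 \<le> H * (s + 1)"
    and ge: "\<eta> \<le> norm (Lam n q M g0 g1 (\<lambda>x. W (x mod int (q * a)) * chi n (k (x mod int (q * a)) * x)))"
  shows "\<exists>g \<alpha>. per (q * a) g \<and> one_bounded g \<and>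
     (\<forall>x. g x \<noteq> 0 \<longrightarrow> (\<exists>r. 0 \<le> r \<and> r < int (q * a) \<and> r mod int q = x mod int q \<and> W r \<noteq> 0 \<and> k r = \<alpha> (x mod int q))) \<and>
     \<eta> / (2 * real H) \<le> norm (Lam n q M g0 g1 (\<lambda>x. g x * chi n (\<alpha> (x mod int q) * x)))"
proof -
  define Q where "Q = q * a"
  have a0: "a > 0" using assms(3) prime_gt_0_nat by blast
  have Q0: "Q > 0" using assms a0 by (auto simp: Q_def)
  have H0: "H > 0" using eta(4) by (cases H) auto
  define R where "R = (\<lambda>c v. {r' \<in> {0..<int Q}. r' mod int q = c \<and> W r' \<noteq> 0 \<and> k r' = v})"
  define V where "V = (\<lambda>c. {v. s < card (R c v)})"
  have fR: "finite (R c v)" for c v unfolding R_def by (rule finite_filter_int)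
  have fV: "finite (V c)" for c
  proof (rule finite_subset[of _ "k ` {0..<int Q}"])
    show "V c \<subseteq> k ` {0..<int Q}"
    proof
      fix v assume "v \<in> V c"
      then have "R c v \<noteq> {}" by (auto simp: V_def)
      then show "v \<in> k ` {0..<int Q}" by (auto simp: R_def)
    qed
  qed simp
  have cV: "card (V c) \<le> H" for c
  proof -
    have "card (V c) * (s + 1) = (\<Sum>v\<in>V c. s + 1)" by simp
    also have "\<dots> \<le> (\<Sum>v\<in>V c. card (R c v))" by (intro sum_mono) (auto simp: V_def)
    also have "\<dots> = card (\<Union>v\<in>V c. R c v)"
      using fV fR by (intro card_UN_disjoint[symmetric]) (auto simp: R_def)
    also have "\<dots> \<le> card {x \<in> {0..<0 + int Q}. int q dvd x - c}"
    proof (rule card_mono[OF finite_filter_int])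
      show "(\<Union>v\<in>V c. R c v) \<subseteq> {x \<in> {0..<0 + int Q}. int q dvd x - c}"
        using dvd_minus_mod[of "int q"] by (auto simp: R_def)
    qed
    also have "\<dots> \<le> Q div q + 1" by (rule card_cong_le[OF assms(1)])
    also have "\<dots> = a + 1" using assms(1) by (simp add: Q_def)
    also have "\<dots> \<le> H * (s + 1)" by (rule eta(4))
    finally have "card (V c) * (s + 1) \<le> H * (s + 1)" .
    then show ?thesis unfolding mult_le_cancel2 by simp
  qed
  define W1 where "W1 = (\<lambda>r. if k r \<in> V (r mod int q) then 0 else W r)"
  define W2 where "W2 = (\<lambda>r. if k r \<in> V (r mod int q) then W r else 0)"
  define X where "X = (\<lambda>U. Lam n q M g0 g1 (\<lambda>x. U (x mod int (q * a)) * chi n (k (x mod int (q * a)) * x)))"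
  have "card {r' \<in> {0..<int (q * a)}. r' mod int q = r mod int q \<and> W1 r' \<noteq> 0 \<and> k r' = k r} \<le> s" for r
  proof (cases "k r \<in> V (r mod int q)")
    case True
    then have "{r' \<in> {0..<int (q * a)}. r' mod int q = r mod int q \<and> W1 r' \<noteq> 0 \<and> k r' = k r} = {}"
      by (auto simp: W1_def)
    then show ?thesis by (simp only: card.empty)
  next
    case False
    have "card {r' \<in> {0..<int (q * a)}. r' mod int q = r mod int q \<and> W1 r' \<noteq> 0 \<and> k r' = k r} \<le> card (R (r mod int q) (k r))"
      by (rule card_mono[OF fR]) (auto simp: R_def W1_def Q_def split: if_splits)
    also have "\<dots> \<le> s" using False by (simp add: V_def)
    finally show ?thesis .
  qed
  note unpop = this
  have "norm (X W1) < \<eta> / 2"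
  proof (rule ccontr)
    assume "\<not> norm (X W1) < \<eta> / 2"
    then have g: "\<eta> / 2 \<le> norm (Lam n q M g0 g1 (\<lambda>x. W1 (x mod int (q * a)) * chi n (k (x mod int (q * a)) * x)))"
      by (simp add: X_def)
    have e: "0 < \<eta> / 2" "24 \<le> (\<eta> / 2) ^ 4 * real a" using eta by (auto simp: power_divide)
    have b1: "one_bounded W1" using bd(3) by (simp add: one_bounded_def W1_def)
    have "(\<eta> / 2) ^ 8 * real a \<le> 13824 * (real s + real q)"
      by (rule unpopular_small[OF assms(1-6) n per bd(1,2) b1 krange unpop e g])
    then have "\<eta> ^ 8 * real a \<le> 256 * 13824 * (real s + real q)" by (simp add: power_divide)
    also have "\<dots> \<le> 2 ^ 22 * (real s + real q)" by (intro mult_right_mono) auto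
    finally show False using eta(3) by simp
  qed
  moreover have "\<eta> \<le> norm (X W1 + X W2)"
  proof -
    have "X W1 + X W2 = X W"
      unfolding X_def Lam_add[symmetric] by (intro arg_cong[where f = "Lam n q M g0 g1"] ext) (simp add: W1_def W2_def)
    then show ?thesis using ge by (simp add: X_def)
  qed
  ultimately have X2: "\<eta> / 2 \<le> norm (X W2)" using norm_triangle_ineq[of "X W1" "X W2"] by linarith
  \<comment> \<open>An enumeration of the popular frequencies of each class; inverting it gives the
    frequency \<open>\<alpha> c\<close> of the chosen piece.\<close>
  have "\<exists>e. inj_on e (V c) \<and> e ` V c \<subseteq> {..<H}" for c
  proof -
    obtain e and m :: nat where e: "e ` V c = {i. i < m}" "inj_on e (V c)"
      using finite_imp_inj_to_nat_seg[OF fV] by metis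
    have "m = card (V c)" using card_image[OF e(2)] e(1) by simp
    then show ?thesis using e cV[of c] by (intro exI[of _ e]) auto
  qed
  then obtain e where e: "\<And>c. inj_on (e c) (V c)" "\<And>c. e c ` V c \<subseteq> {..<H}" by metis
  define Wi where "Wi = (\<lambda>i r. if k r \<in> V (r mod int q) \<and> e (r mod int q) (k r) = i then W r else 0)"
  have "W2 r = (\<Sum>i<H. Wi i r)" for r
  proof (cases "k r \<in> V (r mod int q)")
    case True
    then have "e (r mod int q) (k r) < H" using e(2) by auto
    then show ?thesis using True by (simp add: W2_def Wi_def)
  qed (simp add: W2_def Wi_def)
  then have "X W2 = (\<Sum>i<H. X (Wi i))"
    unfolding X_def Lam_sum[symmetric] by (simp add: sum_distrib_right)
  then have "\<eta> / 2 \<le> (\<Sum>i<H. norm (X (Wi i)))" using X2 norm_sum order_trans by metis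
  moreover have "\<exists>i<H. \<eta> / (2 * real H) \<le> norm (X (Wi i))"
  proof (rule ccontr)
    assume "\<not> (\<exists>i<H. \<eta> / (2 * real H) \<le> norm (X (Wi i)))"
    then have "(\<Sum>i<H. norm (X (Wi i))) < (\<Sum>i<H. \<eta> / (2 * real H))"
      using H0 by (intro sum_strict_mono) (auto simp: not_le)
    then show False using \<open>\<eta> / 2 \<le> (\<Sum>i<H. norm (X (Wi i)))\<close> H0 by simp
  qed
  ultimately obtain i where i: "\<eta> / (2 * real H) \<le> norm (X (Wi i))" by blast
  define \<alpha> where "\<alpha> = (\<lambda>c. SOME v. v \<in> V c \<and> e c v = i)"
  have \<alpha>: "k r = \<alpha> (r mod int q)" if "Wi i r \<noteq> 0" for r
  proof -
    have r: "k r \<in> V (r mod int q) \<and> e (r mod int q) (k r) = i" using that by (auto simp: Wi_def split: if_splits)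
    then have "\<alpha> (r mod int q) \<in> V (r mod int q) \<and> e (r mod int q) (\<alpha> (r mod int q)) = i"
      unfolding \<alpha>_def by (rule someI)
    then show ?thesis using r e(1)[of "r mod int q"] by (auto dest: inj_onD)
  qed
  define g where "g = (\<lambda>x. Wi i (x mod int Q))"
  have mm: "(x mod int Q) mod int q = x mod int q" for x by (simp add: Q_def mod_mod_cancel)
  have ex: "\<exists>r. 0 \<le> r \<and> r < int (q * a) \<and> r mod int q = x mod int q \<and> W r \<noteq> 0 \<and> k r = \<alpha> (x mod int q)" if "g x \<noteq> 0" for x
  proof (intro exI[of _ "x mod int Q"] conjI)
    show "0 \<le> x mod int Q" "x mod int Q < int (q * a)" using Q0 by (auto simp: Q_def)
    show "W (x mod int Q) \<noteq> 0" using that by (auto simp: g_def Wi_def split: if_splits)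
    show "k (x mod int Q) = \<alpha> (x mod int q)" using \<alpha>[of "x mod int Q"] that by (simp add: g_def mm)
  qed (rule mm)
  have eqf: "(\<lambda>x. g x * chi n (\<alpha> (x mod int q) * x)) = (\<lambda>x. Wi i (x mod int (q * a)) * chi n (k (x mod int (q * a)) * x))"
  proof
    fix x show "g x * chi n (\<alpha> (x mod int q) * x) = Wi i (x mod int (q * a)) * chi n (k (x mod int (q * a)) * x)"
      using \<alpha>[of "x mod int Q"] mm[of x] by (cases "g x = 0") (simp_all add: g_def Q_def)
  qed
  show ?thesis
  proof (intro exI[of _ g] exI[of _ \<alpha>] conjI allI impI)
    show "per (q * a) g" unfolding g_def Q_def by (rule per_classfun) simp
    show "one_bounded g" using bd(3) by (simp add: one_bounded_def g_def Wi_def)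
    show "\<eta> / (2 * real H) \<le> norm (Lam n q M g0 g1 (\<lambda>x. g x * chi n (\<alpha> (x mod int q) * x)))"
      unfolding eqf using i unfolding X_def .
  qed (rule ex)
qed

text \<open>The arguments \<open>x\<close> and x + q y^2 lie in the same class modulo
  \<open>q\<close>, so a weight on classes can move between the first and the third
  function.\<close>

lemma Lam_restrict:
  "Lam n q M (\<lambda>x. P (x mod int q) * u0 x) u1 f = Lam n q M u0 u1 (\<lambda>x. P (x mod int q) * f x)"
  unfolding Lam_def by (simp add: mult_ac)

text \<open>\<open>popular_frequencies\<close> leaves a function of period \<open>q a\<close>
  twisted by frequencies depending on the class modulo \<open>q\<close>.
  \<open>class_frequency_step\<close>, with \<open>d = q\<close> and cyclic groups of order
  \<open>a\<close>, replaces that function by characters. Its minor arc hypothesis with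
  \<open>Rs = {0}\<close> follows from \<open>major_arc\<close>: a frequency j/(q a) with
  \<open>a\<close> not dividing j is minor, as \<open>a\<close> is too large a denominator. The
  clause on \<open>W'\<close> traces every new frequency, modulo \<open>L\<close>, to an old
  one.\<close>

lemma frequency_mod_q:
  fixes W :: "int \<Rightarrow> complex" and \<kappa> :: "int \<Rightarrow> int"
  assumes "q > 0" "L > 0" "prime a" "\<not> a dvd 2 * q" "a \<le> M" and n: "n = q * a * L"
    and rho: "0 < \<rho>" "\<rho> \<le> 1 / 1024" and k: "k \<ge> 1"
    and qa: "real q \<le> \<rho> ^ (40000 * k) * real a"
    and per: "per n g0" "per n g1" and bd: "one_bounded g0" "one_bounded g1" "one_bounded W"
    and krange: "\<And>r. 0 \<le> \<kappa> r \<and> \<kappa> r < int L"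
    and ge: "\<rho> ^ k \<le> norm (Lam n q M g0 g1 (\<lambda>x. W (x mod int (q * a)) * chi n (\<kappa> (x mod int (q * a)) * x)))"
  shows "\<exists>W' \<beta>. one_bounded W' \<and>
     (\<forall>c. W' c \<noteq> 0 \<longrightarrow> (\<exists>r. 0 \<le> r \<and> r < int (q * a) \<and> W r \<noteq> 0 \<and> int L dvd \<beta> c - \<kappa> r)) \<and>
     \<rho> ^ (2500 * k) \<le> norm (Lam n q M g0 g1 (\<lambda>x. W' (x mod int q) * chi n (\<beta> (x mod int q) * x)))"
proof -
  have a0: "a > 0" using assms(3) prime_gt_0_nat by blast
  have M0: "M > 0" using a0 assms(5) by linarith
  have n0: "n > 0" using n assms(1,2) a0 by simp
  have r1: "\<rho> < 1" using rho by simp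
  have dec: "\<rho> ^ j \<le> \<rho> ^ i" if "i \<le> j" for i j using that rho by (intro power_decreasing) auto
  have rp: "\<rho> ^ i > 0" for i using rho by simp
  have kb: "1024 ^ i * \<rho> ^ i \<le> 1" for i
    using power_mono[of "1024 * \<rho>" 1 i] rho by (simp add: power_mult_distrib)
  have big: "1024 ^ i * real q \<le> \<rho> ^ j * real a" if "j + i \<le> 40000 * k" for i j
  proof -
    have "1024 ^ i * real q \<le> 1024 ^ i * (\<rho> ^ (j + i) * real a)"
      using order_trans[OF qa mult_right_mono[OF dec[OF that]]] by (intro mult_left_mono) auto
    also have "\<dots> = (1024 ^ i * \<rho> ^ i) * (\<rho> ^ j * real a)" by (simp add: power_add)
    also have "\<dots> \<le> 1 * (\<rho> ^ j * real a)" using kb rho by (intro mult_right_mono) auto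
    finally show ?thesis by simp
  qed
  have big1: "1024 ^ i \<le> \<rho> ^ j * real a" if "j + i \<le> 40000 * k" for i j
    by (rule order_trans[OF _ big[OF that]]) (use assms(1) in simp)
  have bigM: "1024 ^ i * real q \<le> \<rho> ^ j * real M" if "j + i \<le> 40000 * k" for i j
    using order_trans[OF big[OF that] mult_left_mono[of "real a" "real M" "\<rho> ^ j"]] assms(5) rho by simp
  have bigM1: "1024 ^ i \<le> \<rho> ^ j * real M" if "j + i \<le> 40000 * k" for i j
    using order_trans[OF big1[OF that] mult_left_mono[of "real a" "real M" "\<rho> ^ j"]] assms(5) rho by simp
  have qM: "q \<le> M" using big[of 0 0] assms(5) by simp
  \<comment> \<open>\<open>s\<close> is small enough for \<open>unpopular_small\<close> to fail at
    level \<rho>^k, and \<open>H\<close> is about a/s with a spare factor 1/\<rho>.\<close>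
  define s where "s = nat \<lfloor>\<rho> ^ (8 * k + 3) * real a\<rfloor>"
  define H where "H = nat \<lceil>1 / \<rho> ^ (8 * k + 4)\<rceil>"
  have s1: "real s \<le> \<rho> ^ (8 * k + 3) * real a" using rho by (simp add: s_def)
  have s2: "\<rho> ^ (8 * k + 3) * real a \<le> real s + 1" using rho unfolding s_def by linarith
  have H1: "1 / \<rho> ^ (8 * k + 4) \<le> real H" unfolding H_def by (rule real_nat_ceiling_ge)
  have H2: "real H \<le> 1 / \<rho> ^ (8 * k + 4) + 1" using rho unfolding H_def by (simp add: of_nat_nat; linarith)
  have e1: "(\<rho> ^ k) ^ 4 = \<rho> ^ (4 * k)" "(\<rho> ^ k) ^ 8 = \<rho> ^ (8 * k)" by (simp_all add: mult.commute flip: power_mult)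
  have p1: "384 \<le> (\<rho> ^ k) ^ 4 * real a"
    unfolding e1 using big1[of "4 * k" 1] k by simp
  have p2: "2 ^ 22 * (real s + real q) < (\<rho> ^ k) ^ 8 * real a"
  proof -
    have "1024 ^ 3 * real s \<le> (1024 ^ 3 * \<rho> ^ 3) * (\<rho> ^ (8 * k) * real a)" using s1 by (simp add: power_add mult_ac)
    also have "\<dots> \<le> 1 * (\<rho> ^ (8 * k) * real a)" using kb[of 3] rho by (intro mult_right_mono) auto
    finally have "1024 ^ 3 * real s \<le> \<rho> ^ (8 * k) * real a" by simp
    moreover have "1024 ^ 3 * real q \<le> \<rho> ^ (8 * k) * real a" using big[of "8 * k" 3] k by simp
    moreover have "0 < \<rho> ^ (8 * k) * real a" using rho a0 by simp
    ultimately show ?thesis unfolding e1 by simp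
  qed
  have p3: "a + 1 \<le> H * (s + 1)"
  proof -
    have "real (a + 1) \<le> 1024 * real a" using a0 by simp
    also have "\<dots> \<le> (1 / \<rho>) * real a" using rho by (intro mult_right_mono) (auto simp: field_simps)
    also have "\<dots> = 1 / \<rho> ^ (8 * k + 4) * (\<rho> ^ (8 * k + 3) * real a)" using rho by (simp add: power_add field_simps numeral_eq_Suc)
    also have "\<dots> \<le> real H * (real s + 1)" using H1 s2 rho by (intro mult_mono) auto
    also have "\<dots> = real (H * (s + 1))" by (simp only: of_nat_mult of_nat_add of_nat_1)
    finally show ?thesis by (simp only: of_nat_le_iff)
  qed
  obtain g \<alpha> where g: "per (q * a) g" "one_bounded g"
    and gW: "\<And>x. g x \<noteq> 0 \<Longrightarrow> \<exists>r. 0 \<le> r \<and> r < int (q * a) \<and> r mod int q = x mod int q \<and> W r \<noteq> 0 \<and> \<kappa> r = \<alpha> (x mod int q)"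
    and gge: "\<rho> ^ k / (2 * real H) \<le> norm (Lam n q M g0 g1 (\<lambda>x. g x * chi n (\<alpha> (x mod int q) * x)))"
    using popular_frequencies[OF assms(1-5) qM n per bd krange rp p1 p2 p3 ge] by blast
  \<comment> \<open>Exponent after the choice of a popular frequency: k + 8k + 5 <= 14k.\<close>
  define k1 where "k1 = 14 * k"
  have l1: "\<rho> ^ k1 \<le> \<rho> ^ k / (2 * real H)"
  proof -
    have "1 \<le> 1 / \<rho> ^ (8 * k + 4)" using rho r1 by (simp add: power_le_one)
    then have "2 * real H \<le> 4 * (1 / \<rho> ^ (8 * k + 4))" using H2 by linarith
    also have "\<dots> \<le> (1 / \<rho>) * (1 / \<rho> ^ (8 * k + 4))" using rho by (intro mult_right_mono) (auto simp: field_simps)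
    also have "\<dots> = 1 / \<rho> ^ (8 * k + 5)" by (simp add: power_add field_simps numeral_eq_Suc)
    finally have "2 * real H * \<rho> ^ (8 * k + 5) \<le> 1" using rho by (simp add: pos_le_divide_eq)
    moreover have "0 < real H" using H1 rp[of "8 * k + 4"] by (meson divide_pos_pos less_le_trans zero_less_one)
    ultimately have "\<rho> ^ (8 * k + 5) \<le> 1 / (2 * real H)" by (simp add: pos_le_divide_eq mult.commute)
    then have "\<rho> ^ k * \<rho> ^ (8 * k + 5) \<le> \<rho> ^ k * (1 / (2 * real H))" using rp by (intro mult_left_mono) (auto intro: less_imp_le)
    moreover have "\<rho> ^ k1 \<le> \<rho> ^ k * \<rho> ^ (8 * k + 5)"
      unfolding power_add[symmetric] k1_def using k by (intro dec) simp
    ultimately show ?thesis by simp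
  qed
  \<comment> \<open>The classes modulo \<open>q\<close> that meet the support of \<open>g\<close>.
    Restricting the first function to them confines the weights found below to them as well, so the
    origin of the frequencies \<open>\<alpha>\<close> is not lost.\<close>
  define G where "G = {c. \<exists>x. x mod int q = c \<and> g x \<noteq> 0}"
  define P where "P = (\<lambda>c. if c \<in> G then 1 else 0 :: complex)"
  define u0 where "u0 = (\<lambda>x. P (x mod int q) * g0 x)"
  have qn: "q dvd n" by (simp add: n)
  have pu0: "per n u0" unfolding u0_def by (rule per_times[OF per_classfun[OF qn, of P] per(1)])
  have bu0: "one_bounded u0" using bd(1) by (auto simp: one_bounded_def u0_def P_def)
  have restr: "Lam n q M u0 g1 f = Lam n q M g0 g1 (\<lambda>x. P (x mod int q) * f x)" for f
    unfolding u0_def by (rule Lam_restrict)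
  have ge1: "\<rho> ^ k1 \<le> norm (Lam n q M u0 g1 (\<lambda>x. g x * chi n (\<alpha> (x mod int q) * x)))"
  proof -
    have "(\<lambda>x. P (x mod int q) * (g x * chi n (\<alpha> (x mod int q) * x))) = (\<lambda>x. g x * chi n (\<alpha> (x mod int q) * x))"
      by (rule ext) (auto simp: P_def G_def)
    then show ?thesis unfolding restr using order_trans[OF l1 gge] by simp
  qed
  define J where "J = nat \<lceil>1 / \<rho> ^ (8 * k1 + 1)\<rceil>"
  define X where "X = \<rho> ^ (16 * k1) * real M / 2 ^ 22"
  define T where "T = nat \<lfloor>X\<rfloor>"
  define K where "K = 1 / \<rho> ^ (16 * k1 + 3)"
  define \<zeta> where "\<zeta> = (\<rho> ^ k1) ^ 16 / (2 ^ 22 * K)"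
  have e2: "(\<rho> ^ k1) ^ 4 = \<rho> ^ (4 * k1)" "(\<rho> ^ k1) ^ 8 = \<rho> ^ (8 * k1)" "(\<rho> ^ k1) ^ 16 = \<rho> ^ (16 * k1)"
    by (simp_all add: mult.commute flip: power_mult)
  have J1: "1 / \<rho> ^ (8 * k1 + 1) \<le> real J" unfolding J_def by (rule real_nat_ceiling_ge)
  have J2: "real J \<le> 1 / \<rho> ^ (8 * k1 + 1) + 1" using rho unfolding J_def by (simp add: of_nat_nat; linarith)
  have J512: "512 / (\<rho> ^ k1) ^ 8 \<le> real J"
  proof -
    have "512 / \<rho> ^ (8 * k1) \<le> (1 / \<rho>) / \<rho> ^ (8 * k1)" using rho by (intro divide_right_mono) (auto simp: field_simps)
    also have "\<dots> = 1 / \<rho> ^ (8 * k1 + 1)" by simp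
    finally show ?thesis using J1 by (simp add: e2)
  qed
  have J0: "J > 0"
  proof -
    have "0 < 512 / (\<rho> ^ k1) ^ 8" using rho by simp
    then show ?thesis using J512 by linarith
  qed
  have Jsq: "(real J)\<^sup>2 \<le> 1 / \<rho> ^ (16 * k1 + 3)"
  proof -
    have "1 \<le> 1 / \<rho> ^ (8 * k1 + 1)" using rho r1 by (simp add: power_le_one mult_le_one)
    then have "real J \<le> 2 * (1 / \<rho> ^ (8 * k1 + 1))" using J2 by linarith
    then have "(real J)\<^sup>2 \<le> (2 * (1 / \<rho> ^ (8 * k1 + 1)))\<^sup>2" by (intro power_mono) auto
    also have "\<dots> = 4 * (1 / \<rho> ^ (16 * k1 + 2))"
    proof -
      have "(\<rho> ^ (8 * k1 + 1))\<^sup>2 = \<rho> ^ (16 * k1 + 2)"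
        unfolding power_mult[symmetric] by (rule arg_cong[where f = "power \<rho>"]) simp
      then show ?thesis by (simp only: power_mult_distrib power_divide) simp
    qed
    also have "\<dots> \<le> (1 / \<rho>) * (1 / \<rho> ^ (16 * k1 + 2))" using rho by (intro mult_right_mono) (auto simp: field_simps)
    also have "\<dots> = 1 / \<rho> ^ (16 * k1 + 3)" by (simp add: power_add field_simps numeral_eq_Suc)
    finally show ?thesis .
  qed
  have tauq: "32 * real q * (real J)\<^sup>2 \<le> (\<rho> ^ k1) ^ 4 * real M"
  proof -
    have "32 * real q * (real J)\<^sup>2 \<le> 1024 * real q * (1 / \<rho> ^ (16 * k1 + 3))"
      using Jsq by (intro mult_mono) auto
    also have "\<dots> \<le> (\<rho> ^ (20 * k1 + 3) * real M) * (1 / \<rho> ^ (16 * k1 + 3))"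
      using bigM[of "20 * k1 + 3" 1] k rho by (intro mult_right_mono) (auto simp: k1_def)
    also have "\<dots> = \<rho> ^ (4 * k1) * real M"
    proof -
      have "20 * k1 + 3 = 4 * k1 + (16 * k1 + 3)" by simp
      then have "\<rho> ^ (20 * k1 + 3) = \<rho> ^ (4 * k1) * \<rho> ^ (16 * k1 + 3)" by (simp only: power_add)
      then show ?thesis using rp[of "16 * k1 + 3"] rho by simp
    qed
    finally show ?thesis by (simp add: e2)
  qed
  have X1: "1 \<le> X" using bigM1[of "16 * k1" 3] k by (simp add: X_def k1_def)
  have T0: "T > 0" using X1 by (simp add: T_def)
  have "X < real T + 1" using X1 unfolding T_def by linarith
  moreover have "1 \<le> real T" using T0 by simp
  ultimately have "X \<le> 2 * real T" by linarith
  moreover have "real T \<le> X" using X1 unfolding T_def by linarith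
  ultimately have TX: "real T \<le> X" "X \<le> 2 * real T" by blast+
  have T16: "16 * real T \<le> ((\<rho> ^ k1) ^ 8 / 512)\<^sup>2 * real M"
  proof -
    have "((\<rho> ^ k1) ^ 8 / 512)\<^sup>2 * real M = 16 * X" unfolding e2 X_def by (simp add: power_divide flip: power_mult)
    then show ?thesis using TX by simp
  qed
  have K1: "1 * (1 + real a / real T) \<le> K"
  proof -
    have "real a / real T \<le> real M / (X / 2)" using assms(5) TX X1 T0 by (intro frac_le) auto
    also have "\<dots> = 2 ^ 23 / \<rho> ^ (16 * k1)" using M0 rho by (simp add: X_def)
    finally have "real a / real T \<le> 2 ^ 23 / \<rho> ^ (16 * k1)" .
    moreover have "1 \<le> 2 ^ 23 / \<rho> ^ (16 * k1)"
    proof -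
      have "\<rho> ^ (16 * k1) \<le> 1" using rho r1 by (simp add: power_le_one)
      then show ?thesis using rp[of "16 * k1"] by simp
    qed
    ultimately have "1 * (1 + real a / real T) \<le> 2 ^ 24 / \<rho> ^ (16 * k1)" by simp
    also have "\<dots> \<le> (1 / \<rho> ^ 3) / \<rho> ^ (16 * k1)"
      using kb[of 3] rp[of 3] rp[of "16 * k1"] by (intro divide_right_mono) (auto simp: pos_le_divide_eq)
    also have "\<dots> = K" by (simp add: K_def power_add mult.commute)
    finally show ?thesis .
  qed
  have K0: "K > 0" using rho by (simp add: K_def)
  have zlow: "\<rho> ^ (32 * k1 + 6) \<le> \<zeta>"
  proof -
    have "\<zeta> = \<rho> ^ (16 * k1) * \<rho> ^ (16 * k1 + 3) / 2 ^ 22" using rho by (simp add: \<zeta>_def e2 K_def)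
    also have "\<rho> ^ (16 * k1) * \<rho> ^ (16 * k1 + 3) = \<rho> ^ (32 * k1 + 3)" unfolding power_add[symmetric] by simp
    finally have z: "\<zeta> = \<rho> ^ (32 * k1 + 3) / 2 ^ 22" .
    have "\<rho> ^ (32 * k1 + 6) = \<rho> ^ (32 * k1 + 3) * \<rho> ^ 3"
      unfolding power_add[symmetric] by (rule arg_cong[where f = "power \<rho>"]) simp
    also have "\<dots> \<le> \<rho> ^ (32 * k1 + 3) * (1 / 2 ^ 22)"
      using kb[of 3] rp by (intro mult_left_mono) (auto intro: less_imp_le)
    finally show ?thesis by (simp add: z)
  qed
  define k2 where "k2 = 64 * k1 + 13"
  have z2: "\<rho> ^ k2 \<le> \<zeta>\<^sup>2 / 2"
  proof -
    have "(\<rho> ^ (32 * k1 + 6))\<^sup>2 \<le> \<zeta>\<^sup>2" using zlow rho by (intro power_mono) auto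
    moreover have "\<rho> ^ k2 = (\<rho> ^ (32 * k1 + 6))\<^sup>2 * \<rho>"
      unfolding k2_def power_mult[symmetric] power_Suc2[symmetric] by (rule arg_cong[where f = "power \<rho>"]) simp
    moreover have "(\<rho> ^ (32 * k1 + 6))\<^sup>2 * \<rho> \<le> (\<rho> ^ (32 * k1 + 6))\<^sup>2 * (1 / 2)" using rho by (intro mult_left_mono) auto
    ultimately show ?thesis by simp
  qed
  \<comment> \<open>Differences of shift coefficients are below J^2 <= a, hence coprime to the prime
    \<open>a\<close>, as is 2q.\<close>
  have gam: "real_of_int (gcd ((2 * int q) * e) (int a)) \<le> 1" if "e \<noteq> 0" "\<bar>e\<bar> < int J ^ 2" for e
  proof -
    have "(real J)\<^sup>2 \<le> real a"
    proof -
      have "1 \<le> \<rho> ^ (16 * k1 + 3) * real a" using big1[of "16 * k1 + 3" 0] k by (simp add: k1_def)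
      then have "1 / \<rho> ^ (16 * k1 + 3) \<le> real a" using rp[of "16 * k1 + 3"] by (simp add: pos_divide_le_eq mult.commute)
      then show ?thesis using Jsq by linarith
    qed
    then have "int J ^ 2 \<le> int a" by (metis of_nat_le_iff of_nat_power)
    with that(2) have "\<bar>e\<bar> < int a" by (rule less_le_trans)
    then have "\<not> int a dvd \<bar>e\<bar>" using that(1) by (intro zdvd_not_zless) auto
    then have "\<not> int a dvd e" by simp
    moreover have "\<not> int a dvd 2 * int q" using assms(4) by (metis int_dvd_int_iff of_nat_mult of_nat_numeral)
    moreover have pa: "prime (int a)" using assms(3) by simp
    ultimately have "\<not> int a dvd (2 * int q) * e" by (simp add: prime_dvd_mult_iff)
    then have "coprime (int a) ((2 * int q) * e)" using pa by (rule prime_imp_coprime[rotated])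
    then show ?thesis by (simp add: coprime_iff_gcd_eq_1 gcd.commute)
  qed
  have minor: "norm (Lam n q M h0 h1 (\<lambda>x. U (x mod int q) * chi (q * a) (j (x mod int q) * x))) \<le> \<zeta>\<^sup>2 / 2"
    if h: "per n h0" "per n h1" "one_bounded h0" "one_bounded h1" "one_bounded U"
      and nz: "\<And>r. 0 \<le> r \<Longrightarrow> r < int q \<Longrightarrow> U r \<noteq> 0 \<Longrightarrow> j r mod int a \<notin> {0}" for h0 h1 U j
  proof (rule ccontr)
    assume "\<not> ?thesis"
    moreover have "chi (q * a) (j (x mod int q) * x) = chi n ((int L * j (x mod int q)) * x)" for x
      unfolding n using chi_div[of "q * a" L "j (x mod int q) * x"] assms(1,2) a0 by (simp add: mult.assoc)
    ultimately have ge: "\<rho> ^ k2 \<le> norm (Lam n q M h0 h1 (\<lambda>x. U (x mod int q) * chi n ((int L * j (x mod int q)) * x)))"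
      using z2 by simp
    have pw: "(\<rho> ^ k2) ^ 22 = \<rho> ^ (22 * k2)" "(\<rho> ^ k2) ^ 28 = \<rho> ^ (28 * k2)" "(\<rho> ^ k2) ^ 10 = \<rho> ^ (10 * k2)"
      by (simp_all add: mult.commute flip: power_mult)
    have M18: "10 ^ 18 \<le> (\<rho> ^ k2) ^ 22 * real M"
      unfolding pw using bigM1[of "22 * k2" 6] k by (simp add: k2_def k1_def)
    obtain c kk m :: int where c: "0 \<le> c" "c < int q" "U c \<noteq> 0" and kk: "1 \<le> kk" "real_of_int kk \<le> 10 ^ 7 / (\<rho> ^ k2) ^ 10"
      and near: "\<bar>of_int (kk * int q * (int L * j c)) / real n - of_int m\<bar> \<le> 10 ^ 19 / ((\<rho> ^ k2) ^ 28 * (real M)\<^sup>2)"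
      using major_arc[OF n0 assms(1) qn h(1,2) h(3,4,5) rp _ M18 ge] rho r1 by (auto simp: power_le_one)
    define u where "u = real_of_int (kk * int q * (int L * j c)) / real n"
    have "u = of_int (kk * j c) / real a"
      using assms(1,2) a0 unfolding u_def n by (simp add: field_simps)
    then have "of_int (kk * j c) - of_int m * real a = real a * (u - of_int m)"
      using a0 by (simp add: field_simps)
    then have "\<bar>of_int (kk * j c) - of_int m * real a\<bar> = real a * \<bar>u - of_int m\<bar>"
      by (simp only: abs_mult abs_of_nat)
    also have "\<dots> \<le> real M * (10 ^ 19 / ((\<rho> ^ k2) ^ 28 * (real M)\<^sup>2))" using near[folded u_def] assms(5) by (intro mult_mono) auto
    also have "\<dots> = 10 ^ 19 / (\<rho> ^ (28 * k2) * real M)" using M0 by (simp add: pw power2_eq_square)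
    also have "\<dots> < 1"
    proof -
      have "1024 ^ 7 \<le> \<rho> ^ (28 * k2) * real M" using k by (intro bigM1) (simp add: k2_def k1_def)
      then have "10 ^ 19 < \<rho> ^ (28 * k2) * real M" by simp
      then show ?thesis using M0 rho by simp
    qed
    finally have "\<bar>real_of_int (kk * j c - m * int a)\<bar> < 1" by simp
    then have "kk * j c = m * int a" by linarith
    then have "int a dvd kk * j c" by simp
    moreover have "\<not> int a dvd j c" using nz[OF c] by (simp add: dvd_eq_mod_eq_0)
    ultimately have "int a dvd kk" using assms(3) by (simp add: prime_dvd_mult_iff)
    then have "int a \<le> kk" using kk(1) by (simp add: zdvd_imp_le)
    then have "real a \<le> 10 ^ 7 / \<rho> ^ (10 * k2)" using kk(2) unfolding pw by linarith
    then have "\<rho> ^ (10 * k2) * real a \<le> 10 ^ 7" using rho by (simp add: pos_le_divide_eq mult.commute)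
    moreover have "1024 ^ 3 \<le> \<rho> ^ (10 * k2) * real a" using k by (intro big1) (simp add: k2_def k1_def)
    ultimately show False by simp
  qed
  have nq: "n = q * a * L" by (rule n)
  \<comment> \<open>Differencing by multiples of \<tau> = q: the shifts stay inside the classes
    modulo \<open>q\<close>, and \<open>d\<close> divides \<tau>, so the twist by
    \<open>\<alpha>\<close> survives.\<close>
  have Dq: "2 * int q * int q = int q * (2 * int q)" by simp
  have ar: "(\<forall>c. \<alpha> c = 0) \<or> q dvd q" by simp
  have "\<exists>U j. one_bounded U \<and> \<zeta> ^ 4 / (2 * real 1 * K) \<le>
     norm (Lam n q M u0 g1 (\<lambda>x. U (x mod int q) * chi (q * a) (j (x mod int q) * x) * chi n (\<alpha> (x mod int q) * x)))"
    by (rule class_frequency_step[where Rs = "{0}" and \<gamma> = 1 and ?m0.0 = 1, OF assms(1) a0 assms(2) M0 J0 T0 assms(1) nq Dq ar pu0 per(2) g(1) bu0 bd(2) g(2) rp _ ge1 J512 tauq T16 gam K1 order_refl \<zeta>_def _ _ _ minor])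
      (use rho r1 in \<open>auto simp: power_le_one\<close>)
  then obtain U j where U: "one_bounded U" and Uge: "\<zeta> ^ 4 / (2 * K) \<le>
     norm (Lam n q M u0 g1 (\<lambda>x. U (x mod int q) * chi (q * a) (j (x mod int q) * x) * chi n (\<alpha> (x mod int q) * x)))" by auto
  define W' where "W' = (\<lambda>c. P c * U c)"
  \<comment> \<open>Characters modulo \<open>q a\<close> are characters modulo \<open>n\<close> with
    frequency divisible by \<open>L\<close>, so \<open>\<beta>\<close> agrees with
    \<open>\<alpha>\<close> modulo \<open>L\<close>.\<close>
  define \<beta> where "\<beta> = (\<lambda>c. int L * j c + \<alpha> c)"
  have "Lam n q M u0 g1 (\<lambda>x. U (x mod int q) * chi (q * a) (j (x mod int q) * x) * chi n (\<alpha> (x mod int q) * x))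
    = Lam n q M g0 g1 (\<lambda>x. W' (x mod int q) * chi n (\<beta> (x mod int q) * x))"
  proof -
    have "chi (q * a) (j (x mod int q) * x) = chi n (int L * j (x mod int q) * x)" for x
      unfolding n using chi_div[of "q * a" L "j (x mod int q) * x"] assms(1,2) a0 by (simp add: mult.assoc)
    then show ?thesis unfolding restr W'_def \<beta>_def by (simp add: distrib_right chi_add mult.assoc)
  qed
  \<comment> \<open>The loss is 144 k1 + 28 = 2016 k + 28 <= 2500 k.\<close>
  moreover have "\<rho> ^ (2500 * k) \<le> \<zeta> ^ 4 / (2 * K)"
  proof -
    have "\<rho> ^ (2500 * k) \<le> \<rho> ^ ((32 * k1 + 6) * 4 + (16 * k1 + 3) + 1)" using k by (intro dec) (simp add: k1_def)
    also have "\<dots> = (\<rho> ^ (32 * k1 + 6)) ^ 4 * \<rho> ^ (16 * k1 + 3) * \<rho>" by (simp only: power_add power_mult power_one_right)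
    also have "\<dots> \<le> \<zeta> ^ 4 * \<rho> ^ (16 * k1 + 3) * (1 / 2)"
      using zlow rho by (intro mult_mono power_mono) auto
    also have "\<dots> = \<zeta> ^ 4 / (2 * K)" by (simp add: K_def)
    finally show ?thesis .
  qed
  ultimately have "\<rho> ^ (2500 * k) \<le> norm (Lam n q M g0 g1 (\<lambda>x. W' (x mod int q) * chi n (\<beta> (x mod int q) * x)))"
    using Uge by simp
  moreover have "one_bounded W'" using U by (auto simp: one_bounded_def W'_def P_def)
  moreover have "\<exists>r. 0 \<le> r \<and> r < int (q * a) \<and> W r \<noteq> 0 \<and> int L dvd \<beta> c - \<kappa> r" if "W' c \<noteq> 0" for c
  proof -
    have "c \<in> G" using that by (auto simp: W'_def P_def split: if_splits)
    then obtain x where x: "x mod int q = c" "g x \<noteq> 0" by (auto simp: G_def)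
    then obtain r where r: "0 \<le> r" "r < int (q * a)" "W r \<noteq> 0" "\<kappa> r = \<alpha> c" using gW[of x] by auto
    then show ?thesis by (intro exI[of _ r]) (simp add: \<beta>_def)
  qed
  ultimately show ?thesis by blast
qed

subsection \<open>Major arc frequencies\<close>

text \<open>The conclusion of \<open>major_arc\<close> for a single frequency, at level
  \<eta>.\<close>

definition major :: "nat \<Rightarrow> nat \<Rightarrow> nat \<Rightarrow> real \<Rightarrow> int \<Rightarrow> bool" where
  "major n q M \<eta> \<beta> \<longleftrightarrow> (\<exists>k m::int. 1 \<le> k \<and> real_of_int k \<le> 10 ^ 7 / \<eta> ^ 10 \<and>
    \<bar>of_int (k * int q * \<beta>) / real n - of_int m\<bar> \<le> 10 ^ 19 / (\<eta> ^ 28 * (real M)\<^sup>2))"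

text \<open>If k \<beta> = m a L + \<theta> with \<theta> small, then u = \<beta> mod L satisfies k
  u = \<theta> + L w with w small, and the triple (k, \<theta>, w) determines u.\<close>

lemma major_count:
  assumes "q > 0" "a > 0" "L > 0" and n: "n = q * a * L"
    and Q: "10 ^ 7 / \<eta> ^ 10 \<le> Q" "1 \<le> Q" and B: "10 ^ 19 / (\<eta> ^ 28 * (real M)\<^sup>2) * (real a * real L) \<le> B" "0 \<le> B"
  shows "real (card {u \<in> {0..<int L}. \<exists>\<beta>. \<beta> mod int L = u \<and> major n q M \<eta> \<beta>}) \<le> Q * ((2 * B + 1) * (2 * (Q + B) + 1))"
proof -
  define Qi where "Qi = \<lfloor>Q\<rfloor>"
  define Bi where "Bi = \<lfloor>B\<rfloor>"
  have Qi: "1 \<le> Qi" "real_of_int Qi \<le> Q" and Bi: "0 \<le> Bi" "real_of_int Bi \<le> B"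
    using Q(2) B(2) by (auto simp: Qi_def Bi_def le_floor_iff)
  define Z where "Z = {1..Qi} \<times> {- Bi..Bi} \<times> {- (Qi + Bi)..Qi + Bi}"
  have "{u \<in> {0..<int L}. \<exists>\<beta>. \<beta> mod int L = u \<and> major n q M \<eta> \<beta>} \<subseteq> (\<lambda>(k, \<theta>, w). (\<theta> + int L * w) div k) ` Z"
  proof
    fix u assume u: "u \<in> {u \<in> {0..<int L}. \<exists>\<beta>. \<beta> mod int L = u \<and> major n q M \<eta> \<beta>}"
    then obtain \<beta> k m where \<beta>: "\<beta> mod int L = u" and k: "1 \<le> k" "real_of_int k \<le> 10 ^ 7 / \<eta> ^ 10"
      and near: "\<bar>of_int (k * int q * \<beta>) / real n - of_int m\<bar> \<le> 10 ^ 19 / (\<eta> ^ 28 * (real M)\<^sup>2)"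
      by (auto simp: major_def)
    have ur: "0 \<le> u" "u < int L" using u by auto
    have kQ: "k \<le> Qi" using k(2) Q(1) by (simp add: Qi_def le_floor_iff)
    define \<theta> where "\<theta> = k * \<beta> - m * int a * int L"
    define w where "w = m * int a - k * (\<beta> div int L)"
    define z where "z = real_of_int (k * int q * \<beta>) / real n"
    have "z = of_int (k * \<beta>) / (real a * real L)" using assms by (simp add: z_def field_simps)
    then have "real_of_int \<theta> = (real a * real L) * (z - of_int m)"
      using assms by (simp add: \<theta>_def field_simps)
    then have "\<bar>real_of_int \<theta>\<bar> = (real a * real L) * \<bar>z - of_int m\<bar>" by (simp add: abs_mult)
    also have "\<dots> \<le> (real a * real L) * (10 ^ 19 / (\<eta> ^ 28 * (real M)\<^sup>2))"
      using near by (intro mult_left_mono) (auto simp: z_def)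
    also have "\<dots> \<le> B" using B(1) by (simp only: mult.commute)
    finally have "of_int \<bar>\<theta>\<bar> \<le> B" by simp
    then have "\<bar>\<theta>\<bar> \<le> Bi" by (simp add: Bi_def le_floor_iff)
    have "\<beta> = int L * (\<beta> div int L) + u" using \<beta> by (metis mult_div_mod_eq)
    then have "k * \<beta> = k * (int L * (\<beta> div int L)) + k * u" by (metis distrib_left)
    then have ku: "\<theta> + int L * w = k * u" by (simp add: \<theta>_def w_def algebra_simps)
    have "\<bar>int L * w\<bar> \<le> int L * (Qi + Bi)"
    proof -
      have "0 \<le> k * u" "k * u \<le> Qi * int L" using k(1) kQ ur Qi by (auto intro!: mult_mono)
      moreover have "Bi \<le> int L * Bi" using assms(3) Bi by (simp add: mult_le_cancel_right1)
      ultimately show ?thesis using ku \<open>\<bar>\<theta>\<bar> \<le> Bi\<close> by (simp add: distrib_left mult.commute; linarith)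
    qed
    then have "int L * \<bar>w\<bar> \<le> int L * (Qi + Bi)" by (simp add: abs_mult)
    then have "\<bar>w\<bar> \<le> Qi + Bi" using assms(3) by simp
    then have "(k, \<theta>, w) \<in> Z" using k kQ \<open>\<bar>\<theta>\<bar> \<le> Bi\<close> by (auto simp: Z_def)
    moreover have "u = (\<theta> + int L * w) div k" using ku k(1) by simp
    ultimately show "u \<in> (\<lambda>(k, \<theta>, w). (\<theta> + int L * w) div k) ` Z" by force
  qed
  then have "card {u \<in> {0..<int L}. \<exists>\<beta>. \<beta> mod int L = u \<and> major n q M \<eta> \<beta>} \<le> card Z"
    by (rule surj_card_le[rotated]) (simp add: Z_def)
  also have "card Z = nat Qi * (nat (2 * Bi + 1) * nat (2 * (Qi + Bi) + 1))"
    unfolding Z_def card_cartesian_product card_atLeastAtMost_int by (simp add: algebra_simps)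
  finally have "real (card {u \<in> {0..<int L}. \<exists>\<beta>. \<beta> mod int L = u \<and> major n q M \<eta> \<beta>}) \<le> real (nat Qi * (nat (2 * Bi + 1) * nat (2 * (Qi + Bi) + 1)))"
    by (simp only: of_nat_le_iff)
  also have "\<dots> = real_of_int Qi * ((2 * real_of_int Bi + 1) * (2 * (real_of_int Qi + real_of_int Bi) + 1))"
    using Qi Bi by simp
  also have "\<dots> \<le> Q * ((2 * B + 1) * (2 * (Q + B) + 1))"
    using Qi Bi Q B by (intro mult_mono) auto
  finally show ?thesis .
qed

text \<open>A frequency divisible by \<open>L\<close> gives a character modulo \<open>Q\<close>. It
  is constant on classes modulo \<open>Q\<close> and can be counted as part of the weight.\<close>

lemma reduce_frequency_mod:
  fixes W :: "int \<Rightarrow> complex" and j :: "int \<Rightarrow> int"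
  assumes "Q > 0" "L > 0" and n: "n = Q * L"
  shows "W (x mod int Q) * chi n (j (x mod int Q) * x) =
    (W (x mod int Q) * chi Q ((j (x mod int Q) div int L) * (x mod int Q))) * chi n ((j (x mod int Q) mod int L) * x)"
proof -
  define t where "t = j (x mod int Q) div int L"
  have "j (x mod int Q) * x = int L * (t * x) + (j (x mod int Q) mod int L) * x"
    unfolding t_def by (metis distrib_right mult.assoc mult_div_mod_eq)
  then have "chi n (j (x mod int Q) * x) = chi Q (t * x) * chi n ((j (x mod int Q) mod int L) * x)"
    unfolding n by (simp only: chi_add chi_div[OF assms(1,2)])
  moreover have "chi Q (t * x) = chi Q (t * (x mod int Q))"
  proof (rule chi_eq[OF assms(1)])
    have "t * x = t * (int Q * (x div int Q) + x mod int Q)" by simp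
    then show "t * x = t * (x mod int Q) + int Q * (t * (x div int Q))" by (simp only: algebra_simps)
  qed
  ultimately show ?thesis by (simp add: t_def)
qed

text \<open>The exponents \<open>K4\<close>, \<open>K6\<close> and, below, \<open>K7\<close>, \<open>K8\<close>, \<open>Kx\<close> record the accumulated powers of
  \<open>\<rho>\<close> lost on the way; here \<open>K4 = 84 * 457500 + 467\<close>, where \<open>457500 = 2500 * 183\<close> is the exponent of the
  level at which the first round excludes minor arc frequencies. All that matters in the end is
  \<open>K7 \<le> 2 ^ 66\<close>.\<close>

definition K4 :: nat where "K4 = 38430467"

definition K6 :: nat where "K6 = 2500 * K4 + 1"

text \<open>The first round is \<open>class_frequency_step\<close> with \<open>d = q a\<close>,
  \<tau> = a and no twist. Its minor arc hypothesis is shown by contradiction: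
  \<open>frequency_mod_q\<close> and \<open>major_arc\<close> would produce a major arc frequency
  congruent modulo \<open>L\<close> to one outside \<open>Rs\<close>. The output passes through
  \<open>frequency_mod_q\<close> again, classes with minor arc frequencies are discarded, and a
  pigeonhole over denominators gives one \<open>q'\<close> for all remaining classes.\<close>

lemma inverse_structure:
  assumes "q > 0" "L > 0" "prime a" "\<not> a dvd 2 * q" and n: "n = q * a * L"
    and rho: "0 < \<rho>" "\<rho> \<le> 1 / 1024"
    and qa: "real q \<le> \<rho> ^ (60000 * K4) * real a" and aM: "real a \<le> \<rho> ^ 30 * real M"
    and LM: "\<rho> ^ 33 * real L \<le> real M" and aL: "\<rho> * (real a * real L) \<le> (real M)\<^sup>2"
    and per: "per n f0" "per n f1" "per n f2" and bd: "one_bounded f0" "one_bounded f1" "one_bounded f2"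
    and ge: "\<rho> \<le> norm (Lam n q M f0 f1 f2)"
  shows "\<exists>q' W \<beta>. 1 \<le> q' \<and> real_of_int q' \<le> 1 / \<rho> ^ (10 * K6 + 3) \<and> one_bounded W \<and>
     (\<forall>c. W c \<noteq> 0 \<longrightarrow> (\<exists>m::int. \<bar>of_int (q' * int q * \<beta> c) / real n - of_int m\<bar> \<le> 10 ^ 19 / ((\<rho> ^ K6) ^ 28 * (real M)\<^sup>2))) \<and>
     \<rho> ^ (11 * K6 + 3) \<le> norm (Lam n q M f0 f1 (\<lambda>x. W (x mod int q) * chi n (\<beta> (x mod int q) * x)))"
proof -
  have a0: "a > 0" using assms(3) prime_gt_0_nat by blast
  have n0: "n > 0" using n assms(1,2) a0 by simp
  have qn: "q dvd n" by (simp add: n)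
  have r1: "\<rho> < 1" using rho by simp
  have dec: "\<rho> ^ j \<le> \<rho> ^ i" if "i \<le> j" for i j using that rho by (intro power_decreasing) auto
  have rp: "\<rho> ^ i > 0" for i using rho by simp
  have rle: "\<rho> ^ i \<le> 1" for i using rho r1 by (simp add: power_le_one)
  have kb: "1024 ^ i * \<rho> ^ i \<le> 1" for i
    using power_mono[of "1024 * \<rho>" 1 i] rho by (simp add: power_mult_distrib)
  have inv: "c / \<rho> ^ j \<le> 1 / \<rho> ^ (j + i)" if "c \<le> 1024 ^ i" for c i j
  proof -
    have "c * \<rho> ^ i \<le> 1" using kb[of i] mult_right_mono[OF that, of "\<rho> ^ i"] rp[of i] by linarith
    then have "(c * \<rho> ^ i) / (\<rho> ^ i * \<rho> ^ j) \<le> 1 / (\<rho> ^ i * \<rho> ^ j)" using rho by (intro divide_right_mono) auto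
    then show ?thesis using rho by (simp add: power_add mult.commute)
  qed
  have "\<rho> ^ 30 * real M \<le> 1 * real M" using rle by (intro mult_right_mono) auto
  then have aM1: "a \<le> M" using aM by simp
  have M0: "M > 0" using a0 aM1 by linarith
  have bigM: "1024 ^ i \<le> \<rho> ^ j * real M" if "j + i \<le> 60000 * K4" for i j
  proof -
    have "1024 ^ i * 1 \<le> 1024 ^ i * (\<rho> ^ (60000 * K4) * real M)"
    proof (intro mult_left_mono)
      have "1 \<le> real q" using assms(1) by simp
      also have "\<dots> \<le> \<rho> ^ (60000 * K4) * real M"
        using qa aM1 rp by (intro order_trans[OF qa] mult_left_mono) (auto intro: less_imp_le)
      finally show "1 \<le> \<rho> ^ (60000 * K4) * real M" .
    qed simp
    also have "\<dots> \<le> 1024 ^ i * (\<rho> ^ (j + i) * real M)" by (intro mult_left_mono mult_right_mono dec[OF that]) auto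
    also have "\<dots> = (1024 ^ i * \<rho> ^ i) * (\<rho> ^ j * real M)" by (simp add: power_add)
    also have "\<dots> \<le> 1 * (\<rho> ^ j * real M)" using kb rho by (intro mult_right_mono) auto
    finally show ?thesis by simp
  qed
  have qa': "real q \<le> \<rho> ^ (40000 * k) * real a" if "k \<le> K4" for k
    by (rule order_trans[OF qa mult_right_mono[OF dec]]) (use that in auto)
  have K4n: "K4 = 38430467" by (rule K4_def)
  define J where "J = nat \<lceil>1 / \<rho> ^ 9\<rceil>"
  define X where "X = \<rho> ^ 16 * real M / 2 ^ 22"
  define T where "T = nat \<lfloor>X\<rfloor>"
  define \<gamma> where "\<gamma> = 1 / \<rho> ^ 20"
  define K where "K = 1 / \<rho> ^ 72"
  define \<zeta> where "\<zeta> = \<rho> ^ 16 / (2 ^ 22 * K)"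
  have K0: "K > 0" using rho by (simp add: K_def)
  have J1: "1 / \<rho> ^ 9 \<le> real J" unfolding J_def by (rule real_nat_ceiling_ge)
  have J2: "real J \<le> 1 / \<rho> ^ 9 + 1" using rho unfolding J_def by (simp add: of_nat_nat; linarith)
  have J512: "512 / \<rho> ^ 8 \<le> real J" using inv[of 512 1 8] J1 by simp
  have "0 < 512 / \<rho> ^ 8" using rho by simp
  then have J0: "J > 0" using J512 by linarith
  have Jsq: "(real J)\<^sup>2 \<le> 1 / \<rho> ^ 19"
  proof -
    have "1 \<le> 1 / \<rho> ^ 9" using rp[of 9] rle[of 9] by simp
    then have "real J \<le> 2 / \<rho> ^ 9" using J2 by linarith
    then have "(real J)\<^sup>2 \<le> (2 / \<rho> ^ 9)\<^sup>2" by (intro power_mono) auto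
    also have "\<dots> = 4 / \<rho> ^ 18" by (simp add: power_divide flip: power_mult)
    also have "\<dots> \<le> 1 / \<rho> ^ 19" using inv[of 4 1 18] by simp
    finally show ?thesis .
  qed
  have taua: "32 * real a * (real J)\<^sup>2 \<le> \<rho> ^ 4 * real M"
  proof -
    have "32 * real a * (real J)\<^sup>2 \<le> 32 * (\<rho> ^ 30 * real M) * (1 / \<rho> ^ 19)"
      using Jsq aM by (intro mult_mono) auto
    also have "\<dots> = 32 * (\<rho> ^ 11 * real M)" using rho by (simp add: field_simps flip: power_add)
    also have "\<dots> \<le> 32 * (\<rho> ^ 5 * real M)" by (intro mult_left_mono mult_right_mono dec) auto
    also have "\<dots> = (32 * \<rho>) * (\<rho> ^ 4 * real M)" by (simp add: numeral_eq_Suc)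
    also have "\<dots> \<le> 1 * (\<rho> ^ 4 * real M)" using rho by (intro mult_right_mono) auto
    finally show ?thesis by simp
  qed
  have X1: "1 \<le> X" using bigM[of 16 3] by (simp add: X_def K4n)
  have T0: "T > 0" using X1 by (simp add: T_def)
  have "X < real T + 1" using X1 unfolding T_def by linarith
  moreover have "1 \<le> real T" using T0 by simp
  ultimately have TX2: "X \<le> 2 * real T" by linarith
  have TX1: "real T \<le> X" using X1 unfolding T_def by linarith
  have T16: "16 * real T \<le> (\<rho> ^ 8 / 512)\<^sup>2 * real M"
  proof -
    have "(\<rho> ^ 8 / 512)\<^sup>2 * real M = 16 * X" unfolding X_def by (simp add: power_divide flip: power_mult)
    then show ?thesis using TX1 by simp
  qed
  have g1: "1 \<le> \<gamma>" using rp[of 20] rle[of 20] by (simp add: \<gamma>_def)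
  have gJ: "2 * (real J)\<^sup>2 \<le> \<gamma>"
  proof -
    have "2 * (real J)\<^sup>2 \<le> 2 / \<rho> ^ 19" using Jsq by simp
    then show ?thesis using inv[of 2 1 19] by (simp add: \<gamma>_def)
  qed
  have gam: "real_of_int (gcd (2 * e) (int L)) \<le> \<gamma>" if "e \<noteq> 0" "\<bar>e\<bar> < int J ^ 2" for e
  proof -
    have "gcd (2 * e) (int L) \<le> \<bar>2 * e\<bar>" using that by (intro zdvd_imp_le) auto
    then have "gcd (2 * e) (int L) \<le> 2 * int J ^ 2" using that by linarith
    then have "real_of_int (gcd (2 * e) (int L)) \<le> real_of_int (2 * int J ^ 2)" by (simp only: of_int_le_iff)
    then show ?thesis using gJ by simp
  qed
  have Kg: "\<gamma> * (1 + real L / real T) \<le> K"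
  proof -
    have "real L \<le> real M / \<rho> ^ 33" using LM rp[of 33] by (simp add: pos_le_divide_eq mult.commute)
    then have "real L / real T \<le> (real M / \<rho> ^ 33) / (X / 2)" using TX2 X1 T0 by (intro frac_le) auto
    also have "\<dots> = 2 ^ 23 / (\<rho> ^ 33 * \<rho> ^ 16)" using M0 rho by (simp add: X_def)
    also have "\<dots> = 2 ^ 23 / \<rho> ^ 49" by (simp flip: power_add)
    finally have "real L / real T \<le> 2 ^ 23 / \<rho> ^ 49" .
    moreover have "1 \<le> 2 ^ 23 / \<rho> ^ 49" using rp[of 49] rle[of 49] by (simp add: pos_le_divide_eq)
    ultimately have "1 + real L / real T \<le> 2 ^ 24 / \<rho> ^ 49" by simp
    also have "\<dots> \<le> 1 / \<rho> ^ 52" using inv[of "2 ^ 24" 3 49] by simp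
    finally have "\<gamma> * (1 + real L / real T) \<le> \<gamma> * (1 / \<rho> ^ 52)" using g1 by (intro mult_left_mono) auto
    also have "\<dots> = K" unfolding \<gamma>_def K_def by (simp flip: power_add)
    finally show ?thesis .
  qed
  have zlow: "\<rho> ^ 91 \<le> \<zeta>"
  proof -
    have "\<zeta> = \<rho> ^ 88 / 2 ^ 22" by (simp add: \<zeta>_def K_def flip: power_add)
    moreover have "\<rho> ^ 91 = \<rho> ^ 88 * \<rho> ^ 3" by (simp flip: power_add)
    moreover have "\<rho> ^ 88 * \<rho> ^ 3 \<le> \<rho> ^ 88 * (1 / 2 ^ 22)"
      using kb[of 3] rp by (intro mult_left_mono) (auto intro: less_imp_le)
    ultimately show ?thesis by simp
  qed
  have z2: "\<rho> ^ 183 \<le> \<zeta>\<^sup>2 / 2"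
  proof -
    have "(\<rho> ^ 91)\<^sup>2 \<le> \<zeta>\<^sup>2" using zlow rho by (intro power_mono) auto
    moreover have "\<rho> ^ 183 = (\<rho> ^ 91)\<^sup>2 * \<rho>" by (simp flip: power_mult power_Suc2)
    moreover have "(\<rho> ^ 91)\<^sup>2 * \<rho> \<le> (\<rho> ^ 91)\<^sup>2 * (1 / 2)" using rho by (intro mult_left_mono) auto
    ultimately show ?thesis by simp
  qed
  \<comment> \<open>457500 = 2500 * 183: a form of size at least \<rho>^183, to be excluded by the
    minor arc hypothesis, leaves \<rho>^k3 after \<open>frequency_mod_q\<close>.\<close>
  define k3 :: nat where "k3 = 457500"
  have p10: "(\<rho> ^ k) ^ 10 = \<rho> ^ (10 * k)" "(\<rho> ^ k) ^ 22 = \<rho> ^ (22 * k)" "(\<rho> ^ k) ^ 28 = \<rho> ^ (28 * k)" for k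
    by (simp_all add: mult.commute flip: power_mult)
  \<comment> \<open>Residues modulo \<open>L\<close> suffice, since multiples of \<open>L\<close> go
    into the weight by \<open>reduce_frequency_mod\<close>; only these residues are few enough for
    the pigeonhole.\<close>
  define Rs where "Rs = {u \<in> {0..<int L}. \<exists>\<beta>. \<beta> mod int L = u \<and> major n q M (\<rho> ^ k3) \<beta>}"
  have Rsf: "finite Rs" unfolding Rs_def by (rule finite_filter_int)
  define Y where "Y = 1 / \<rho> ^ (28 * k3 + 8)"
  have Y1: "1 \<le> Y" using rp[of "28 * k3 + 8"] rle[of "28 * k3 + 8"] by (simp add: Y_def)
  have cR: "real (card Rs) \<le> 1 / \<rho> ^ (84 * k3 + 27)"
  proof -
    have q1: "10 ^ 7 / (\<rho> ^ k3) ^ 10 \<le> Y"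
    proof -
      have "10 ^ 7 / \<rho> ^ (10 * k3) \<le> 1 / \<rho> ^ (10 * k3 + 3)" by (rule inv) simp
      also have "\<dots> \<le> Y" unfolding Y_def using rp by (intro divide_left_mono dec) auto
      finally show ?thesis by (simp add: p10)
    qed
    have b1: "10 ^ 19 / ((\<rho> ^ k3) ^ 28 * (real M)\<^sup>2) * (real a * real L) \<le> Y"
    proof -
      have "real a * real L \<le> (real M)\<^sup>2 / \<rho>" using aL rho by (simp add: pos_le_divide_eq mult.commute)
      then have "10 ^ 19 / ((\<rho> ^ k3) ^ 28 * (real M)\<^sup>2) * (real a * real L) \<le> 10 ^ 19 / ((\<rho> ^ k3) ^ 28 * (real M)\<^sup>2) * ((real M)\<^sup>2 / \<rho>)"
        using rho by (intro mult_left_mono) auto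
      also have "\<dots> = 10 ^ 19 / \<rho> ^ (28 * k3 + 1)" using M0 by (simp add: p10)
      also have "\<dots> \<le> 1 / \<rho> ^ (28 * k3 + 1 + 7)" by (rule inv) simp
      also have "\<dots> = Y" unfolding Y_def by (rule arg_cong[where f = "\<lambda>i. 1 / \<rho> ^ i"]) simp
      finally show ?thesis .
    qed
    have "real (card Rs) \<le> Y * ((2 * Y + 1) * (2 * (Y + Y) + 1))"
      unfolding Rs_def using Y1 by (intro major_count[OF assms(1) a0 assms(2) n q1 _ b1]) auto
    also have "\<dots> \<le> Y * ((3 * Y) * (5 * Y))" using Y1 by (intro mult_mono) auto
    also have "\<dots> = 15 * Y ^ 3" by (simp add: numeral_eq_Suc)
    also have "\<dots> = 15 / \<rho> ^ (84 * k3 + 24)"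
    proof -
      have "(\<rho> ^ (28 * k3 + 8)) ^ 3 = \<rho> ^ (84 * k3 + 24)"
        unfolding power_mult[symmetric] by (rule arg_cong[where f = "power \<rho>"]) simp
      then show ?thesis by (simp only: Y_def power_divide) simp
    qed
    also have "\<dots> \<le> 1 / \<rho> ^ (84 * k3 + 24 + 1)" by (rule inv) simp
    also have "\<dots> \<le> 1 / \<rho> ^ (84 * k3 + 27)" using rp by (intro divide_left_mono dec) auto
    finally show ?thesis .
  qed
  define m0 where "m0 = nat \<lfloor>1 / \<rho> ^ (84 * k3 + 27)\<rfloor>"
  define y where "y = 1 / \<rho> ^ (84 * k3 + 27)"
  have y1: "1 \<le> y" using rp[of "84 * k3 + 27"] rle[of "84 * k3 + 27"] by (simp add: y_def)
  have m0y: "m0 = nat \<lfloor>y\<rfloor>" by (simp add: m0_def y_def)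
  have m0: "0 < m0" "real m0 \<le> 1 / \<rho> ^ (84 * k3 + 27)"
    using y1 unfolding m0y y_def[symmetric] by simp_all
  have cRm: "card Rs \<le> m0" using cR unfolding m0y y_def[symmetric] by (rule le_nat_floor)
  have minor: "norm (Lam n q M g0 g1 (\<lambda>x. W (x mod int (q * a)) * chi (q * a * L) (j (x mod int (q * a)) * x))) \<le> \<zeta>\<^sup>2 / 2"
    if h: "per n g0" "per n g1" "one_bounded g0" "one_bounded g1" "one_bounded W"
      and nz: "\<And>r. 0 \<le> r \<Longrightarrow> r < int (q * a) \<Longrightarrow> W r \<noteq> 0 \<Longrightarrow> j r mod int L \<notin> Rs" for g0 g1 W j
  proof (rule ccontr)
    assume "\<not> ?thesis"
    then have g: "\<rho> ^ 183 \<le> norm (Lam n q M g0 g1 (\<lambda>x. W (x mod int (q * a)) * chi n (j (x mod int (q * a)) * x)))"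
      using z2 by (simp add: n)
    define W1 where "W1 = (\<lambda>r. W r * chi (q * a) ((j r div int L) * r))"
    have Qp: "q * a > 0" using assms(1) a0 by simp
    have bW1: "one_bounded W1" using h(5) by (simp add: one_bounded_def W1_def norm_mult)
    have g': "\<rho> ^ 183 \<le> norm (Lam n q M g0 g1 (\<lambda>x. W1 (x mod int (q * a)) * chi n ((j (x mod int (q * a)) mod int L) * x)))"
      using g unfolding W1_def reduce_frequency_mod[OF Qp assms(2) n] by simp
    have kr: "0 \<le> j r mod int L \<and> j r mod int L < int L" for r using assms(2) by simp
    obtain W' \<beta> where W': "one_bounded W'"
      and sup: "\<And>c. W' c \<noteq> 0 \<Longrightarrow> \<exists>r. 0 \<le> r \<and> r < int (q * a) \<and> W1 r \<noteq> 0 \<and> int L dvd \<beta> c - j r mod int L"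
      and ge': "\<rho> ^ (2500 * 183) \<le> norm (Lam n q M g0 g1 (\<lambda>x. W' (x mod int q) * chi n (\<beta> (x mod int q) * x)))"
      using frequency_mod_q[OF assms(1-4) aM1 n rho _ qa' h(1-4) bW1 kr g'] by (auto simp: K4n)
    have M18: "10 ^ 18 \<le> (\<rho> ^ k3) ^ 22 * real M"
      unfolding p10 using bigM[of "22 * k3" 6] by (simp add: K4n k3_def)
    have ge'': "\<rho> ^ k3 \<le> norm (Lam n q M g0 g1 (\<lambda>x. W' (x mod int q) * chi n (\<beta> (x mod int q) * x)))"
      using ge' by (simp add: k3_def)
    obtain c k m :: int where c: "W' c \<noteq> 0" and k: "1 \<le> k" "real_of_int k \<le> 10 ^ 7 / (\<rho> ^ k3) ^ 10"
      "\<bar>of_int (k * int q * \<beta> c) / real n - of_int m\<bar> \<le> 10 ^ 19 / ((\<rho> ^ k3) ^ 28 * (real M)\<^sup>2)"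
      using major_arc[OF n0 assms(1) qn h(1-4) W' rp rle M18 ge''] by blast
    then have mj: "major n q M (\<rho> ^ k3) (\<beta> c)" unfolding major_def by blast
    obtain r where r: "0 \<le> r" "r < int (q * a)" "W1 r \<noteq> 0" "int L dvd \<beta> c - j r mod int L" using sup[OF c] by blast
    have "\<beta> c mod int L = j r mod int L" using r(4) by (metis mod_eq_dvd_iff mod_mod_trivial)
    then have "j r mod int L \<in> Rs" unfolding Rs_def using mj assms(2) by auto
    moreover have "W r \<noteq> 0" using r(3) by (auto simp: W1_def)
    ultimately show False using nz r(1,2) by blast
  qed
  have Qp: "q * a > 0" using assms(1) a0 by simp
  \<comment> \<open>Differencing by multiples of \<open>a\<close>, together with the factor 2q from
    the quadratic term, moves by multiples of \<open>q a\<close>.\<close>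
  have D2: "2 * int q * int a = int (q * a) * 2" by simp
  have n1: "n = q * a * L * 1" by (simp add: n)
  have per2: "per (q * a * L) f2" using per(3) by (simp add: n)
  have ge0: "\<rho> \<le> norm (Lam n q M f0 f1 (\<lambda>x. f2 x * chi n ((\<lambda>_. 0) (x mod int (q * a)) * x)))"
    using ge by simp
  have "\<exists>W k. one_bounded W \<and> \<zeta> ^ 4 / (2 * real m0 * K) \<le>
     norm (Lam n q M f0 f1 (\<lambda>x. W (x mod int (q * a)) * chi (q * a * L) (k (x mod int (q * a)) * x) * chi n ((\<lambda>_. 0) (x mod int (q * a)) * x)))"
    by (rule class_frequency_step[OF Qp assms(2) zero_less_one M0 J0 T0 a0 n1 D2 _ per(1,2) per2 bd rho(1) _ ge0 J512 taua T16 gam Kg g1 \<zeta>_def Rsf cRm m0(1) minor])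
      (use r1 in auto)
  then obtain W k where W: "one_bounded W" and Wge: "\<zeta> ^ 4 / (2 * real m0 * K) \<le>
     norm (Lam n q M f0 f1 (\<lambda>x. W (x mod int (q * a)) * chi n (k (x mod int (q * a)) * x)))" by (auto simp: n)
  define W1 where "W1 = (\<lambda>r. W r * chi (q * a) ((k r div int L) * r))"
  have bW1: "one_bounded W1" using W by (simp add: one_bounded_def W1_def norm_mult)
  have lev: "\<rho> ^ K4 \<le> \<zeta> ^ 4 / (2 * real m0 * K)"
  proof -
    define Z where "Z = 84 * k3 + 27"
    \<comment> \<open>The exponents: 4 * 91 from \<open>\<zeta>\<close>, 1 from the factor 2,
      \<open>Z\<close> from \<open>m0\<close>, 72 from \<open>K\<close>, and 3 to spare.\<close>
    have "K4 = 364 + (1 + (Z + 75))" by (simp add: K4n k3_def Z_def)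
    then have "\<rho> ^ K4 \<le> \<rho> ^ (91 * 4 + (1 + (Z + 72)))" by (intro dec) simp
    also have "\<dots> = (\<rho> ^ 91) ^ 4 * (\<rho> * (\<rho> ^ Z * \<rho> ^ 72))" by (simp only: power_add power_mult power_one_right)
    also have "\<dots> \<le> \<zeta> ^ 4 * ((1 / 2) * ((1 / real m0) * (1 / K)))"
    proof (intro mult_mono power_mono zlow)
      have "real m0 * \<rho> ^ Z \<le> 1" using m0(2) rp[of Z] by (simp add: Z_def pos_le_divide_eq)
      then show "\<rho> ^ Z \<le> 1 / real m0" using m0(1) by (simp add: pos_le_divide_eq mult.commute)
      show "\<rho> ^ 72 \<le> 1 / K" by (simp add: K_def)
    qed (use rho K0 in auto)
    also have "\<dots> = \<zeta> ^ 4 / (2 * real m0 * K)" by simp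
    finally show ?thesis .
  qed
  have ge4: "\<rho> ^ K4 \<le> norm (Lam n q M f0 f1 (\<lambda>x. W1 (x mod int (q * a)) * chi n ((k (x mod int (q * a)) mod int L) * x)))"
    using order_trans[OF lev Wge] unfolding W1_def reduce_frequency_mod[OF Qp assms(2) n] by simp
  have kr: "0 \<le> k r mod int L \<and> k r mod int L < int L" for r using assms(2) by simp
  have K41: "K4 \<ge> 1" by (simp add: K4n)
  obtain V \<beta> where V: "one_bounded V"
    and Vge: "\<rho> ^ (2500 * K4) \<le> norm (Lam n q M f0 f1 (\<lambda>x. V (x mod int q) * chi n (\<beta> (x mod int q) * x)))"
    using frequency_mod_q[OF assms(1-4) aM1 n rho K41 qa'[OF order_refl] per(1,2) bd(1,2) bW1 kr ge4] by blast
  define \<eta> where "\<eta> = \<rho> ^ K6"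
  have eta: "0 < \<eta>" "\<eta> \<le> 1" using rp rle by (auto simp: \<eta>_def)
  define X where "X = (\<lambda>V. Lam n q M f0 f1 (\<lambda>x. V (x mod int q) * chi n (\<beta> (x mod int q) * x)))"
  \<comment> \<open>The weights are split according to major and minor arc frequencies. The minor
    part is below \<eta>, as \<open>major_arc\<close> would find a major arc frequency among its
    classes of nonzero weight.\<close>
  define V1 where "V1 = (\<lambda>c. if major n q M \<eta> (\<beta> c) then V c else 0)"
  define V2 where "V2 = (\<lambda>c. if major n q M \<eta> (\<beta> c) then 0 else V c)"
  have "norm (X V2) < \<eta>"
  proof (rule ccontr)
    assume "\<not> norm (X V2) < \<eta>"
    then have g: "\<eta> \<le> norm (Lam n q M f0 f1 (\<lambda>x. V2 (x mod int q) * chi n (\<beta> (x mod int q) * x)))" by (simp add: X_def)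
    have bV2: "one_bounded V2" using V by (simp add: one_bounded_def V2_def)
    have M18: "10 ^ 18 \<le> \<eta> ^ 22 * real M"
      unfolding p10 \<eta>_def using bigM[of "22 * K6" 6] by (simp add: K4n K6_def)
    obtain c k m :: int where c: "V2 c \<noteq> 0" and k: "1 \<le> k" "real_of_int k \<le> 10 ^ 7 / \<eta> ^ 10"
      "\<bar>of_int (k * int q * \<beta> c) / real n - of_int m\<bar> \<le> 10 ^ 19 / (\<eta> ^ 28 * (real M)\<^sup>2)"
      using major_arc[OF n0 assms(1) qn per(1,2) bd(1,2) bV2 eta M18 g] by blast
    then have "major n q M \<eta> (\<beta> c)" unfolding major_def by blast
    then show False using c by (simp add: V2_def)
  qed
  moreover have "\<rho> ^ (2500 * K4) \<le> norm (X V1 + X V2)"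
  proof -
    have "X V1 + X V2 = X V"
      unfolding X_def Lam_add[symmetric] by (intro arg_cong[where f = "Lam n q M f0 f1"] ext) (simp add: V1_def V2_def)
    then show ?thesis using Vge by (simp add: X_def)
  qed
  moreover have "2 * \<eta> \<le> \<rho> ^ (2500 * K4)"
  proof -
    have "\<eta> = \<rho> ^ (2500 * K4) * \<rho>" by (simp add: \<eta>_def K6_def)
    moreover have "\<rho> ^ (2500 * K4) * \<rho> \<le> \<rho> ^ (2500 * K4) * (1 / 2)" using rho by (intro mult_left_mono) auto
    ultimately show ?thesis by simp
  qed
  ultimately have X1: "\<eta> \<le> norm (X V1)" using norm_triangle_ineq[of "X V1" "X V2"] by linarith
  define Qf where "Qf = nat \<lfloor>10 ^ 7 / \<eta> ^ 10\<rfloor>"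
  have Qfr: "real Qf \<le> 1 / \<rho> ^ (10 * K6 + 3)"
  proof -
    have "real Qf \<le> 10 ^ 7 / \<eta> ^ 10" using eta by (simp add: Qf_def)
    also have "\<dots> \<le> 1 / \<rho> ^ (10 * K6 + 3)" unfolding \<eta>_def p10 by (rule inv) simp
    finally show ?thesis .
  qed
  \<comment> \<open>Denominators are stored shifted by one, k = 0 standing for the denominator 1, so
    that the pieces are indexed by i < Qf.\<close>
  define ok where "ok = (\<lambda>c k. \<exists>m::int. \<bar>of_int ((int k + 1) * int q * \<beta> c) / real n - of_int m\<bar> \<le> 10 ^ 19 / (\<eta> ^ 28 * (real M)\<^sup>2))"
  define sel where "sel = (\<lambda>c. SOME k::nat. k < Qf \<and> ok c k)"
  have sel: "sel c < Qf \<and> ok c (sel c)" if mj: "major n q M \<eta> (\<beta> c)" for c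
  proof -
    obtain k m :: int where k: "1 \<le> k" "real_of_int k \<le> 10 ^ 7 / \<eta> ^ 10"
      "\<bar>of_int (k * int q * \<beta> c) / real n - of_int m\<bar> \<le> 10 ^ 19 / (\<eta> ^ 28 * (real M)\<^sup>2)"
      using mj unfolding major_def by blast
    have "k \<le> int Qf" using k by (simp add: Qf_def le_floor_iff)
    then have "nat (k - 1) < Qf \<and> ok c (nat (k - 1))" using k by (auto simp: ok_def)
    then show ?thesis unfolding sel_def by (rule someI)
  qed
  define Vi where "Vi = (\<lambda>i c. if V1 c \<noteq> 0 \<and> sel c = i then V1 c else 0)"
  have "V1 c = (\<Sum>i<Qf. Vi i c)" for c
  proof (cases "V1 c = 0")
    case False
    then have "sel c < Qf" using sel by (auto simp: V1_def split: if_splits)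
    then show ?thesis using False by (simp add: Vi_def)
  qed (simp add: Vi_def)
  then have XV: "X V1 = (\<Sum>i<Qf. X (Vi i))"
    unfolding X_def Lam_sum[symmetric] by (simp add: sum_distrib_right)
  have S: "\<eta> \<le> (\<Sum>i<Qf. norm (X (Vi i)))" by (rule order_trans[OF X1]) (simp add: XV norm_sum)
  have Qf0: "Qf > 0" using S eta by (cases Qf) auto
  have "\<exists>i<Qf. \<eta> / real Qf \<le> norm (X (Vi i))"
  proof (rule ccontr)
    assume "\<not> (\<exists>i<Qf. \<eta> / real Qf \<le> norm (X (Vi i)))"
    then have "(\<Sum>i<Qf. norm (X (Vi i))) < (\<Sum>i<Qf. \<eta> / real Qf)"
      using Qf0 by (intro sum_strict_mono) (auto simp: not_le)
    then show False using S Qf0 by simp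
  qed
  then obtain i where i: "i < Qf" "\<eta> / real Qf \<le> norm (X (Vi i))" by blast
  show ?thesis
  proof (rule exI[of _ "int i + 1"], rule exI[of _ "Vi i"], rule exI[of _ \<beta>], intro conjI allI impI)
    show "1 \<le> int i + 1" by simp
    show "real_of_int (int i + 1) \<le> 1 / \<rho> ^ (10 * K6 + 3)" using i(1) Qfr by (simp add: Suc_leI flip: of_nat_Suc)
    show "one_bounded (Vi i)" using V by (simp add: one_bounded_def Vi_def V1_def)
    fix c assume "Vi i c \<noteq> 0"
    then have "V1 c \<noteq> 0" "sel c = i" by (auto simp: Vi_def split: if_splits)
    then have "ok c i" using sel[of c] by (auto simp: V1_def split: if_splits)
    then show "\<exists>m::int. \<bar>of_int ((int i + 1) * int q * \<beta> c) / real n - of_int m\<bar> \<le> 10 ^ 19 / ((\<rho> ^ K6) ^ 28 * (real M)\<^sup>2)"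
      by (simp only: ok_def \<eta>_def)
  next
    have "real Qf * \<rho> ^ (10 * K6 + 3) \<le> 1" using Qfr rp[of "10 * K6 + 3"] by (simp add: pos_le_divide_eq)
    then have "\<rho> ^ (10 * K6 + 3) \<le> 1 / real Qf" using Qf0 by (simp add: pos_le_divide_eq mult.commute)
    then have "\<eta> * \<rho> ^ (10 * K6 + 3) \<le> \<eta> * (1 / real Qf)" using eta by (intro mult_left_mono) auto
    moreover have "\<rho> ^ (11 * K6 + 3) = \<eta> * \<rho> ^ (10 * K6 + 3)"
      unfolding \<eta>_def power_add[symmetric] by (rule arg_cong[where f = "power \<rho>"]) simp
    ultimately show "\<rho> ^ (11 * K6 + 3) \<le> norm (Lam n q M f0 f1 (\<lambda>x. Vi i (x mod int q) * chi n (\<beta> (x mod int q) * x)))"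
      using i(2) unfolding X_def by simp
  qed
qed

subsection \<open>Primes in intervals\<close>

lemma prod_primes_dvd:
  fixes N :: nat
  assumes "finite S" "\<And>p. p \<in> S \<Longrightarrow> prime p \<and> p dvd N"
  shows "\<Prod>S dvd N"
  using assms
proof (induction S rule: finite_induct)
  case (insert p S)
  have "coprime p (\<Prod>S)"
    using insert.hyps insert.prems by (intro prod_coprime_right primes_coprime) auto
  then have "p * \<Prod>S dvd N" using insert by (intro divides_mult) auto
  then show ?case using insert.hyps by simp
qed simp

lemma finite_primes_le: "finite {p::nat. prime p \<and> p \<le> n}"
  by (rule finite_subset[of _ "{..n}"]) auto

text \<open>The classical induction of Erdos: for n = 2m + 1 the primes from m + 2 to n all divide
  the binomial coefficient \<open>n choose m\<close>, which is at most 4^m because it occurs twice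
  in a row with sum 2 * 4^m.\<close>

lemma primorial_le: "\<Prod>{p::nat. prime p \<and> p \<le> n} \<le> 4 ^ n"
proof (induction n rule: less_induct)
  case (less n)
  consider "n < 2" | "n = 2" | m where "n = 2 * m" "m \<ge> 2" | m where "n = 2 * m + 1" "m \<ge> 1"
  proof -
    have "n < 2 \<or> n = 2 \<or> (\<exists>m\<ge>2. n = 2 * m) \<or> (\<exists>m\<ge>1. n = 2 * m + 1)" by presburger
    then show thesis using that by blast
  qed
  then show ?case
  proof cases
    case 1
    have "\<not> (prime p \<and> p \<le> n)" for p :: nat using prime_ge_2_nat[of p] 1 by auto
    then have e: "{p::nat. prime p \<and> p \<le> n} = {}" by blast
    show ?thesis unfolding e by simp
  next
    case 2
    have "prime p \<and> p \<le> n \<longleftrightarrow> p = 2" for p :: nat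
      using prime_ge_2_nat[of p] 2 by (cases "p = 2") auto
    then have e: "{p::nat. prime p \<and> p \<le> n} = {2}" by simp
    show ?thesis unfolding e using 2 by simp
  next
    case (3 m)
    have "\<not> prime n" using 3 prime_odd_nat[of n] by auto
    then have "p \<le> n \<longleftrightarrow> p \<le> n - 1" if "prime p" for p using that by (cases "p = n") auto
    then have e: "{p::nat. prime p \<and> p \<le> n} = {p. prime p \<and> p \<le> n - 1}" by blast
    have "\<Prod>{p::nat. prime p \<and> p \<le> n - 1} \<le> 4 ^ (n - 1)" using 3 by (intro less.IH) auto
    also have "\<dots> \<le> 4 ^ n" by (intro power_increasing) auto
    finally show ?thesis unfolding e .
  next
    case (4 m)
    define A where "A = {p::nat. prime p \<and> p \<le> m + 1}"
    define B where "B = {p::nat. prime p \<and> m + 1 < p \<and> p \<le> n}"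
    have AB: "{p::nat. prime p \<and> p \<le> n} = A \<union> B" "A \<inter> B = {}" using 4 by (auto simp: A_def B_def)
    have fin: "finite A" "finite B" unfolding A_def B_def by (auto intro: finite_subset[OF _ finite_primes_le[of n]] finite_primes_le)
    have "\<Prod>A \<le> 4 ^ (m + 1)" unfolding A_def using 4 by (intro less.IH) auto
    moreover have "\<Prod>B \<le> 4 ^ m"
    proof -
      have "\<Prod>B dvd (n choose m)"
      proof (rule prod_primes_dvd[OF fin(2)])
        fix p assume p: "p \<in> B"
        then have pp: "prime p" by (simp add: B_def)
        have "fact m * fact (n - m) * (n choose m) = (fact n :: nat)" using 4 by (intro binomial_fact_lemma) auto
        moreover have "p dvd (fact n :: nat)" using p pp by (simp add: prime_dvd_fact_iff B_def)
        moreover have "\<not> p dvd (fact m :: nat)" "\<not> p dvd (fact (n - m) :: nat)"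
          using p 4 by (simp_all only: prime_dvd_fact_iff[OF pp]) (auto simp: B_def)
        ultimately show "prime p \<and> p dvd (n choose m)" using pp by (metis prime_dvd_mult_iff)
      qed
      then have "\<Prod>B \<le> (n choose m)" using 4 by (intro dvd_imp_le) (auto simp: zero_less_binomial_iff)
      moreover have "(n choose m) + (n choose (m + 1)) \<le> (\<Sum>k\<le>n. n choose k)"
      proof -
        have "(n choose m) + (n choose (m + 1)) = (\<Sum>k\<in>{m, m + 1}. n choose k)" by simp
        also have "\<dots> \<le> (\<Sum>k\<le>n. n choose k)" using 4 by (intro sum_mono2) auto
        finally show ?thesis .
      qed
      moreover have "(n choose (m + 1)) = (n choose m)" using 4 binomial_symmetric[of m n] by simp
      moreover have "(\<Sum>k\<le>n. n choose k) = 2 * 4 ^ m"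
      proof -
        have "(\<Sum>k\<le>n. n choose k) = 2 ^ n" by (rule choose_row_sum)
        also have "\<dots> = 2 * 4 ^ m" using 4 by (simp add: power_mult)
        finally show ?thesis .
      qed
      ultimately show ?thesis by linarith
    qed
    ultimately have "\<Prod>A * \<Prod>B \<le> 4 ^ (m + 1) * 4 ^ m" by (rule mult_mono) auto
    then show ?thesis unfolding AB(1) using prod.union_disjoint[OF fin AB(2), of "\<lambda>x. x"] 4
      by (simp add: mult_2 power_add)
  qed
qed

text \<open>The reciprocals of these numbers form Leibniz's harmonic triangle: an entry (n, k + 1)
  is the entry (n - 1, k) minus the entry (n, k). By induction from the first column 1/(n + 1),
  \<open>D\<close> times any entry is an integer.\<close>

lemma leibniz_dvd:
  assumes D: "\<And>i. 1 \<le> i \<Longrightarrow> i \<le> N \<Longrightarrow> i dvd D" and "n < N" "k \<le> n"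
  shows "Suc n * (n choose k) dvd (D::nat)"
proof -
  have "\<exists>z::int. real D / (real (Suc n) * real (n choose k)) = of_int z"
    using assms(2,3)
  proof (induction k arbitrary: n)
    case 0
    then obtain z where "D = Suc n * z" using D[of "Suc n"] by (auto simp: dvd_def)
    then have "real D = real (Suc n) * real z" by (simp only: of_nat_mult)
    then have "real D / (real (Suc n) * real (n choose 0)) = of_int (int z)" by (simp del: of_nat_Suc)
    then show ?case by blast
  next
    case (Suc k n)
    then obtain n' where n': "n = Suc n'" by (cases n) auto
    obtain z1 where z1: "real D / (real (Suc n) * real (n choose k)) = of_int z1" using Suc.IH[of n] Suc.prems by auto
    obtain z2 where z2: "real D / (real (Suc n') * real (n' choose k)) = of_int z2" using Suc.IH[of n'] Suc.prems n' by auto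
    define c where "c = real (n' choose k)"
    have c: "c > 0" using Suc.prems n' by (simp add: c_def zero_less_binomial_iff)
    have nk: "real n - real k > 0" using Suc.prems by simp
    have "Suc n' * (n' choose k) = (n choose Suc k) * Suc k" unfolding n' by (rule Suc_times_binomial_eq)
    then have "real (Suc n' * (n' choose k)) = real ((n choose Suc k) * Suc k)" by simp
    then have a1: "real (n choose Suc k) = real n * c / (real k + 1)" by (simp add: c_def n' field_simps)
    have "(n - k) * (n choose k) = n * ((n - 1) choose k)" by (rule binomial_absorb_comp)
    then have "real ((n - k) * (n choose k)) = real (n * (n' choose k))" by (simp add: n')
    then have a2: "real (n choose k) = real n * c / (real n - real k)" using nk Suc.prems by (simp add: c_def of_nat_diff field_simps)
    have np: "real n > 0" using n' by simp
    have "real D / (real (Suc n) * real (n choose Suc k)) = real D / (real (Suc n') * real (n' choose k)) - real D / (real (Suc n) * real (n choose k))"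
      unfolding a1 a2 c_def[symmetric] n'[symmetric] using c nk np by (simp add: divide_simps) (simp add: algebra_simps)
    also have "\<dots> = of_int (z2 - z1)" using z1 z2 by simp
    finally show ?case by blast
  qed
  then obtain z :: int where z: "real D / (real (Suc n) * real (n choose k)) = of_int z" by blast
  have "real (Suc n) * real (n choose k) > 0" using assms(3) by (simp add: zero_less_binomial_iff del: of_nat_Suc)
  then have nz: "real (Suc n) * real (n choose k) \<noteq> 0" by (rule less_imp_neq[symmetric])
  have "real D = of_int z * real (Suc n * (n choose k))"
    using iffD1[OF nonzero_divide_eq_eq[OF nz] z] by (simp only: of_nat_mult)
  then have "int D = z * int (Suc n * (n choose k))" by (metis of_int_eq_iff of_int_mult of_int_of_nat_eq)
  then have "int (Suc n * (n choose k)) dvd int D" by simp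
  then show ?thesis by (simp only: int_dvd_int_iff)
qed

text \<open>Each number (n + 1) times \<open>n choose k\<close> divides \<open>D\<close> and so is
  at most \<open>D\<close>; over the n + 1 values of k they add up to (n + 1) 2^n.\<close>

lemma common_multiple_ge:
  assumes D: "\<And>i. 1 \<le> i \<Longrightarrow> i \<le> Suc n \<Longrightarrow> i dvd D" and "D > 0"
  shows "2 ^ n \<le> (D::nat)"
proof -
  have "Suc n * 2 ^ n = (\<Sum>k\<le>n. Suc n * (n choose k))" by (simp only: choose_row_sum flip: sum_distrib_left)
  also have "\<dots> \<le> (\<Sum>k\<le>n. D)"
  proof (rule sum_mono)
    fix k assume "k \<in> {..n}"
    then have "Suc n * (n choose k) dvd D" by (intro leibniz_dvd[OF D]) auto
    then show "Suc n * (n choose k) \<le> D" using assms(2) by (rule dvd_imp_le)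
  qed
  also have "\<dots> = Suc n * D" by simp
  finally show ?thesis by (simp only: mult_le_cancel1)
qed

lemma pow8_le: "64 \<le> s \<Longrightarrow> (s + 1) ^ 8 \<le> (2::nat) ^ s"
proof (induction s rule: dec_induct)
  case (step s)
  have "(64 * (s + 1 + 1)) ^ 8 \<le> (65 * (s + 1)) ^ 8" using step by (intro power_mono) auto
  then have "64 ^ 8 * (s + 1 + 1) ^ 8 \<le> 65 ^ 8 * (s + 1) ^ 8" by (simp only: power_mult_distrib)
  also have "\<dots> \<le> (2 * 64 ^ 8) * (s + 1) ^ 8" by (intro mult_right_mono) auto
  finally have "(s + 1 + 1) ^ 8 \<le> 2 * (s + 1) ^ 8" by simp
  then show ?case using step.IH by simp
qed simp

text \<open>Chebyshev's method. Without a prime in (X, 4X] the least common multiple of 1, ..., n =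
  4X has prime factors up to X only. Those up to sqrt n contribute prime powers of size at most n,
  the others occur at most once, so it is at most 2^X 4^X, which is less than 2^(n - 1).\<close>

lemma prime_between:
  assumes "1100 \<le> X"
  shows "\<exists>p. prime p \<and> X < p \<and> p \<le> 4 * (X::nat)"
proof (rule ccontr)
  assume no: "\<not> ?thesis"
  define n where "n = 4 * X"
  define s where "s = nat \<lfloor>sqrt (real n)\<rfloor>"
  have "real s = of_int \<lfloor>sqrt (real n)\<rfloor>" by (simp add: s_def)
  then have sr: "real s \<le> sqrt (real n)" "sqrt (real n) < real s + 1" by linarith+
  have "(real s)\<^sup>2 \<le> (sqrt (real n))\<^sup>2" using sr by (intro power_mono) auto
  then have "real (s\<^sup>2) \<le> real n" by simp
  then have s1: "s\<^sup>2 \<le> n" by (simp only: of_nat_le_iff)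
  have "(sqrt (real n))\<^sup>2 < (real s + 1)\<^sup>2" using sr by (intro power_strict_mono) auto
  then have "real n < real ((s + 1)\<^sup>2)" by (simp add: add.commute)
  then have s2: "n < (s + 1)\<^sup>2" by (simp only: of_nat_less_iff)
  \<comment> \<open>The bound 1100 on \<open>X\<close> is used here: n >= 4400 > 64^2.\<close>
  have s64: "64 \<le> s"
  proof (rule ccontr)
    assume "\<not> 64 \<le> s"
    then have "(s + 1)\<^sup>2 \<le> 64\<^sup>2" by (intro power_mono) auto
    then show False using s2 assms by (simp add: n_def)
  qed
  define P where "P = {p::nat. prime p \<and> p \<le> X}"
  have PX: "{p::nat. prime p \<and> p \<le> n} = P"
    using no by (auto simp: P_def n_def) (meson not_le)
  have fP: "finite P" unfolding P_def by (rule finite_primes_le)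
  define e where "e = (\<lambda>p::nat. Max {i. p ^ i \<le> n})"
  have n0: "n > 0" using assms by (simp add: n_def)
  have fin: "finite {i. p ^ i \<le> n}" if "prime p" for p
  proof (rule finite_subset[of _ "{..n}"])
    show "{i. p ^ i \<le> n} \<subseteq> {..n}"
    proof
      fix i assume "i \<in> {i. p ^ i \<le> n}"
      then have "p ^ i \<le> n" by simp
      moreover have "2 ^ i \<le> p ^ i" using prime_ge_2_nat[OF that] by (intro power_mono) auto
      moreover have "i < 2 ^ i" by (rule less_exp)
      ultimately have "i \<le> n" by linarith
      then show "i \<in> {..n}" by simp
    qed
  qed simp
  have e1: "p ^ e p \<le> n" if "prime p" for p
  proof -
    have "e p \<in> {i. p ^ i \<le> n}" unfolding e_def using n0 by (intro Max_in fin that) (auto intro: exI[of _ 0])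
    then show ?thesis by simp
  qed
  have e2: "i \<le> e p" if "prime p" "p ^ i \<le> n" for p i
    unfolding e_def using that by (intro Max_ge fin) auto
  define D where "D = (\<Prod>p\<in>P. p ^ e p)"
  have D0: "D > 0" unfolding D_def using prime_gt_0_nat by (intro prod_pos) (auto simp: P_def)
  have "i dvd D" if i: "1 \<le> i" "i \<le> Suc (n - 1)" for i
  proof -
    have "i = (\<Prod>p\<in>prime_factors i. p ^ multiplicity p i)" using i by (intro prime_factorization_nat) auto
    also have "\<dots> dvd (\<Prod>p\<in>prime_factors i. p ^ e p)"
    proof (rule prod_dvd_prod)
      fix p assume "p \<in> prime_factors i"
      then have pp: "prime p" by auto
      have "p ^ multiplicity p i \<le> i" using i by (intro dvd_imp_le multiplicity_dvd) auto
      then show "p ^ multiplicity p i dvd p ^ e p" using i n0 pp by (intro le_imp_power_dvd e2) auto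
    qed
    also have "\<dots> dvd D" unfolding D_def
    proof (rule prod_dvd_prod_subset[OF fP])
      show "prime_factors i \<subseteq> P"
        unfolding PX[symmetric] using i n0 by (auto dest!: dvd_imp_le)
    qed
    finally show ?thesis .
  qed
  from common_multiple_ge[OF this D0] have lower: "2 ^ (n - 1) \<le> D" .
  have "D \<le> (\<Prod>p\<in>P. (if p \<le> s then n else 1) * p)"
    unfolding D_def
  proof (rule prod_mono)
    fix p assume "p \<in> P"
    then have pp: "prime p" by (simp add: P_def)
    have "p ^ e p \<le> (if p \<le> s then n else 1) * p"
    proof (cases "p \<le> s")
      case True
      then show ?thesis using e1[OF pp] prime_gt_0_nat[OF pp] by (simp add: mult_le_mono order_trans[of "p ^ e p" n])
    next
      case False
      have "e p \<le> 1"
      proof (rule ccontr)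
        assume "\<not> e p \<le> 1"
        then have "p ^ 2 \<le> p ^ e p" using prime_gt_0_nat[OF pp] by (intro power_increasing) auto
        moreover have "(s + 1)\<^sup>2 \<le> p ^ 2" using False by (intro power_mono) auto
        ultimately show False using e1[OF pp] s2 by linarith
      qed
      then have "p ^ e p \<le> p ^ 1" using prime_gt_0_nat[OF pp] by (intro power_increasing) auto
      then show ?thesis using False by simp
    qed
    then show "0 \<le> p ^ e p \<and> p ^ e p \<le> (if p \<le> s then n else 1) * p" by simp
  qed
  also have "\<dots> = (\<Prod>p\<in>P. if p \<le> s then n else 1) * \<Prod>P" by (simp add: prod.distrib)
  also have "(\<Prod>p\<in>P. if p \<le> s then n else 1) = n ^ card {p \<in> P. p \<le> s}"
    using prod.inter_filter[OF fP, of "\<lambda>_. n" "\<lambda>p. p \<le> s", symmetric] by simp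
  also have "n ^ card {p \<in> P. p \<le> s} * \<Prod>P \<le> n ^ s * 4 ^ X"
  proof (rule mult_mono)
    have "card {p \<in> P. p \<le> s} \<le> card {1..s}"
      using prime_gt_0_nat by (intro card_mono) (auto simp: P_def Suc_le_eq)
    then show "n ^ card {p \<in> P. p \<le> s} \<le> n ^ s" using n0 by (intro power_increasing) auto
    show "\<Prod>P \<le> 4 ^ X" unfolding P_def by (rule primorial_le)
  qed auto
  also have "n ^ s * 4 ^ X \<le> 2 ^ X * 4 ^ X"
  proof (rule mult_right_mono)
    \<comment> \<open>Fourth powers are compared because n = 4X: from n < (s + 1)^2 and (s + 1)^8 <=
      2^s one gets (n^s)^4 <= 2^(s^2) <= 2^n.\<close>
    have "n ^ s \<le> ((s + 1)\<^sup>2) ^ s" by (rule power_mono[OF less_imp_le[OF s2]]) simp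
    then have "(n ^ s) ^ 4 \<le> (((s + 1)\<^sup>2) ^ s) ^ 4" by (rule power_mono) simp
    also have "\<dots> = ((s + 1) ^ 8) ^ s" by (simp add: mult_ac flip: power_mult)
    also have "\<dots> \<le> (2 ^ s) ^ s" using pow8_le[OF s64] by (intro power_mono) auto
    also have "\<dots> = 2 ^ s\<^sup>2" by (simp add: power2_eq_square flip: power_mult)
    also have "\<dots> \<le> 2 ^ n" using s1 by (intro power_increasing) auto
    also have "\<dots> = (2 ^ X) ^ 4" by (simp add: n_def mult.commute flip: power_mult)
    finally show "n ^ s \<le> 2 ^ X" by (subst (asm) power_mono_iff) auto
  qed simp
  also have "\<dots> = 2 ^ (3 * X)"
  proof -
    have "(4::nat) ^ X = 2 ^ (2 * X)" by (simp add: power_mult)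
    then have "(2::nat) ^ X * 4 ^ X = 2 ^ (X + 2 * X)" by (simp only: power_add)
    then show ?thesis by simp
  qed
  also have "\<dots> < (2::nat) ^ (n - 1)" using assms by (intro power_strict_increasing) (auto simp: n_def)
  finally show False using lower by simp
qed

subsection \<open>From averages to local functions\<close>

text \<open>A shift by q q' t keeps the class modulo \<open>q\<close> and multiplies the character
  by e(t k/n) with k = q' q \<beta>, where k/n is within \<epsilon> of an integer.\<close>

lemma twisted_near:
  assumes "n > 0" and W: "one_bounded W"
    and near: "W (x mod int q) \<noteq> 0 \<Longrightarrow> \<exists>m::int. \<bar>of_int (q' * int q * \<beta> (x mod int q)) / real n - of_int m\<bar> \<le> \<epsilon>"
    and "0 \<le> \<epsilon>" and x': "x' = x + int q * q' * t" and t: "real_of_int \<bar>t\<bar> \<le> B"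
  shows "norm (W (x' mod int q) * chi n (\<beta> (x' mod int q) * x') - W (x mod int q) * chi n (\<beta> (x mod int q) * x)) \<le> 2 * pi * B * \<epsilon>"
proof -
  define c where "c = x mod int q"
  have c': "x' mod int q = c" unfolding x' c_def using class_shift[of x q "q' * t"] by (simp add: mult.assoc)
  have B0: "0 \<le> B" using t by (rule order_trans[rotated]) simp
  show ?thesis
  proof (cases "W c = 0")
    case True
    then show ?thesis unfolding c' c_def[symmetric] using assms(4) B0 by simp
  next
    case False
    define k where "k = q' * int q * \<beta> c"
    obtain m :: int where m: "\<bar>of_int k / real n - of_int m\<bar> \<le> \<epsilon>" using near False by (auto simp: c_def k_def)
    have "\<beta> c * x' = \<beta> c * x + t * k" by (simp add: x' k_def algebra_simps)
    then have "chi n (\<beta> c * x') = chi n (\<beta> c * x) * chi n (t * k)" by (simp only: chi_add)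
    moreover have "chi n (t * k) = ee (of_int t * (of_int k / real n - of_int m))"
    proof -
      have "of_int (t * k) / real n = of_int t * (of_int k / real n - of_int m) + of_int (t * m)"
        by (simp add: algebra_simps)
      then show ?thesis unfolding chi_def by (simp only: ee_add_int)
    qed
    ultimately have "W c * chi n (\<beta> c * x') - W c * chi n (\<beta> c * x) =
      W c * chi n (\<beta> c * x) * (ee (of_int t * (of_int k / real n - of_int m)) - 1)" by (simp add: algebra_simps)
    then have "norm (W c * chi n (\<beta> c * x') - W c * chi n (\<beta> c * x)) =
      norm (W c) * norm (ee (of_int t * (of_int k / real n - of_int m)) - 1)" by (simp add: norm_mult)
    also have "\<dots> \<le> 1 * norm (ee (of_int t * (of_int k / real n - of_int m)) - 1)"
      using one_boundedD[OF W] by (intro mult_right_mono) auto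
    also have "\<dots> \<le> 2 * pi * \<bar>of_int t * (of_int k / real n - of_int m)\<bar>"
      using norm_ee_minus_1 by simp
    also have "\<dots> = 2 * pi * (\<bar>of_int t\<bar> * \<bar>of_int k / real n - of_int m\<bar>)" by (simp add: abs_mult)
    also have "\<dots> \<le> 2 * pi * (B * \<epsilon>)" using t m B0 by (intro mult_left_mono mult_mono) auto
    finally show ?thesis unfolding c' c_def[symmetric] by (simp add: mult.assoc)
  qed
qed

lemma shift_core:
  fixes g :: "int \<Rightarrow> complex" and H :: "int \<Rightarrow> int \<Rightarrow> complex" and F :: "int \<Rightarrow> int \<Rightarrow> int \<Rightarrow> complex"
  assumes "M > 0" "U > 0" and g: "\<And>y. norm (g y) \<le> 1"
    and s: "\<And>u. 0 \<le> u \<Longrightarrow> u < int U \<Longrightarrow> 0 \<le> s u \<and> s u \<le> S"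
    and approx: "\<And>u y. 0 \<le> u \<Longrightarrow> u < int U \<Longrightarrow> 0 \<le> y \<Longrightarrow> y < int M \<Longrightarrow> norm (g (y + s u) - av n (\<lambda>x. H x y * F x y u)) \<le> e"
    and H: "\<And>x y. norm (H x y) \<le> 1" and "0 \<le> e"
  shows "norm (av M g) \<le> av M (\<lambda>y. av n (\<lambda>x. norm (av U (F x y)))) + 2 * of_int S / real M + e"
proof -
  have 1: "norm (av M g - av U (\<lambda>u. av M (\<lambda>y. g (y + s u)))) \<le> 2 * of_int S / real M"
    by (rule av_average_shifts_close[OF assms(1,2) g s])
  have 2: "norm (av U (\<lambda>u. av M (\<lambda>y. g (y + s u))) - av U (\<lambda>u. av M (\<lambda>y. av n (\<lambda>x. H x y * F x y u)))) \<le> e"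
    using approx assms(7) by (intro av_norm_diff_le) auto
  have "av U (\<lambda>u. av M (\<lambda>y. av n (\<lambda>x. H x y * F x y u))) = av M (\<lambda>y. av U (\<lambda>u. av n (\<lambda>x. H x y * F x y u)))"
    by (rule av_swap)
  also have "\<dots> = av M (\<lambda>y. av n (\<lambda>x. av U (\<lambda>u. H x y * F x y u)))" by (subst av_swap[of U]) (rule refl)
  also have "\<dots> = av M (\<lambda>y. av n (\<lambda>x. H x y * av U (F x y)))" by (simp only: av_cmult)
  finally have eq: "av U (\<lambda>u. av M (\<lambda>y. av n (\<lambda>x. H x y * F x y u))) = av M (\<lambda>y. av n (\<lambda>x. H x y * av U (F x y)))" .
  have HF: "norm (av n (\<lambda>x. H x y * av U (F x y))) \<le> av n (\<lambda>x. norm (av U (F x y)))" for y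
    by (rule order_trans[OF norm_av_le av_mono]) (unfold norm_mult, rule mult_left_le_one_le, auto simp: H)
  have 3: "norm (av M (\<lambda>y. av n (\<lambda>x. H x y * av U (F x y)))) \<le> av M (\<lambda>y. av n (\<lambda>x. norm (av U (F x y))))"
    by (rule order_trans[OF norm_av_le av_mono[OF HF]])
  define a where "a = av M g"
  define b where "b = av U (\<lambda>u. av M (\<lambda>y. g (y + s u)))"
  define c where "c = av U (\<lambda>u. av M (\<lambda>y. av n (\<lambda>x. H x y * F x y u)))"
  have "norm a \<le> norm c + norm (a - b) + norm (b - c)"
    using norm_triangle_ineq[of "c" "(a - b) + (b - c)"] norm_triangle_ineq[of "a - b" "b - c"] by simp
  then show ?thesis using 1 2 3 unfolding eq[symmetric] a_def[symmetric] b_def[symmetric] c_def[symmetric] by linarith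
qed

lemma av_reflect: "av U (\<lambda>u. h (int U - 1 - u)) = av U h"
proof -
  have "(\<Sum>i<U. h (int U - 1 - int i)) = (\<Sum>i<U. h (int (U - Suc i)))"
    by (intro sum.cong refl) (simp add: of_nat_diff algebra_simps)
  also have "\<dots> = (\<Sum>i<U. h (int i))" by (rule sum.nat_diff_reindex)
  finally show ?thesis by (simp add: av_def)
qed

text \<open>Replacing y by y + q q' u moves the third function by a multiple of q q', under which it
  is nearly invariant, and moves \<open>f1\<close> by q q' u: this gives the bound for
  \<open>f1\<close>. If \<open>x\<close> is moved back by q q' u at the same time, \<open>f1\<close>
  stays in place and \<open>f0\<close> moves instead.\<close>

lemma average_bounds:
  assumes pos: "n > 0" "q > 0" "M > 0" "U > 0" "q' > 0" "q dvd n"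
    and per: "per n f0" "per n f1" and bd: "one_bounded f0" "one_bounded f1" "one_bounded W"
    and near: "\<And>c. W c \<noteq> 0 \<Longrightarrow> \<exists>m::int. \<bar>of_int (q' * int q * \<beta> c) / real n - of_int m\<bar> \<le> \<epsilon>"
    and eps: "0 \<le> \<epsilon>" and S: "int q * q' * int U \<le> int M"
    and E: "E = 2 * of_int (int q * q' * int U) / real M + 2 * pi * (4 * real q * real M * real U) * \<epsilon>"
    and ge: "\<eta> \<le> norm (Lam n q M f0 f1 (\<lambda>x. W (x mod int q) * chi n (\<beta> (x mod int q) * x)))"
  shows "\<eta> - E \<le> av n (\<lambda>x. norm (av U (\<lambda>u. f0 (x + int q * q' * u))))"
    and "\<eta> - E \<le> av n (\<lambda>x. norm (av U (\<lambda>u. f1 (x + int q * q' * u))))"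
proof -
  define G where "G = (\<lambda>x. W (x mod int q) * chi n (\<beta> (x mod int q) * x))"
  have perG: "per n G" unfolding G_def by (rule per_times[OF per_classfun[OF pos(6), of W] per_chi_class[OF pos(6,1) dvd_refl]])
  have bG: "norm (G x) \<le> 1" for x unfolding G_def using one_boundedD[OF bd(3)] by (simp add: norm_mult)
  note b0 = one_boundedD[OF bd(1)] and b1 = one_boundedD[OF bd(2)]
  have Gn: "norm (G x' - G x) \<le> 2 * pi * B * \<epsilon>" if "x' = x + int q * q' * t" "real_of_int \<bar>t\<bar> \<le> B" for x' x t B
    unfolding G_def by (rule twisted_near[OF pos(1) bd(3) near eps that])
  define s where "s = (\<lambda>u. int q * q' * u)"
  have sS: "0 \<le> s u \<and> s u \<le> int q * q' * int U" if "0 \<le> u" "u < int U" for u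
    unfolding s_def using that pos by (intro conjI mult_left_mono) auto
  define B where "B = 4 * real q * real M * real U"
  define e where "e = 2 * pi * B * \<epsilon>"
  have e0: "0 \<le> e" using eps by (simp add: e_def B_def)
  have tb: "real_of_int \<bar>u * (2 * int q * y + int q * s u - v)\<bar> \<le> B"
    if "0 \<le> u" "u < int U" "0 \<le> y" "y < int M" "0 \<le> v" "v \<le> 1" for u y v
  proof -
    have sM: "0 \<le> s u" "s u \<le> int M" using sS[OF that(1,2)] S by auto
    have "0 < int q * int M" using pos by simp
    then have a1: "1 \<le> int q * int M" by linarith
    have a2: "0 \<le> int q * y" "int q * y \<le> int q * int M" using that by (auto intro!: mult_left_mono)
    have a3: "0 \<le> int q * s u" "int q * s u \<le> int q * int M" using sM by (auto intro!: mult_left_mono)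
    have "2 * int q * y = 2 * (int q * y)" by simp
    then have "\<bar>2 * int q * y + int q * s u - v\<bar> \<le> 4 * (int q * int M)" using a1 a2 a3 that(5,6) by linarith
    then have "\<bar>u\<bar> * \<bar>2 * int q * y + int q * s u - v\<bar> \<le> int U * (4 * (int q * int M))" using that by (intro mult_mono) auto
    then have "real_of_int \<bar>u * (2 * int q * y + int q * s u - v)\<bar> \<le> real_of_int (int U * (4 * (int q * int M)))"
      by (simp only: abs_mult of_int_le_iff)
    then show ?thesis by (simp add: B_def mult_ac)
  qed
  define g where "g = (\<lambda>y. av n (\<lambda>x. f0 x * f1 (x + y) * G (x + int q * y\<^sup>2)))"
  have ng: "norm (g y) \<le> 1" for y
    unfolding g_def by (intro norm_av_le_const norm_mult_le_1 b0 b1 bG) auto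
  have LG: "Lam n q M f0 f1 G = av M g" unfolding Lam_def g_def by (rule av_swap)
  have geG: "\<eta> \<le> norm (av M g)" using ge unfolding LG[symmetric] G_def .
  have nxy: "norm (f1 (x + y) * G (x + int q * y\<^sup>2)) \<le> 1" "norm (f0 x * G (x + int q * y\<^sup>2)) \<le> 1" for x y
    by (intro norm_mult_le_1 b0 b1 bG)+
  have ET: "E = 2 * of_int (int q * q' * int U) / real M + e" by (simp add: E e_def B_def)
  have ap0: "norm (g (y + s u) - av n (\<lambda>x. (f1 (x + y) * G (x + int q * y\<^sup>2)) * f0 (x - s u))) \<le> e"
    if u: "0 \<le> u" "u < int U" "0 \<le> y" "y < int M" for u y
  proof -
    have p: "per n (\<lambda>x. f0 x * f1 (x + (y + s u)) * G (x + int q * (y + s u)\<^sup>2))"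
      by (intro per_times per_shift per perG)
    have "g (y + s u) = av n (\<lambda>x. f0 (x - s u) * f1 (x + y) * G (x - s u + int q * (y + s u)\<^sup>2))"
      using av_shift[OF p, of "- s u", symmetric] unfolding g_def by (simp add: add.commute)
    moreover have "norm (av n (\<lambda>x. f0 (x - s u) * f1 (x + y) * G (x - s u + int q * (y + s u)\<^sup>2)) - av n (\<lambda>x. (f1 (x + y) * G (x + int q * y\<^sup>2)) * f0 (x - s u))) \<le> e"
    proof (rule av_norm_diff_le[OF _ e0])
      fix x
      have "norm (f0 (x - s u) * f1 (x + y) * (G (x - s u + int q * (y + s u)\<^sup>2) - G (x + int q * y\<^sup>2))) \<le> 1 * e"
        unfolding norm_mult[of "f0 (x - s u) * f1 (x + y)"]
      proof (rule mult_mono)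
        show "norm (f0 (x - s u) * f1 (x + y)) \<le> 1" by (intro norm_mult_le_1 b0 b1)
        show "norm (G (x - s u + int q * (y + s u)\<^sup>2) - G (x + int q * y\<^sup>2)) \<le> e"
          unfolding e_def
        proof (rule Gn)
          show "x - s u + int q * (y + s u)\<^sup>2 = x + int q * y\<^sup>2 + int q * q' * (u * (2 * int q * y + int q * s u - 1))"
            by (simp add: s_def power2_eq_square algebra_simps)
        qed (use tb[OF u, of 1] in simp)
      qed auto
      then show "norm (f0 (x - s u) * f1 (x + y) * G (x - s u + int q * (y + s u)\<^sup>2) - (f1 (x + y) * G (x + int q * y\<^sup>2)) * f0 (x - s u)) \<le> e"
        by (simp add: algebra_simps)
    qed
    ultimately show ?thesis by simp
  qed
  have r0: "norm (av M g) \<le> av M (\<lambda>y. av n (\<lambda>x. norm (av U (\<lambda>u. f0 (x - s u))))) + 2 * of_int (int q * q' * int U) / real M + e"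
    by (rule shift_core[where H = "\<lambda>x y. f1 (x + y) * G (x + int q * y\<^sup>2)" and F = "\<lambda>x y u. f0 (x - s u)" and g = g and s = s, OF pos(3,4) ng sS ap0 nxy(1) e0])
  \<comment> \<open>The progressions run downwards from x; reversing the order of \<open>u\<close>
    and translating \<open>x\<close> makes them run upwards.\<close>
  have "av n (\<lambda>x. norm (av U (\<lambda>u. f0 (x - s u)))) = av n (\<lambda>x. norm (av U (\<lambda>u. f0 (x + s u))))"
  proof -
    have "av U (\<lambda>u. f0 (x - s u)) = av U (\<lambda>u. f0 (x + - s (int U - 1) + s u))" for x
    proof -
      have "f0 (x - s (int U - 1 - u)) = f0 (x + - s (int U - 1) + s u)" for u
        by (simp add: s_def algebra_simps)
      then show ?thesis using av_reflect[of U "\<lambda>u. f0 (x - s u)"] by simp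
    qed
    moreover have "per n (\<lambda>x. norm (av U (\<lambda>u. f0 (x + s u))))"
      by (intro per_cmp[of n _ norm] per_av per_shift per)
    ultimately show ?thesis using av_shift[of n "\<lambda>x. norm (av U (\<lambda>u. f0 (x + s u)))" "- s (int U - 1)"] by simp
  qed
  then show "\<eta> - E \<le> av n (\<lambda>x. norm (av U (\<lambda>u. f0 (x + int q * q' * u))))"
    using r0 geG pos(3) unfolding ET by (simp add: av_const s_def)
  have ap1: "norm (g (y + s u) - av n (\<lambda>x. (f0 x * G (x + int q * y\<^sup>2)) * f1 (x + y + s u))) \<le> e"
    if u: "0 \<le> u" "u < int U" "0 \<le> y" "y < int M" for u y
    unfolding g_def
  proof (rule av_norm_diff_le[OF _ e0])
    fix x
    have "norm (f0 x * f1 (x + y + s u) * (G (x + int q * (y + s u)\<^sup>2) - G (x + int q * y\<^sup>2))) \<le> 1 * e"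
      unfolding norm_mult[of "f0 x * f1 (x + y + s u)"]
    proof (rule mult_mono)
      show "norm (f0 x * f1 (x + y + s u)) \<le> 1" by (intro norm_mult_le_1 b0 b1)
      show "norm (G (x + int q * (y + s u)\<^sup>2) - G (x + int q * y\<^sup>2)) \<le> e"
        unfolding e_def
      proof (rule Gn)
        show "x + int q * (y + s u)\<^sup>2 = x + int q * y\<^sup>2 + int q * q' * (u * (2 * int q * y + int q * s u - 0))"
          by (simp add: s_def power2_eq_square algebra_simps)
      qed (use tb[OF u, of 0] in simp)
    qed auto
    then show "norm (f0 x * f1 (x + (y + s u)) * G (x + int q * (y + s u)\<^sup>2) - (f0 x * G (x + int q * y\<^sup>2)) * f1 (x + y + s u)) \<le> e"
      by (simp add: algebra_simps)
  qed
  have r1: "norm (av M g) \<le> av M (\<lambda>y. av n (\<lambda>x. norm (av U (\<lambda>u. f1 (x + y + s u))))) + 2 * of_int (int q * q' * int U) / real M + e"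
    by (rule shift_core[where H = "\<lambda>x y. f0 x * G (x + int q * y\<^sup>2)" and F = "\<lambda>x y u. f1 (x + y + s u)" and g = g and s = s, OF pos(3,4) ng sS ap1 nxy(2) e0])
  have "av n (\<lambda>x. norm (av U (\<lambda>u. f1 (x + y + s u)))) = av n (\<lambda>x. norm (av U (\<lambda>u. f1 (x + s u))))" for y
  proof -
    have "per n (\<lambda>x. norm (av U (\<lambda>u. f1 (x + s u))))"
      by (intro per_cmp[of n _ norm] per_av per_shift per)
    from av_shift[OF this, of y] show ?thesis .
  qed
  then show "\<eta> - E \<le> av n (\<lambda>x. norm (av U (\<lambda>u. f1 (x + int q * q' * u))))"
    using r1 geG pos(3) unfolding ET by (simp add: av_const s_def)
qed

section \<open>Local functions built from cells\<close>

lemma interval_partition: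
  fixes b R :: real
  assumes "R > 0"
  shows "partition_on UNIV (range (\<lambda>k::int. {b + of_int k * R..<b + (of_int k + 1) * R}))"
proof -
  have mem: "x \<in> {b + of_int k * R..<b + (of_int k + 1) * R} \<longleftrightarrow> \<lfloor>(x - b) / R\<rfloor> = k" for x and k :: int
    using assms by (auto simp: floor_eq_iff field_simps)
  define f where "f = (\<lambda>k::int. {b + of_int k * R..<b + (of_int k + 1) * R})"
  have memf: "x \<in> f k \<longleftrightarrow> \<lfloor>(x - b) / R\<rfloor> = k" for x k unfolding f_def by (rule mem)
  have "x \<in> \<Union> (range f)" for x using memf[of x "\<lfloor>(x - b) / R\<rfloor>"] by auto
  then have "\<Union> (range f) = UNIV" by blast
  moreover have "disjoint (range f)"
    unfolding disjoint_def
  proof (intro ballI impI)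
    fix p p' assume p: "p \<in> range f" "p' \<in> range f" "p \<noteq> p'"
    obtain k k' where k: "p = f k" "p' = f k'" using p(1,2) by blast
    show "p \<inter> p' = {}"
    proof (rule ccontr)
      assume "p \<inter> p' \<noteq> {}"
      then obtain x where "x \<in> f k" "x \<in> f k'" using k by blast
      then have "k = k'" by (simp add: memf)
      then show False using p(3) k by simp
    qed
  qed
  moreover have "{} \<notin> range f"
  proof
    assume "{} \<in> range f"
    then obtain k where "f k = {}" by auto
    moreover have "b + of_int k * R \<in> f k" using assms unfolding f_def by (simp add: algebra_simps)
    ultimately show False by simp
  qed
  ultimately show ?thesis unfolding partition_on_def f_def by blast
qed

lemma interval_length:
  assumes "R > 0"
  shows "interval_of_length R {b..<b + R}"
  unfolding interval_of_length_def using assms by (simp add: is_interval_co)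

text \<open>The cells have length D U and start at \<open>b\<close> modulo that length. Each x is
  replaced by the first element of its class modulo \<open>D\<close> in its cell, so any function of
  that element is local.\<close>

lemma local_function_cells:
  fixes b :: int and D U :: nat
  assumes "D > 0" "U > 0"
  shows "local_function (real (D * U)) D (\<lambda>x. h (x - int D * (((x - b) mod int (D * U)) div int D)))"
proof -
  define R where "R = D * U"
  have R0: "R > 0" using assms by (simp add: R_def)
  define P where "P = range (\<lambda>k::int. {real_of_int b + of_int k * real R..<real_of_int b + (of_int k + 1) * real R})"
  have "partition_on UNIV P" unfolding P_def using R0 by (intro interval_partition) simp
  moreover have "interval_of_length (real R) I" if IP: "I \<in> P" for I
  proof -
    obtain k :: int where I: "I = {real_of_int b + of_int k * real R..<real_of_int b + (of_int k + 1) * real R}"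
      using IP unfolding P_def by blast
    have "I = {(real_of_int b + of_int k * real R)..<(real_of_int b + of_int k * real R) + real R}"
      unfolding I by (simp add: algebra_simps)
    then show ?thesis using interval_length[of "real R"] R0 by simp
  qed
  moreover have "(\<lambda>x. h (x - int D * (((x - b) mod int R) div int D))) constant_on {x. real_of_int x \<in> I \<and> [x = c] (mod int D)}" if IP: "I \<in> P" for I c
  proof -
    obtain k :: int where I: "I = {real_of_int b + of_int k * real R..<real_of_int b + (of_int k + 1) * real R}"
      using IP unfolding P_def by blast
    have "x - int D * (((x - b) mod int R) div int D) = b + k * int R + (c - (b + k * int R)) mod int D"
      if x: "real_of_int x \<in> I" "[x = c] (mod int D)" for x
    proof -
      have "real_of_int (b + k * int R) \<le> real_of_int x" "real_of_int x < real_of_int (b + (k + 1) * int R)"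
        using x(1) by (auto simp: I)
      then have r: "b + k * int R \<le> x" "x < b + (k + 1) * int R" by (simp_all only: of_int_le_iff of_int_less_iff)
      define r where "r = x - (b + k * int R)"
      have xr: "x = b + k * int R + r" by (simp add: r_def)
      have r01: "0 \<le> r" "r < int R" using r by (auto simp: r_def algebra_simps)
      have "(x - b) mod int R = (r + k * int R) mod int R" by (simp add: r_def)
      also have "\<dots> = r" using r01 by simp
      finally have m: "(x - b) mod int R = r" .
      have "r mod int D = (c - (b + k * int R)) mod int D"
        unfolding r_def using x(2) by (intro mod_diff_cong) (auto simp: cong_def)
      moreover have "x - int D * (r div int D) = b + k * int R + r mod int D"
        using mult_div_mod_eq[of "int D" r] xr by linarith
      ultimately show ?thesis using m by simp
    qed
    then show ?thesis unfolding constant_on_def by auto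
  qed
  ultimately show ?thesis unfolding local_function_def R_def[symmetric] by blast
qed

text \<open>\<open>h\<close> carries the conjugate signs of the sums along progressions. Summed over
  all offsets \<open>b\<close>, the local functions built from \<open>h\<close> give D times the sum
  of \<open>h (x - D u)\<close> over u, whose correlation with \<open>f\<close> is D times the right
  side of \<open>ge\<close>. Some offset does at least as well as the mean, and a constant phase
  makes its correlation real and nonnegative.\<close>

lemma local_correlation:
  fixes f :: "int \<Rightarrow> complex" and D U N :: nat
  assumes pos: "D > 0" "U > 0" and f: "one_bounded f" and sup: "\<And>x. f x \<noteq> 0 \<Longrightarrow> 1 \<le> x \<and> x \<le> int N"
    and ge: "B \<le> (\<Sum>z\<in>{- int (D * U)..int N}. norm (\<Sum>u\<in>{0..<int U}. f (z + int D * u)))"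
  shows "\<exists>\<phi>. one_bounded \<phi> \<and> local_function (real (D * U)) D \<phi> \<and> (\<Sum>x\<in>{1..int N}. f x * \<phi> x) \<in> \<real> \<and>
    B / real U \<le> Re (\<Sum>x\<in>{1..int N}. f x * \<phi> x)"
proof -
  define R where "R = D * U"
  have R0: "R > 0" using pos by (simp add: R_def)
  define A where "A = (\<lambda>z. \<Sum>u\<in>{0..<int U}. f (z + int D * u))"
  define h where "h = (\<lambda>z. cnj (sgn (A z)))"
  have nh: "norm (h z) \<le> 1" for z by (simp add: h_def norm_sgn)
  define \<phi> where "\<phi> = (\<lambda>b x. h (x - int D * (((x - b) mod int R) div int D)))"
  \<comment> \<open>As the offset runs over a full period, the position of x in its cell takes each
    value exactly once.\<close>
  have sum\<phi>: "(\<Sum>b\<in>{0..<int R}. \<phi> b x) = of_nat D * (\<Sum>u\<in>{0..<int U}. h (x - int D * u))" for x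
  proof -
    have "(\<Sum>b\<in>{0..<int R}. \<phi> b x) = (\<Sum>t\<in>{0..<int R}. h (x - int D * (t div int D)))"
      unfolding \<phi>_def
    proof (rule sum.reindex_bij_witness[where i = "\<lambda>t. (x - t) mod int R" and j = "\<lambda>b. (x - b) mod int R"])
      show "(x - (x - b) mod int R) mod int R = b" if "b \<in> {0..<int R}" for b
        using that by (simp add: mod_diff_right_eq)
      then show "(x - (x - b) mod int R) mod int R = b" if "b \<in> {0..<int R}" for b using that .
    qed (use R0 in auto)
    also have "\<dots> = (\<Sum>(u, v)\<in>{0..<int U} \<times> {0..<int D}. h (x - int D * u))"
    proof (rule sum.reindex_bij_witness[where i = "\<lambda>(u, v). int D * u + v" and j = "\<lambda>t. (t div int D, t mod int D)"])
      fix t assume t: "t \<in> {0..<int R}"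
      then have "t div int D < int U"
      proof -
        have "int D * (t div int D) \<le> t" using mult_div_mod_eq[of "int D" t] pos_mod_sign[of "int D" t] pos by linarith
        moreover have "t < int D * int U" using t by (simp add: R_def)
        ultimately have "int D * (t div int D) < int D * int U" by linarith
        then show ?thesis using pos by simp
      qed
      then show "(t div int D, t mod int D) \<in> {0..<int U} \<times> {0..<int D}"
        using t pos by (auto simp: pos_imp_zdiv_nonneg_iff)
    next
      fix p assume p: "p \<in> {0..<int U} \<times> {0..<int D}"
      obtain u v where uv: "p = (u, v)" "0 \<le> u" "u < int U" "0 \<le> v" "v < int D" using p by (cases p) auto
      have "int D * u + v < int D * (u + 1)" using uv by (simp add: distrib_left)
      also have "\<dots> \<le> int D * int U" using uv pos by (intro mult_left_mono) auto
      finally show "(case p of (u, v) \<Rightarrow> int D * u + v) \<in> {0..<int R}" using uv by (simp add: R_def)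
      show "((case p of (u, v) \<Rightarrow> int D * u + v) div int D, (case p of (u, v) \<Rightarrow> int D * u + v) mod int D) = p"
        using uv pos by simp
    qed auto
    also have "\<dots> = (\<Sum>u\<in>{0..<int U}. \<Sum>v\<in>{0..<int D}. h (x - int D * u))" by (rule sum.cartesian_product[symmetric])
    also have "\<dots> = of_nat D * (\<Sum>u\<in>{0..<int U}. h (x - int D * u))" by (simp add: sum_distrib_left)
    finally show ?thesis .
  qed
  \<comment> \<open>Progressions that meet 1, ..., N may start up to \<open>D * U\<close> to the
    left.\<close>
  define Z where "Z = {- int (D * U)..int N}"
  have tr: "(\<Sum>x\<in>{1..int N}. f x * h (x - int D * u)) = (\<Sum>z\<in>Z. f (z + int D * u) * h z)" if u: "u \<in> {0..<int U}" for u
  proof -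
    have du: "0 \<le> int D * u" "int D * u \<le> int (D * U)" using u pos by (auto intro!: mult_left_mono)
    have "(\<Sum>x\<in>{1..int N}. f x * h (x - int D * u)) = (\<Sum>z\<in>{1 - int D * u..int N - int D * u}. f (z + int D * u) * h z)"
      by (rule sum.reindex_bij_witness[where i = "\<lambda>z. z + int D * u" and j = "\<lambda>x. x - int D * u"]) auto
    also have "\<dots> = (\<Sum>z\<in>Z. f (z + int D * u) * h z)"
    proof (rule sum.mono_neutral_left)
      show "{1 - int D * u..int N - int D * u} \<subseteq> Z" using du by (auto simp: Z_def)
      show "\<forall>z\<in>Z - {1 - int D * u..int N - int D * u}. f (z + int D * u) * h z = 0"
      proof
        fix z assume z: "z \<in> Z - {1 - int D * u..int N - int D * u}"
        then have "\<not> (1 \<le> z + int D * u \<and> z + int D * u \<le> int N)" by auto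
        then show "f (z + int D * u) * h z = 0" using sup by fastforce
      qed
    qed (simp add: Z_def)
    finally show ?thesis .
  qed
  define F where "F = (\<lambda>b. \<Sum>x\<in>{1..int N}. f x * \<phi> b x)"
  have "(\<Sum>b\<in>{0..<int R}. F b) = (\<Sum>x\<in>{1..int N}. f x * (\<Sum>b\<in>{0..<int R}. \<phi> b x))"
    unfolding F_def by (subst sum.swap) (simp only: sum_distrib_left)
  also have "\<dots> = of_nat D * (\<Sum>x\<in>{1..int N}. \<Sum>u\<in>{0..<int U}. f x * h (x - int D * u))"
    unfolding sum\<phi> by (simp add: sum_distrib_left mult_ac)
  also have "\<dots> = of_nat D * (\<Sum>u\<in>{0..<int U}. \<Sum>x\<in>{1..int N}. f x * h (x - int D * u))"
    by (subst sum.swap) (rule refl)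
  also have "\<dots> = of_nat D * (\<Sum>u\<in>{0..<int U}. \<Sum>z\<in>Z. f (z + int D * u) * h z)"
    using tr by simp
  also have "\<dots> = of_nat D * (\<Sum>z\<in>Z. A z * h z)"
    unfolding A_def by (subst sum.swap) (simp only: sum_distrib_right)
  also have "\<dots> = of_real (real D * (\<Sum>z\<in>Z. norm (A z)))"
  proof -
    have "A z * h z = of_real (norm (A z))" for z unfolding h_def mult.commute[of "A z"] by (rule cnj_sgn_mult)
    then show ?thesis by simp
  qed
  finally have FF: "(\<Sum>b\<in>{0..<int R}. F b) = of_real (real D * (\<Sum>z\<in>Z. norm (A z)))" .
  have "real D * B \<le> real D * (\<Sum>z\<in>Z. norm (A z))"
    using ge by (intro mult_left_mono) (auto simp: Z_def A_def)
  also have "\<dots> \<le> norm (complex_of_real (real D * (\<Sum>z\<in>Z. norm (A z))))" by (simp only: norm_of_real abs_ge_self)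
  also have "\<dots> \<le> (\<Sum>b\<in>{0..<int R}. norm (F b))" unfolding FF[symmetric] by (rule norm_sum)
  finally have DB: "real D * B \<le> (\<Sum>b\<in>{0..<int R}. norm (F b))" .
  have "\<exists>b\<in>{0..<int R}. B / real U \<le> norm (F b)"
  proof (rule ccontr)
    assume "\<not> (\<exists>b\<in>{0..<int R}. B / real U \<le> norm (F b))"
    then have "(\<Sum>b\<in>{0..<int R}. norm (F b)) < (\<Sum>b\<in>{0..<int R}. B / real U)"
      using R0 by (intro sum_strict_mono) (auto simp: not_le)
    also have "\<dots> = real D * B" using pos by (simp add: R_def)
    finally show False using DB by simp
  qed
  then obtain b where b: "B / real U \<le> norm (F b)" by blast
  define c where "c = cnj (sgn (F b))"
  have cF: "(\<Sum>x\<in>{1..int N}. f x * (c * \<phi> b x)) = of_real (norm (F b))"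
  proof -
    have "(\<Sum>x\<in>{1..int N}. f x * (c * \<phi> b x)) = c * F b" unfolding F_def by (simp add: sum_distrib_left mult_ac)
    then show ?thesis unfolding c_def cnj_sgn_mult .
  qed
  have lf: "local_function (real (D * U)) D (\<lambda>x. c * \<phi> b x)"
    unfolding \<phi>_def R_def using local_function_cells[OF pos, of "\<lambda>z. c * h z" b] .
  have "one_bounded (\<lambda>x. c * \<phi> b x)"
    unfolding one_bounded_def \<phi>_def by (intro allI norm_mult_le_1 nh) (simp add: c_def norm_sgn)
  then show ?thesis using lf b by (intro exI[of _ "\<lambda>x. c * \<phi> b x"]) (simp add: cF)
qed

subsection \<open>Conclusion\<close>

lemma bracket_nat: "bracket (real N) = {1..int N}"
  by (simp add: bracket_def)

lemma average_interval: "average {1..int M} F = av M (\<lambda>y. F (y + 1))"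
proof -
  have "(\<Sum>y\<in>{1..int M}. F y) = (\<Sum>y\<in>{0..<int M}. F (y + 1))"
    by (rule sum.reindex_bij_witness[where i = "\<lambda>y. y + 1" and j = "\<lambda>y. y - 1"]) auto
  then show ?thesis unfolding average_def av_def sum_int_lessThan[of "\<lambda>y. F (y + 1)"] by simp
qed

text \<open>Nothing wraps around for n >= 3N, since M <= N and q M^2 <= N keep all arguments below
  n. Starting \<open>y\<close> at 0 instead of 1 costs 2/M.\<close>

lemma counting_op_le:
  fixes f0 f1 f2 :: "int \<Rightarrow> complex"
  assumes pos: "0 < q" "0 < N" "0 < M" and M: "M = nat \<lfloor>sqrt (real N / real q)\<rfloor>" and n: "3 * N \<le> n"
    and bd: "one_bounded f0" "one_bounded f1" "one_bounded f2" and sup: "\<And>x. f0 x \<noteq> 0 \<Longrightarrow> 1 \<le> x \<and> x \<le> int N"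
  shows "norm (counting_op q N f0 f1 f2) \<le>
    real n / real N * norm (Lam n q M (\<lambda>x. f0 (x mod int n)) (\<lambda>x. f1 (x mod int n)) (\<lambda>x. f2 (x mod int n))) + 2 / real M"
proof -
  have n0: "n > 0" using n pos by simp
  define P where "P = (\<lambda>x y. f0 x * f1 (x + y) * f2 (x + int q * y\<^sup>2))"
  have Pb: "norm (P x y) \<le> 1" for x y
    unfolding P_def by (intro norm_mult_le_1 one_boundedD[OF bd(1)] one_boundedD[OF bd(2)] one_boundedD[OF bd(3)])
  have fl: "\<lfloor>sqrt (real N / real q)\<rfloor> = int M" unfolding M by simp
  have Mr: "real M \<le> sqrt (real N / real q)" using fl by linarith
  then have "(real M)\<^sup>2 \<le> (sqrt (real N / real q))\<^sup>2" by (intro power_mono) auto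
  then have "real q * (real M)\<^sup>2 \<le> real N" using pos by (simp add: pos_le_divide_eq mult.commute)
  then have "real (q * M\<^sup>2) \<le> real N" by simp
  then have qM: "q * M\<^sup>2 \<le> N" by (simp only: of_nat_le_iff)
  have MN: "M \<le> N"
  proof -
    have "1 \<le> q * M" using pos by (simp add: Suc_leI)
    then have "M * 1 \<le> M * (q * M)" by (rule mult_le_mono2)
    also have "\<dots> = q * M\<^sup>2" by (simp add: power2_eq_square)
    finally show ?thesis using qM by linarith
  qed
  have c: "counting_op q N f0 f1 f2 = (\<Sum>x\<in>{1..int N}. av M (\<lambda>y. P x (y + 1))) / of_nat N"
    unfolding counting_op_def Let_def fl of_int_of_nat_eq bracket_nat average_interval[of M]
    by (simp add: average_def P_def)
  define Lm where "Lm = Lam n q M (\<lambda>x. f0 (x mod int n)) (\<lambda>x. f1 (x mod int n)) (\<lambda>x. f2 (x mod int n))"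
  have "Lm = (\<Sum>x\<in>{0..<int n}. av M (\<lambda>y. f0 (x mod int n) * f1 ((x + y) mod int n) * f2 ((x + int q * y\<^sup>2) mod int n))) / of_nat n"
    unfolding Lm_def Lam_def av_def[of n]
    unfolding sum_int_lessThan[of "\<lambda>x. av M (\<lambda>y. f0 (x mod int n) * f1 ((x + y) mod int n) * f2 ((x + int q * y\<^sup>2) mod int n))"] ..
  also have "(\<Sum>x\<in>{0..<int n}. av M (\<lambda>y. f0 (x mod int n) * f1 ((x + y) mod int n) * f2 ((x + int q * y\<^sup>2) mod int n))) =
     (\<Sum>x\<in>{1..int N}. av M (\<lambda>y. f0 (x mod int n) * f1 ((x + y) mod int n) * f2 ((x + int q * y\<^sup>2) mod int n)))"
  proof (rule sum.mono_neutral_right)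
    show "{1..int N} \<subseteq> {0..<int n}" using n pos by auto
    show "\<forall>x\<in>{0..<int n} - {1..int N}. av M (\<lambda>y. f0 (x mod int n) * f1 ((x + y) mod int n) * f2 ((x + int q * y\<^sup>2) mod int n)) = 0"
    proof
      fix x assume x: "x \<in> {0..<int n} - {1..int N}"
      then have "f0 (x mod int n) = 0" using sup[of x] by auto
      then show "av M (\<lambda>y. f0 (x mod int n) * f1 ((x + y) mod int n) * f2 ((x + int q * y\<^sup>2) mod int n)) = 0"
        by (simp add: av_def)
    qed
  qed simp
  also have "\<dots> = (\<Sum>x\<in>{1..int N}. av M (P x))"
  proof (intro sum.cong refl av_cong)
    fix x y assume x: "x \<in> {1..int N}" and y: "0 \<le> y" "y < int M"
    have "int q * y\<^sup>2 \<le> int q * (int M)\<^sup>2" using y by (intro mult_left_mono power_mono) auto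
    also have "\<dots> \<le> int N" using qM by (metis of_nat_le_iff of_nat_mult of_nat_power)
    finally have "int q * y\<^sup>2 \<le> int N" .
    moreover have "0 \<le> int q * y\<^sup>2" by simp
    ultimately have "x mod int n = x" "(x + y) mod int n = x + y" "(x + int q * y\<^sup>2) mod int n = x + int q * y\<^sup>2"
      using x y n MN pos by (auto intro!: mod_pos_pos_trivial)
    then show "f0 (x mod int n) * f1 ((x + y) mod int n) * f2 ((x + int q * y\<^sup>2) mod int n) = P x y"
      by (simp add: P_def)
  qed
  finally have L: "of_nat n * Lm = (\<Sum>x\<in>{1..int N}. av M (P x))" using n0 by simp
  have "norm ((\<Sum>x\<in>{1..int N}. av M (\<lambda>y. P x (y + 1))) - (\<Sum>x\<in>{1..int N}. av M (P x))) \<le> (\<Sum>x\<in>{1..int N}. 2 / real M)"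
    unfolding sum_subtractf[symmetric]
  proof (rule order_trans[OF norm_sum sum_mono])
    fix x
    show "norm (av M (\<lambda>y. P x (y + 1)) - av M (P x)) \<le> 2 / real M"
      using av_shift_close[of M "P x" 1] Pb pos by (simp add: norm_minus_commute)
  qed
  also have "\<dots> = real N * (2 / real M)" by simp
  finally have d: "norm ((\<Sum>x\<in>{1..int N}. av M (\<lambda>y. P x (y + 1))) - of_nat n * Lm) \<le> real N * (2 / real M)" unfolding L .
  define s where "s = (\<Sum>x\<in>{1..int N}. av M (\<lambda>y. P x (y + 1)))"
  have "norm s \<le> norm (of_nat n * Lm) + norm (s - of_nat n * Lm)"
    using norm_triangle_ineq[of "of_nat n * Lm" "s - of_nat n * Lm"] by simp
  also have "\<dots> \<le> real n * norm Lm + real N * (2 / real M)" using d by (simp add: s_def norm_mult)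
  finally have "norm s / real N \<le> (real n * norm Lm + real N * (2 / real M)) / real N" by (rule divide_right_mono) simp
  also have "\<dots> = real n / real N * norm Lm + 2 / real M" using pos by (simp add: add_divide_distrib)
  finally show ?thesis unfolding c s_def[symmetric] Lm_def[symmetric] by (simp add: norm_divide)
qed

definition K7 :: nat where "K7 = 11 * K6 + 3"

text \<open>Governs the length \<open>U\<close>: 28 K6 compensates the factor (1/\<rho>^K6)^28 in
  the major arc error, and the additional 8 absorbs the constant, so that the phase error stays
  below \<rho>^K7.\<close>

definition K8 :: nat where "K8 = K7 + 28 * K6 + 8"

text \<open>How far \<open>M\<close> must exceed \<open>q\<close>: enough for the first round with
  \<open>a\<close> as small as \<rho>^31 M, and for \<open>U\<close> to be at least 1.\<close>

definition Kx :: nat where "Kx = 60000 * K4 + K8 + 40"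

lemma periodized_sum:
  fixes f :: "int \<Rightarrow> complex"
  assumes pos: "D > 0" "U > 0" "n > 0" and n: "int N + int (D * U) < int n"
    and sup: "\<And>x. f x \<noteq> 0 \<Longrightarrow> 1 \<le> x \<and> x \<le> int N"
    and ge: "\<eta> \<le> av n (\<lambda>x. norm (av U (\<lambda>u. f ((x + int D * u) mod int n))))"
  shows "\<eta> * real n * real U \<le> (\<Sum>z\<in>{- int (D * U)..int N}. norm (\<Sum>u\<in>{0..<int U}. f (z + int D * u)))"
proof -
  define h where "h = (\<lambda>x. norm (av U (\<lambda>u. f ((x + int D * u) mod int n))))"
  define R where "R = int (D * U)"
  have "per n h"
    unfolding h_def by (rule per_cmp[of n _ norm], rule per_av) (rule per_shift[OF per_classfun[OF dvd_refl]])
  then have "av n h = av n (\<lambda>x. h (x - R))" using av_shift[of n h "- R"] by simp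
  also have "\<dots> = (\<Sum>x\<in>{0..<int n}. h (x - R)) / real n"
    unfolding av_def sum_int_lessThan[of "\<lambda>x. h (x - R)"] by simp
  also have "(\<Sum>x\<in>{0..<int n}. h (x - R)) = (\<Sum>z\<in>{- R..<int n - R}. h z)"
    by (rule sum.reindex_bij_witness[where i = "\<lambda>z. z + R" and j = "\<lambda>x. x - R"]) auto
  also have "\<dots> = (\<Sum>z\<in>{- R..<int n - R}. norm (\<Sum>u\<in>{0..<int U}. f (z + int D * u)) / real U)"
  proof (intro sum.cong refl)
    fix z assume z: "z \<in> {- R..<int n - R}"
    have "f ((z + int D * u) mod int n) = f (z + int D * u)" if u: "u \<in> {0..<int U}" for u
    proof -
      have "int D * u \<le> R" unfolding R_def of_nat_mult using u by (intro mult_left_mono) auto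
      moreover have "0 \<le> int D * u" using u by simp
      ultimately have b: "- R \<le> z + int D * u" "z + int D * u < int n" using z by auto
      show ?thesis
      proof (cases "0 \<le> z + int D * u")
        case True
        then show ?thesis using b by simp
      next
        case False
        have "(z + int D * u) mod int n = (z + int D * u + int n) mod int n" by simp
        also have "\<dots> = z + int D * u + int n" using False b n pos unfolding R_def[symmetric] by (intro mod_pos_pos_trivial) auto
        finally have "(z + int D * u) mod int n > int N" using b n unfolding R_def[symmetric] by linarith
        then have "f ((z + int D * u) mod int n) = 0" using sup by fastforce
        moreover have "f (z + int D * u) = 0" using sup False by fastforce
        ultimately show ?thesis by simp
      qed
    qed
    then have "av U (\<lambda>u. f ((z + int D * u) mod int n)) = (\<Sum>u\<in>{0..<int U}. f (z + int D * u)) / of_nat U"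
      unfolding av_def sum_int_lessThan[of "\<lambda>u. f ((z + int D * u) mod int n)"] by simp
    then show "h z = norm (\<Sum>u\<in>{0..<int U}. f (z + int D * u)) / real U" by (simp add: h_def norm_divide)
  qed
  also have "\<dots> = (\<Sum>z\<in>{- R..<int n - R}. norm (\<Sum>u\<in>{0..<int U}. f (z + int D * u))) / real U"
    by (simp only: sum_divide_distrib)
  also have "(\<Sum>z\<in>{- R..<int n - R}. norm (\<Sum>u\<in>{0..<int U}. f (z + int D * u))) = (\<Sum>z\<in>{- R..int N}. norm (\<Sum>u\<in>{0..<int U}. f (z + int D * u)))"
  proof (rule sum.mono_neutral_right)
    show "{- R..int N} \<subseteq> {- R..<int n - R}" using n unfolding R_def[symmetric] by auto
    show "\<forall>z\<in>{- R..<int n - R} - {- R..int N}. norm (\<Sum>u\<in>{0..<int U}. f (z + int D * u)) = 0"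
    proof
      fix z assume z: "z \<in> {- R..<int n - R} - {- R..int N}"
      have "f (z + int D * u) = 0" if u: "u \<in> {0..<int U}" for u
      proof -
        have "0 \<le> int D * u" using u by simp
        then have "\<not> z + int D * u \<le> int N" using z by auto
        then show ?thesis using sup by blast
      qed
      then show "norm (\<Sum>u\<in>{0..<int U}. f (z + int D * u)) = 0" by simp
    qed
  qed simp
  finally have "\<eta> \<le> (\<Sum>z\<in>{- R..int N}. norm (\<Sum>u\<in>{0..<int U}. f (z + int D * u))) / real U / real n"
    using ge by (simp add: h_def)
  then show ?thesis using pos unfolding R_def by (simp add: pos_le_divide_eq mult_ac)
qed

text \<open>Fixes the parameters: a prime \<open>a\<close> between \<rho>^31 M and \<rho>^30 M, the
  least \<open>L\<close> for which n = q a L exceeds 3N, and \<open>U\<close> about \<rho>^K8 M/q,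
  so short that the shifts and phases in \<open>average_bounds\<close> cost at most half of
  \<rho>^K7.\<close>

lemma inverse_core:
  fixes f0 f1 f2 :: "int \<Rightarrow> complex"
  assumes pos: "0 < q" "q \<le> N" and M: "M = nat \<lfloor>sqrt (real N / real q)\<rfloor>"
    and delta: "0 < \<delta>" "\<delta> \<le> 1" and \<rho>: "\<rho> = \<delta> / 2048" and big: "real q \<le> \<rho> ^ Kx * real M"
    and bd: "one_bounded f0" "one_bounded f1" "one_bounded f2"
    and sup: "\<And>x. f0 x \<noteq> 0 \<Longrightarrow> 1 \<le> x \<and> x \<le> int N" "\<And>x. f1 x \<noteq> 0 \<Longrightarrow> 1 \<le> x \<and> x \<le> int N"
    and ge: "\<delta> / 2 \<le> norm (counting_op q N f0 f1 f2)"
  shows "\<exists>q' U::nat. 0 < q' \<and> real q' \<le> 1 / \<rho> ^ (10 * K6 + 3) \<and> 0 < U \<and> \<rho> ^ K8 * real M / 2 \<le> real (q * q' * U) \<and>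
    (\<forall>f\<in>{f0, f1}. (\<rho> ^ K7 / 2) * real N * real U \<le> (\<Sum>z\<in>{- int (q * q' * U)..int N}. norm (\<Sum>u\<in>{0..<int U}. f (z + int (q * q') * u))))"
proof -
  have rho: "0 < \<rho>" "\<rho> \<le> 1 / 2048" "\<rho> \<le> 1 / 1024" using delta by (auto simp: \<rho>)
  have rp: "\<rho> ^ i > 0" for i using rho by simp
  have rle: "\<rho> ^ i \<le> 1" for i using rho by (simp add: power_le_one)
  have dec: "\<rho> ^ j \<le> \<rho> ^ i" if "i \<le> j" for i j using that rho by (intro power_decreasing) auto
  have kb: "1024 ^ i * \<rho> ^ i \<le> 1" for i
    using power_mono[of "1024 * \<rho>" 1 i] rho by (simp add: power_mult_distrib)
  have bigM: "1024 ^ i * real q \<le> \<rho> ^ j * real M" if "j + i \<le> Kx" for i j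
  proof -
    have "1024 ^ i * real q \<le> 1024 ^ i * (\<rho> ^ (j + i) * real M)"
      using order_trans[OF big mult_right_mono[OF dec[OF that]]] by (intro mult_left_mono) auto
    also have "\<dots> = (1024 ^ i * \<rho> ^ i) * (\<rho> ^ j * real M)" by (simp add: power_add)
    also have "\<dots> \<le> 1 * (\<rho> ^ j * real M)" using kb rho by (intro mult_right_mono) auto
    finally show ?thesis by simp
  qed
  have q1: "1 \<le> real q" using pos by simp
  have bigM1: "1024 ^ i \<le> \<rho> ^ j * real M" if "j + i \<le> Kx" for i j
    by (rule order_trans[OF _ bigM[OF that]]) (use q1 in simp)
  have Kx40: "60000 * K4 + 40 \<le> Kx" "K8 \<le> Kx" "40 \<le> Kx" by (auto simp: Kx_def)
  have M1: "1 \<le> real M" using bigM1[of 0 0] by simp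
  then have M0: "M > 0" by simp
  have fl: "\<lfloor>sqrt (real N / real q)\<rfloor> = int M" unfolding M by simp
  have Mr: "real M \<le> sqrt (real N / real q)" "sqrt (real N / real q) < real M + 1" using fl by linarith+
  have Nq: "real N = real q * (sqrt (real N / real q))\<^sup>2" using pos by simp
  have qM2: "real q * (real M)\<^sup>2 \<le> real N"
  proof -
    have "(real M)\<^sup>2 \<le> (sqrt (real N / real q))\<^sup>2" using Mr by (intro power_mono) auto
    then have "real q * (real M)\<^sup>2 \<le> real q * (sqrt (real N / real q))\<^sup>2" by (rule mult_left_mono) simp
    then show ?thesis using Nq by simp
  qed
  have N4: "real N \<le> 4 * real q * (real M)\<^sup>2"
  proof -
    have "(sqrt (real N / real q))\<^sup>2 \<le> (2 * real M)\<^sup>2" using Mr M1 by (intro power_mono) auto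
    then have "real q * (sqrt (real N / real q))\<^sup>2 \<le> real q * (2 * real M)\<^sup>2" by (rule mult_left_mono) simp
    then show ?thesis using Nq by (simp add: power_mult_distrib)
  qed
  \<comment> \<open>\<open>prime_between\<close> loses a factor 4, which the gap between \<rho>^31 M
    and \<rho>^30 M absorbs.\<close>
  define X where "X = nat \<lfloor>\<rho> ^ 31 * real M\<rfloor>"
  have X0: "1024 ^ 2 \<le> \<rho> ^ 31 * real M" using Kx40 by (intro bigM1) auto
  have X1: "real X \<le> \<rho> ^ 31 * real M" "\<rho> ^ 31 * real M < real X + 1" 
  proof -
    have "0 \<le> \<rho> ^ 31 * real M" using rp[of 31] by simp
    then have "real X = of_int \<lfloor>\<rho> ^ 31 * real M\<rfloor>" by (simp add: X_def)
    then show "real X \<le> \<rho> ^ 31 * real M" "\<rho> ^ 31 * real M < real X + 1" by linarith+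
  qed
  have "1100 \<le> real X" using X0 X1 by simp
  then have "1100 \<le> X" by simp
  then obtain a where a: "prime a" "X < a" "a \<le> 4 * X" using prime_between by blast
  have a0: "a > 0" using a by simp
  have alo: "\<rho> ^ 31 * real M \<le> real a"
  proof -
    have "real (X + 1) \<le> real a" using a(2) by (simp only: of_nat_le_iff)
    then show ?thesis using X1 by simp
  qed
  have ahi: "real a \<le> \<rho> ^ 30 * real M"
  proof -
    have "real a \<le> real (4 * X)" using a(3) by (simp only: of_nat_le_iff)
    also have "\<dots> \<le> 4 * (\<rho> ^ 31 * real M)" using X1 by simp
    also have "\<dots> = (4 * \<rho>) * (\<rho> ^ 30 * real M)" by (simp flip: power_Suc)
    also have "\<dots> \<le> 1 * (\<rho> ^ 30 * real M)" using rho by (intro mult_right_mono) auto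
    finally show ?thesis by simp
  qed
  have aM: "real a \<le> real M" using ahi mult_right_mono[OF rle[of 30], of "real M"] by simp
  have qa: "real q \<le> \<rho> ^ (60000 * K4) * real a"
  proof -
    have "real q \<le> \<rho> ^ (60000 * K4 + 31) * real M" using bigM[of "60000 * K4 + 31" 0] Kx40 by simp
    also have "\<dots> = \<rho> ^ (60000 * K4) * (\<rho> ^ 31 * real M)" by (simp add: power_add)
    also have "\<dots> \<le> \<rho> ^ (60000 * K4) * real a" using alo rho by (intro mult_left_mono) auto
    finally show ?thesis .
  qed
  have nd: "\<not> a dvd 2 * q"
  proof
    assume "a dvd 2 * q"
    then have "a \<le> 2 * q" using pos by (intro dvd_imp_le) auto
    then have "real a \<le> real (2 * q)" by (simp only: of_nat_le_iff)
    moreover have "real q \<le> \<rho> * real a"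
      using qa mult_right_mono[OF dec[of 1 "60000 * K4"], of "real a"] by (simp add: K4_def)
    moreover have "\<rho> * real a \<le> 1 / 2048 * real a" using rho by (intro mult_right_mono) auto
    moreover have "0 < real a" using a0 by simp
    ultimately show False by simp
  qed
  define L where "L = 3 * N div (q * a) + 1"
  define n where "n = q * a * L"
  have L0: "L > 0" by (simp add: L_def)
  have qa0: "q * a > 0" using pos a0 by simp
  have n3: "3 * N < n" "n \<le> 3 * N + q * a"
  proof -
    have "3 * N = q * a * (3 * N div (q * a)) + 3 * N mod (q * a)" by simp
    moreover have "3 * N mod (q * a) < q * a" using qa0 by simp
    moreover have "n = q * a * (3 * N div (q * a)) + q * a" by (simp add: n_def L_def distrib_left)
    ultimately show "3 * N < n" "n \<le> 3 * N + q * a" by linarith+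
  qed
  have MM: "real q * real M \<le> real N"
  proof -
    have "real q * real M \<le> real q * (real M)\<^sup>2" using M1 by (intro mult_left_mono) (auto simp: power2_eq_square)
    then show ?thesis using qM2 by linarith
  qed
  have MN: "real M \<le> real N"
  proof -
    have "1 * real M \<le> real q * real M" using q1 by (intro mult_right_mono) auto
    then show ?thesis using MM by linarith
  qed
  have n4: "real n \<le> 4 * real N"
  proof -
    have "real (q * a) \<le> real N" using mult_left_mono[OF aM, of "real q"] MM by simp
    moreover have "real n \<le> real (3 * N + q * a)" using n3(2) by (simp only: of_nat_le_iff)
    ultimately show ?thesis by simp
  qed
  have aL16: "real a * real L \<le> 16 * (real M)\<^sup>2"
  proof -
    have "real q * (real a * real L) = real n" by (simp add: n_def)
    also have "\<dots> \<le> real q * (16 * (real M)\<^sup>2)" using n4 N4 by simp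
    finally show ?thesis using q1 by (simp only: mult_le_cancel_left_pos)
  qed
  have LM: "\<rho> ^ 33 * real L \<le> real M"
  proof -
    have "real M * (\<rho> ^ 31 * real L) \<le> real M * (16 * real M)"
      using order_trans[OF mult_right_mono[OF alo, of "real L"] aL16] by (simp add: power2_eq_square mult_ac)
    then have "\<rho> ^ 31 * real L \<le> 16 * real M" using M1 by (simp only: mult_le_cancel_left_pos)
    then have "\<rho>\<^sup>2 * (\<rho> ^ 31 * real L) \<le> \<rho>\<^sup>2 * (16 * real M)" by (rule mult_left_mono) simp
    also have "\<dots> \<le> (1 / 16) * (16 * real M)"
    proof (rule mult_right_mono)
      have "\<rho>\<^sup>2 \<le> \<rho> ^ 1" by (rule dec) simp
      then show "\<rho>\<^sup>2 \<le> 1 / 16" using rho by simp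
    qed simp
    finally show ?thesis by (simp add: mult.assoc[symmetric] flip: power_add)
  qed
  have aL: "\<rho> * (real a * real L) \<le> (real M)\<^sup>2"
  proof -
    have "\<rho> * (real a * real L) \<le> (1 / 16) * (16 * (real M)\<^sup>2)" by (rule mult_mono[OF _ aL16]) (use rho in auto)
    then show ?thesis by simp
  qed
  define h0 where "h0 = (\<lambda>x. f0 (x mod int n))"
  define h1 where "h1 = (\<lambda>x. f1 (x mod int n))"
  define h2 where "h2 = (\<lambda>x. f2 (x mod int n))"
  have ph: "per n h0" "per n h1" "per n h2" unfolding h0_def h1_def h2_def by (rule per_classfun[OF dvd_refl])+
  have bh: "one_bounded h0" "one_bounded h1" "one_bounded h2" using bd by (auto simp: one_bounded_def h0_def h1_def h2_def)
  have N0: "N > 0" using pos by linarith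
  have n0: "n > 0" using n3 by linarith
  \<comment> \<open>From n/N <= 4 and 2/M <= \<delta>/4 one would get \<delta>/16; the smaller
    \<rho> = \<delta>/2048 is taken to have \<rho> <= 1/1024.\<close>
  have gL: "\<rho> \<le> norm (Lam n q M h0 h1 h2)"
  proof -
    have "\<delta> / 2 \<le> real n / real N * norm (Lam n q M h0 h1 h2) + 2 / real M"
      unfolding h0_def h1_def h2_def
      by (rule order_trans[OF ge counting_op_le[OF pos(1) N0 M0 M _ bd sup(1)]]) (use n3 in auto)
    moreover have "real n / real N * norm (Lam n q M h0 h1 h2) \<le> 4 * norm (Lam n q M h0 h1 h2)"
      using n4 N0 by (intro mult_right_mono) (auto simp: pos_divide_le_eq)
    moreover have "2 / real M \<le> \<delta> / 4"
    proof -
      have "1 \<le> \<rho> * real M" using bigM1[of 1 0] Kx40 by simp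
      then show ?thesis using M1 by (simp add: \<rho> pos_divide_le_eq)
    qed
    ultimately show ?thesis using delta by (simp add: \<rho>)
  qed
  obtain q' W \<beta> where q': "1 \<le> q'" "real_of_int q' \<le> 1 / \<rho> ^ (10 * K6 + 3)" and W: "one_bounded W"
    and near: "\<And>c. W c \<noteq> 0 \<Longrightarrow> \<exists>m::int. \<bar>of_int (q' * int q * \<beta> c) / real n - of_int m\<bar> \<le> 10 ^ 19 / ((\<rho> ^ K6) ^ 28 * (real M)\<^sup>2)"
    and ge7: "\<rho> ^ (11 * K6 + 3) \<le> norm (Lam n q M h0 h1 (\<lambda>x. W (x mod int q) * chi n (\<beta> (x mod int q) * x)))"
    using inverse_structure[OF pos(1) L0 a(1) nd n_def rho(1,3) qa ahi LM aL ph bh gL] by blast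
  define q'' where "q'' = nat q'"
  have q'': "q' = int q''" "q'' > 0" "real q'' \<le> 1 / \<rho> ^ (10 * K6 + 3)" using q' by (auto simp: q''_def)
  define U where "U = nat \<lfloor>\<rho> ^ K8 * real M / real q\<rfloor>"
  have U1: "1 \<le> \<rho> ^ K8 * real M / real q" using bigM[of K8 0] Kx40 q1 by (simp add: pos_le_divide_eq)
  have U2: "real U \<le> \<rho> ^ K8 * real M / real q" "\<rho> ^ K8 * real M / real q < real U + 1" using U1 unfolding U_def by linarith+
  have U0: "U > 0" using U1 by (simp add: U_def)
  have qU: "real q * real U \<le> \<rho> ^ K8 * real M" using U2(1) q1 by (simp add: pos_le_divide_eq mult.commute)
  have qU2: "\<rho> ^ K8 * real M / 2 \<le> real q * real U"
  proof -
    have "1 \<le> real U" using U0 by simp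
    then have "\<rho> ^ K8 * real M / real q \<le> 2 * real U" using U2 by linarith
    then show ?thesis using q1 by (simp add: pos_divide_le_eq mult_ac)
  qed
  have qqU: "real q * real q'' * real U \<le> \<rho> ^ (K7 + 2) * real M"
  proof -
    have "real q * real q'' * real U = (real q * real U) * real q''" by simp
    also have "\<dots> \<le> (\<rho> ^ K8 * real M) * (1 / \<rho> ^ (10 * K6 + 3))" by (rule mult_mono[OF qU q''(3)]) (use rho in auto)
    also have "\<dots> = \<rho> ^ (K7 + 18 * K6 + 5) * real M"
    proof -
      have "\<rho> ^ K8 = \<rho> ^ (K7 + 18 * K6 + 5) * \<rho> ^ (10 * K6 + 3)"
        unfolding power_add[symmetric] K8_def by (rule arg_cong[where f = "power \<rho>"]) simp
      then show ?thesis using rp[of "10 * K6 + 3"] by simp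
    qed
    also have "\<dots> \<le> \<rho> ^ (K7 + 2) * real M" by (intro mult_right_mono dec) auto
    finally show ?thesis .
  qed
  have qqM: "real q * real q'' * real U \<le> real M"
    using qqU mult_right_mono[OF rle[of "K7 + 2"], of "real M"] by simp
  then have "real (q * q'' * U) \<le> real M" by simp
  then have qqMn: "q * q'' * U \<le> M" by (simp only: of_nat_le_iff)
  then have qqMi: "int q * q' * int U \<le> int M" unfolding q''(1) by (metis of_nat_le_iff of_nat_mult)
  define \<epsilon> where "\<epsilon> = 10 ^ 19 / ((\<rho> ^ K6) ^ 28 * (real M)\<^sup>2)"
  have eps0: "0 \<le> \<epsilon>" using rho by (simp add: \<epsilon>_def)
  define E where "E = 2 * of_int (int q * q' * int U) / real M + 2 * pi * (4 * real q * real M * real U) * \<epsilon>"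
  have EK: "E \<le> \<rho> ^ K7 / 2"
  proof -
    have sm: "c * \<rho> ^ (K7 + i) \<le> \<rho> ^ K7 / 4" if "4 * c \<le> 1024 ^ i" for c i
    proof -
      have "(4 * c) * \<rho> ^ i \<le> 1" using mult_right_mono[OF that, of "\<rho> ^ i"] kb[of i] rp[of i] by linarith
      then have "\<rho> ^ K7 * ((4 * c) * \<rho> ^ i) \<le> \<rho> ^ K7 * 1" using rho by (intro mult_left_mono) auto
      then show ?thesis by (simp add: power_add mult_ac)
    qed
    have "2 * of_int (int q * q' * int U) / real M = 2 * (real q * real q'' * real U) / real M" by (simp add: q''(1))
    also have "\<dots> \<le> 2 * (\<rho> ^ (K7 + 2) * real M) / real M" using qqU by (intro divide_right_mono) auto
    also have "\<dots> = 2 * \<rho> ^ (K7 + 2)" using M1 by simp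
    also have "\<dots> \<le> \<rho> ^ K7 / 4" by (rule sm) simp
    finally have 1: "2 * of_int (int q * q' * int U) / real M \<le> \<rho> ^ K7 / 4" .
    have "2 * pi * (4 * real q * real M * real U) * \<epsilon> = (8 * pi * real M * \<epsilon>) * (real q * real U)" by simp
    also have "\<dots> \<le> (8 * 4 * real M * \<epsilon>) * (\<rho> ^ K8 * real M)"
    proof (rule mult_mono[OF _ qU])
      have "pi * (8 * (real M * \<epsilon>)) \<le> 4 * (8 * (real M * \<epsilon>))" using pi_less_4 eps0 by (intro mult_right_mono) auto
      then show "8 * pi * real M * \<epsilon> \<le> 8 * 4 * real M * \<epsilon>" by (simp add: mult_ac)
    qed (use eps0 in auto)
    also have "\<dots> = 32 * 10 ^ 19 * (\<rho> ^ K8 / (\<rho> ^ K6) ^ 28)"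
      using M1 by (simp add: \<epsilon>_def power2_eq_square)
    also have "\<rho> ^ K8 / (\<rho> ^ K6) ^ 28 = \<rho> ^ (K7 + 8)"
    proof -
      have "\<rho> ^ K8 = \<rho> ^ (K7 + 8) * (\<rho> ^ K6) ^ 28"
        unfolding power_mult[symmetric] power_add[symmetric] K8_def by (rule arg_cong[where f = "power \<rho>"]) simp
      then show ?thesis using rho by simp
    qed
    also have "32 * 10 ^ 19 * \<rho> ^ (K7 + 8) \<le> \<rho> ^ K7 / 4" by (rule sm) simp
    finally show ?thesis using 1 by (simp add: E_def)
  qed
  have qn: "q dvd n" by (simp add: n_def)
  have q'0: "q' > 0" using q' by simp
  have ge7': "\<rho> ^ K7 \<le> norm (Lam n q M h0 h1 (\<lambda>x. W (x mod int q) * chi n (\<beta> (x mod int q) * x)))"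
    using ge7 by (simp add: K7_def)
  note ab = average_bounds[OF n0 pos(1) M0 U0 q'0 qn ph(1,2) bh(1,2) W near[folded \<epsilon>_def] eps0 qqMi E_def ge7']
  have D: "int q * q' * u = int (q * q'') * u" for u by (simp add: q''(1))
  have nn: "int N + int (q * q'' * U) < int n"
  proof -
    have "real (q * q'' * U) \<le> real N" using qqM MN by simp
    then have "q * q'' * U \<le> N" by (simp only: of_nat_le_iff)
    then have "N + q * q'' * U < n" using n3 N0 by linarith
    then show ?thesis unfolding of_nat_add[symmetric] of_nat_less_iff .
  qed
  have Dp: "q * q'' > 0" using pos q'' by simp
  have fin: "(\<rho> ^ K7 / 2) * real N * real U \<le> (\<Sum>z\<in>{- int (q * q'' * U)..int N}. norm (\<Sum>u\<in>{0..<int U}. f (z + int (q * q'') * u)))"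
    if f: "\<And>x. f x \<noteq> 0 \<Longrightarrow> 1 \<le> x \<and> x \<le> int N"
      and g: "\<rho> ^ K7 - E \<le> av n (\<lambda>x. norm (av U (\<lambda>u. f ((x + int (q * q'') * u) mod int n))))" for f :: "int \<Rightarrow> complex"
  proof -
    have "(\<rho> ^ K7 - E) * real n * real U \<le> (\<Sum>z\<in>{- int (q * q'' * U)..int N}. norm (\<Sum>u\<in>{0..<int U}. f (z + int (q * q'') * u)))"
      by (rule periodized_sum[OF Dp U0 n0 nn f g])
    moreover have "(\<rho> ^ K7 / 2) * real N * real U \<le> (\<rho> ^ K7 - E) * real n * real U"
    proof (rule mult_right_mono[OF mult_mono])
      show "\<rho> ^ K7 / 2 \<le> \<rho> ^ K7 - E" using EK by simp
      then show "0 \<le> \<rho> ^ K7 - E" using rp[of K7] by (smt (verit) half_gt_zero)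
      show "real N \<le> real n" using n3 by simp
    qed auto
    ultimately show ?thesis by linarith
  qed
  have "\<rho> ^ K8 * real M / 2 \<le> real (q * q'' * U)"
  proof -
    have "real q * real U * 1 \<le> real q * real U * real q''" using q'' by (intro mult_left_mono) auto
    then show ?thesis using qU2 by (simp add: mult_ac)
  qed
  moreover have "\<forall>f\<in>{f0, f1}. (\<rho> ^ K7 / 2) * real N * real U \<le> (\<Sum>z\<in>{- int (q * q'' * U)..int N}. norm (\<Sum>u\<in>{0..<int U}. f (z + int (q * q'') * u)))"
    using fin[OF sup(1)] fin[OF sup(2)] ab unfolding h0_def h1_def D by blast
  ultimately show ?thesis using q'' U0 by blast
qed

lemma norm_average_le_1:
  assumes "\<And>s. s \<in> S \<Longrightarrow> norm (F s) \<le> 1"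
  shows "norm (average S F) \<le> 1"
proof -
  have "norm (\<Sum>s\<in>S. F s) \<le> (\<Sum>s\<in>S. norm (F s))" by (rule norm_sum)
  also have "\<dots> \<le> real (card S) * 1" by (rule sum_bounded_above) (rule assms)
  finally have "norm (\<Sum>s\<in>S. F s) / real (card S) \<le> 1"
    by (cases "card S = 0") (auto simp: divide_le_eq_1)
  then show ?thesis by (simp add: average_def norm_divide)
qed

lemma norm_counting_op_le_1:
  assumes "one_bounded f0" "one_bounded f1" "one_bounded f2"
  shows "norm (counting_op q N f0 f1 f2) \<le> 1"
  unfolding counting_op_def Let_def
  by (intro norm_average_le_1 norm_mult_le_1 one_boundedD assms)

text \<open>The supremum may not be attained, hence the loss of a factor 2. The bound \<delta> <= 1
  holds because the counting operator is at most 1 on bounded functions.\<close>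

lemma partial_cut_norm_witness:
  assumes ge: "\<delta> \<le> partial_cut_norm q N f" and f: "one_bounded f" and delta: "0 < \<delta>"
  obtains g1 g2 where "one_bounded g1" "one_bounded g2" "supp g1 \<subseteq> bracket (real N)" "supp g2 \<subseteq> bracket (real N)"
    "\<delta> / 2 \<le> norm (counting_op q N f g1 g2) \<or> \<delta> / 2 \<le> norm (counting_op q N g1 f g2)" "\<delta> \<le> 1"
proof -
  define X where "X = (\<Union>(g1, g2) \<in> {(g1, g2). one_bounded g1 \<and> one_bounded g2 \<and>
                supp g1 \<subseteq> bracket (real N) \<and> supp g2 \<subseteq> bracket (real N)}.
          {norm (counting_op q N f g1 g2), norm (counting_op q N g1 f g2)})"
  have S: "\<delta> \<le> Sup X" using ge by (simp add: partial_cut_norm_def X_def)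
  have z: "one_bounded (\<lambda>_. 0)" "supp (\<lambda>_. 0) \<subseteq> bracket (real N)" by (auto simp: one_bounded_def supp_def)
  have "norm (counting_op q N f (\<lambda>_. 0) (\<lambda>_. 0)) \<in> X" unfolding X_def using z by blast
  then have ne: "X \<noteq> {}" by blast
  have "x \<le> 1" if xX: "x \<in> X" for x
  proof -
    obtain g1 g2 where g: "one_bounded g1" "one_bounded g2" "x = norm (counting_op q N f g1 g2) \<or> x = norm (counting_op q N g1 f g2)"
      using xX unfolding X_def by blast
    then show ?thesis using norm_counting_op_le_1[OF f g(1,2)] norm_counting_op_le_1[OF g(1) f g(2)] by blast
  qed
  then have "Sup X \<le> 1" by (rule cSup_least[OF ne])
  then have d1: "\<delta> \<le> 1" using S by simp
  have "\<delta> / 2 < Sup X" using S delta by simp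
  from less_cSupE[OF this ne] obtain x where x: "x \<in> X" "\<delta> / 2 < x" by blast
  obtain g1 g2 where g: "one_bounded g1" "one_bounded g2" "supp g1 \<subseteq> bracket (real N)" "supp g2 \<subseteq> bracket (real N)"
    "x = norm (counting_op q N f g1 g2) \<or> x = norm (counting_op q N g1 f g2)"
    using x(1) unfolding X_def by blast
  show ?thesis using that[OF g(1-4) _ d1] g(5) x(2) by (meson less_imp_le order_trans order_refl)
qed

text \<open>As \<open>M\<close> is within a factor 2 of sqrt(N/q), squaring reduces the first claim
  to 4 q^3 <= \<rho>^(2K) N, where q^3 <= q^(2K) for K >= 2.\<close>

lemma large_M:
  assumes q: "0 < q" "q \<le> N" and delta: "0 < \<delta>" "\<delta> \<le> 1" and M: "M = nat \<lfloor>sqrt (real N / real q)\<rfloor>"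
    and big: "2048 ^ (2 * K) * 4 * (real q / \<delta>) ^ (2 * K) \<le> real N" and K: "2 \<le> K"
  shows "real q \<le> (\<delta> / 2048) ^ K * real M" and "sqrt (real N) / (2 * real q) \<le> real M"
proof -
  have q1: "1 \<le> real q" using q by simp
  have "1 \<le> real N / real q" using q by simp
  then have s1: "1 \<le> sqrt (real N / real q)" by simp
  have fl: "\<lfloor>sqrt (real N / real q)\<rfloor> = int M" unfolding M by simp
  have "1 \<le> \<lfloor>sqrt (real N / real q)\<rfloor>" using s1 by (simp only: le_floor_iff of_int_1)
  then have "1 \<le> real M" unfolding fl by simp
  moreover have "sqrt (real N / real q) < real M + 1" using fl by linarith
  ultimately have M2: "sqrt (real N / real q) \<le> 2 * real M" by linarith
  have "sqrt (real N) / real q \<le> sqrt (real N) / sqrt (real q)"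
  proof (intro divide_left_mono)
    have "sqrt (real q) \<le> sqrt ((real q)\<^sup>2)" using q1 by (intro real_sqrt_le_mono) (simp add: power2_eq_square)
    then show "sqrt (real q) \<le> real q" by simp
  qed (use q1 in auto)
  also have "\<dots> = sqrt (real N / real q)" by (simp add: real_sqrt_divide)
  finally have "sqrt (real N) / real q \<le> sqrt (real N / real q)" .
  moreover have "sqrt (real N) / (2 * real q) = sqrt (real N) / real q / 2" by simp
  ultimately show "sqrt (real N) / (2 * real q) \<le> real M" using M2 by linarith
  define \<rho> where "\<rho> = \<delta> / 2048"
  have rp: "0 < \<rho>" using delta by (simp add: \<rho>_def)
  have "4 * real q ^ (2 * K) = \<rho> ^ (2 * K) * (2048 ^ (2 * K) * 4 * (real q / \<delta>) ^ (2 * K))"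
    using delta by (simp add: \<rho>_def power_divide)
  also have "\<dots> \<le> \<rho> ^ (2 * K) * real N" using big rp by (intro mult_left_mono) auto
  finally have 1: "4 * real q ^ (2 * K) \<le> \<rho> ^ (2 * K) * real N" .
  have "real q ^ 3 \<le> real q ^ (2 * K)" using q1 K by (intro power_increasing) auto
  then have "4 * real q ^ 3 \<le> \<rho> ^ (2 * K) * real N" using 1 by linarith
  also have "real N = real q * (sqrt (real N / real q))\<^sup>2" using q by simp
  also have "\<rho> ^ (2 * K) * (real q * (sqrt (real N / real q))\<^sup>2) \<le> \<rho> ^ (2 * K) * (real q * (2 * real M)\<^sup>2)"
    using M2 rp by (intro mult_left_mono power_mono) auto
  also have "\<dots> = real q * (4 * (\<rho> ^ K * real M)\<^sup>2)" by (simp add: power_mult_distrib mult_ac flip: power_mult)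
  finally have 2: "4 * real q ^ 3 \<le> real q * (4 * (\<rho> ^ K * real M)\<^sup>2)" .
  have 3: "4 * real q ^ 3 = real q * (4 * (real q)\<^sup>2)" by (simp add: power2_eq_square power3_eq_cube)
  have "0 < real q" using q by simp
  from mult_left_le_imp_le[OF 2[unfolded 3] this] have "(real q)\<^sup>2 \<le> (\<rho> ^ K * real M)\<^sup>2" by linarith
  then show "real q \<le> (\<delta> / 2048) ^ K * real M"
    unfolding \<rho>_def[symmetric] by (rule power2_le_imp_le) (use rp in simp)
qed

theorem theorem1p6:
  shows "\<exists>C::real. C > 0 \<and>
    (\<forall>(q::nat) (N::nat) (\<delta>::real) (f :: int \<Rightarrow> complex).
      0 < q \<and> q \<le> N \<and> \<delta> > 0 \<and>
      one_bounded f \<and> supp f \<subseteq> bracket (real N) \<and>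
      partial_cut_norm q N f \<ge> \<delta> \<longrightarrow>
        real N \<le> C * (real q / \<delta>) powr C \<or>
        (\<exists>(q'::nat) (R::real) (\<phi> :: int \<Rightarrow> complex).
          0 < q' \<and> real q' \<le> C * \<delta> powr (- C) \<and>
          R \<ge> inverse C * (\<delta> / real q) powr C * real N powr (1 / 2) \<and>
          one_bounded \<phi> \<and> local_function R (q * q') \<phi> \<and>
          (\<Sum>x\<in>bracket (real N). f x * \<phi> x) \<in> \<real> \<and>
          Re (\<Sum>x\<in>bracket (real N). f x * \<phi> x) \<ge> inverse C * \<delta> ^ (2 ^ 66) * real N))"
proof -
  \<comment> \<open>One constant serves as factor and as exponent: it dominates both 4 * 2048^j and
    j for all exponents j <= 2 Kx that occur.\<close>
  define C :: real where "C = 4 * 2048 ^ (2 * Kx)"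
  have C0: "C > 0" by (simp add: C_def)
  have Cp: "4 * 2048 ^ j \<le> C" if "j \<le> 2 * Kx" for j
    unfolding C_def using that by (intro mult_left_mono power_increasing) auto
  have Cn: "real j \<le> C" if "j \<le> 2 * Kx" for j
  proof -
    have "j < 2 ^ j" by (rule less_exp)
    then have "real j < real (2 ^ j)" by (simp only: of_nat_less_iff)
    also have "real (2 ^ j) \<le> 2048 ^ j" by (simp add: power_mono)
    also have "\<dots> \<le> 4 * 2048 ^ j" by simp
    also have "\<dots> \<le> C" by (rule Cp[OF that])
    finally show ?thesis by simp
  qed
  have Kb: "10 * K6 + 3 \<le> 2 * Kx" "K8 \<le> 2 * Kx" "K7 \<le> 2 * Kx" "1 \<le> K8" "2 \<le> Kx"
    by (auto simp: Kx_def K8_def K7_def)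
  \<comment> \<open>There is ample room: \<open>K7\<close> equals 1056837842514, which is below
    2^40.\<close>
  have K66: "K7 \<le> 2 ^ 66" by (simp add: K7_def K6_def K4_def)
  have main: "\<exists>(q'::nat) (R::real) (\<phi> :: int \<Rightarrow> complex).
          0 < q' \<and> real q' \<le> C * \<delta> powr (- C) \<and>
          R \<ge> inverse C * (\<delta> / real q) powr C * real N powr (1 / 2) \<and>
          one_bounded \<phi> \<and> local_function R (q * q') \<phi> \<and>
          (\<Sum>x\<in>bracket (real N). f x * \<phi> x) \<in> \<real> \<and>
          Re (\<Sum>x\<in>bracket (real N). f x * \<phi> x) \<ge> inverse C * \<delta> ^ (2 ^ 66) * real N"
    if q: "0 < q" "q \<le> N" and delta: "0 < \<delta>" and f: "one_bounded f" and sf: "supp f \<subseteq> bracket (real N)"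
      and ge: "\<delta> \<le> partial_cut_norm q N f" and big: "\<not> real N \<le> C * (real q / \<delta>) powr C" for q N :: nat and \<delta> :: real and f
  proof -
    obtain g1 g2 where g: "one_bounded g1" "one_bounded g2" and sg: "supp g1 \<subseteq> bracket (real N)" "supp g2 \<subseteq> bracket (real N)"
      and gg: "\<delta> / 2 \<le> norm (counting_op q N f g1 g2) \<or> \<delta> / 2 \<le> norm (counting_op q N g1 f g2)" and d1: "\<delta> \<le> 1"
      by (rule partial_cut_norm_witness[OF ge f delta])
    define M where "M = nat \<lfloor>sqrt (real N / real q)\<rfloor>"
    define \<rho> where "\<rho> = \<delta> / 2048"
    have rp: "0 < \<rho>" using delta by (simp add: \<rho>_def)
    have q1: "1 \<le> real q" using q by simp
    have qd: "1 \<le> real q / \<delta>" using q1 delta d1 by (simp add: pos_le_divide_eq)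
    have "2048 ^ (2 * Kx) * 4 * (real q / \<delta>) ^ (2 * Kx) \<le> C * (real q / \<delta>) powr C"
    proof -
      have "(real q / \<delta>) ^ (2 * Kx) = (real q / \<delta>) powr real (2 * Kx)" using qd by (subst powr_realpow) auto
      also have "\<dots> \<le> (real q / \<delta>) powr C" using qd Cn[of "2 * Kx"] by (intro powr_mono) auto
      finally have "C * (real q / \<delta>) ^ (2 * Kx) \<le> C * (real q / \<delta>) powr C" using C0 by (intro mult_left_mono) auto
      then show ?thesis by (simp add: C_def mult_ac)
    qed
    then have big': "2048 ^ (2 * Kx) * 4 * (real q / \<delta>) ^ (2 * Kx) \<le> real N" using big by linarith
    note LM = large_M[OF q delta d1 M_def big' Kb(5)]
    have br: "1 \<le> x \<and> x \<le> int N" if "h x \<noteq> 0" "supp h \<subseteq> bracket (real N)" for h :: "int \<Rightarrow> complex" and x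
      using that by (auto simp: supp_def bracket_nat)
    have "\<exists>q' U::nat. 0 < q' \<and> real q' \<le> 1 / \<rho> ^ (10 * K6 + 3) \<and> 0 < U \<and> \<rho> ^ K8 * real M / 2 \<le> real (q * q' * U) \<and>
      (\<rho> ^ K7 / 2) * real N * real U \<le> (\<Sum>z\<in>{- int (q * q' * U)..int N}. norm (\<Sum>u\<in>{0..<int U}. f (z + int (q * q') * u)))"
      using gg
    proof
      assume a: "\<delta> / 2 \<le> norm (counting_op q N f g1 g2)"
      show ?thesis
        using inverse_core[OF q M_def delta d1 \<rho>_def LM(1)[folded \<rho>_def] f g br[OF _ sf] br[OF _ sg(1)] a] by blast
    next
      assume a: "\<delta> / 2 \<le> norm (counting_op q N g1 f g2)"
      show ?thesis
        using inverse_core[OF q M_def delta d1 \<rho>_def LM(1)[folded \<rho>_def] g(1) f g(2) br[OF _ sg(1)] br[OF _ sf] a] by blast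
    qed
    then obtain q' U :: nat where q': "0 < q'" "real q' \<le> 1 / \<rho> ^ (10 * K6 + 3)" and U: "0 < U" "\<rho> ^ K8 * real M / 2 \<le> real (q * q' * U)"
      and S: "(\<rho> ^ K7 / 2) * real N * real U \<le> (\<Sum>z\<in>{- int (q * q' * U)..int N}. norm (\<Sum>u\<in>{0..<int U}. f (z + int (q * q') * u)))"
      by blast
    have D: "0 < q * q'" using q q' by simp
    obtain \<phi> where \<phi>: "one_bounded \<phi>" "local_function (real (q * q' * U)) (q * q') \<phi>" "(\<Sum>x\<in>{1..int N}. f x * \<phi> x) \<in> \<real>"
      "(\<rho> ^ K7 / 2) * real N * real U / real U \<le> Re (\<Sum>x\<in>{1..int N}. f x * \<phi> x)"
      using local_correlation[OF D U(1) f br[OF _ sf] S] by blast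
    have "real q' \<le> C * \<delta> powr (- C)"
    proof -
      have "1 / \<rho> ^ (10 * K6 + 3) = 2048 ^ (10 * K6 + 3) * (1 / \<delta> ^ (10 * K6 + 3))"
        unfolding \<rho>_def power_divide by simp
      also have "1 / \<delta> ^ (10 * K6 + 3) = \<delta> powr (- real (10 * K6 + 3))"
        using delta by (simp only: powr_minus powr_realpow inverse_eq_divide)
      also have "2048 ^ (10 * K6 + 3) * \<delta> powr (- real (10 * K6 + 3)) \<le> C * \<delta> powr (- C)"
      proof (intro mult_mono powr_mono')
        show "2048 ^ (10 * K6 + 3) \<le> C" by (rule order_trans[OF _ Cp[OF Kb(1)]]) simp
        show "- C \<le> - real (10 * K6 + 3)" using Cn[OF Kb(1)] by simp
      qed (use delta d1 C0 in auto)
      finally show ?thesis using q'(2) by simp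
    qed
    moreover have "inverse C * (\<delta> / real q) powr C * real N powr (1 / 2) \<le> real (q * q' * U)"
    proof -
      have dq: "0 < \<delta> / real q" "\<delta> / real q \<le> 1" using delta d1 q1 by auto
      have "(\<delta> / real q) powr C \<le> (\<delta> / real q) powr real K8"
        using dq Cn[OF Kb(2)] by (intro powr_mono') auto
      also have "\<dots> = \<delta> ^ K8 / real q ^ K8" using dq by (simp add: powr_realpow power_divide)
      also have "\<dots> \<le> \<delta> ^ K8 / real q"
      proof (intro divide_left_mono)
        have "real q ^ 1 \<le> real q ^ K8" using q1 Kb(4) by (intro power_increasing) auto
        then show "real q \<le> real q ^ K8" by simp
      qed (use delta q1 in auto)
      finally have 1: "(\<delta> / real q) powr C \<le> \<delta> ^ K8 / real q" .
      have 2: "inverse C \<le> 1 / (4 * 2048 ^ K8)"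
        unfolding inverse_eq_divide using Cp[OF Kb(2)] C0 by (intro divide_left_mono) auto
      have "inverse C * (\<delta> / real q) powr C * real N powr (1 / 2) \<le> 1 / (4 * 2048 ^ K8) * (\<delta> ^ K8 / real q) * sqrt (real N)"
        using 1 2 C0 delta by (intro mult_mono) (auto simp: powr_half_sqrt)
      also have "\<dots> = \<rho> ^ K8 * (sqrt (real N) / (2 * real q)) / 2"
        by (simp add: \<rho>_def power_divide)
      also have "\<dots> \<le> \<rho> ^ K8 * real M / 2"
        using LM(2) rp by (intro divide_right_mono mult_left_mono) auto
      finally show ?thesis using U(2) by simp
    qed
    moreover have "inverse C * \<delta> ^ (2 ^ 66) * real N \<le> Re (\<Sum>x\<in>{1..int N}. f x * \<phi> x)"
    proof -
      have 2: "inverse C \<le> 1 / (4 * 2048 ^ K7)"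
        unfolding inverse_eq_divide using Cp[OF Kb(3)] C0 by (intro divide_left_mono) auto
      have 3: "\<delta> ^ (2 ^ 66) \<le> \<delta> ^ K7" using delta d1 K66 by (intro power_decreasing) auto
      have "inverse C * \<delta> ^ (2 ^ 66) * real N \<le> 1 / (4 * 2048 ^ K7) * \<delta> ^ K7 * real N"
        by (intro mult_mono 2 3) (use C0 delta in auto)
      also have "\<dots> = \<rho> ^ K7 / 4 * real N" by (simp add: \<rho>_def power_divide)
      also have "\<dots> \<le> \<rho> ^ K7 / 2 * real N" using rp by (intro mult_right_mono) auto
      also have "\<dots> \<le> Re (\<Sum>x\<in>{1..int N}. f x * \<phi> x)" using \<phi>(4) U(1) by simp
      finally show ?thesis .
    qed
    ultimately show ?thesis using q'(1) \<phi>(1-3) unfolding bracket_nat by blast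
  qed
  show ?thesis
    using C0 main by (intro exI[of _ C] conjI allI impI) auto
qed

end
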